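(* Let $u_D^*\in H_0^1(\Omega)$ and $u_N^*\in H^1(\Omega)$ be the weak solutions of the Dirichlet problem $-\nabla\cdot(A\nabla u)+cu=f$ in $\Omega$, $u=0$ on $\partial\Omega$, and of the Neumann problem $-\nabla\cdot(A\nabla u)+cu=f$ in $\Omega$, $A\nabla u\cdot\nu=0$ on $\partial\Omega$, respectively. Suppose the basic assumptions on $(A,c,f)$ and the Barron assumptions on $A$ and $c$ given in the context hold. (1) (Dirichlet.) Suppose in addition that $f\in\mathcal B_s^0(\Omega)$ and put $\ell_{f,D}=\|f\|_{\mathcal B_s^0(\Omega)}$. Then for every $0<\varepsilon<1/2$ there exist a positive integer $k$ and a two-layer ReLU network $$R_k(x)=\gamma+\sum_{i=1}^ka_i\operatorname{ReLU}(w_i^\top x+b_i),\qquad \gamma,a_i,b_i\in\mathbb R,\ w_i\in\mathbb R^d,$$ such that $$|\gamma|\le2M_D,\qquad\sum_{i=1}^k|a_i|\le4\sqrt d\,M_D,\qquad|w_i|=1,\quad|b_i|\le\sqrt d\quad(i=1,\dots,k),$$ and $\|R_k-u_D^*\|_{H^1(\Omega)}\le\varepsilon$. (2) (Neumann.) Suppose instead in addition that $f\in\mathcal B_c^0(\Omega)$ and put $\ell_{f,N}=\|f\|_{\mathcal B_c^0(\Omega)}$. Then for every $0<\varepsilon<1/2$ there exist a positive integer $k$ and a network $R_k$ of the same form satisfying the same bounds with $M_D$ replaced by $M_N$, and $\|R_k-u_N^*\|_{H^1(\Omega)}\le\varepsilon$. Moreover, in case $X\in\{D,N\}$ the width can be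 chosen such that $k=\mathcal O(d^{C_1|\log\varepsilon|})$, and $M_X=\mathcal O(d^{C_2|\log\varepsilon|})$; that is, there are constants $C_0,C_1,C_2>0$, depending only on $a_{\min},a_{\max},c_{\min},c_{\max},\ell_A,\ell_c,\ell_{f,X}$ and $\|f\|_{H^{-1}(\Omega)}$ (if $X=D$) or $\|f\|_{(H^1(\Omega))^*}$ (if $X=N$), and not otherwise on $d$ or $\varepsilon$, such that $k\le C_0d^{C_1|\log\varepsilon|}$ and $M_X\le C_0d^{C_2|\log\varepsilon|}$.
   Context: **Setting.** $d\ge2$ is an integer, $\Omega=(0,1)^d\subset\mathbb R^d$, $\nu$ is the outward unit normal on $\partial\Omega$, $\mathbb N=\{0,1,2,\dots\}$, $|\cdot|$ is the Euclidean norm, all functions are real-valued, $\operatorname{ReLU}(t)=\max\{t,0\}$, and $(u,v)_{H^1(\Omega)}=\int_\Omega\nabla u\cdot\nabla v+uv\,dx$ (used also on $H_0^1(\Omega)$). **Basic assumptions on $(A,c,f)$.** $A(x)=(A_{ij}(x))_{1\le i,j\le d}$ is a symmetric (measurable) matrix-valued function on $\Omega$; there is $a_{\min}>0$ with $v^\top A(x)v\ge a_{\min}|v|^2$ for all $x\in\Omega$, $v\in\mathbb R^d$; $a_{\max}:=\sup_{x\in\Omega}\sup_{v\ne0}|A(x)v|/|v|<\infty$. The (measurable) function $c$ satisfies $0<c_{\min}\le c(x)\le c_{\max}<\infty$ on $\Omega$. $f\in L^2(\Omega)$. **Weak solutions.** $u_D^*\in H_0^1(\Omega)$ is the unique function with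 $\int_\Omega(\nabla u_D^*\cdot A\nabla v+cu_D^*v-fv)\,dx=0$ for all $v\in H_0^1(\Omega)$; $u_N^*\in H^1(\Omega)$ is the unique function with the same identity (with $u_N^*$ in place of $u_D^*$) for all $v\in H^1(\Omega)$. **Barron spaces.** For $g\in L^2(\Omega)$, $n\ge0$ (convention $0^0=1$): - With $S_k(x)=\prod_{m=1}^d\sin(\pi k_mx_m)$, and $g=\sum_{k\in\mathbb N^d}a_kS_k$ in $L^2(\Omega)$ the (unique, real) expansion, where $a_k=0$ whenever some $k_m=0$: $\|g\|_{\mathcal B_s^n(\Omega)}=\sum_k|a_k|(1+\pi^n|k|^n)$. - With $C_k(x)=\prod_{m=1}^d\cos(\pi k_mx_m)$ and $g=\sum_{k\in\mathbb N^d}a_kC_k$: $\|g\|_{\mathcal B_c^n(\Omega)}=\sum_k|a_k|(1+\pi^n|k|^n)$. - For $i\ne j$, with $M_{k,i,j}(x)=\sin(\pi k_ix_i)\sin(\pi k_jx_j)\prod_{m\ne i,j}\cos(\pi k_mx_m)$ and $g=\sum_{k\in\mathbb N^d}a_kM_{k,i,j}$, where $a_k=0$ if $k_i=0$ or $k_j=0$: $\|g\|_{\mathcal B_{i,j}^n(\Omega)}=\sum_k|a_k|(1+\pi^n|k|^n)$. Each space consists of those $g\in L^2(\Omega)$ for which the corresponding norm is finite. **Barron assumptions on $A$ and $c$.** $A_{ii}\in\mathcal B_c^1(\Omega)$ for all $i$; $A_{ij}\in\mathcal B_{i,j}^1(\Omega)$ for all $i\ne j$; $\ell_A:=\max\{\max_i\|A_{ii}\|_{\mathcal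 B_c^1(\Omega)},\max_{i\ne j}\|A_{ij}\|_{\mathcal B_{i,j}^1(\Omega)}\}$; $c\in\mathcal B_c^2(\Omega)$ with $\ell_c:=\|c\|_{\mathcal B_c^2(\Omega)}$. **Constants.** $\lambda_{\min}=\min\{a_{\min},c_{\min}\}$, $\lambda_{\max}=\max\{a_{\max},c_{\max}\}$, $\alpha_*=\lambda_{\min}/\lambda_{\max}^2$, $\beta_*=(1-\lambda_{\min}^2/\lambda_{\max}^2)^{1/2}$, $p(d)=\frac{1+\pi}{\pi}\alpha_*\ell_Ad^2+\alpha_*\ell_c+1$, $\log_+t=\max\{\log t,0\}$ (with $\log_+0=0$), $$T_D=\left\lceil\frac{\log_+(2\|f\|_{H^{-1}(\Omega)}/(\varepsilon\lambda_{\min}))}{|\log\beta_*|}\right\rceil,\qquad T_N=\left\lceil\frac{\log_+(2\|f\|_{(H^1(\Omega))^*}/(\varepsilon\lambda_{\min}))}{|\log\beta_*|}\right\rceil,$$ with $T_D=T_N=1$ when $\beta_*=0$, and for $X\in\{D,N\}$ $$M_X=\frac{\alpha_*\ell_{f,X}(p(d)^{T_X}-1)}{2(p(d)-1)}.$$ Here $\|f\|_{H^{-1}(\Omega)}=\sup\{\int_\Omega f\phi\,dx:\phi\in H_0^1(\Omega),\ \|\nabla\phi\|_{L^2(\Omega)}\le1\}$ and $\|f\|_{(H^1(\Omega))^*}=\sup\{\int_\Omega f\phi\,dx:\phi\in H^1(\Omega),\ \|\phi\|_{H^1(\Omega)}\le1\}$. *)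

theory Defs
  imports "HOL-Analysis.Analysis"
begin

text \<open>
  The dimension \<^term>\<open>d::nat\<close> has to be quantified inside the theorem (the constants must
  not depend on it), so it cannot be a type.  A point of the cube is an extensional function
  \<^typ>\<open>nat \<Rightarrow> real\<close> with the coordinates \<^prop>\<open>i < d\<close>, and the Euclidean norm of
  such a vector is \<^term>\<open>L2_set x {..<d}\<close>.
\<close>

definition cube :: "nat \<Rightarrow> (nat \<Rightarrow> real) set" where
  "cube d = PiE {..<d} (\<lambda>_. {0<..<1})"

text \<open>The completion makes measurability mean Lebesgue (not just Borel) measurability.\<close>

definition cube_lebesgue :: "nat \<Rightarrow> (nat \<Rightarrow> real) measure" where
  "cube_lebesgue d = completion (Pi\<^sub>M {..<d} (\<lambda>_. restrict_space lborel {0<..<1}))"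

definition L2 :: "nat \<Rightarrow> ((nat \<Rightarrow> real) \<Rightarrow> real) set" where
  "L2 d = {u. u \<in> borel_measurable (cube_lebesgue d) \<and>
              integrable (cube_lebesgue d) (\<lambda>x. (u x)\<^sup>2)}"

definition partial_deriv ::
    "nat \<Rightarrow> ((nat \<Rightarrow> real) \<Rightarrow> real) \<Rightarrow> (nat \<Rightarrow> real) \<Rightarrow> real" where
  "partial_deriv i \<phi> x = deriv (\<lambda>t. \<phi> (x(i := t))) (x i)"

text \<open>\<open>Ck m d \<phi>\<close>: all partial derivatives of \<open>\<phi>\<close> up to order \<open>m\<close> exist and are continuous on
  the open cube (the product topology on \<^typ>\<open>nat \<Rightarrow> real\<close> induces the Euclidean one there).\<close>

primrec Ck :: "nat \<Rightarrow> nat \<Rightarrow> ((nat \<Rightarrow> real) \<Rightarrow> real) \<Rightarrow> bool" where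
  "Ck 0 d \<phi> \<longleftrightarrow> continuous_on (cube d) \<phi>"
| "Ck (Suc m) d \<phi> \<longleftrightarrow> continuous_on (cube d) \<phi> \<and>
     (\<forall>i<d. (\<forall>x\<in>cube d. (\<lambda>t. \<phi> (x(i := t))) differentiable (at (x i))) \<and>
             Ck m d (partial_deriv i \<phi>))"

definition test_functions :: "nat \<Rightarrow> ((nat \<Rightarrow> real) \<Rightarrow> real) set" where
  "test_functions d = {\<phi>. (\<forall>m. Ck m d \<phi>) \<and>
     (\<exists>K. compact K \<and> K \<subseteq> cube d \<and> (\<forall>x\<in>cube d - K. \<phi> x = 0))}"

definition is_weak_partial ::
    "nat \<Rightarrow> nat \<Rightarrow> ((nat \<Rightarrow> real) \<Rightarrow> real) \<Rightarrow> ((nat \<Rightarrow> real) \<Rightarrow> real) \<Rightarrow> bool" where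
  "is_weak_partial d i u g \<longleftrightarrow> g \<in> L2 d \<and>
     (\<forall>\<phi>\<in>test_functions d.
        (\<integral>x. u x * partial_deriv i \<phi> x \<partial>cube_lebesgue d) = - (\<integral>x. g x * \<phi> x \<partial>cube_lebesgue d))"

text \<open>Weak derivatives are unique only almost everywhere, so we choose a representative; every
  use below is under an integral.\<close>

definition weak_partial ::
    "nat \<Rightarrow> nat \<Rightarrow> ((nat \<Rightarrow> real) \<Rightarrow> real) \<Rightarrow> (nat \<Rightarrow> real) \<Rightarrow> real" where
  "weak_partial d i u = (SOME g. is_weak_partial d i u g)"

definition H1 :: "nat \<Rightarrow> ((nat \<Rightarrow> real) \<Rightarrow> real) set" where
  "H1 d = {u \<in> L2 d. \<forall>i<d. \<exists>g. is_weak_partial d i u g}"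

definition H1_inner ::
    "nat \<Rightarrow> ((nat \<Rightarrow> real) \<Rightarrow> real) \<Rightarrow> ((nat \<Rightarrow> real) \<Rightarrow> real) \<Rightarrow> real" where
  "H1_inner d u v =
     (\<integral>x. (\<Sum>i<d. weak_partial d i u x * weak_partial d i v x) + u x * v x \<partial>cube_lebesgue d)"

definition H1_norm :: "nat \<Rightarrow> ((nat \<Rightarrow> real) \<Rightarrow> real) \<Rightarrow> real" where
  "H1_norm d u = sqrt (H1_inner d u u)"

definition H10 :: "nat \<Rightarrow> ((nat \<Rightarrow> real) \<Rightarrow> real) set" where
  "H10 d = {u \<in> H1 d. \<exists>\<phi> :: nat \<Rightarrow> (nat \<Rightarrow> real) \<Rightarrow> real. (\<forall>n. \<phi> n \<in> test_functions d) \<and>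
     (\<lambda>n. H1_norm d (\<lambda>x. u x - \<phi> n x)) \<longlonglongrightarrow> 0}"

definition grad_norm :: "nat \<Rightarrow> ((nat \<Rightarrow> real) \<Rightarrow> real) \<Rightarrow> real" where
  "grad_norm d u = sqrt (\<integral>x. (\<Sum>i<d. (weak_partial d i u x)\<^sup>2) \<partial>cube_lebesgue d)"

text \<open>The norms of \<open>f\<close> as a functional on \<open>H\<^sup>1\<^sub>0\<close> (with the gradient norm) and on
  \<open>H\<^sup>1\<close>.  For \<open>f\<close> in \<open>L\<^sup>2\<close> both sets are bounded and contain 0.\<close>

definition Hminus1_norm :: "nat \<Rightarrow> ((nat \<Rightarrow> real) \<Rightarrow> real) \<Rightarrow> real" where
  "Hminus1_norm d f =
     Sup {\<integral>x. f x * \<phi> x \<partial>cube_lebesgue d | \<phi>. \<phi> \<in> H10 d \<and> grad_norm d \<phi> \<le> 1}"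

definition H1_dual_norm :: "nat \<Rightarrow> ((nat \<Rightarrow> real) \<Rightarrow> real) \<Rightarrow> real" where
  "H1_dual_norm d f =
     Sup {\<integral>x. f x * \<phi> x \<partial>cube_lebesgue d | \<phi>. \<phi> \<in> H1 d \<and> H1_norm d \<phi> \<le> 1}"

text \<open>The entry \<open>A\<^sub>i\<^sub>j(x)\<close> is \<open>A x i j\<close>; indices run over \<^term>\<open>{..<d}\<close>.\<close>

definition op_norm_quotients :: "nat \<Rightarrow> ((nat \<Rightarrow> real) \<Rightarrow> nat \<Rightarrow> nat \<Rightarrow> real) \<Rightarrow> real set" where
  "op_norm_quotients d A =
     {L2_set (\<lambda>i. \<Sum>j<d. A x i j * v j) {..<d} / L2_set v {..<d} |x v.
        x \<in> cube d \<and> (\<exists>i<d. v i \<noteq> 0)}"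

definition basic_assumptions ::
    "nat \<Rightarrow> ((nat \<Rightarrow> real) \<Rightarrow> nat \<Rightarrow> nat \<Rightarrow> real) \<Rightarrow> ((nat \<Rightarrow> real) \<Rightarrow> real) \<Rightarrow> ((nat \<Rightarrow> real) \<Rightarrow> real) \<Rightarrow>
     real \<Rightarrow> real \<Rightarrow> real \<Rightarrow> real \<Rightarrow> bool" where
  "basic_assumptions d A c f a_min a_max c_min c_max \<longleftrightarrow>
     (\<forall>i<d. \<forall>j<d. (\<lambda>x. A x i j) \<in> borel_measurable (cube_lebesgue d)) \<and>
     (\<forall>x\<in>cube d. \<forall>i<d. \<forall>j<d. A x i j = A x j i) \<and>
     0 < a_min \<and>
     (\<forall>x\<in>cube d. \<forall>v. (\<Sum>i<d. \<Sum>j<d. v i * A x i j * v j) \<ge> a_min * (L2_set v {..<d})\<^sup>2) \<and>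
     bdd_above (op_norm_quotients d A) \<and>
     a_max = Sup (op_norm_quotients d A) \<and>
     c \<in> borel_measurable (cube_lebesgue d) \<and>
     0 < c_min \<and>
     (\<forall>x\<in>cube d. c_min \<le> c x \<and> c x \<le> c_max) \<and>
     f \<in> L2 d"

definition weak_identity ::
    "nat \<Rightarrow> ((nat \<Rightarrow> real) \<Rightarrow> nat \<Rightarrow> nat \<Rightarrow> real) \<Rightarrow> ((nat \<Rightarrow> real) \<Rightarrow> real) \<Rightarrow> ((nat \<Rightarrow> real) \<Rightarrow> real) \<Rightarrow>
     ((nat \<Rightarrow> real) \<Rightarrow> real) \<Rightarrow> ((nat \<Rightarrow> real) \<Rightarrow> real) \<Rightarrow> bool" where
  "weak_identity d A c f u v \<longleftrightarrow>
     (\<integral>x. (\<Sum>i<d. weak_partial d i u x * (\<Sum>j<d. A x i j * weak_partial d j v x))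
          + c x * u x * v x - f x * v x \<partial>cube_lebesgue d) = 0"

definition dirichlet_solution ::
    "nat \<Rightarrow> ((nat \<Rightarrow> real) \<Rightarrow> nat \<Rightarrow> nat \<Rightarrow> real) \<Rightarrow> ((nat \<Rightarrow> real) \<Rightarrow> real) \<Rightarrow> ((nat \<Rightarrow> real) \<Rightarrow> real) \<Rightarrow>
     ((nat \<Rightarrow> real) \<Rightarrow> real) \<Rightarrow> bool" where
  "dirichlet_solution d A c f u \<longleftrightarrow> u \<in> H10 d \<and> (\<forall>v\<in>H10 d. weak_identity d A c f u v)"

definition neumann_solution ::
    "nat \<Rightarrow> ((nat \<Rightarrow> real) \<Rightarrow> nat \<Rightarrow> nat \<Rightarrow> real) \<Rightarrow> ((nat \<Rightarrow> real) \<Rightarrow> real) \<Rightarrow> ((nat \<Rightarrow> real) \<Rightarrow> real) \<Rightarrow>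
     ((nat \<Rightarrow> real) \<Rightarrow> real) \<Rightarrow> bool" where
  "neumann_solution d A c f u \<longleftrightarrow> u \<in> H1 d \<and> (\<forall>v\<in>H1 d. weak_identity d A c f u v)"

definition multi_indices :: "nat \<Rightarrow> (nat \<Rightarrow> nat) set" where
  "multi_indices d = PiE {..<d} (\<lambda>_. UNIV)"

definition sin_basis :: "nat \<Rightarrow> (nat \<Rightarrow> nat) \<Rightarrow> (nat \<Rightarrow> real) \<Rightarrow> real" where
  "sin_basis d k x = (\<Prod>m<d. sin (pi * real (k m) * x m))"

definition cos_basis :: "nat \<Rightarrow> (nat \<Rightarrow> nat) \<Rightarrow> (nat \<Rightarrow> real) \<Rightarrow> real" where
  "cos_basis d k x = (\<Prod>m<d. cos (pi * real (k m) * x m))"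

definition mixed_basis :: "nat \<Rightarrow> nat \<Rightarrow> nat \<Rightarrow> (nat \<Rightarrow> nat) \<Rightarrow> (nat \<Rightarrow> real) \<Rightarrow> real" where
  "mixed_basis d i j k x = sin (pi * real (k i) * x i) * sin (pi * real (k j) * x j) *
     (\<Prod>m\<in>{..<d} - {i, j}. cos (pi * real (k m) * x m))"

text \<open>
  \<open>g = \<Sum>\<^sub>k a\<^sub>k e\<^sub>k\<close> with unconditional convergence in \<open>L\<^sup>2\<close>.  The coordinates in \<open>Z\<close> are those
  carrying a sine factor: \<open>a\<^sub>k = 0\<close> whenever one of their indices vanishes.  Setting \<open>a\<close> to 0
  outside the multi-indices makes it unique as a function.
\<close>

definition is_expansion ::
    "nat \<Rightarrow> ((nat \<Rightarrow> nat) \<Rightarrow> (nat \<Rightarrow> real) \<Rightarrow> real) \<Rightarrow> nat set \<Rightarrow>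
     ((nat \<Rightarrow> real) \<Rightarrow> real) \<Rightarrow> ((nat \<Rightarrow> nat) \<Rightarrow> real) \<Rightarrow> bool" where
  "is_expansion d e Z g a \<longleftrightarrow>
     (\<forall>k. k \<notin> multi_indices d \<longrightarrow> a k = 0) \<and>
     (\<forall>k. (\<exists>m\<in>Z. k m = 0) \<longrightarrow> a k = 0) \<and>
     ((\<lambda>F. \<integral>x. (g x - (\<Sum>k\<in>F. a k * e k x))\<^sup>2 \<partial>cube_lebesgue d) \<longlongrightarrow> 0)
       (finite_subsets_at_top (multi_indices d))"

definition coefficients ::
    "nat \<Rightarrow> ((nat \<Rightarrow> nat) \<Rightarrow> (nat \<Rightarrow> real) \<Rightarrow> real) \<Rightarrow> nat set \<Rightarrow>
     ((nat \<Rightarrow> real) \<Rightarrow> real) \<Rightarrow> (nat \<Rightarrow> nat) \<Rightarrow> real" where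
  "coefficients d e Z g = (THE a. is_expansion d e Z g a)"

definition weighted :: "nat \<Rightarrow> nat \<Rightarrow> ((nat \<Rightarrow> nat) \<Rightarrow> real) \<Rightarrow> (nat \<Rightarrow> nat) \<Rightarrow> real" where
  "weighted d n a k = \<bar>a k\<bar> * (1 + pi ^ n * L2_set (\<lambda>m. real (k m)) {..<d} ^ n)"

definition barron_space ::
    "nat \<Rightarrow> ((nat \<Rightarrow> nat) \<Rightarrow> (nat \<Rightarrow> real) \<Rightarrow> real) \<Rightarrow> nat set \<Rightarrow> nat \<Rightarrow>
     ((nat \<Rightarrow> real) \<Rightarrow> real) set" where
  "barron_space d e Z n =
     {g \<in> L2 d. \<exists>a. is_expansion d e Z g a \<and> weighted d n a summable_on multi_indices d}"

definition barron_norm ::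
    "nat \<Rightarrow> ((nat \<Rightarrow> nat) \<Rightarrow> (nat \<Rightarrow> real) \<Rightarrow> real) \<Rightarrow> nat set \<Rightarrow> nat \<Rightarrow>
     ((nat \<Rightarrow> real) \<Rightarrow> real) \<Rightarrow> real" where
  "barron_norm d e Z n g = infsum (weighted d n (coefficients d e Z g)) (multi_indices d)"

definition "barron_space_s d = barron_space d (sin_basis d) {..<d}"
definition "barron_norm_s d = barron_norm d (sin_basis d) {..<d}"
definition "barron_space_c d = barron_space d (cos_basis d) {}"
definition "barron_norm_c d = barron_norm d (cos_basis d) {}"
definition "barron_space_mixed d i j = barron_space d (mixed_basis d i j) {i, j}"
definition "barron_norm_mixed d i j = barron_norm d (mixed_basis d i j) {i, j}"

definition ell_A :: "nat \<Rightarrow> ((nat \<Rightarrow> real) \<Rightarrow> nat \<Rightarrow> nat \<Rightarrow> real) \<Rightarrow> real" where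
  "ell_A d A = max
     (Max {barron_norm_c d 1 (\<lambda>x. A x i i) |i. i < d})
     (Max {barron_norm_mixed d i j 1 (\<lambda>x. A x i j) |i j. i < d \<and> j < d \<and> i \<noteq> j})"

definition barron_assumptions ::
    "nat \<Rightarrow> ((nat \<Rightarrow> real) \<Rightarrow> nat \<Rightarrow> nat \<Rightarrow> real) \<Rightarrow> ((nat \<Rightarrow> real) \<Rightarrow> real) \<Rightarrow> real \<Rightarrow> real \<Rightarrow> bool" where
  "barron_assumptions d A c l_A l_c \<longleftrightarrow>
     (\<forall>i<d. (\<lambda>x. A x i i) \<in> barron_space_c d 1) \<and>
     (\<forall>i<d. \<forall>j<d. i \<noteq> j \<longrightarrow> (\<lambda>x. A x i j) \<in> barron_space_mixed d i j 1) \<and>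
     l_A = ell_A d A \<and>
     c \<in> barron_space_c d 2 \<and>
     l_c = barron_norm_c d 2 c"

definition lambda_min :: "real \<Rightarrow> real \<Rightarrow> real" where
  "lambda_min a_min c_min = min a_min c_min"

definition lambda_max :: "real \<Rightarrow> real \<Rightarrow> real" where
  "lambda_max a_max c_max = max a_max c_max"

definition alpha_star :: "real \<Rightarrow> real \<Rightarrow> real" where
  "alpha_star l_min l_max = l_min / l_max\<^sup>2"

definition beta_star :: "real \<Rightarrow> real \<Rightarrow> real" where
  "beta_star l_min l_max = sqrt (1 - l_min\<^sup>2 / l_max\<^sup>2)"

definition log_plus :: "real \<Rightarrow> real" where
  "log_plus t = (if t = 0 then 0 else max (ln t) 0)"

definition growth_factor :: "real \<Rightarrow> real \<Rightarrow> real \<Rightarrow> nat \<Rightarrow> real" where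
  "growth_factor \<alpha> l_A l_c d = (1 + pi) / pi * \<alpha> * l_A * (real d)\<^sup>2 + \<alpha> * l_c + 1"

text \<open>The number \<open>T\<^sub>X\<close> of iterations; \<open>F\<close> is the dual norm of the right-hand side.\<close>

definition num_steps :: "real \<Rightarrow> real \<Rightarrow> real \<Rightarrow> real \<Rightarrow> nat" where
  "num_steps l_min l_max F \<epsilon> =
     (if beta_star l_min l_max = 0 then 1
      else nat \<lceil>log_plus (2 * F / (\<epsilon> * l_min)) / \<bar>ln (beta_star l_min l_max)\<bar>\<rceil>)"

text \<open>The bound \<open>M\<^sub>X\<close>; \<open>l_f\<close> is the Barron norm and \<open>F\<close> the dual norm of the right-hand side.\<close>

definition M_bound ::
    "nat \<Rightarrow> real \<Rightarrow> real \<Rightarrow> real \<Rightarrow> real \<Rightarrow> real \<Rightarrow> real \<Rightarrow> real \<Rightarrow> real \<Rightarrow> real \<Rightarrow> real" where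
  "M_bound d a_min a_max c_min c_max l_A l_c l_f F \<epsilon> =
     (let l_min = lambda_min a_min c_min; l_max = lambda_max a_max c_max;
          \<alpha> = alpha_star l_min l_max; p = growth_factor \<alpha> l_A l_c d;
          T = num_steps l_min l_max F \<epsilon>
      in \<alpha> * l_f * (p ^ T - 1) / (2 * (p - 1)))"

definition ReLU :: "real \<Rightarrow> real" where
  "ReLU t = max t 0"

definition network ::
    "nat \<Rightarrow> nat \<Rightarrow> real \<Rightarrow> (nat \<Rightarrow> real) \<Rightarrow> (nat \<Rightarrow> nat \<Rightarrow> real) \<Rightarrow> (nat \<Rightarrow> real) \<Rightarrow>
     (nat \<Rightarrow> real) \<Rightarrow> real" where
  "network d k \<gamma> a w b x = \<gamma> + (\<Sum>i=1..k. a i * ReLU ((\<Sum>j<d. w i j * x j) + b i))"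

definition network_approximates ::
    "nat \<Rightarrow> nat \<Rightarrow> real \<Rightarrow> real \<Rightarrow> ((nat \<Rightarrow> real) \<Rightarrow> real) \<Rightarrow> bool" where
  "network_approximates d k M \<epsilon> u \<longleftrightarrow>
     (\<exists>(\<gamma>::real) (a :: nat \<Rightarrow> real) (w :: nat \<Rightarrow> nat \<Rightarrow> real) (b :: nat \<Rightarrow> real).
        \<bar>\<gamma>\<bar> \<le> 2 * M \<and>
        (\<Sum>i=1..k. \<bar>a i\<bar>) \<le> 4 * sqrt (real d) * M \<and>
        (\<forall>i\<in>{1..k}. L2_set (w i) {..<d} = 1 \<and> \<bar>b i\<bar> \<le> sqrt (real d)) \<and>
        H1_norm d (\<lambda>x. network d k \<gamma> a w b x - u x) \<le> \<epsilon>)"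

end

theory Submission
  imports Defs "HOL-Real_Asymp.Real_Asymp"
begin

text \<open>The iteration \<open>v - \<alpha> (1 - \<Delta>)\<^sup>-\<^sup>1 (L v - f)\<close>, \<open>L v = - div (A grad v) + c v\<close>, contracts in
  \<open>H\<^sup>1\<close> with factor \<open>\<beta>\<close>. With the expansions of \<open>A\<close>, \<open>c\<close>, \<open>f\<close> truncated it maps trigonometric
  polynomials to trigonometric polynomials, and product-to-sum formulas together with the inverse of
  \<open>1 - \<Delta>\<close> show that the weighted coefficient sum grows at most by the factor \<open>p(d)\<close> per step, up to
  the contribution of \<open>f\<close>. Hence the solution is close in \<open>H\<^sup>1\<close> to a trigonometric polynomial of norm
  of the order \<open>M\<close>. Such a polynomial is a superposition of ridge functions, each of which is a
  superposition of rectified linear units with total weight controlled by its second derivative;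
  a greedy version of Maurey's sampling argument then selects a network of the required width.\<close>

section \<open>Smooth cutoff functions of one variable\<close>

text \<open>The obstacle is that the H1 gradient of the residual has to be a trigonometric
  polynomial of controlled size, although nothing is known about an expansion of the solution. This
  is settled in weak form: against functions that integrate by parts correctly, a trigonometric
  product of type \<open>Z\<close> behaves as an eigenfunction of 1 - \<Delta>, so a functional with
  trigonometric data has an explicit Riesz representative. The set \<open>Z\<close> of coordinates
  carrying a sine treats both boundary conditions at once. Differentiation in x_i toggles i in
  \<open>Z\<close>, and the parity assumed for A_ij is what returns a flux to the right type.
  Truncation takes place in L2; its error, measured against 1 plus the energy of the test function,
  vanishes in an arbitrarily small \<delta> per step. The step size lmin / lmax^2 minimizes 1 - 2
  \<alpha> lmin + \<alpha>^2 lmax^2. The norm obeys U' \<le> p U + \<alpha> l_f / 2 starting from 0,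
  whence M. The passage to units controls their total weight only, so the width enters through the
  sampling alone, at the price M^2 d^2 / \<epsilon>^2.\<close>

text \<open>Continuous differentiability of order n on the whole line. The derivative is an
  existential witness, so the closure properties go by induction on n with the function
  generalized.\<close>

primrec times_differentiable :: "nat \<Rightarrow> (real \<Rightarrow> real) \<Rightarrow> bool" where
  "times_differentiable 0 f \<longleftrightarrow> continuous_on UNIV f"
| "times_differentiable (Suc n) f \<longleftrightarrow>
     (\<exists>f'. (\<forall>t. (f has_real_derivative f' t) (at t)) \<and> times_differentiable n f')"

lemma times_differentiable_continuous: "times_differentiable n f \<Longrightarrow> continuous_on UNIV f"
  by (cases n) (auto intro: DERIV_continuous_on)

lemma times_differentiable_Suc_D: "times_differentiable (Suc n) f \<Longrightarrow> times_differentiable n f"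
proof (induction n arbitrary: f)
  case 0
  then show ?case using times_differentiable_continuous by fastforce
next
  case (Suc n)
  then show ?case by (metis times_differentiable.simps(2))
qed

lemma times_differentiable_add:
  "times_differentiable n f \<Longrightarrow> times_differentiable n g \<Longrightarrow> times_differentiable n (\<lambda>t. f t + g t)"
proof (induction n arbitrary: f g)
  case 0
  then show ?case by (auto intro: continuous_intros)
next
  case (Suc n)
  then obtain f' g' where "\<forall>t. (f has_real_derivative f' t) (at t)" "times_differentiable n f'"
    "\<forall>t. (g has_real_derivative g' t) (at t)" "times_differentiable n g'" by auto
  then show ?case using Suc.IH[of f' g']
    by (auto intro!: exI[of _ "\<lambda>t. f' t + g' t"] derivative_eq_intros)
qed

lemma times_differentiable_mult:
  "times_differentiable n f \<Longrightarrow> times_differentiable n g \<Longrightarrow> times_differentiable n (\<lambda>t. f t * g t)"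
proof (induction n arbitrary: f g)
  case 0
  then show ?case by (auto intro: continuous_intros)
next
  case (Suc n)
  then obtain f' g' where fg: "\<forall>t. (f has_real_derivative f' t) (at t)" "times_differentiable n f'"
    "\<forall>t. (g has_real_derivative g' t) (at t)" "times_differentiable n g'" by auto
  then have "times_differentiable n (\<lambda>t. f' t * g t + f t * g' t)"
    using Suc times_differentiable_Suc_D by (intro times_differentiable_add) blast+
  then show ?case using fg
    by (auto intro!: exI[of _ "\<lambda>t. f' t * g t + f t * g' t"] derivative_eq_intros)
qed

lemma times_differentiable_const: "times_differentiable n (\<lambda>t. c)"
  by (induction n arbitrary: c) (auto intro!: exI[of _ "\<lambda>t. 0::real"])

lemma times_differentiable_affine:
  "times_differentiable n f \<Longrightarrow> times_differentiable n (\<lambda>t. f (a * t + b))"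
proof (induction n arbitrary: f)
  case 0
  then show ?case by (auto intro!: continuous_intros continuous_on_compose2[of UNIV f])
next
  case (Suc n)
  then obtain f' where f': "\<forall>t. (f has_real_derivative f' t) (at t)" "times_differentiable n f'"
    by auto
  have "((\<lambda>t. f (a * t + b)) has_real_derivative f' (a * t + b) * a) (at t)" for t
    using f'(1) by (intro DERIV_chain2[of f]) (auto intro!: derivative_eq_intros)
  moreover have "times_differentiable n (\<lambda>t. f' (a * t + b) * a)"
    using Suc.IH[OF f'(2)] by (intro times_differentiable_mult times_differentiable_const)
  ultimately show ?case by (auto intro!: exI[of _ "\<lambda>t. f' (a * t + b) * a"])
qed

lemma times_differentiable_cos: "times_differentiable n cos" "times_differentiable n sin"
proof (induction n)
  case (Suc n)
  case 1
  have "times_differentiable n (\<lambda>t. (-1) * sin t)"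
    using Suc by (intro times_differentiable_mult times_differentiable_const)
  then show ?case by (auto intro!: exI[of _ "\<lambda>t. -1 * sin t"] derivative_eq_intros)
  case 2
  show ?case using Suc by (auto intro!: exI[of _ cos] derivative_eq_intros)
qed (auto intro: continuous_intros)

text \<open>exp(-1/t), extended by 0, is the classical smooth function that is flat at the origin;
  the factors (1/t)^k make the family closed under differentiation.\<close>

definition flat :: "nat \<Rightarrow> real \<Rightarrow> real" where
  "flat k t = (if t > 0 then (1 / t) ^ k * exp (- (1 / t)) else 0)"

definition flat' :: "nat \<Rightarrow> real \<Rightarrow> real" where
  "flat' k t = flat (k + 2) t + - real k * flat (k + 1) t"

text \<open>With y = 1/t this is the decay of y^k exp(-y) at infinity.\<close>

lemma flat_tendsto_0: "(flat k \<longlongrightarrow> 0) (at_right 0)"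
proof -
  have "((\<lambda>y::real. y ^ k / exp y) \<longlongrightarrow> 0) at_top" by (rule tendsto_power_div_exp_0)
  then have "((\<lambda>t::real. (inverse t) ^ k / exp (inverse t)) \<longlongrightarrow> 0) (at_right 0)"
    by (rule filterlim_compose) (rule filterlim_inverse_at_top_right)
  then show ?thesis
  proof (rule Lim_transform_eventually)
    show "\<forall>\<^sub>F t in at_right (0::real). (inverse t) ^ k / exp (inverse t) = flat k t"
      using eventually_at_right_less[of "0::real"]
      by eventually_elim (auto simp: flat_def exp_minus divide_inverse)
  qed
qed

lemma has_real_derivative_flat: "(flat k has_real_derivative flat' k t) (at t)"
proof -
  consider "t > 0" | "t < 0" | "t = 0" by linarith
  then show ?thesis
  proof cases
    case 1
    have "((\<lambda>t. (1 / t) ^ k * exp (- (1 / t))) has_real_derivative flat' k t) (at t)"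
    proof -
      have inv: "((\<lambda>t. 1 / t) has_real_derivative - ((1 / t) ^ 2)) (at t)"
        using 1 by (auto intro!: derivative_eq_intros simp: power2_eq_square)
      have "((\<lambda>t. (1 / t) ^ k * exp (- (1 / t))) has_real_derivative
          real k * (1 / t) ^ (k - 1) * - ((1 / t) ^ 2) * exp (- (1 / t)) +
          (1 / t) ^ k * (exp (- (1 / t)) * (1 / t) ^ 2)) (at t)"
        by (rule derivative_eq_intros inv refl | simp)+
      moreover have "real k * (1 / t) ^ (k - 1) * - ((1 / t) ^ 2) * exp (- (1 / t)) +
          (1 / t) ^ k * (exp (- (1 / t)) * (1 / t) ^ 2) = flat' k t"
        using 1 by (cases k) (simp_all add: flat'_def flat_def power2_eq_square algebra_simps
            add_divide_distrib diff_divide_distrib)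
      ultimately show ?thesis by simp
    qed
    then show ?thesis
    proof (rule has_field_derivative_transform_within_open[of _ _ _ "{0<..}"])
    qed (use 1 in \<open>auto simp: flat_def\<close>)
  next
    case 2
    have "((\<lambda>t. 0) has_real_derivative flat' k t) (at t)"
      using 2 by (auto simp: flat'_def flat_def)
    then show ?thesis
    proof (rule has_field_derivative_transform_within_open[of _ _ _ "{..<0}"])
    qed (use 2 in \<open>auto simp: flat_def\<close>)
  next
    case 3
    \<comment> \<open>For h > 0 the difference quotient at 0 is \<open>flat (Suc k) h\<close>, so
      differentiability at the origin is the limit of the next member of the family.\<close>
    have R: "((\<lambda>h. flat k h / h) \<longlongrightarrow> 0) (at_right 0)"
    proof (rule Lim_transform_eventually[OF flat_tendsto_0[of "Suc k"]])
      show "\<forall>\<^sub>F h in at_right (0::real). flat (Suc k) h = flat k h / h"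
        using eventually_at_right_less[of "0::real"]
        by eventually_elim (auto simp: flat_def)
    qed
    have L: "((\<lambda>h. flat k h / h) \<longlongrightarrow> 0) (at_left 0)"
    proof (rule tendsto_eventually)
      show "\<forall>\<^sub>F h in at_left (0::real). flat k h / h = 0"
        unfolding eventually_at_left_field by (intro exI[of _ "-1"]) (auto simp: flat_def)
    qed
    have "((\<lambda>h. flat k h / h) \<longlongrightarrow> 0) (at 0)"
      using L R by (simp add: filterlim_split_at)
    then show ?thesis using 3 by (simp add: DERIV_def flat_def flat'_def)
  qed
qed

lemma times_differentiable_flat: "times_differentiable n (flat k)"
proof (induction n arbitrary: k)
  case 0
  then show ?case using has_real_derivative_flat by (auto intro!: DERIV_continuous_on)
next
  case (Suc n)
  have "times_differentiable n (flat' k)"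
    unfolding flat'_def[abs_def] using Suc
    by (intro times_differentiable_add times_differentiable_mult times_differentiable_const)
  then show ?case using has_real_derivative_flat by auto
qed

lemma flat_0_bounds: "0 \<le> flat 0 t" "flat 0 t \<le> 1"
  by (auto simp: flat_def)

text \<open>The arguments are n (t - a) - 1 and n (b - t) - 1, written as affine functions of t. The
  shift by 1 keeps the support inside [a + 1/n, b - 1/n], while for fixed t in (a, b) both arguments
  tend to infinity and the value to 1.\<close>

definition bump :: "real \<Rightarrow> real \<Rightarrow> nat \<Rightarrow> real \<Rightarrow> real" where
  "bump a b n t = flat 0 (real n * t + (- real n * a - 1)) * flat 0 (- real n * t + (real n * b - 1))"

text \<open>\<open>flat 2\<close> appears because it is the derivative of
  \<open>flat 0\<close>.\<close>

definition bump' :: "real \<Rightarrow> real \<Rightarrow> nat \<Rightarrow> real \<Rightarrow> real" where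
  "bump' a b n t =
     real n * flat 2 (real n * t + (- real n * a - 1)) * flat 0 (- real n * t + (real n * b - 1))
     - real n * flat 0 (real n * t + (- real n * a - 1)) * flat 2 (- real n * t + (real n * b - 1))"

lemma times_differentiable_bump: "times_differentiable m (bump a b n)"
  unfolding bump_def[abs_def]
  by (intro times_differentiable_mult times_differentiable_affine times_differentiable_flat)

lemma has_real_derivative_bump: "(bump a b n has_real_derivative bump' a b n t) (at t)"
proof -
  have "((\<lambda>t. flat 0 (c * t + e)) has_real_derivative flat' 0 (c * t + e) * c) (at t)" for c e t
    by (intro DERIV_chain2[of "flat 0"] has_real_derivative_flat) (auto intro!: derivative_eq_intros)
  from DERIV_mult[OF this this] show ?thesis
    unfolding bump_def[abs_def] bump'_def flat'_def by (rule DERIV_cong) (simp add: numeral_2_eq_2)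
qed

lemma bump_bounds: "0 \<le> bump a b n t" "bump a b n t \<le> 1"
  unfolding bump_def using flat_0_bounds by (auto intro: mult_nonneg_nonneg mult_le_one)

lemma bump_eq_0: "t \<le> a + 1 / real n \<or> b - 1 / real n \<le> t \<Longrightarrow> n > 0 \<Longrightarrow> bump a b n t = 0"
  by (auto simp: bump_def flat_def field_simps)

lemma bump_eq_0_outside: "t \<le> a \<or> b \<le> t \<Longrightarrow> bump a b n t = 0"
proof -
  assume t: "t \<le> a \<or> b \<le> t"
  have "real n * t \<le> real n * a \<or> real n * b \<le> real n * t"
    using t by (auto intro: mult_left_mono)
  then show ?thesis by (auto simp: bump_def flat_def)
qed

lemma flat_0_tendsto:
  assumes "c > 0"
  shows "(\<lambda>n. flat 0 (real n * c - 1)) \<longlonglongrightarrow> 1"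
proof -
  have lim: "filterlim (\<lambda>n. real n * c - 1) at_top sequentially"
    using assms by real_asymp
  have "((\<lambda>s::real. exp (- (1 / s))) \<longlongrightarrow> 1) at_top" by real_asymp
  moreover have "\<forall>\<^sub>F s in at_top. exp (- (1 / s)) = flat 0 s"
    using eventually_gt_at_top[of 0] by eventually_elim (auto simp: flat_def)
  ultimately have "(flat 0 \<longlongrightarrow> 1) at_top" by (rule Lim_transform_eventually)
  then show ?thesis using lim by (rule filterlim_compose)
qed

lemma flat_2_tendsto:
  assumes "c > 0"
  shows "(\<lambda>n. real n * flat 2 (real n * c - 1)) \<longlonglongrightarrow> 0"
proof -
  have lim: "filterlim (\<lambda>n. real n * c - 1) at_top sequentially"
    using assms by real_asymp
  have "((\<lambda>s::real. (s + 1) * ((1 / s)^2 * exp (- (1 / s)))) \<longlongrightarrow> 0) at_top"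
    by real_asymp
  from tendsto_mult_left[OF this, of "1 / c"]
  have "((\<lambda>s::real. (s + 1) / c * ((1 / s)^2 * exp (- (1 / s)))) \<longlongrightarrow> 0) at_top"
    by simp
  moreover have "\<forall>\<^sub>F s in at_top. (s + 1) / c * ((1 / s)^2 * exp (- (1 / s))) = (s + 1) / c * flat 2 s"
    using eventually_gt_at_top[of 0] by eventually_elim (auto simp: flat_def)
  ultimately have "((\<lambda>s. (s + 1) / c * flat 2 s) \<longlongrightarrow> 0) at_top" by (rule Lim_transform_eventually)
  then have "(\<lambda>n. (real n * c - 1 + 1) / c * flat 2 (real n * c - 1)) \<longlonglongrightarrow> 0"
    using lim by (rule filterlim_compose)
  then show ?thesis using assms by simp
qed

lemma bump_tendsto:
  assumes "a < t" "t < b"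
  shows "(\<lambda>n. bump a b n t) \<longlonglongrightarrow> 1"
  using tendsto_mult[OF flat_0_tendsto[of "t - a"] flat_0_tendsto[of "b - t"]] assms
  by (auto simp: bump_def algebra_simps)

lemma bump'_tendsto:
  assumes "a < t" "t < b"
  shows "(\<lambda>n. bump' a b n t) \<longlonglongrightarrow> 0"
proof -
  have "(\<lambda>n. (real n * flat 2 (real n * (t - a) - 1)) * flat 0 (real n * (b - t) - 1)
     - flat 0 (real n * (t - a) - 1) * (real n * flat 2 (real n * (b - t) - 1))) \<longlonglongrightarrow> 0 * 1 - 1 * 0"
    using assms by (intro tendsto_intros flat_0_tendsto flat_2_tendsto) auto
  then show ?thesis by (simp add: bump'_def algebra_simps)
qed

text \<open>At distance c from an endpoint the derivative of a bump is at most of the order 1/c: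
  with s = n c - 1 and y = 1/s the left side is (y + y^2) exp(-y), which is bounded independently of
  n.\<close>

lemma flat_2_bound:
  assumes "n > 0" "c \<ge> 0"
  shows "c * (real n * flat 2 (real n * c - 1)) \<le> 3"
proof (cases "real n * c - 1 > 0")
  case True
  define s where "s = real n * c - 1"
  have "s > 0" using True by (simp add: s_def)
  define y where "y = 1 / s"
  have y: "y > 0" using \<open>s > 0\<close> by (simp add: y_def)
  have "1 + y + y^2 / 2 \<le> exp y" by (rule exp_lower_Taylor_quadratic) (use y in simp)
  then have "y + y^2 \<le> 3 * exp y" using y zero_le_power2[of y] by linarith
  then have "(y + y^2) * exp (- y) \<le> 3" by (simp add: exp_minus field_simps)
  moreover have "(s + 1) * flat 2 s = (y + y^2) * exp (- y)"
    using \<open>s > 0\<close> by (simp add: flat_def y_def field_simps power2_eq_square)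
  moreover have "c * (real n * flat 2 s) = (s + 1) * flat 2 s" by (simp add: s_def algebra_simps)
  ultimately show ?thesis by (simp add: s_def)
next
  case False
  then show ?thesis by (simp add: flat_def)
qed

lemma flat_nonneg: "0 \<le> flat k t"
  by (auto simp: flat_def)

text \<open>Uniform in n. A sine vanishing at both ends of the interval is of the order min t (1 -
  t), so this bound keeps the derivatives of truncated sine products dominated.\<close>

lemma bump'_bound:
  assumes "n > 0" "0 < t" "t < 1"
  shows "min t (1 - t) * \<bar>bump' 0 1 n t\<bar> \<le> 6"
proof -
  let ?u = "real n * t - 1" and ?v = "real n * (1 - t) - 1"
  have eq: "bump' 0 1 n t = real n * flat 2 ?u * flat 0 ?v - flat 0 ?u * (real n * flat 2 ?v)"
    by (simp add: bump'_def algebra_simps)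
  have "\<bar>bump' 0 1 n t\<bar> \<le> real n * flat 2 ?u * flat 0 ?v + flat 0 ?u * (real n * flat 2 ?v)"
    unfolding eq by (rule abs_leI) (auto simp: flat_nonneg)
  also have "\<dots> \<le> real n * flat 2 ?u * 1 + 1 * (real n * flat 2 ?v)"
    by (intro add_mono mult_left_mono mult_right_mono) (auto simp: flat_nonneg flat_0_bounds)
  finally have "min t (1 - t) * \<bar>bump' 0 1 n t\<bar>
      \<le> min t (1 - t) * (real n * flat 2 ?u) + min t (1 - t) * (real n * flat 2 ?v)"
    using assms by (simp add: distrib_left[symmetric] mult_left_mono)
  also have "\<dots> \<le> t * (real n * flat 2 ?u) + (1 - t) * (real n * flat 2 ?v)"
    by (intro add_mono mult_right_mono) (auto simp: flat_nonneg)
  also have "\<dots> \<le> 3 + 3"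
    using assms by (intro add_mono flat_2_bound) auto
  finally show ?thesis by simp
qed

section \<open>Integration over the cube\<close>

abbreviation unit_interval :: "real measure" where
  "unit_interval \<equiv> restrict_space lborel {0<..<1}"

text \<open>The product measure before completion. Fubini and product integrals are applied here;
  integrals of Borel functions agree for both measures.\<close>

definition cube_borel :: "nat \<Rightarrow> (nat \<Rightarrow> real) measure" where
  "cube_borel d = Pi\<^sub>M {..<d} (\<lambda>_. unit_interval)"

lemma cube_lebesgue_eq: "cube_lebesgue d = completion (cube_borel d)"
  by (simp add: cube_lebesgue_def cube_borel_def)

lemma space_cube_borel [simp]: "space (cube_borel d) = cube d"
  by (simp add: cube_borel_def space_PiM cube_def space_restrict_space)

lemma space_cube_lebesgue [simp]: "space (cube_lebesgue d) = cube d"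
  by (simp add: cube_lebesgue_eq)

lemma emeasure_unit_interval [simp]: "emeasure unit_interval {0<..<1} = 1"
  by (simp add: emeasure_restrict_space)

lemma finite_measure_unit_interval: "finite_measure unit_interval"
  by (rule finite_measureI) (simp add: space_restrict_space)

lemma product_sigma_finite_unit_interval: "product_sigma_finite (\<lambda>_. unit_interval)"
  unfolding product_sigma_finite_def
  using finite_measure_unit_interval by (simp add: finite_measure_def)

lemma emeasure_cube_lebesgue: "emeasure (cube_lebesgue d) (cube d) = 1"
proof -
  interpret product_sigma_finite "\<lambda>_::nat. unit_interval" by (rule product_sigma_finite_unit_interval)
  have "emeasure (cube_borel d) (PiE {..<d} (\<lambda>_. space unit_interval)) = 1"
    unfolding cube_borel_def
    by (subst emeasure_PiM) (auto simp: space_restrict_space sets_restrict_space_iff simp del: sets_lborel)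
  moreover have "cube d \<in> sets (cube_borel d)"
    using sets.top[of "cube_borel d"] by simp
  ultimately show ?thesis
    by (simp add: cube_lebesgue_eq cube_def space_restrict_space)
qed

lemma finite_measure_cube_lebesgue: "finite_measure (cube_lebesgue d)"
  by (rule finite_measureI) (simp add: emeasure_cube_lebesgue)

lemma measure_cube_lebesgue [simp]: "measure (cube_lebesgue d) (cube d) = 1"
  by (simp add: measure_def emeasure_cube_lebesgue)

lemma integral_const_cube [simp]: "(\<integral>x. c \<partial>cube_lebesgue d) = (c::real)"
  by simp

lemma borel_measurable_cubeI:
  "f \<in> borel_measurable (cube_borel d) \<Longrightarrow> f \<in> borel_measurable (cube_lebesgue d)"
  unfolding cube_lebesgue_eq by (rule measurable_completion)

lemma measurable_coordinate [measurable]: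
  assumes "i < d" shows "(\<lambda>x. x i) \<in> borel_measurable (cube_borel d)"
proof -
  have "(\<lambda>x. x i) \<in> measurable (cube_borel d) unit_interval"
    unfolding cube_borel_def using assms by (intro measurable_component_singleton) simp
  then show ?thesis by (simp add: measurable_restrict_space2_iff)
qed

lemma abs_le_imp_square_le: "\<bar>a\<bar> \<le> B \<Longrightarrow> a\<^sup>2 \<le> (B::real)\<^sup>2"
  using power_mono[of "\<bar>a\<bar>" B 2] by simp

lemma integrable_bounded:
  fixes f :: "(nat \<Rightarrow> real) \<Rightarrow> real"
  assumes "f \<in> borel_measurable (cube_lebesgue d)" "\<And>x. x \<in> cube d \<Longrightarrow> \<bar>f x\<bar> \<le> B"
  shows "integrable (cube_lebesgue d) f"
proof -
  interpret finite_measure "cube_lebesgue d" by (rule finite_measure_cube_lebesgue)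
  show ?thesis using assms by (intro integrable_const_bound[of _ B]) auto
qed

text \<open>The Bochner integral of a function that is not integrable is 0; \<open>0 \<le> B\<close>
  covers that case.\<close>

lemma integral_le_bound:
  fixes f :: "(nat \<Rightarrow> real) \<Rightarrow> real"
  assumes "\<And>x. x \<in> cube d \<Longrightarrow> f x \<le> B" "0 \<le> B"
  shows "(\<integral>x. f x \<partial>cube_lebesgue d) \<le> B"
proof (cases "integrable (cube_lebesgue d) f")
  case True
  interpret finite_measure "cube_lebesgue d" by (rule finite_measure_cube_lebesgue)
  have "(\<integral>x. f x \<partial>cube_lebesgue d) \<le> (\<integral>x. B \<partial>cube_lebesgue d)"
    using True assms by (intro integral_mono) auto
  then show ?thesis by simp
qed (use assms in \<open>simp add: not_integrable_integral_eq\<close>)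

section \<open>Square-integrable functions on the cube\<close>

lemma L2_measurable: "u \<in> L2 d \<Longrightarrow> u \<in> borel_measurable (cube_lebesgue d)"
  and L2_square: "u \<in> L2 d \<Longrightarrow> integrable (cube_lebesgue d) (\<lambda>x. (u x)\<^sup>2)"
  by (auto simp: L2_def)

lemma abs_mult_le_squares: "\<bar>a * b\<bar> \<le> a\<^sup>2 + (b::real)\<^sup>2"
proof -
  have "0 \<le> (\<bar>a\<bar> - \<bar>b\<bar>)\<^sup>2" by simp
  moreover have "(\<bar>a\<bar> - \<bar>b\<bar>)\<^sup>2 = a\<^sup>2 + b\<^sup>2 - 2 * \<bar>a * b\<bar>"
    by (simp add: power2_diff abs_mult)
  ultimately show ?thesis by simp
qed

lemma L2_mult_integrable:
  assumes "u \<in> L2 d" "v \<in> L2 d"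
  shows "integrable (cube_lebesgue d) (\<lambda>x. u x * v x)"
proof (rule Bochner_Integration.integrable_bound)
  show "integrable (cube_lebesgue d) (\<lambda>x. (u x)\<^sup>2 + (v x)\<^sup>2)"
    using assms by (intro Bochner_Integration.integrable_add L2_square)
  show "(\<lambda>x. u x * v x) \<in> borel_measurable (cube_lebesgue d)"
    using assms by (intro borel_measurable_times L2_measurable)
  have "norm (u x * v x) \<le> norm ((u x)\<^sup>2 + (v x)\<^sup>2)" for x
    using abs_mult_le_squares[of "u x" "v x"] by simp
  then show "AE x in cube_lebesgue d. norm (u x * v x) \<le> norm ((u x)\<^sup>2 + (v x)\<^sup>2)"
    by (intro AE_I2)
qed

lemma L2_bounded:
  assumes "u \<in> borel_measurable (cube_lebesgue d)" "\<And>x. x \<in> cube d \<Longrightarrow> \<bar>u x\<bar> \<le> B"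
  shows "u \<in> L2 d"
  unfolding L2_def
proof (intro CollectI conjI assms(1))
  show "integrable (cube_lebesgue d) (\<lambda>x. (u x)\<^sup>2)"
    using assms by (intro integrable_bounded[of _ _ "B\<^sup>2"])
      (auto intro!: abs_le_imp_square_le)
qed

lemma L2_const: "(\<lambda>x. c) \<in> L2 d"
  by (rule L2_bounded[of _ _ "\<bar>c\<bar>"]) auto

lemma L2_integrable: "u \<in> L2 d \<Longrightarrow> integrable (cube_lebesgue d) u"
  using L2_mult_integrable[OF _ L2_const[of 1]] by simp

lemma L2_add:
  assumes "u \<in> L2 d" "v \<in> L2 d"
  shows "(\<lambda>x. u x + v x) \<in> L2 d"
proof -
  have "integrable (cube_lebesgue d) (\<lambda>x. (u x)\<^sup>2 + (v x)\<^sup>2 + 2 * (u x * v x))"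
    using assms by (intro Bochner_Integration.integrable_add L2_square integrable_mult_right
        L2_mult_integrable)
  then show ?thesis
    using assms by (auto simp: L2_def power2_sum mult.assoc)
qed

lemma L2_bounded_mult:
  assumes "c \<in> borel_measurable (cube_lebesgue d)" "\<And>x. x \<in> cube d \<Longrightarrow> \<bar>c x\<bar> \<le> B" "u \<in> L2 d"
  shows "(\<lambda>x. c x * u x) \<in> L2 d"
proof -
  have "integrable (cube_lebesgue d) (\<lambda>x. (c x * u x)\<^sup>2)"
  proof (rule Bochner_Integration.integrable_bound)
    show "integrable (cube_lebesgue d) (\<lambda>x. B\<^sup>2 * (u x)\<^sup>2)"
      using assms by (intro integrable_mult_right L2_square)
    show "(\<lambda>x. (c x * u x)\<^sup>2) \<in> borel_measurable (cube_lebesgue d)"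
      using assms(1) L2_measurable[OF assms(3)] by (intro borel_measurable_power borel_measurable_times)
    show "AE x in cube_lebesgue d. norm ((c x * u x)\<^sup>2) \<le> norm (B\<^sup>2 * (u x)\<^sup>2)"
    proof (rule AE_I2)
      fix x assume "x \<in> space (cube_lebesgue d)"
      then have "(c x)\<^sup>2 \<le> B\<^sup>2"
        using assms(2) by (auto intro!: abs_le_imp_square_le)
      then show "norm ((c x * u x)\<^sup>2) \<le> norm (B\<^sup>2 * (u x)\<^sup>2)"
        by (simp add: power_mult_distrib mult_right_mono)
    qed
  qed
  then show ?thesis using assms(1) L2_measurable[OF assms(3)] by (auto simp: L2_def)
qed

lemma L2_scale: "u \<in> L2 d \<Longrightarrow> (\<lambda>x. c * u x) \<in> L2 d"
  by (rule L2_bounded_mult[of _ _ "\<bar>c\<bar>"]) auto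

lemma L2_diff: "u \<in> L2 d \<Longrightarrow> v \<in> L2 d \<Longrightarrow> (\<lambda>x. u x - v x) \<in> L2 d"
  using L2_add[OF _ L2_scale[of v d "-1"]] by simp

lemma L2_sum: "finite I \<Longrightarrow> (\<And>i. i \<in> I \<Longrightarrow> u i \<in> L2 d) \<Longrightarrow> (\<lambda>x. \<Sum>i\<in>I. u i x) \<in> L2 d"
  by (induction I rule: finite_induct) (auto intro: L2_const L2_add)

text \<open>The squared norm of u + s v is a nonnegative polynomial of degree two in s, evaluated at
  its minimum.\<close>

lemma L2_Cauchy_Schwarz:
  assumes "u \<in> L2 d" "v \<in> L2 d"
  shows "(\<integral>x. u x * v x \<partial>cube_lebesgue d)\<^sup>2
    \<le> (\<integral>x. (u x)\<^sup>2 \<partial>cube_lebesgue d) * (\<integral>x. (v x)\<^sup>2 \<partial>cube_lebesgue d)"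
proof -
  let ?uu = "\<integral>x. (u x)\<^sup>2 \<partial>cube_lebesgue d" and ?vv = "\<integral>x. (v x)\<^sup>2 \<partial>cube_lebesgue d"
  let ?uv = "\<integral>x. u x * v x \<partial>cube_lebesgue d"
  have q: "0 \<le> ?uu + s * (2 * ?uv) + s\<^sup>2 * ?vv" for s
  proof -
    have "0 \<le> (\<integral>x. (u x + s * v x)\<^sup>2 \<partial>cube_lebesgue d)" by (rule integral_nonneg_AE) auto
    also have "\<dots> = (\<integral>x. (u x)\<^sup>2 + s * (2 * (u x * v x)) + s\<^sup>2 * (v x)\<^sup>2 \<partial>cube_lebesgue d)"
      by (rule Bochner_Integration.integral_cong) (auto simp: power2_eq_square algebra_simps)
    also have "\<dots> = ?uu + s * (2 * ?uv) + s\<^sup>2 * ?vv"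
      using assms by (simp add: L2_square L2_mult_integrable Bochner_Integration.integral_add)
    finally show ?thesis .
  qed
  have vv: "0 \<le> ?vv" by (rule integral_nonneg_AE) auto
  show ?thesis
  proof (cases "?vv = 0")
    case True
    have "?uv = 0"
    proof (rule ccontr)
      assume nz: "?uv \<noteq> 0"
      \<comment> \<open>With v of norm 0 the polynomial is affine in s; this choice of s gives it
        the value -1.\<close>
      have "0 \<le> ?uu + (- (?uu + 1) / (2 * ?uv)) * (2 * ?uv)" using q[of "- (?uu + 1) / (2 * ?uv)"] True by simp
      then show False using nz by simp
    qed
    then show ?thesis using True by simp
  next
    case False
    then have "?vv > 0" using vv by linarith
    have "0 \<le> ?uu - ?uv\<^sup>2 / ?vv"
      using q[of "- ?uv / ?vv"] \<open>?vv > 0\<close> by (simp add: power2_eq_square)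
    then show ?thesis using \<open>?vv > 0\<close> by (simp add: pos_divide_le_eq)
  qed
qed

lemma L2_tendsto_0_mult:
  assumes "\<And>n. w n \<in> L2 d" "v \<in> L2 d"
    and "(\<lambda>n. \<integral>x. (w n x)\<^sup>2 \<partial>cube_lebesgue d) \<longlonglongrightarrow> 0"
  shows "(\<lambda>n. \<integral>x. w n x * v x \<partial>cube_lebesgue d) \<longlonglongrightarrow> 0"
proof -
  let ?v = "\<integral>x. (v x)\<^sup>2 \<partial>cube_lebesgue d"
  have "(\<lambda>n. (\<integral>x. (w n x)\<^sup>2 \<partial>cube_lebesgue d) * ?v) \<longlonglongrightarrow> 0 * ?v"
    by (intro tendsto_mult assms tendsto_const)
  then have lim: "(\<lambda>n. (\<integral>x. (w n x)\<^sup>2 \<partial>cube_lebesgue d) * ?v) \<longlonglongrightarrow> 0" by simp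
  have "(\<lambda>n. (\<integral>x. w n x * v x \<partial>cube_lebesgue d)\<^sup>2) \<longlonglongrightarrow> 0"
  proof (rule Lim_null_comparison[OF _ lim], rule always_eventually, rule allI)
    fix n
    show "norm ((\<integral>x. w n x * v x \<partial>cube_lebesgue d)\<^sup>2) \<le> (\<integral>x. (w n x)\<^sup>2 \<partial>cube_lebesgue d) * ?v"
      using L2_Cauchy_Schwarz[OF assms(1,2)] by simp
  qed
  then show ?thesis by simp
qed

section \<open>Fubini in one coordinate and the fundamental theorem of calculus on a segment\<close>

lemma integral_cube_insert:
  fixes f :: "(nat \<Rightarrow> real) \<Rightarrow> real"
  assumes "i < d" "f \<in> borel_measurable (cube_borel d)" "\<And>x. x \<in> cube d \<Longrightarrow> \<bar>f x\<bar> \<le> B"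
  shows "(\<integral>x. f x \<partial>cube_lebesgue d) =
    (\<integral>x. (\<integral>t. f (x(i := t)) \<partial>unit_interval) \<partial>Pi\<^sub>M ({..<d} - {i}) (\<lambda>_. unit_interval))"
proof -
  interpret product_sigma_finite "\<lambda>_::nat. unit_interval" by (rule product_sigma_finite_unit_interval)
  have eq: "insert i ({..<d} - {i}) = {..<d}" using assms(1) by auto
  have "integrable (cube_lebesgue d) f"
    using assms by (intro integrable_bounded borel_measurable_cubeI)
  then have "integrable (cube_borel d) f"
    using assms(2) by (simp add: cube_lebesgue_eq integrable_completion)
  then have int: "integrable (Pi\<^sub>M (insert i ({..<d} - {i})) (\<lambda>_. unit_interval)) f"
    unfolding eq cube_borel_def .
  have "(\<integral>x. f x \<partial>cube_lebesgue d) = (\<integral>x. f x \<partial>cube_borel d)"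
    using assms(2) by (simp add: cube_lebesgue_eq integral_completion)
  then show ?thesis
    using product_integral_insert[OF _ _ int] unfolding eq cube_borel_def by simp
qed

lemma fun_upd_in_cube:
  assumes "i < d" "x \<in> PiE ({..<d} - {i}) (\<lambda>_. {0<..<1}) \<or> x \<in> cube d" "t \<in> {0<..<1}"
  shows "x(i := t) \<in> cube d"
  using assms by (auto simp: cube_def PiE_def extensional_def Pi_def)

lemma measurable_fun_upd_cube:
  assumes "i < d" "x \<in> space (Pi\<^sub>M ({..<d} - {i}) (\<lambda>_. unit_interval))"
    "f \<in> borel_measurable (cube_borel d)"
  shows "(\<lambda>t. f (x(i := t))) \<in> borel_measurable unit_interval"
proof -
  have eq: "insert i ({..<d} - {i}) = {..<d}" using assms(1) by auto
  have "(\<lambda>t. x(i := t)) \<in> measurable unit_interval (Pi\<^sub>M (insert i ({..<d} - {i})) (\<lambda>_. unit_interval))"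
    using assms(2) by (intro measurable_component_update) auto
  then have "(\<lambda>t. x(i := t)) \<in> measurable unit_interval (cube_borel d)"
    unfolding eq cube_borel_def .
  from measurable_compose[OF this assms(3)] show ?thesis .
qed

text \<open>The exceptional set \<open>S\<close> admits kinks such as those of rectified linear
  units: the fundamental theorem of calculus tolerates finitely many points without a derivative. It
  is applied on [a, b], off which \<open>f'\<close> vanishes.\<close>

lemma integral_derivative_compact_support:
  fixes f f' :: "real \<Rightarrow> real"
  assumes ab: "0 < a" "a < b" "b < 1" and f: "continuous_on {a..b} f" "f a = 0" "f b = 0"
    and S: "finite S" and f': "\<And>t. t \<in> {a<..<b} - S \<Longrightarrow> (f has_real_derivative f' t) (at t)"
    and meas: "f' \<in> borel_measurable unit_interval"
    and bdd: "\<And>t. t \<in> {0<..<1} \<Longrightarrow> \<bar>f' t\<bar> \<le> B"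
    and zero: "\<And>t. t \<in> {0<..<1} - {a..b} \<Longrightarrow> f' t = 0"
  shows "(\<integral>t. f' t \<partial>unit_interval) = 0"
proof -
  have eq: "indicator {0<..<1} t *\<^sub>R f' t = indicator {a..b} t *\<^sub>R f' t" for t
    using ab zero[of t] by (auto simp: indicator_def)
  have "(\<lambda>t. indicator {0<..<1} t *\<^sub>R f' t) \<in> borel_measurable lborel"
    using meas by (subst (asm) borel_measurable_restrict_space_iff) auto
  then have m: "(\<lambda>t. indicator {a..b} t *\<^sub>R f' t) \<in> borel_measurable lborel"
    unfolding eq .
  have int: "set_integrable lborel {a..b} f'"
    unfolding set_integrable_def
  proof (rule Bochner_Integration.integrable_bound[OF _ m])
    show "integrable lborel (\<lambda>t. indicator {a..b} t *\<^sub>R B)"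
      using ab by (intro integrable_scaleR_left integrable_real_indicator) auto
    show "AE x in lborel. norm (indicator {a..b} x *\<^sub>R f' x) \<le> norm (indicator {a..b} x *\<^sub>R B)"
    proof (rule AE_I2)
      fix x
      show "norm (indicator {a..b} x *\<^sub>R f' x) \<le> norm (indicator {a..b} x *\<^sub>R B)"
        using bdd[of x] ab by (auto simp: indicator_def)
    qed
  qed
  have "(f' has_integral f b - f a) {a..b}"
    using S ab f f'
    by (intro fundamental_theorem_of_calculus_interior_strong)
       (auto simp: has_real_derivative_iff_has_vector_derivative)
  then have "integral {a..b} f' = 0" using f by (simp add: integral_unique)
  then have "(\<integral>t. indicator {a..b} t *\<^sub>R f' t \<partial>lborel) = 0"
    using set_borel_integral_eq_integral(2)[OF int] by (simp add: set_lebesgue_integral_def)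
  then show ?thesis
    by (subst integral_restrict_space) (simp_all only: eq, simp_all)
qed

section \<open>Test functions\<close>

text \<open>The identity is measurable from the finite product of intervals to the Borel sets of
  \<open>nat \<Rightarrow> real\<close>, and a continuous function on the cube is composed with
  it.\<close>

lemma borel_measurable_continuous_on_cube:
  fixes f :: "(nat \<Rightarrow> real) \<Rightarrow> real"
  assumes "continuous_on (cube d) f"
  shows "f \<in> borel_measurable (cube_borel d)"
proof -
  have "(\<lambda>x i. x i) \<in> measurable (cube_borel d) (Pi\<^sub>M UNIV (\<lambda>_::nat. borel :: real measure))"
  proof (rule measurable_PiM_single')
    fix i :: nat
    show "(\<lambda>x. x i) \<in> borel_measurable (cube_borel d)"
    proof (cases "i < d")
      case False
      \<comment> \<open>Points of the cube are extensional, so the coordinates from d on are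
        constant and hence measurable.\<close>
      then have "x i = undefined" if "x \<in> space (cube_borel d)" for x
        using that by (auto simp: cube_def PiE_def extensional_def)
      then show ?thesis by (subst measurable_cong[of _ _ "\<lambda>_. undefined"]) auto
    qed auto
  qed auto
  then have "(\<lambda>x. x) \<in> measurable (cube_borel d) (borel :: (nat \<Rightarrow> real) measure)"
    using measurable_cong_sets[OF refl sets_PiM_equal_borel] by blast
  then have "(\<lambda>x. x) \<in> measurable (cube_borel d) (restrict_space borel (cube d))"
    by (rule measurable_restrict_space2[rotated]) auto
  from measurable_compose[OF this borel_measurable_continuous_on_restrict[OF assms]]
  show ?thesis .
qed

lemma bounded_compact_support:
  fixes f :: "(nat \<Rightarrow> real) \<Rightarrow> real"
  assumes "continuous_on (cube d) f" "compact K" "K \<subseteq> cube d" "\<And>x. x \<in> cube d - K \<Longrightarrow> f x = 0"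
  obtains B where "\<And>x. x \<in> cube d \<Longrightarrow> \<bar>f x\<bar> \<le> B"
proof -
  have "compact (f ` K)"
    using assms continuous_on_subset by (intro compact_continuous_image) blast+
  then have "bounded (f ` K)" by (rule compact_imp_bounded)
  then obtain B where B: "\<And>x. x \<in> K \<Longrightarrow> \<bar>f x\<bar> \<le> B" by (auto simp: bounded_iff)
  have "\<bar>f x\<bar> \<le> max B 0" if "x \<in> cube d" for x
    using B[of x] assms(4)[of x] that by fastforce
  then show ?thesis by (rule that)
qed

lemma continuous_fun_upd: "continuous_on A (\<lambda>t. (x :: nat \<Rightarrow> real)(i := t))"
proof (rule continuous_on_coordinatewise_then_product)
  fix j show "continuous_on A (\<lambda>t. (x(i := t)) j)" by (cases "j = i") auto
qed

lemma test_function_Ck: "\<phi> \<in> test_functions d \<Longrightarrow> Ck m d \<phi>"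
  by (auto simp: test_functions_def)

lemma test_function_continuous: "\<phi> \<in> test_functions d \<Longrightarrow> continuous_on (cube d) \<phi>"
  using test_function_Ck[of \<phi> d 0] by simp

lemma test_function_partial_continuous:
  "\<phi> \<in> test_functions d \<Longrightarrow> i < d \<Longrightarrow> continuous_on (cube d) (partial_deriv i \<phi>)"
  using test_function_Ck[of \<phi> d 1] by simp

lemma test_function_has_derivative:
  assumes "\<phi> \<in> test_functions d" "i < d" "x \<in> cube d"
  shows "((\<lambda>t. \<phi> (x(i := t))) has_real_derivative partial_deriv i \<phi> x) (at (x i))"
  using test_function_Ck[OF assms(1), of 1] assms(2,3)
  by (auto simp: partial_deriv_def DERIV_deriv_iff_real_differentiable)

text \<open>A compact set is closed, so around a point of the cube off the set a short segment in
  direction i avoids it; on that segment the function is 0.\<close>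

lemma partial_deriv_eq_0_off_support:
  assumes "compact K" "\<And>x. x \<in> cube d - K \<Longrightarrow> \<phi> x = 0" "i < d" "x \<in> cube d - K"
  shows "partial_deriv i \<phi> x = 0"
proof -
  have op: "open ((\<lambda>t. x(i := t)) -` (- K))"
    using compact_imp_closed[OF assms(1)] continuous_fun_upd[of UNIV x i]
    by (intro open_vimage) auto
  have xi: "x i \<in> {0<..<1}" using assms by (auto simp: cube_def PiE_def Pi_def)
  have "((\<lambda>t. \<phi> (x(i := t))) has_real_derivative 0) (at (x i))"
  proof (rule has_field_derivative_transform_within_open[of "\<lambda>t. 0" 0])
    show "open ((\<lambda>t. x(i := t)) -` (- K) \<inter> {0<..<1})" using op by auto
    show "x i \<in> (\<lambda>t. x(i := t)) -` (- K) \<inter> {0<..<1}" using assms xi by auto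
    fix t assume "t \<in> (\<lambda>t. x(i := t)) -` (- K) \<inter> {0<..<1}"
    then show "0 = \<phi> (x(i := t))" using assms by (subst assms(2)) (auto intro: fun_upd_in_cube)
  qed auto
  then show ?thesis unfolding partial_deriv_def by (rule DERIV_imp_deriv)
qed

text \<open>The projection of the compact support to coordinate i is a compact subset of (0, 1) and
  so stays away from both ends. One interval and one bound serve the function and its
  derivative.\<close>

lemma test_function_support:
  assumes "\<phi> \<in> test_functions d" "i < d"
  shows "\<exists>a b B. 0 < a \<and> a < b \<and> b < 1 \<and>
    (\<forall>x\<in>cube d. x i \<notin> {a<..<b} \<longrightarrow> \<phi> x = 0 \<and> partial_deriv i \<phi> x = 0) \<and>
    (\<forall>x\<in>cube d. \<bar>\<phi> x\<bar> \<le> B \<and> \<bar>partial_deriv i \<phi> x\<bar> \<le> B)"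
proof -
  obtain K where K: "compact K" "K \<subseteq> cube d" "\<And>x. x \<in> cube d - K \<Longrightarrow> \<phi> x = 0"
    using assms by (auto simp: test_functions_def)
  have K': "partial_deriv i \<phi> x = 0" if "x \<in> cube d - K" for x
    using partial_deriv_eq_0_off_support[OF K(1) _ assms(2) that] K(3) by blast
  obtain B1 where B1: "\<And>x. x \<in> cube d \<Longrightarrow> \<bar>\<phi> x\<bar> \<le> B1"
    using bounded_compact_support[OF test_function_continuous[OF assms(1)] K] by blast
  obtain B2 where B2: "\<And>x. x \<in> cube d \<Longrightarrow> \<bar>partial_deriv i \<phi> x\<bar> \<le> B2"
    using bounded_compact_support[OF test_function_partial_continuous[OF assms] K(1,2) K'] by blast
  have "compact ((\<lambda>x. x i) ` K)"
    using K(1) by (intro compact_continuous_image continuous_on_subset[OF continuous_on_product_coordinates]) auto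
  moreover have "(\<lambda>x. x i) ` K \<subseteq> {0<..<1}" using K(2) assms(2) by (auto simp: cube_def)
  ultimately have "\<exists>a b. 0 < a \<and> a < b \<and> b < 1 \<and> (\<lambda>x. x i) ` K \<subseteq> {a<..<b}"
  proof (cases "K = {}")
    case True
    \<comment> \<open>With empty support any interval inside (0, 1) will do.\<close>
    then show ?thesis by (intro exI[of _ "1/3"] exI[of _ "2/3"]) auto
  next
    case False
    let ?I = "(\<lambda>x. x i) ` K"
    assume c: "compact ?I" and s: "?I \<subseteq> {0<..<1}"
    obtain l where l: "l \<in> ?I" "\<And>y. y \<in> ?I \<Longrightarrow> l \<le> y"
      using compact_attains_inf[OF c] False by auto
    obtain u where u: "u \<in> ?I" "\<And>y. y \<in> ?I \<Longrightarrow> y \<le> u"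
      using compact_attains_sup[OF c] False by auto
    have lu: "0 < l" "l \<le> u" "u < 1" using l u s by auto
    have "?I \<subseteq> {l / 2<..<(1 + u) / 2}" using l(2) u(2) lu by fastforce
    then show ?thesis using lu by (intro exI[of _ "l / 2"] exI[of _ "(1 + u) / 2"]) auto
  qed
  then obtain a b where ab: "0 < a" "a < b" "b < 1" "(\<lambda>x. x i) ` K \<subseteq> {a<..<b}" by blast
  have "\<phi> x = 0" "partial_deriv i \<phi> x = 0" if "x \<in> cube d" "x i \<notin> {a<..<b}" for x
    using that ab(4) K(3)[of x] K'[of x] by (auto simp: image_subset_iff)
  moreover have "\<bar>\<phi> x\<bar> \<le> max B1 B2" "\<bar>partial_deriv i \<phi> x\<bar> \<le> max B1 B2" if "x \<in> cube d" for x
    using B1[OF that] B2[OF that] by auto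
  ultimately show ?thesis
    using ab by (intro exI[of _ a] exI[of _ b] exI[of _ "max B1 B2"]) auto
qed

lemma test_function_measurable:
  "\<phi> \<in> test_functions d \<Longrightarrow> \<phi> \<in> borel_measurable (cube_borel d)"
  by (intro borel_measurable_continuous_on_cube test_function_continuous)

lemma test_function_partial_measurable:
  "\<phi> \<in> test_functions d \<Longrightarrow> i < d \<Longrightarrow> partial_deriv i \<phi> \<in> borel_measurable (cube_borel d)"
  by (intro borel_measurable_continuous_on_cube test_function_partial_continuous)

lemma test_function_L2:
  assumes "\<phi> \<in> test_functions d" "i < d"
  shows "\<phi> \<in> L2 d" "partial_deriv i \<phi> \<in> L2 d"
proof -
  obtain B where B: "\<And>x. x \<in> cube d \<Longrightarrow> \<bar>\<phi> x\<bar> \<le> B" "\<And>x. x \<in> cube d \<Longrightarrow> \<bar>partial_deriv i \<phi> x\<bar> \<le> B"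
    using test_function_support[OF assms] by blast
  show "\<phi> \<in> L2 d" "partial_deriv i \<phi> \<in> L2 d"
    using L2_bounded[OF borel_measurable_cubeI[OF test_function_measurable[OF assms(1)]] B(1)]
      L2_bounded[OF borel_measurable_cubeI[OF test_function_partial_measurable[OF assms]] B(2)]
    by auto
qed

section \<open>Products of functions of one variable\<close>

lemma prod_fun_upd_lessThan:
  fixes \<eta> :: "nat \<Rightarrow> real \<Rightarrow> real"
  assumes "i < d"
  shows "(\<Prod>m<d. \<eta> m ((x(i := t)) m)) = \<eta> i t * (\<Prod>m\<in>{..<d} - {i}. \<eta> m (x m))"
proof -
  have "(\<Prod>m<d. \<eta> m ((x(i := t)) m)) = \<eta> i t * (\<Prod>m\<in>{..<d} - {i}. \<eta> m ((x(i := t)) m))"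
    using assms by (subst prod.remove[of _ i]) auto
  also have "(\<Prod>m\<in>{..<d} - {i}. \<eta> m ((x(i := t)) m)) = (\<Prod>m\<in>{..<d} - {i}. \<eta> m (x m))"
    by (rule prod.cong) auto
  finally show ?thesis .
qed

lemma has_derivative_prod_coordinate:
  fixes \<eta> :: "nat \<Rightarrow> real \<Rightarrow> real"
  assumes "i < d" "(\<eta> i has_real_derivative \<eta>') (at t)"
  shows "((\<lambda>t. \<Prod>m<d. \<eta> m ((x(i := t)) m)) has_real_derivative
    \<eta>' * (\<Prod>m\<in>{..<d} - {i}. \<eta> m (x m))) (at t)"
  unfolding prod_fun_upd_lessThan[OF assms(1)] using assms(2) by (rule DERIV_cmult_right)

lemma partial_deriv_prod:
  fixes \<eta> :: "nat \<Rightarrow> real \<Rightarrow> real"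
  assumes "i < d" "(\<eta> i has_real_derivative \<eta>') (at (x i))"
  shows "partial_deriv i (\<lambda>x. \<Prod>m<d. \<eta> m (x m)) x = \<eta>' * (\<Prod>m\<in>{..<d} - {i}. \<eta> m (x m))"
  unfolding partial_deriv_def by (rule DERIV_imp_deriv[OF has_derivative_prod_coordinate[where \<eta> = \<eta>, OF assms]])

lemma prod_remove_fun_upd:
  fixes \<eta> :: "nat \<Rightarrow> real \<Rightarrow> real"
  assumes "i < d"
  shows "(\<Prod>m<d. (\<eta>(i := \<eta>')) m (x m)) = \<eta>' (x i) * (\<Prod>m\<in>{..<d} - {i}. \<eta> m (x m))"
  using assms by (subst prod.remove[of _ i]) (auto intro!: prod.cong)

text \<open>A partial derivative of such a product is again such a product, with factor i replaced
  by its derivative; generalizing \<eta> therefore closes the induction.\<close>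

lemma Ck_prod:
  assumes "\<And>m. m < d \<Longrightarrow> times_differentiable n (\<eta> m)"
  shows "Ck n d (\<lambda>x. \<Prod>m<d. \<eta> m (x m))"
  using assms
proof (induction n arbitrary: \<eta>)
  case 0
  have "continuous_on (cube d) (\<lambda>x. \<eta> m (x m))" if "m < d" for m
  proof (rule continuous_on_compose2[of UNIV "\<eta> m"])
    show "continuous_on UNIV (\<eta> m)" using 0[OF that] by simp
    show "continuous_on (cube d) (\<lambda>x. x m)"
      by (rule continuous_on_subset[OF continuous_on_product_coordinates]) simp
  qed simp
  then show ?case unfolding Ck.simps by (intro continuous_on_prod) simp
next
  case (Suc n)
  have "times_differentiable n (\<eta> m)" if "m < d" for m
    by (rule times_differentiable_Suc_D[OF Suc.prems[OF that]])
  then have "Ck n d (\<lambda>x. \<Prod>m<d. \<eta> m (x m))" by (rule Suc.IH)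
  then have cont: "continuous_on (cube d) (\<lambda>x. \<Prod>m<d. \<eta> m (x m))" by (cases n) auto
  have "(\<forall>x\<in>cube d. (\<lambda>t. \<Prod>m<d. \<eta> m ((x(i := t)) m)) differentiable (at (x i))) \<and>
        Ck n d (partial_deriv i (\<lambda>x. \<Prod>m<d. \<eta> m (x m)))" if i: "i < d" for i
  proof -
    obtain \<eta>' where \<eta>': "\<And>t. (\<eta> i has_real_derivative \<eta>' t) (at t)" "times_differentiable n \<eta>'"
      using Suc.prems[OF i] by auto
    have eq: "partial_deriv i (\<lambda>x. \<Prod>m<d. \<eta> m (x m)) = (\<lambda>x. \<Prod>m<d. (\<eta>(i := \<eta>')) m (x m))"
      by (rule ext) (simp only: partial_deriv_prod[where \<eta> = \<eta>, OF i \<eta>'(1)] prod_remove_fun_upd[OF i])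
    have C: "Ck n d (\<lambda>x. \<Prod>m<d. (\<eta>(i := \<eta>')) m (x m))"
      using times_differentiable_Suc_D[OF Suc.prems] \<eta>'(2) by (intro Suc.IH) auto
    have D: "(\<lambda>t. \<Prod>m<d. \<eta> m ((x(i := t)) m)) differentiable (at (x i))" for x
      unfolding real_differentiable_def
      by (rule exI, rule has_derivative_prod_coordinate[where \<eta> = \<eta>, OF i \<eta>'(1)])
    show ?thesis unfolding eq by (intro conjI ballI C D)
  qed
  then show ?case unfolding Ck.simps using cont by blast
qed

lemma compact_box_PiE: "compact (PiE {..<d} (\<lambda>m. {a m..b m :: real}))"
proof -
  \<comment> \<open>As a subset of all functions the extensional box is a full product, with the
    singleton of \<open>undefined\<close> in the remaining coordinates, so Tychonoff's theorem
    applies.\<close>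
  have eq: "PiE {..<d} (\<lambda>m. {a m..b m}) = PiE UNIV (\<lambda>m. if m < d then {a m..b m} else {undefined})"
    by (auto simp: PiE_def extensional_def Pi_def split: if_splits)
  have "compactin (product_topology (\<lambda>_. euclidean) UNIV)
    (PiE UNIV (\<lambda>m. if m < d then {a m..b m} else {undefined}))"
    unfolding compactin_PiE by auto
  then show ?thesis by (simp add: eq euclidean_product_topology)
qed

lemma prod_test_function:
  assumes "\<And>m n. m < d \<Longrightarrow> times_differentiable n (\<eta> m)"
    and "\<And>m. m < d \<Longrightarrow> 0 < a m" "\<And>m. m < d \<Longrightarrow> b m < 1"
    and "\<And>m t. m < d \<Longrightarrow> t \<notin> {a m..b m} \<Longrightarrow> \<eta> m t = 0"
  shows "(\<lambda>x. \<Prod>m<d. \<eta> m (x m)) \<in> test_functions d"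
  unfolding test_functions_def
proof (intro CollectI conjI allI Ck_prod assms exI[of _ "PiE {..<d} (\<lambda>m. {a m..b m})"] ballI)
  show "PiE {..<d} (\<lambda>m. {a m..b m}) \<subseteq> cube d"
    using assms(2,3) unfolding cube_def by (intro PiE_mono) force
  fix x assume x: "x \<in> cube d - PiE {..<d} (\<lambda>m. {a m..b m})"
  then obtain m where "m < d" "x m \<notin> {a m..b m}"
    unfolding cube_def PiE_def by (auto simp: Pi_def)
  then show "(\<Prod>m<d. \<eta> m (x m)) = 0" using assms(4) by (intro prod_zero) auto
qed (auto intro: compact_box_PiE)

section \<open>Weak derivatives\<close>

text \<open>On each coordinate line the classical derivative may fail at finitely many points, as
  for a ridge function with a kink. The product u \<phi> is continuous along the line and vanishes
  near both ends, so its derivative has integral 0 on every line, and Fubini concludes.\<close>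

lemma is_weak_partial_classical:
  assumes i: "i < d"
    and meas: "u \<in> borel_measurable (cube_borel d)" "g \<in> borel_measurable (cube_borel d)"
    and bdd: "\<And>x. x \<in> cube d \<Longrightarrow> \<bar>u x\<bar> \<le> B" "\<And>x. x \<in> cube d \<Longrightarrow> \<bar>g x\<bar> \<le> B"
    and cont: "\<And>x. x \<in> cube d \<Longrightarrow> continuous_on {0<..<1} (\<lambda>t. u (x(i := t)))"
    and deriv: "\<And>x. x \<in> cube d \<Longrightarrow> \<exists>S. finite S \<and>
      (\<forall>t\<in>{0<..<1} - S. ((\<lambda>t. u (x(i := t))) has_real_derivative g (x(i := t))) (at t))"
  shows "is_weak_partial d i u g"
proof -
  have L2: "u \<in> L2 d" "g \<in> L2 d"
    using L2_bounded borel_measurable_cubeI meas bdd by blast+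
  have "(\<integral>x. u x * partial_deriv i \<phi> x \<partial>cube_lebesgue d) = - (\<integral>x. g x * \<phi> x \<partial>cube_lebesgue d)"
    if \<phi>: "\<phi> \<in> test_functions d" for \<phi>
  proof -
    obtain a b C where ab: "0 < a" "a < b" "b < 1"
      and supp: "\<And>x. x \<in> cube d \<Longrightarrow> x i \<notin> {a<..<b} \<Longrightarrow> \<phi> x = 0 \<and> partial_deriv i \<phi> x = 0"
      and C: "\<And>x. x \<in> cube d \<Longrightarrow> \<bar>\<phi> x\<bar> \<le> C \<and> \<bar>partial_deriv i \<phi> x\<bar> \<le> C"
      using test_function_support[OF \<phi> i] by blast
    note m = test_function_measurable[OF \<phi>] test_function_partial_measurable[OF \<phi> i]
    note \<phi>L2 = test_function_L2[OF \<phi> i]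
    define F where "F = (\<lambda>x. u x * partial_deriv i \<phi> x + g x * \<phi> x)"
    have Fm: "F \<in> borel_measurable (cube_borel d)"
      unfolding F_def using meas m by measurable
    have Fb: "\<bar>F x\<bar> \<le> B * C + B * C" if "x \<in> cube d" for x
    proof -
      have B: "0 \<le> B" using bdd(1)[OF that] by (rule order_trans[OF abs_ge_zero])
      have "\<bar>u x * partial_deriv i \<phi> x\<bar> \<le> B * C" "\<bar>g x * \<phi> x\<bar> \<le> B * C"
        unfolding abs_mult using bdd[OF that] C[OF that] B by (auto intro!: mult_mono)
      then show ?thesis unfolding F_def by linarith
    qed
    have inner: "(\<integral>t. F (y(i := t)) \<partial>unit_interval) = 0"
      if y: "y \<in> space (Pi\<^sub>M ({..<d} - {i}) (\<lambda>_. unit_interval))" for y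
    proof -
      have in_cube: "y(i := t) \<in> cube d" if "t \<in> {0<..<1}" for t
        using y that i by (intro fun_upd_in_cube) (auto simp: space_PiM space_restrict_space)
      \<comment> \<open>The Fubini variable \<open>y\<close> lacks coordinate i, while the
        hypotheses concern points of the cube. The value 1/2 merely completes it and is overwritten
        by t.\<close>
      define x where "x = y(i := 1/2)"
      have x: "x \<in> cube d" unfolding x_def by (rule in_cube) auto
      have xt: "x(i := t) = y(i := t)" for t by (simp add: x_def)
      obtain S where S: "finite S"
        "\<And>t. t \<in> {0<..<1} - S \<Longrightarrow> ((\<lambda>t. u (x(i := t))) has_real_derivative g (x(i := t))) (at t)"
        using deriv[OF x] by blast
      have d\<phi>: "((\<lambda>t. \<phi> (x(i := t))) has_real_derivative partial_deriv i \<phi> (x(i := t))) (at t)"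
        if "t \<in> {0<..<1}" for t
        using test_function_has_derivative[OF \<phi> i, of "x(i := t)"] in_cube[OF that] by (simp add: xt)
      show ?thesis
      proof (rule integral_derivative_compact_support[OF ab _ _ _ S(1), where f = "\<lambda>t. u (x(i := t)) * \<phi> (x(i := t))"])
        have "continuous_on {0<..<1} (\<lambda>t. \<phi> (x(i := t)))"
          by (rule DERIV_continuous_on[where D = "\<lambda>t. partial_deriv i \<phi> (x(i := t))"])
             (rule has_field_derivative_at_within, rule d\<phi>)
        then have "continuous_on {0<..<1} (\<lambda>t. u (x(i := t)) * \<phi> (x(i := t)))"
          using cont[OF x] by (intro continuous_on_mult)
        then show "continuous_on {a..b} (\<lambda>t. u (x(i := t)) * \<phi> (x(i := t)))"
          by (rule continuous_on_subset) (use ab in auto)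
        show "u (x(i := a)) * \<phi> (x(i := a)) = 0" "u (x(i := b)) * \<phi> (x(i := b)) = 0"
          using supp[of "x(i := a)"] supp[of "x(i := b)"] in_cube ab unfolding xt by auto
        show "((\<lambda>t. u (x(i := t)) * \<phi> (x(i := t))) has_real_derivative F (y(i := t))) (at t)"
          if "t \<in> {a<..<b} - S" for t
          unfolding F_def xt[symmetric] using that ab
          by (intro DERIV_cong[OF DERIV_mult[OF S(2) d\<phi>]]) auto
        show "(\<lambda>t. F (y(i := t))) \<in> borel_measurable unit_interval"
          by (rule measurable_fun_upd_cube[OF i y Fm])
        show "\<bar>F (y(i := t))\<bar> \<le> B * C + B * C" if "t \<in> {0<..<1}" for t
          using Fb in_cube that by blast
        show "F (y(i := t)) = 0" if "t \<in> {0<..<1} - {a..b}" for t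
          using supp[of "y(i := t)"] in_cube[of t] that unfolding F_def by auto
      qed
    qed
    have "(\<integral>x. F x \<partial>cube_lebesgue d) =
        (\<integral>x. (\<integral>t. F (x(i := t)) \<partial>unit_interval) \<partial>Pi\<^sub>M ({..<d} - {i}) (\<lambda>_. unit_interval))"
      by (rule integral_cube_insert[OF i Fm Fb])
    also have "\<dots> = (\<integral>x. 0 \<partial>Pi\<^sub>M ({..<d} - {i}) (\<lambda>_. unit_interval))"
      by (rule Bochner_Integration.integral_cong[OF refl inner])
    finally have "(\<integral>x. F x \<partial>cube_lebesgue d) = 0" by simp
    then show ?thesis
      unfolding F_def using L2 \<phi>L2 by (simp add: Bochner_Integration.integral_add L2_mult_integrable)
  qed
  then show ?thesis using L2 by (simp add: is_weak_partial_def)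
qed

section \<open>The fundamental lemma of the calculus of variations\<close>

lemma sets_unit_interval:
  "sets unit_interval = sigma_sets {0<..<1} {{a<..<b} | a b. 0 \<le> a \<and> b \<le> 1}"
proof -
  have "(\<inter>) {0<..<1} ` range (\<lambda>(a, b). {a<..<b}) = {{a<..<b} | a b :: real. 0 \<le> a \<and> b \<le> 1}"
  proof (intro set_eqI iffI)
    fix X :: "real set" assume "X \<in> (\<inter>) {0<..<1} ` range (\<lambda>(a, b). {a<..<b})"
    then obtain a b where "X = {0<..<1} \<inter> {a<..<b}" by auto
    then have "X = {max 0 a<..<min 1 b}" by auto
    then show "X \<in> {{a<..<b} | a b. 0 \<le> a \<and> b \<le> 1}" by (intro CollectI exI[of _ "max 0 a"] exI[of _ "min 1 b"]) simp
  next
    fix X :: "real set" assume "X \<in> {{a<..<b} | a b. 0 \<le> a \<and> b \<le> 1}"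
    then obtain a b :: real where "X = {a<..<b}" "0 \<le> a" "b \<le> 1" by auto
    then have "X = {0<..<1} \<inter> {a<..<b}" by auto
    moreover have "{a<..<b} \<in> range (\<lambda>(a, b). {a<..<b})" by (rule image_eqI[of _ _ "(a, b)"]) simp_all
    ultimately show "X \<in> (\<inter>) {0<..<1} ` range (\<lambda>(a, b). {a<..<b})" by (rule image_eqI)
  qed
  moreover have "sets (borel :: real measure) = sigma_sets UNIV (range (\<lambda>(a, b). {a<..<b}))"
    unfolding borel_eq_box box_real by (rule sets_measure_of) auto
  moreover have "sets unit_interval = (\<inter>) {0<..<1} ` sets (borel :: real measure)"
    by (simp only: sets_restrict_space sets_lborel)
  moreover have "(\<inter>) {0<..<1} ` sigma_sets UNIV (range (\<lambda>(a, b). {a<..<b :: real})) =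
      sigma_sets {0<..<1} ((\<inter>) {0<..<1} ` range (\<lambda>(a, b). {a<..<b}))"
  proof (rule sigma_sets_Int)
    show "{0<..<1 :: real} \<in> sigma_sets UNIV (range (\<lambda>(a, b). {a<..<b}))"
      by (rule sigma_sets.Basic) auto
  qed auto
  ultimately show ?thesis by metis
qed

text \<open>Open boxes inside the cube are a generator stable under intersection, and their
  indicators are limits of test functions. Both properties are used for the fundamental
  lemma.\<close>

lemma sets_cube_borel:
  "sets (cube_borel d) = sigma_sets (cube d)
    {PiE {..<d} F | F. \<forall>i\<in>{..<d}. F i \<in> {{a<..<b} | a b :: real. 0 \<le> a \<and> b \<le> 1}}"
proof -
  let ?E = "{{a<..<b} | a b :: real. 0 \<le> a \<and> b \<le> 1}"
  let ?P = "{{f\<in>(\<Pi>\<^sub>E i\<in>{..<d}. {0<..<1}). \<forall>i\<in>j. f i \<in> A i} | A j. j \<in> {{..<d}} \<and> A \<in> Pi j (\<lambda>_. ?E)}"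
  have E: "?E \<subseteq> Pow {0<..<1}" by auto
  have "sets unit_interval = sets (sigma {0<..<1} ?E)"
    using E by (simp add: sets_unit_interval)
  then have "sets (cube_borel d) = sets (Pi\<^sub>M {..<d} (\<lambda>_. sigma {0<..<1} ?E))"
    unfolding cube_borel_def by (intro sets_PiM_cong refl)
  also have "\<dots> = sets (sigma (\<Pi>\<^sub>E i\<in>{..<d}. {0<..<1}) ?P)"
  proof (rule sets_PiM_sigma)
    show "\<exists>S\<subseteq>?E. countable S \<and> {0<..<1} = \<Union> S" by (intro exI[of _ "{{0<..<1}}"]) auto
  qed (use E in auto)
  also have "?P = {PiE {..<d} F | F. \<forall>i\<in>{..<d}. F i \<in> ?E}"
  proof (intro set_eqI iffI)
    fix X assume "X \<in> ?P"
    then obtain A where A: "X = {f\<in>(\<Pi>\<^sub>E i\<in>{..<d}. {0<..<1}). \<forall>i\<in>{..<d}. f i \<in> A i}" "A \<in> Pi {..<d} (\<lambda>_. ?E)"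
      by blast
    have "A i \<subseteq> {0<..<1}" if "i \<in> {..<d}" for i using A(2) that E by blast
    then have "X = PiE {..<d} A" unfolding A(1) by (auto simp: PiE_iff subset_iff extensional_def)
    then show "X \<in> {PiE {..<d} F | F. \<forall>i\<in>{..<d}. F i \<in> ?E}" using A(2) by blast
  next
    fix X assume "X \<in> {PiE {..<d} F | F. \<forall>i\<in>{..<d}. F i \<in> ?E}"
    then obtain A where A: "X = PiE {..<d} A" "\<forall>i\<in>{..<d}. A i \<in> ?E" by blast
    have "A i \<subseteq> {0<..<1}" if "i \<in> {..<d}" for i using A(2) that E by blast
    then have "X = {f\<in>(\<Pi>\<^sub>E i\<in>{..<d}. {0<..<1}). \<forall>i\<in>{..<d}. f i \<in> A i}"
      unfolding A(1) by (auto simp: PiE_iff subset_iff extensional_def)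
    then show "X \<in> ?P" using A(2) by blast
  qed
  also have "sets (sigma (\<Pi>\<^sub>E i\<in>{..<d}. {0<..<1::real}) \<dots>) = sigma_sets (cube d) \<dots>"
    unfolding cube_def
  proof (rule sets_measure_of, rule subsetI)
    fix X assume "X \<in> {PiE {..<d} F | F. \<forall>i\<in>{..<d}. F i \<in> ?E}"
    then obtain A where A: "X = PiE {..<d} A" "\<forall>i\<in>{..<d}. A i \<in> ?E" by blast
    then have "A i \<subseteq> {0<..<1}" if "i \<in> {..<d}" for i using that E by blast
    then show "X \<in> Pow (\<Pi>\<^sub>E i\<in>{..<d}. {0<..<1})" unfolding A(1) by (auto simp: PiE_iff subset_iff extensional_def)
  qed
  finally show ?thesis .
qed

text \<open>Products of bumps converge to the indicator of the box from inside and are bounded by 1,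
  so dominated convergence applies with majorant |g|. The index \<open>Suc n\<close> keeps the
  margin 1/n meaningful.\<close>

lemma integral_open_box_eq_0:
  assumes g: "g \<in> L2 d" and 0: "\<And>\<phi>. \<phi> \<in> test_functions d \<Longrightarrow> (\<integral>x. g x * \<phi> x \<partial>cube_lebesgue d) = 0"
    and ab: "\<And>m. m < d \<Longrightarrow> 0 \<le> a m \<and> b m \<le> 1"
  shows "(\<integral>x. g x * indicator (PiE {..<d} (\<lambda>m. {a m<..<b m})) x \<partial>cube_lebesgue d) = 0"
proof -
  let ?E = "PiE {..<d} (\<lambda>m. {a m<..<b m})"
  define \<phi> where "\<phi> n x = (\<Prod>m<d. bump (a m) (b m) (Suc n) (x m))" for n x
  have \<phi>: "\<phi> n \<in> test_functions d" for n
    unfolding \<phi>_def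
  proof (rule prod_test_function[of d _ "\<lambda>m. a m + 1 / real (Suc n)" "\<lambda>m. b m - 1 / real (Suc n)"])
    fix m assume m: "m < d"
    have "1 / real (Suc n) > 0" by simp
    with ab[OF m] show "0 < a m + 1 / real (Suc n)" "b m - 1 / real (Suc n) < 1"
      by linarith+
    show "bump (a m) (b m) (Suc n) t = 0" if "t \<notin> {a m + 1 / real (Suc n)..b m - 1 / real (Suc n)}" for t
    proof (rule bump_eq_0)
      show "t \<le> a m + 1 / real (Suc n) \<or> b m - 1 / real (Suc n) \<le> t"
        using that unfolding atLeastAtMost_iff by (meson linear)
    qed simp
  qed (rule times_differentiable_bump)
  have lim: "(\<lambda>n. \<phi> n x) \<longlonglongrightarrow> indicator ?E x" if x: "x \<in> cube d" for x
  proof (cases "x \<in> ?E")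
    case True
    have "(\<lambda>n. bump (a m) (b m) (Suc n) (x m)) \<longlonglongrightarrow> 1" if "m < d" for m
    proof -
      have "x m \<in> {a m<..<b m}" using PiE_mem[OF True] that by blast
      then have "(\<lambda>n. bump (a m) (b m) n (x m)) \<longlonglongrightarrow> 1" by (intro bump_tendsto) simp_all
      then show ?thesis by (rule LIMSEQ_Suc)
    qed
    then have "(\<lambda>n. \<Prod>m<d. bump (a m) (b m) (Suc n) (x m)) \<longlonglongrightarrow> (\<Prod>m<d. 1)"
      by (intro tendsto_prod) auto
    then show ?thesis using True by (simp add: \<phi>_def)
  next
    case False
    then obtain m where m: "m < d" "x m \<notin> {a m<..<b m}"
      using x unfolding cube_def PiE_def by (auto simp: Pi_def)
    then have "\<phi> n x = 0" for n
      unfolding \<phi>_def by (intro prod_zero bexI[of _ m] bump_eq_0_outside) auto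
    then show ?thesis using False by simp
  qed
  have \<phi>b: "\<bar>\<phi> n x\<bar> \<le> 1" for n x
    unfolding \<phi>_def abs_prod by (intro prod_le_1) (auto simp: bump_bounds)
  have "(\<lambda>n. \<integral>x. g x * \<phi> n x \<partial>cube_lebesgue d) \<longlonglongrightarrow> (\<integral>x. g x * indicator ?E x \<partial>cube_lebesgue d)"
  proof (rule integral_dominated_convergence[where w = "\<lambda>x. \<bar>g x\<bar>"])
    have "?E \<in> {PiE {..<d} F | F. \<forall>i\<in>{..<d}. F i \<in> {{a<..<b} | a b :: real. 0 \<le> a \<and> b \<le> 1}}"
      by (intro CollectI exI[of _ "\<lambda>m. {a m<..<b m}"] conjI refl ballI) (use ab in auto)
    then have "?E \<in> sets (cube_borel d)"
      unfolding sets_cube_borel by (rule sigma_sets.Basic)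
    then have "indicator ?E \<in> borel_measurable (cube_lebesgue d)"
      by (intro borel_measurable_cubeI borel_measurable_indicator)
    then show "(\<lambda>x. g x * indicator ?E x) \<in> borel_measurable (cube_lebesgue d)"
      using L2_measurable[OF g] by (intro borel_measurable_times)
    show "(\<lambda>x. g x * \<phi> n x) \<in> borel_measurable (cube_lebesgue d)" for n
      using L2_measurable[OF g] borel_measurable_cubeI[OF test_function_measurable[OF \<phi>]]
      by (intro borel_measurable_times)
    show "integrable (cube_lebesgue d) (\<lambda>x. \<bar>g x\<bar>)" using L2_integrable[OF g] by simp
    show "AE x in cube_lebesgue d. (\<lambda>n. g x * \<phi> n x) \<longlonglongrightarrow> g x * indicator ?E x"
      by (rule AE_I2, rule tendsto_mult[OF tendsto_const lim]) simp
    show "AE x in cube_lebesgue d. norm (g x * \<phi> n x) \<le> \<bar>g x\<bar>" for n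
      by (rule AE_I2) (simp add: abs_mult mult_left_le \<phi>b)
  qed
  then have "(\<lambda>n. 0::real) \<longlonglongrightarrow> (\<integral>x. g x * indicator ?E x \<partial>cube_lebesgue d)"
    unfolding 0[OF \<phi>] .
  then show ?thesis by (simp add: LIMSEQ_const_iff)
qed

text \<open>The integral of g vanishes over open boxes, hence over all Borel sets by a Dynkin
  argument, and a density whose integrals all vanish is 0 almost everywhere.\<close>

lemma fundamental_lemma_AE:
  assumes g: "g \<in> L2 d" and 0: "\<And>\<phi>. \<phi> \<in> test_functions d \<Longrightarrow> (\<integral>x. g x * \<phi> x \<partial>cube_lebesgue d) = 0"
  shows "AE x in cube_lebesgue d. g x = 0"
proof -
  \<comment> \<open>Uniqueness of densities is applied for the uncompleted measure, so g is replaced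
    by a Borel representative.\<close>
  obtain g' where g': "g' \<in> borel_measurable (cube_borel d)" "AE x in cube_borel d. g x = g' x"
    using completion_ex_borel_measurable_real[OF L2_measurable[OF g, unfolded cube_lebesgue_eq]] by blast
  have AE: "AE x in cube_lebesgue d. g x = g' x"
    unfolding cube_lebesgue_eq using g'(2) by (rule AE_completion)
  have g'm: "g' \<in> borel_measurable (cube_lebesgue d)" by (rule borel_measurable_cubeI[OF g'(1)])
  have "integrable (cube_lebesgue d) g'"
    using integrable_cong_AE_imp[OF L2_integrable[OF g] g'm] AE by simp
  then have int: "integrable (cube_borel d) g'"
    using g'(1) by (simp add: cube_lebesgue_eq integrable_completion)
  let ?E = "{{a<..<b} | a b :: real. 0 \<le> a \<and> b \<le> 1}"
  let ?P = "{PiE {..<d} F | F. \<forall>i\<in>{..<d}. F i \<in> ?E}"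
  have gen: "sets (cube_borel d) = sigma_sets (cube d) ?P"
    by (rule sets_cube_borel)
  have "set_lebesgue_integral (cube_borel d) A g' = 0" if A: "A \<in> sets (cube_borel d)" for A
  proof -
    have "Int_stable ?P"
    proof (rule Int_stableI)
      fix X Y assume "X \<in> ?P" "Y \<in> ?P"
      then obtain F G where FG: "X = PiE {..<d} F" "\<forall>i\<in>{..<d}. F i \<in> ?E"
        "Y = PiE {..<d} G" "\<forall>i\<in>{..<d}. G i \<in> ?E" by blast
      have "F i \<inter> G i \<in> ?E" if i: "i \<in> {..<d}" for i
      proof -
        obtain a b :: real where "F i = {a<..<b}" "0 \<le> a" "b \<le> 1"
          using bspec[OF FG(2) i] by blast
        moreover obtain a' b' :: real where "G i = {a'<..<b'}" "0 \<le> a'" "b' \<le> 1"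
          using bspec[OF FG(4) i] by blast
        ultimately have "F i \<inter> G i = {max a a'<..<min b b'}" "0 \<le> max a a'" "min b b' \<le> 1" by auto
        then show ?thesis by blast
      qed
      then show "X \<inter> Y \<in> ?P"
        unfolding FG(1,3) PiE_Int by (intro CollectI exI[of _ "\<lambda>i. F i \<inter> G i"]) auto
    qed
    moreover have "?P \<subseteq> Pow (cube d)"
    proof
      fix X assume "X \<in> ?P"
      then have "X \<in> sets (cube_borel d)" unfolding gen by (rule sigma_sets.Basic)
      then show "X \<in> Pow (cube d)" using sets.sets_into_space by fastforce
    qed
    moreover have "A \<in> sigma_sets (cube d) ?P" using A gen by simp
    ultimately show ?thesis
    proof (induction rule: sigma_sets_induct_disjoint)
      case (basic A)
      then obtain F where F: "A = PiE {..<d} F" "\<forall>i\<in>{..<d}. \<exists>a b. F i = {a<..<b} \<and> 0 \<le> a \<and> b \<le> 1" by auto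
      obtain a where "\<forall>i\<in>{..<d}. \<exists>b. F i = {a i<..<b} \<and> 0 \<le> a i \<and> b \<le> 1"
        using bchoice[OF F(2)] by blast
      from bchoice[OF this] obtain b where ab: "\<forall>i\<in>{..<d}. F i = {a i<..<b i} \<and> 0 \<le> a i \<and> b i \<le> 1"
        by blast
      then have A: "A = PiE {..<d} (\<lambda>i. {a i<..<b i})" unfolding F by (intro PiE_cong) auto
      have "A \<in> sets (cube_borel d)" unfolding gen using basic by (rule sigma_sets.Basic)
      then have m: "(\<lambda>x. g' x * indicator A x) \<in> borel_measurable (cube_borel d)"
        using g'(1) by measurable
      have "set_lebesgue_integral (cube_borel d) A g' = (\<integral>x. g' x * indicator A x \<partial>cube_borel d)"
        by (simp add: set_lebesgue_integral_def mult.commute)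
      also have "\<dots> = (\<integral>x. g' x * indicator A x \<partial>cube_lebesgue d)"
        using m by (simp add: cube_lebesgue_eq integral_completion)
      also have "\<dots> = (\<integral>x. g x * indicator A x \<partial>cube_lebesgue d)"
      proof (rule integral_cong_AE)
        show "(\<lambda>x. g' x * indicator A x) \<in> borel_measurable (cube_lebesgue d)"
          by (rule borel_measurable_cubeI[OF m])
        have "indicator A \<in> borel_measurable (cube_lebesgue d)"
          using \<open>A \<in> sets (cube_borel d)\<close> by (intro borel_measurable_cubeI borel_measurable_indicator)
        then show "(\<lambda>x. g x * indicator A x) \<in> borel_measurable (cube_lebesgue d)"
          using L2_measurable[OF g] by (intro borel_measurable_times)
        show "AE x in cube_lebesgue d. g' x * indicator A x = g x * indicator A x"
          using AE by eventually_elim simp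
      qed
      also have "\<dots> = 0" unfolding A using ab by (intro integral_open_box_eq_0[OF g 0]) auto
      finally show ?case .
    next
      case empty
      then show ?case by (simp add: set_lebesgue_integral_def)
    next
      case (compl A)
      \<comment> \<open>The cube is itself an open box, so complements are handled by subtraction
        from an integral that is 0.\<close>
      have "cube d \<in> ?P"
        unfolding cube_def by (intro CollectI exI[of _ "\<lambda>_. {0<..<1}"]) auto
      then have whole: "set_lebesgue_integral (cube_borel d) (cube d) g' = 0"
      proof -
        have "(\<integral>x. g x * indicator (PiE {..<d} (\<lambda>m. {0<..<1})) x \<partial>cube_lebesgue d) = 0"
          by (intro integral_open_box_eq_0[OF g 0]) auto
        then have "(\<integral>x. g x \<partial>cube_lebesgue d) = 0"
          by (subst (asm) Bochner_Integration.integral_cong[OF refl, of _ _ g])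
             (auto simp: cube_def[symmetric])
        moreover have "(\<integral>x. g x \<partial>cube_lebesgue d) = (\<integral>x. g' x \<partial>cube_lebesgue d)"
          using AE L2_measurable[OF g] g'm by (intro integral_cong_AE)
        moreover have "(\<integral>x. g' x \<partial>cube_lebesgue d) = (\<integral>x. g' x \<partial>cube_borel d)"
          using g'(1) by (simp add: cube_lebesgue_eq integral_completion)
        moreover have "(\<integral>x. g' x \<partial>cube_borel d) = set_lebesgue_integral (cube_borel d) (cube d) g'"
          unfolding set_lebesgue_integral_def by (rule Bochner_Integration.integral_cong) auto
        ultimately show ?thesis by simp
      qed
      have A: "A \<in> sets (cube_borel d)" "A \<subseteq> cube d"
        using compl(1) gen sets.sets_into_space[of A "cube_borel d"] by auto
      have sA: "set_integrable (cube_borel d) A g'" "set_integrable (cube_borel d) (cube d - A) g'"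
        unfolding set_integrable_def using A int sets.top[of "cube_borel d"]
        by (intro integrable_mult_indicator; auto)+
      have "set_lebesgue_integral (cube_borel d) (A \<union> (cube d - A)) g' =
          set_lebesgue_integral (cube_borel d) A g' + set_lebesgue_integral (cube_borel d) (cube d - A) g'"
        by (rule set_integral_Un[OF _ sA]) auto
      moreover have "A \<union> (cube d - A) = cube d" using A by auto
      ultimately show ?case using compl(2) whole by simp
    next
      case (union A)
      have A: "A i \<in> sets (cube_borel d)" for i using union(2) gen by auto
      have "set_lebesgue_integral (cube_borel d) (\<Union>i. A i) g' = (\<Sum>i. set_lebesgue_integral (cube_borel d) (A i) g')"
      proof (rule lebesgue_integral_countable_add)
        show "A i \<inter> A j = {}" if "i \<noteq> j" for i j
          using union(1) that by (auto simp: disjoint_family_on_def)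
        show "set_integrable (cube_borel d) (\<Union>i. A i) g'"
          unfolding set_integrable_def using A int by (intro integrable_mult_indicator) auto
      qed (rule A)
      then show ?case using union(3) by simp
    qed
  qed
  moreover have "set_lebesgue_integral (cube_borel d) A (\<lambda>_. 0) = (0::real)" for A
    by (simp add: set_lebesgue_integral_def)
  ultimately have "AE x in cube_borel d. g' x = 0"
    by (intro density_unique_real int integrable_zero) simp
  then have "AE x in cube_lebesgue d. g' x = 0"
    unfolding cube_lebesgue_eq by (rule AE_completion)
  then show ?thesis using AE by eventually_elim simp
qed

section \<open>Weak gradients and the H1 energy\<close>

lemma is_weak_partialD:
  assumes "is_weak_partial d i u g"
  shows "g \<in> L2 d"
    "\<phi> \<in> test_functions d \<Longrightarrow>
      (\<integral>x. u x * partial_deriv i \<phi> x \<partial>cube_lebesgue d) = - (\<integral>x. g x * \<phi> x \<partial>cube_lebesgue d)"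
  using assms by (auto simp: is_weak_partial_def)

lemma weak_partial_unique:
  assumes "is_weak_partial d i u g" "is_weak_partial d i u h" "i < d"
  shows "AE x in cube_lebesgue d. g x = h x"
proof -
  note L2 = is_weak_partialD(1)[OF assms(1)] is_weak_partialD(1)[OF assms(2)]
  have "AE x in cube_lebesgue d. g x - h x = 0"
  proof (rule fundamental_lemma_AE)
    show "(\<lambda>x. g x - h x) \<in> L2 d" using L2 by (rule L2_diff)
    fix \<phi> assume \<phi>: "\<phi> \<in> test_functions d"
    have "(\<integral>x. (g x - h x) * \<phi> x \<partial>cube_lebesgue d) =
        (\<integral>x. g x * \<phi> x \<partial>cube_lebesgue d) - (\<integral>x. h x * \<phi> x \<partial>cube_lebesgue d)"
      using L2 test_function_L2(1)[OF \<phi> assms(3)]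
      by (simp add: left_diff_distrib Bochner_Integration.integral_diff L2_mult_integrable)
    then show "(\<integral>x. (g x - h x) * \<phi> x \<partial>cube_lebesgue d) = 0"
      using is_weak_partialD(2)[OF assms(1) \<phi>] is_weak_partialD(2)[OF assms(2) \<phi>] by simp
  qed
  then show ?thesis by eventually_elim simp
qed

definition weak_gradient ::
    "nat \<Rightarrow> ((nat \<Rightarrow> real) \<Rightarrow> real) \<Rightarrow> (nat \<Rightarrow> (nat \<Rightarrow> real) \<Rightarrow> real) \<Rightarrow> bool" where
  "weak_gradient d u g \<longleftrightarrow> u \<in> L2 d \<and> (\<forall>i<d. is_weak_partial d i u (g i))"

lemma weak_gradient_L2:
  "weak_gradient d u g \<Longrightarrow> u \<in> L2 d"
  "weak_gradient d u g \<Longrightarrow> i < d \<Longrightarrow> g i \<in> L2 d"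
  by (auto simp: weak_gradient_def dest: is_weak_partialD(1))

lemma weak_gradient_H1: "weak_gradient d u g \<Longrightarrow> u \<in> H1 d"
  by (auto simp: weak_gradient_def H1_def)

lemma H1_weak_gradient: "u \<in> H1 d \<Longrightarrow> weak_gradient d u (\<lambda>i. weak_partial d i u)"
  unfolding weak_gradient_def H1_def weak_partial_def by (auto intro!: someI_ex[of "is_weak_partial d i u" for i])

lemma weak_gradient_AE:
  assumes "weak_gradient d u g"
  shows "AE x in cube_lebesgue d. \<forall>i\<in>{..<d}. g i x = weak_partial d i u x"
proof (subst AE_finite_all)
  show "\<forall>i\<in>{..<d}. AE x in cube_lebesgue d. g i x = weak_partial d i u x"
    using assms H1_weak_gradient[OF weak_gradient_H1[OF assms]]
    by (auto simp: weak_gradient_def intro: weak_partial_unique)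
qed simp

lemma weak_gradient_linear:
  assumes u: "weak_gradient d u g" and v: "weak_gradient d v h"
  shows "weak_gradient d (\<lambda>x. a * u x + b * v x) (\<lambda>i x. a * g i x + b * h i x)"
  unfolding weak_gradient_def is_weak_partial_def
proof (intro conjI allI impI ballI)
  show "(\<lambda>x. a * u x + b * v x) \<in> L2 d"
    using weak_gradient_L2(1)[OF u] weak_gradient_L2(1)[OF v] by (intro L2_add L2_scale)
  fix i assume i: "i < d"
  show "(\<lambda>x. a * g i x + b * h i x) \<in> L2 d"
    using weak_gradient_L2(2)[OF u i] weak_gradient_L2(2)[OF v i] by (intro L2_add L2_scale)
  fix \<phi> assume \<phi>: "\<phi> \<in> test_functions d"
  note \<phi>L2 = test_function_L2[OF \<phi> i]
  have "(\<integral>x. (a * u x + b * v x) * partial_deriv i \<phi> x \<partial>cube_lebesgue d) =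
      (\<integral>x. a * (u x * partial_deriv i \<phi> x) + b * (v x * partial_deriv i \<phi> x) \<partial>cube_lebesgue d)"
    by (simp add: algebra_simps)
  also have "\<dots> = a * (\<integral>x. u x * partial_deriv i \<phi> x \<partial>cube_lebesgue d) +
      b * (\<integral>x. v x * partial_deriv i \<phi> x \<partial>cube_lebesgue d)"
    using weak_gradient_L2(1)[OF u] weak_gradient_L2(1)[OF v] \<phi>L2
    by (simp add: Bochner_Integration.integral_add L2_mult_integrable)
  also have "\<dots> = - (a * (\<integral>x. g i x * \<phi> x \<partial>cube_lebesgue d) + b * (\<integral>x. h i x * \<phi> x \<partial>cube_lebesgue d))"
    using u v i \<phi> by (simp add: weak_gradient_def is_weak_partial_def)
  also have "\<dots> = - (\<integral>x. a * (g i x * \<phi> x) + b * (h i x * \<phi> x) \<partial>cube_lebesgue d)"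
    using weak_gradient_L2(2)[OF u i] weak_gradient_L2(2)[OF v i] \<phi>L2
    by (simp add: Bochner_Integration.integral_add L2_mult_integrable)
  also have "\<dots> = - (\<integral>x. (a * g i x + b * h i x) * \<phi> x \<partial>cube_lebesgue d)"
    by (simp add: algebra_simps)
  finally show "(\<integral>x. (a * u x + b * v x) * partial_deriv i \<phi> x \<partial>cube_lebesgue d) =
      - (\<integral>x. (a * g i x + b * h i x) * \<phi> x \<partial>cube_lebesgue d)" .
qed

lemma weak_gradient_0: "weak_gradient d (\<lambda>x. 0) (\<lambda>i x. 0)"
  by (simp add: weak_gradient_def is_weak_partial_def L2_const)

lemma weak_gradient_test_function:
  assumes \<phi>: "\<phi> \<in> test_functions d" and "d > 0"
  shows "weak_gradient d \<phi> (\<lambda>i. partial_deriv i \<phi>)"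
  unfolding weak_gradient_def
proof (intro conjI allI impI)
  show "\<phi> \<in> L2 d" using test_function_L2(1)[OF \<phi> \<open>d > 0\<close>] .
  fix i assume i: "i < d"
  obtain C where C: "\<And>x. x \<in> cube d \<Longrightarrow> \<bar>\<phi> x\<bar> \<le> C \<and> \<bar>partial_deriv i \<phi> x\<bar> \<le> C"
    using test_function_support[OF \<phi> i] by blast
  have D: "((\<lambda>t. \<phi> (x(i := t))) has_real_derivative partial_deriv i \<phi> (x(i := t))) (at t)"
    if "x \<in> cube d" "t \<in> {0<..<1}" for x t
    using test_function_has_derivative[OF \<phi> i fun_upd_in_cube[OF i disjI2[OF that(1)] that(2)]] by simp
  show "is_weak_partial d i \<phi> (partial_deriv i \<phi>)"
  proof (rule is_weak_partial_classical[OF i, of _ _ C])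
    fix x assume x: "x \<in> cube d"
    show "continuous_on {0<..<1} (\<lambda>t. \<phi> (x(i := t)))"
      by (rule DERIV_continuous_on[where D = "\<lambda>t. partial_deriv i \<phi> (x(i := t))"])
         (rule has_field_derivative_at_within, rule D[OF x])
    show "\<exists>S. finite S \<and> (\<forall>t\<in>{0<..<1} - S.
        ((\<lambda>t. \<phi> (x(i := t))) has_real_derivative partial_deriv i \<phi> (x(i := t))) (at t))"
      using D[OF x] by (intro exI[of _ "{}"]) auto
  qed (use C in \<open>auto intro: test_function_measurable[OF \<phi>] test_function_partial_measurable[OF \<phi> i]\<close>)
qed

text \<open>A weak gradient is carried along explicitly, so that \<^const>\<open>weak_partial\<close> with its choice of a
  representative is needed only at the interface to the definitions.\<close>

definition energy ::
    "nat \<Rightarrow> ((nat \<Rightarrow> real) \<Rightarrow> real) \<Rightarrow> (nat \<Rightarrow> (nat \<Rightarrow> real) \<Rightarrow> real) \<Rightarrow>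
     ((nat \<Rightarrow> real) \<Rightarrow> real) \<Rightarrow> (nat \<Rightarrow> (nat \<Rightarrow> real) \<Rightarrow> real) \<Rightarrow> real" where
  "energy d u g v h = (\<integral>x. (\<Sum>i<d. g i x * h i x) + u x * v x \<partial>cube_lebesgue d)"

lemma integrable_sum_mult:
  "finite I \<Longrightarrow> (\<And>i. i \<in> I \<Longrightarrow> g i \<in> L2 d) \<Longrightarrow> (\<And>i. i \<in> I \<Longrightarrow> h i \<in> L2 d) \<Longrightarrow>
    integrable (cube_lebesgue d) (\<lambda>x. \<Sum>i\<in>I. g i x * h i x)"
  by (intro Bochner_Integration.integrable_sum L2_mult_integrable)

lemma integrable_energy:
  assumes "weak_gradient d u g" "weak_gradient d v h"
  shows "integrable (cube_lebesgue d) (\<lambda>x. (\<Sum>i<d. g i x * h i x) + u x * v x)"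
  using weak_gradient_L2[OF assms(1)] weak_gradient_L2[OF assms(2)]
  by (intro Bochner_Integration.integrable_add integrable_sum_mult L2_mult_integrable) auto

lemma H1_inner_eq_energy:
  assumes u: "weak_gradient d u g" and v: "weak_gradient d v h"
  shows "H1_inner d u v = energy d u g v h"
  unfolding H1_inner_def energy_def
proof (rule integral_cong_AE)
  show "(\<lambda>x. (\<Sum>i<d. weak_partial d i u x * weak_partial d i v x) + u x * v x) \<in> borel_measurable (cube_lebesgue d)"
    using integrable_energy[OF H1_weak_gradient H1_weak_gradient, OF weak_gradient_H1[OF u] weak_gradient_H1[OF v]]
    by (rule borel_measurable_integrable)
  show "(\<lambda>x. (\<Sum>i<d. g i x * h i x) + u x * v x) \<in> borel_measurable (cube_lebesgue d)"
    using integrable_energy[OF u v] by (rule borel_measurable_integrable)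
  show "AE x in cube_lebesgue d. (\<Sum>i<d. weak_partial d i u x * weak_partial d i v x) + u x * v x =
      (\<Sum>i<d. g i x * h i x) + u x * v x"
    using weak_gradient_AE[OF u] weak_gradient_AE[OF v] by eventually_elim simp
qed

lemma energy_commute: "energy d u g v h = energy d v h u g"
  by (simp add: energy_def mult.commute)

lemma energy_nonneg: "0 \<le> energy d u g u g"
  unfolding energy_def by (rule integral_nonneg_AE) (auto intro!: AE_I2 add_nonneg_nonneg sum_nonneg)

lemma energy_linear:
  assumes "weak_gradient d u g" "weak_gradient d v h" "weak_gradient d w k"
  shows "energy d (\<lambda>x. a * u x + b * v x) (\<lambda>i x. a * g i x + b * h i x) w k =
    a * energy d u g w k + b * energy d v h w k"
proof -
  have "energy d (\<lambda>x. a * u x + b * v x) (\<lambda>i x. a * g i x + b * h i x) w k =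
    (\<integral>x. a * ((\<Sum>i<d. g i x * k i x) + u x * w x) + b * ((\<Sum>i<d. h i x * k i x) + v x * w x) \<partial>cube_lebesgue d)"
    unfolding energy_def
    by (rule Bochner_Integration.integral_cong[OF refl])
       (simp add: algebra_simps sum.distrib sum_distrib_left)
  also have "\<dots> = a * energy d u g w k + b * energy d v h w k"
    unfolding energy_def using integrable_energy[OF assms(1,3)] integrable_energy[OF assms(2,3)]
    by (subst Bochner_Integration.integral_add) auto
  finally show ?thesis .
qed

text \<open>The triangle inequality in squared form, from (p + q)^2 \<le> 2 p^2 + 2 q^2 at each
  point. It serves to insert a trigonometric polynomial and a large network between the solution and
  the final network.\<close>

lemma energy_diff_le:
  assumes "weak_gradient d u g" "weak_gradient d v h" "weak_gradient d w k"
  shows "energy d (\<lambda>x. u x - v x) (\<lambda>i x. g i x - h i x) (\<lambda>x. u x - v x) (\<lambda>i x. g i x - h i x)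
    \<le> 2 * energy d (\<lambda>x. u x - w x) (\<lambda>i x. g i x - k i x) (\<lambda>x. u x - w x) (\<lambda>i x. g i x - k i x)
    + 2 * energy d (\<lambda>x. w x - v x) (\<lambda>i x. k i x - h i x) (\<lambda>x. w x - v x) (\<lambda>i x. k i x - h i x)"
proof -
  have sq: "(a - b) * (a - b) \<le> 2 * ((a - c) * (a - c)) + 2 * ((c - b) * (c - b))" for a b c :: real
    using zero_le_square[of "(a - c) - (c - b)"] by (simp add: algebra_simps)
  have wg: "weak_gradient d (\<lambda>x. p x - q x) (\<lambda>i x. r i x - s i x)"
    if "weak_gradient d p r" "weak_gradient d q s" for p q r s
    using weak_gradient_linear[OF that, of 1 "-1"] by simp
  note uv = wg[OF assms(1,2)] and uw = wg[OF assms(1,3)] and wv = wg[OF assms(3,2)]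
  have "energy d (\<lambda>x. u x - v x) (\<lambda>i x. g i x - h i x) (\<lambda>x. u x - v x) (\<lambda>i x. g i x - h i x)
    \<le> (\<integral>x. 2 * ((\<Sum>i<d. (g i x - k i x) * (g i x - k i x)) + (u x - w x) * (u x - w x)) +
      2 * ((\<Sum>i<d. (k i x - h i x) * (k i x - h i x)) + (w x - v x) * (w x - v x)) \<partial>cube_lebesgue d)"
    unfolding energy_def
  proof (rule integral_mono)
    fix x
    have "(\<Sum>i<d. (g i x - h i x) * (g i x - h i x)) \<le>
        (\<Sum>i<d. 2 * ((g i x - k i x) * (g i x - k i x)) + 2 * ((k i x - h i x) * (k i x - h i x)))"
      by (rule sum_mono) (rule sq)
    then show "(\<Sum>i<d. (g i x - h i x) * (g i x - h i x)) + (u x - v x) * (u x - v x)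
      \<le> 2 * ((\<Sum>i<d. (g i x - k i x) * (g i x - k i x)) + (u x - w x) * (u x - w x)) +
      2 * ((\<Sum>i<d. (k i x - h i x) * (k i x - h i x)) + (w x - v x) * (w x - v x))"
      using sq[of "u x" "v x" "w x"] by (simp add: sum.distrib sum_distrib_left[symmetric])
  qed (intro Bochner_Integration.integrable_add integrable_mult_right integrable_energy uv uw wv)+
  also have "\<dots> = 2 * energy d (\<lambda>x. u x - w x) (\<lambda>i x. g i x - k i x) (\<lambda>x. u x - w x) (\<lambda>i x. g i x - k i x)
    + 2 * energy d (\<lambda>x. w x - v x) (\<lambda>i x. k i x - h i x) (\<lambda>x. w x - v x) (\<lambda>i x. k i x - h i x)"
    unfolding energy_def using integrable_energy[OF uw uw] integrable_energy[OF wv wv]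
    by (subst Bochner_Integration.integral_add) (auto simp del: distrib_left_numeral)
  finally show ?thesis .
qed

section \<open>Products of sines and cosines\<close>

definition sin_or_cos :: "bool \<Rightarrow> real \<Rightarrow> real" where
  "sin_or_cos s t = (if s then sin t else cos t)"

text \<open>\<open>Z\<close> collects the coordinates that carry a sine. The sets
  \<open>{..<d}\<close>, \<open>{}\<close> and \<open>{i, j}\<close> give the sine, cosine and mixed
  bases; other types arise by differentiation.\<close>

definition trig :: "nat \<Rightarrow> nat set \<Rightarrow> (nat \<Rightarrow> nat) \<Rightarrow> (nat \<Rightarrow> real) \<Rightarrow> real" where
  "trig d Z k x = (\<Prod>m<d. sin_or_cos (m \<in> Z) (pi * real (k m) * x m))"

text \<open>The calculus of parities: a product of functions of types \<open>Z\<close> and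
  \<open>W\<close> has type \<open>sdiff Z W\<close>, and a derivative in coordinate i has type
  \<open>sdiff Z {i}\<close>.\<close>

definition sdiff :: "nat set \<Rightarrow> nat set \<Rightarrow> nat set" where
  "sdiff Z W = (Z - W) \<union> (W - Z)"

lemma mem_sdiff: "m \<in> sdiff Z W \<longleftrightarrow> (m \<in> Z) \<noteq> (m \<in> W)"
  by (auto simp: sdiff_def)

text \<open>The sign in sin' = cos and cos' = - sin.\<close>

definition trig_sign :: "nat set \<Rightarrow> nat \<Rightarrow> real" where
  "trig_sign Z i = (if i \<in> Z then 1 else - 1)"

definition dtrig :: "nat \<Rightarrow> nat set \<Rightarrow> (nat \<Rightarrow> nat) \<Rightarrow> nat \<Rightarrow> (nat \<Rightarrow> real) \<Rightarrow> real" where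
  "dtrig d Z k i x = trig_sign Z i * (pi * real (k i)) * trig d (sdiff Z {i}) k x"

lemma abs_sin_or_cos: "\<bar>sin_or_cos s t\<bar> \<le> 1"
  by (simp add: sin_or_cos_def)

lemma sin_basis_eq: "sin_basis d = trig d {..<d}"
  by (intro ext) (simp add: sin_basis_def trig_def sin_or_cos_def)

lemma cos_basis_eq: "cos_basis d = trig d {}"
  by (intro ext) (simp add: cos_basis_def trig_def sin_or_cos_def)

lemma mixed_basis_eq:
  assumes "i < d" "j < d" "i \<noteq> j"
  shows "mixed_basis d i j = trig d {i, j}"
proof (intro ext)
  fix k x
  have eq: "{..<d} - {i, j} = {..<d} - {i} - {j}" by auto
  have "trig d {i, j} k x = sin (pi * real (k i) * x i) * (sin (pi * real (k j) * x j) *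
      (\<Prod>m\<in>{..<d} - {i} - {j}. sin_or_cos (m \<in> {i, j}) (pi * real (k m) * x m)))"
    unfolding trig_def using assms
    by (subst prod.remove[of _ i], simp, simp, subst prod.remove[of _ j]) (auto simp: sin_or_cos_def)
  also have "(\<Prod>m\<in>{..<d} - {i} - {j}. sin_or_cos (m \<in> {i, j}) (pi * real (k m) * x m)) =
      (\<Prod>m\<in>{..<d} - {i} - {j}. cos (pi * real (k m) * x m))"
    by (rule prod.cong) (auto simp: sin_or_cos_def)
  finally show "mixed_basis d i j k x = trig d {i, j} k x"
    unfolding mixed_basis_def eq by simp
qed

lemma abs_trig_le_1: "\<bar>trig d Z k x\<bar> \<le> 1"
  unfolding trig_def abs_prod by (intro prod_le_1) (simp add: abs_sin_or_cos)

lemma abs_dtrig_le: "\<bar>dtrig d Z k i x\<bar> \<le> pi * real (k i)"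
proof -
  have "\<bar>dtrig d Z k i x\<bar> = pi * real (k i) * \<bar>trig d (sdiff Z {i}) k x\<bar>"
    by (simp add: dtrig_def trig_sign_def abs_mult)
  also have "\<dots> \<le> pi * real (k i)"
    by (intro mult_left_le abs_trig_le_1) simp
  finally show ?thesis .
qed

lemma trig_measurable: "trig d Z k \<in> borel_measurable (cube_borel d)"
proof -
  have [measurable]: "sin_or_cos s \<in> borel_measurable borel" for s
    unfolding sin_or_cos_def[abs_def] by (cases s) auto
  show ?thesis unfolding trig_def[abs_def] by (intro borel_measurable_prod) measurable
qed

lemma dtrig_measurable: "dtrig d Z k i \<in> borel_measurable (cube_borel d)"
  unfolding dtrig_def[abs_def] by (intro borel_measurable_times trig_measurable borel_measurable_const)

lemma trig_L2: "trig d Z k \<in> L2 d"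
  by (rule L2_bounded[OF borel_measurable_cubeI[OF trig_measurable] abs_trig_le_1])

lemma dtrig_L2: "dtrig d Z k i \<in> L2 d"
  by (rule L2_bounded[OF borel_measurable_cubeI[OF dtrig_measurable] abs_dtrig_le])

definition sin_or_cos' :: "bool \<Rightarrow> real \<Rightarrow> real \<Rightarrow> real" where
  "sin_or_cos' s a t = (if s then 1 else - 1) * a * sin_or_cos (\<not> s) (a * t)"

lemma has_derivative_sin_or_cos:
  "((\<lambda>t. sin_or_cos s (a * t)) has_real_derivative sin_or_cos' s a t) (at t)"
  by (cases s) (auto simp: sin_or_cos_def sin_or_cos'_def intro!: derivative_eq_intros)

lemma abs_sin_or_cos': "0 \<le> a \<Longrightarrow> \<bar>sin_or_cos' s a t\<bar> \<le> a"
  using mult_left_le[OF abs_sin_or_cos, of a "\<not> s" "a * t"] by (cases s) (simp_all add: sin_or_cos'_def abs_mult)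

lemma dtrig_eq_prod:
  assumes "i < d"
  shows "dtrig d Z k i x = sin_or_cos' (i \<in> Z) (pi * real (k i)) (x i) *
    (\<Prod>m\<in>{..<d} - {i}. sin_or_cos (m \<in> Z) (pi * real (k m) * x m))"
proof -
  have "trig d (sdiff Z {i}) k x = sin_or_cos (i \<notin> Z) (pi * real (k i) * x i) *
      (\<Prod>m\<in>{..<d} - {i}. sin_or_cos (m \<in> sdiff Z {i}) (pi * real (k m) * x m))"
    unfolding trig_def using assms by (subst prod.remove[of _ i]) (auto simp: sdiff_def)
  also have "(\<Prod>m\<in>{..<d} - {i}. sin_or_cos (m \<in> sdiff Z {i}) (pi * real (k m) * x m)) =
      (\<Prod>m\<in>{..<d} - {i}. sin_or_cos (m \<in> Z) (pi * real (k m) * x m))"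
    by (rule prod.cong) (auto simp: sdiff_def)
  finally show ?thesis by (simp add: dtrig_def sin_or_cos'_def trig_sign_def)
qed

lemma has_derivative_trig:
  assumes "i < d"
  shows "((\<lambda>t. trig d Z k (x(i := t))) has_real_derivative dtrig d Z k i (x(i := t))) (at t)"
proof -
  have "dtrig d Z k i (x(i := t)) = sin_or_cos' (i \<in> Z) (pi * real (k i)) t *
      (\<Prod>m\<in>{..<d} - {i}. sin_or_cos (m \<in> Z) (pi * real (k m) * x m))"
    unfolding dtrig_eq_prod[OF assms] by (auto intro!: prod.cong)
  then show ?thesis
    using has_derivative_prod_coordinate[OF assms, of "\<lambda>m t. sin_or_cos (m \<in> Z) (pi * real (k m) * t)"
        "sin_or_cos' (i \<in> Z) (pi * real (k i)) t" t x, OF has_derivative_sin_or_cos]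
    by (simp add: trig_def)
qed

lemma weak_gradient_trig: "weak_gradient d (trig d Z k) (dtrig d Z k)"
  unfolding weak_gradient_def
proof (intro conjI allI impI trig_L2)
  fix i assume i: "i < d"
  show "is_weak_partial d i (trig d Z k) (dtrig d Z k i)"
  proof (rule is_weak_partial_classical[OF i trig_measurable dtrig_measurable, where B = "max 1 (pi * real (k i))"])
    fix x assume "x \<in> cube d"
    show "continuous_on {0<..<1} (\<lambda>t. trig d Z k (x(i := t)))"
      by (rule DERIV_continuous_on[where D = "\<lambda>t. dtrig d Z k i (x(i := t))"])
         (rule has_field_derivative_at_within, rule has_derivative_trig[OF i])
    show "\<exists>S. finite S \<and> (\<forall>t\<in>{0<..<1} - S.
        ((\<lambda>t. trig d Z k (x(i := t))) has_real_derivative dtrig d Z k i (x(i := t))) (at t))"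
      by (intro exI[of _ "{}"]) (simp add: has_derivative_trig[OF i])
    show "\<bar>trig d Z k x\<bar> \<le> max 1 (pi * real (k i))" using abs_trig_le_1[of d Z k x] by linarith
    show "\<bar>dtrig d Z k i x\<bar> \<le> max 1 (pi * real (k i))" using abs_dtrig_le[of d Z k i x] by linarith
  qed
qed

section \<open>Product-to-sum formulas\<close>

definition product_frequency :: "(nat \<Rightarrow> nat) \<Rightarrow> (nat \<Rightarrow> nat) \<Rightarrow> (nat \<Rightarrow> bool) \<Rightarrow> nat \<Rightarrow> nat" where
  "product_frequency k l s m = (if s m then k m + l m else if k m \<le> l m then l m - k m else k m - l m)"

text \<open>\<open>s\<close> selects the sum frequency. The order of k and l matters because the
  difference frequency is kept a natural number: sin((k - l) t) = - sin((l - k) t).\<close>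

definition product_sign :: "bool \<Rightarrow> bool \<Rightarrow> nat \<Rightarrow> nat \<Rightarrow> bool \<Rightarrow> real" where
  "product_sign a b k l s =
     (if s then (if a \<and> b then - 1 else 1)
      else if a = b then 1 else if a then (if k \<le> l then - 1 else 1) else (if k \<le> l then 1 else - 1))"

lemma abs_product_sign: "\<bar>product_sign a b k l s\<bar> = 1"
  by (simp add: product_sign_def)

lemma sin_or_cos_mult:
  "sin_or_cos a (pi * real k * t) * sin_or_cos b (pi * real l * t) =
    (\<Sum>s\<in>UNIV. 1 / 2 * product_sign a b k l s *
      sin_or_cos (a \<noteq> b) (pi * real (if s then k + l else if k \<le> l then l - k else k - l) * t))"
proof -
  have p: "pi * real (k + l) * t = pi * real k * t + pi * real l * t" by (simp add: algebra_simps)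
  have m: "pi * real (l - k) * t = pi * real l * t - pi * real k * t" if "k \<le> l"
    using that by (simp add: of_nat_diff algebra_simps)
  have m': "pi * real (k - l) * t = pi * real k * t - pi * real l * t" if "\<not> k \<le> l"
    using that by (simp add: of_nat_diff algebra_simps)
  show ?thesis
    by (cases a; cases b; cases "k \<le> l")
       (simp_all add: UNIV_bool product_sign_def sin_or_cos_def p m m' cos_add cos_diff sin_add sin_diff
          field_simps)
qed

definition product_coefficient ::
    "nat \<Rightarrow> nat set \<Rightarrow> nat set \<Rightarrow> (nat \<Rightarrow> nat) \<Rightarrow> (nat \<Rightarrow> nat) \<Rightarrow> (nat \<Rightarrow> bool) \<Rightarrow> real" where
  "product_coefficient d Z W k l s = (\<Prod>m<d. 1 / 2 * product_sign (m \<in> Z) (m \<in> W) (k m) (l m) (s m))"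

definition sign_choices :: "nat \<Rightarrow> (nat \<Rightarrow> bool) set" where
  "sign_choices d = PiE {..<d} (\<lambda>_. UNIV)"

lemma finite_sign_choices: "finite (sign_choices d)"
  by (simp add: sign_choices_def finite_PiE)

lemma card_sign_choices: "card (sign_choices d) = 2 ^ d"
  by (simp add: sign_choices_def card_PiE)

text \<open>One product-to-sum formula per coordinate, multiplied out: 2^d terms with coefficients
  of modulus 2^(-d). The moduli add up to 1, so products do not enlarge coefficient sums.\<close>

lemma trig_mult:
  "trig d Z k x * trig d W l x =
    (\<Sum>s\<in>sign_choices d. product_coefficient d Z W k l s * trig d (sdiff Z W) (product_frequency k l s) x)"
proof -
  have "trig d Z k x * trig d W l x =
      (\<Prod>m<d. sin_or_cos (m \<in> Z) (pi * real (k m) * x m) * sin_or_cos (m \<in> W) (pi * real (l m) * x m))"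
    by (simp add: trig_def prod.distrib)
  also have "\<dots> = (\<Prod>m<d. \<Sum>s\<in>UNIV. 1 / 2 * product_sign (m \<in> Z) (m \<in> W) (k m) (l m) s *
      sin_or_cos (m \<in> sdiff Z W) (pi * real (if s then k m + l m else if k m \<le> l m then l m - k m else k m - l m) * x m))"
    by (intro prod.cong refl, subst sin_or_cos_mult) (simp only: mem_sdiff)
  also have "\<dots> = (\<Sum>s\<in>sign_choices d. \<Prod>m<d. 1 / 2 * product_sign (m \<in> Z) (m \<in> W) (k m) (l m) (s m) *
      sin_or_cos (m \<in> sdiff Z W) (pi * real (if s m then k m + l m else if k m \<le> l m then l m - k m else k m - l m) * x m))"
    unfolding sign_choices_def by (rule prod_sum_PiE) auto
  finally show ?thesis
    unfolding product_coefficient_def trig_def product_frequency_def prod.distrib .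
qed

lemma abs_product_coefficient: "\<bar>product_coefficient d Z W k l s\<bar> = (1 / 2) ^ d"
  by (simp add: product_coefficient_def abs_prod abs_mult abs_product_sign prod.distrib power_one_over)

lemma sum_abs_product_coefficient: "(\<Sum>s\<in>sign_choices d. \<bar>product_coefficient d Z W k l s\<bar>) = 1"
  by (simp add: abs_product_coefficient card_sign_choices power_one_over)

lemma product_frequency_le: "product_frequency k l s m \<le> k m + l m"
  by (auto simp: product_frequency_def)

section \<open>Integration by parts\<close>

text \<open>Every factor carries its own bump, so the product is again a product of functions of one
  variable and a test function. With growing n it and its first derivatives converge pointwise to
  those of \<open>trig\<close>.\<close>

definition cutoff :: "nat \<Rightarrow> nat set \<Rightarrow> (nat \<Rightarrow> nat) \<Rightarrow> nat \<Rightarrow> (nat \<Rightarrow> real) \<Rightarrow> real" where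
  "cutoff d Z k n x =
     (\<Prod>m<d. sin_or_cos (m \<in> Z) (pi * real (k m) * x m) * bump 0 1 (Suc n) (x m))"

lemma cutoff_test_function: "cutoff d Z k n \<in> test_functions d"
  unfolding cutoff_def[abs_def]
proof (rule prod_test_function[of d _ "\<lambda>_. 1 / real (Suc n)" "\<lambda>_. 1 - 1 / real (Suc n)"])
  fix m j
  have "times_differentiable j (sin_or_cos s)" for s
    unfolding sin_or_cos_def[abs_def] using times_differentiable_cos[of j] by (cases s) auto
  from times_differentiable_affine[OF this, of _ "pi * real (k m)" 0]
  show "times_differentiable j (\<lambda>t. sin_or_cos (m \<in> Z) (pi * real (k m) * t) * bump 0 1 (Suc n) t)"
    by (intro times_differentiable_mult times_differentiable_bump) simp
next
  fix m t assume t: "t \<notin> {1 / real (Suc n)..1 - 1 / real (Suc n)}"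
  have "bump 0 1 (Suc n) t = 0"
  proof (rule bump_eq_0)
    show "t \<le> 0 + 1 / real (Suc n) \<or> 1 - 1 / real (Suc n) \<le> t"
      using t unfolding atLeastAtMost_iff by (simp only: add_0) (meson linear)
  qed simp
  then show "sin_or_cos (m \<in> Z) (pi * real (k m) * t) * bump 0 1 (Suc n) t = 0" by simp
qed auto

lemma abs_cutoff: "\<bar>cutoff d Z k n x\<bar> \<le> 1"
  unfolding cutoff_def abs_prod abs_mult
  by (intro prod_le_1) (auto simp: bump_bounds intro!: mult_le_one abs_sin_or_cos)

lemma cube_coordinate: "x \<in> cube d \<Longrightarrow> m < d \<Longrightarrow> 0 < x m \<and> x m < 1"
  by (auto simp: cube_def PiE_def Pi_def)

lemma cutoff_tendsto:
  assumes "x \<in> cube d" shows "(\<lambda>n. cutoff d Z k n x) \<longlonglongrightarrow> trig d Z k x"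
  unfolding cutoff_def trig_def
proof (intro tendsto_prod)
  fix m assume "m \<in> {..<d}"
  then have "(\<lambda>n. bump 0 1 n (x m)) \<longlonglongrightarrow> 1" using cube_coordinate[OF assms] by (intro bump_tendsto) auto
  from tendsto_mult[OF tendsto_const LIMSEQ_Suc[OF this]]
  show "(\<lambda>n. sin_or_cos (m \<in> Z) (pi * real (k m) * x m) * bump 0 1 (Suc n) (x m))
      \<longlonglongrightarrow> sin_or_cos (m \<in> Z) (pi * real (k m) * x m)" by simp
qed

lemma partial_deriv_cutoff:
  assumes "i < d"
  shows "partial_deriv i (cutoff d Z k n) x =
    (sin_or_cos' (i \<in> Z) (pi * real (k i)) (x i) * bump 0 1 (Suc n) (x i) +
     bump' 0 1 (Suc n) (x i) * sin_or_cos (i \<in> Z) (pi * real (k i) * x i)) *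
    (\<Prod>m\<in>{..<d} - {i}. sin_or_cos (m \<in> Z) (pi * real (k m) * x m) * bump 0 1 (Suc n) (x m))"
  unfolding cutoff_def[abs_def]
  using partial_deriv_prod[OF assms, of "\<lambda>m t. sin_or_cos (m \<in> Z) (pi * real (k m) * t) * bump 0 1 (Suc n) t",
      OF DERIV_mult[OF has_derivative_sin_or_cos has_real_derivative_bump]] by simp

text \<open>Since k is an integer, the sine vanishes at t = 1 as well as at t = 0; the second half
  of the bound follows by reflecting t to 1 - t.\<close>

lemma abs_sin_pi_le:
  assumes "0 < t" "t < 1"
  shows "\<bar>sin (pi * real k * t)\<bar> \<le> pi * real k * min t (1 - t)"
proof -
  have 1: "\<bar>sin (pi * real k * t)\<bar> \<le> pi * real k * t"
    using abs_sin_x_le_abs_x[of "pi * real k * t"] assms by (simp add: abs_mult)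
  have "pi * real k * t = pi * real k - pi * real k * (1 - t)" by (simp add: algebra_simps)
  then have "\<bar>sin (pi * real k * t)\<bar> = \<bar>cos (pi * real k) * sin (pi * real k * (1 - t))\<bar>"
    using sin_npi[of k] by (simp add: sin_diff mult.commute)
  also have "\<dots> \<le> 1 * \<bar>sin (pi * real k * (1 - t))\<bar>"
    unfolding abs_mult by (intro mult_right_mono) auto
  also have "\<dots> \<le> pi * real k * (1 - t)"
    using abs_sin_x_le_abs_x[of "pi * real k * (1 - t)"] assms by (simp add: abs_mult)
  finally show ?thesis using 1 by (simp add: min_def)
qed

text \<open>The derivative of the cutoff is of the order of the inverse distance to the face, which the
  sine factor compensates.\<close>

lemma abs_partial_deriv_cutoff:
  assumes "i < d" "i \<in> Z" "x \<in> cube d"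
  shows "\<bar>partial_deriv i (cutoff d Z k n) x\<bar> \<le> 7 * (pi * real (k i))"
proof -
  let ?p = "pi * real (k i)" and ?t = "x i"
  have t: "0 < ?t" "?t < 1" using cube_coordinate[OF assms(3,1)] by auto
  have "\<bar>sin_or_cos' (i \<in> Z) ?p ?t * bump 0 1 (Suc n) ?t\<bar> \<le> ?p * 1"
    unfolding abs_mult by (intro mult_mono abs_sin_or_cos') (auto simp: bump_bounds)
  moreover have "\<bar>bump' 0 1 (Suc n) ?t * sin_or_cos (i \<in> Z) (?p * ?t)\<bar> \<le> ?p * 6"
  proof -
    have "\<bar>bump' 0 1 (Suc n) ?t * sin_or_cos (i \<in> Z) (?p * ?t)\<bar> \<le> \<bar>bump' 0 1 (Suc n) ?t\<bar> * (?p * min ?t (1 - ?t))"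
      using abs_sin_pi_le[OF t, of "k i"] assms(2)
      unfolding abs_mult by (intro mult_left_mono) (auto simp: sin_or_cos_def)
    also have "\<dots> = ?p * (min ?t (1 - ?t) * \<bar>bump' 0 1 (Suc n) ?t\<bar>)" by (simp add: mult_ac)
    also have "\<dots> \<le> ?p * 6" by (intro mult_left_mono bump'_bound t) auto
    finally show ?thesis .
  qed
  ultimately have "\<bar>sin_or_cos' (i \<in> Z) ?p ?t * bump 0 1 (Suc n) ?t +
      bump' 0 1 (Suc n) ?t * sin_or_cos (i \<in> Z) (?p * ?t)\<bar> \<le> 7 * ?p" by linarith
  moreover have "\<bar>\<Prod>m\<in>{..<d} - {i}. sin_or_cos (m \<in> Z) (pi * real (k m) * x m) * bump 0 1 (Suc n) (x m)\<bar> \<le> 1"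
    unfolding abs_prod abs_mult
    by (intro prod_le_1) (auto simp: bump_bounds intro!: mult_le_one abs_sin_or_cos)
  ultimately have "\<bar>partial_deriv i (cutoff d Z k n) x\<bar> \<le> (7 * ?p) * 1"
    unfolding partial_deriv_cutoff[OF assms(1)] abs_mult by (intro mult_mono) auto
  then show ?thesis by simp
qed

lemma partial_deriv_cutoff_tendsto:
  assumes "i < d" "x \<in> cube d"
  shows "(\<lambda>n. partial_deriv i (cutoff d Z k n) x) \<longlonglongrightarrow> dtrig d Z k i x"
proof -
  have b: "(\<lambda>n. bump 0 1 (Suc n) (x m)) \<longlonglongrightarrow> 1" "(\<lambda>n. bump' 0 1 (Suc n) (x m)) \<longlonglongrightarrow> 0" if "m < d" for m
    using cube_coordinate[OF assms(2) that]
    by (auto intro!: LIMSEQ_Suc[OF bump_tendsto] LIMSEQ_Suc[OF bump'_tendsto])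
  have "(\<lambda>n. partial_deriv i (cutoff d Z k n) x) \<longlonglongrightarrow>
    (sin_or_cos' (i \<in> Z) (pi * real (k i)) (x i) * 1 + 0 * sin_or_cos (i \<in> Z) (pi * real (k i) * x i)) *
    (\<Prod>m\<in>{..<d} - {i}. sin_or_cos (m \<in> Z) (pi * real (k m) * x m) * 1)"
    unfolding partial_deriv_cutoff[OF assms(1)] using assms(1)
    by (intro tendsto_mult tendsto_add tendsto_prod tendsto_const b) auto
  then show ?thesis by (simp add: dtrig_eq_prod[OF assms(1)])
qed

text \<open>The sine factor in coordinate i vanishes on the two faces orthogonal to it, which
  removes the boundary term for every v in H1. The truncated product is a test function whose i-th
  derivative is dominated uniformly in n, and the bumps in the other coordinates are not
  differentiated.\<close>

lemma integration_by_parts_H1: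
  assumes v: "weak_gradient d v h" and i: "i < d" "i \<in> Z"
  shows "(\<integral>x. trig d Z k x * h i x \<partial>cube_lebesgue d) = - (\<integral>x. dtrig d Z k i x * v x \<partial>cube_lebesgue d)"
proof -
  let ?\<phi> = "cutoff d Z k"
  note v2 = weak_gradient_L2(1)[OF v] and h2 = weak_gradient_L2(2)[OF v i(1)]
  note m = borel_measurable_cubeI[OF test_function_measurable[OF cutoff_test_function]]
    borel_measurable_cubeI[OF test_function_partial_measurable[OF cutoff_test_function i(1)]]
  have 1: "(\<lambda>n. \<integral>x. ?\<phi> n x * h i x \<partial>cube_lebesgue d) \<longlonglongrightarrow> (\<integral>x. trig d Z k x * h i x \<partial>cube_lebesgue d)"
  proof (rule integral_dominated_convergence[where w = "\<lambda>x. \<bar>h i x\<bar>"])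
    show "AE x in cube_lebesgue d. (\<lambda>n. ?\<phi> n x * h i x) \<longlonglongrightarrow> trig d Z k x * h i x"
      by (rule AE_I2, rule tendsto_mult[OF cutoff_tendsto tendsto_const]) simp
    show "AE x in cube_lebesgue d. norm (?\<phi> n x * h i x) \<le> \<bar>h i x\<bar>" for n
      by (rule AE_I2) (simp add: abs_mult mult_right_le_one_le mult_left_le_one_le abs_cutoff)
  qed (use L2_integrable[OF h2] L2_measurable[OF h2] L2_measurable[OF trig_L2] m in
      \<open>auto intro!: borel_measurable_times\<close>)
  have 2: "(\<lambda>n. \<integral>x. partial_deriv i (?\<phi> n) x * v x \<partial>cube_lebesgue d) \<longlonglongrightarrow> (\<integral>x. dtrig d Z k i x * v x \<partial>cube_lebesgue d)"
  proof (rule integral_dominated_convergence[where w = "\<lambda>x. 7 * (pi * real (k i)) * \<bar>v x\<bar>"])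
    show "AE x in cube_lebesgue d. (\<lambda>n. partial_deriv i (?\<phi> n) x * v x) \<longlonglongrightarrow> dtrig d Z k i x * v x"
      by (rule AE_I2, rule tendsto_mult[OF partial_deriv_cutoff_tendsto[OF i(1)] tendsto_const]) simp
    show "AE x in cube_lebesgue d. norm (partial_deriv i (?\<phi> n) x * v x) \<le> 7 * (pi * real (k i)) * \<bar>v x\<bar>" for n
      using abs_partial_deriv_cutoff[OF i] by (intro AE_I2) (auto simp: abs_mult intro!: mult_right_mono)
  qed (use L2_integrable[OF v2] L2_measurable[OF v2] L2_measurable[OF dtrig_L2] m in
      \<open>auto intro!: borel_measurable_times\<close>)
  have eq: "(\<integral>x. partial_deriv i (?\<phi> n) x * v x \<partial>cube_lebesgue d) = - (\<integral>x. ?\<phi> n x * h i x \<partial>cube_lebesgue d)" for n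
    using v i(1) cutoff_test_function[of d Z k n]
    unfolding weak_gradient_def is_weak_partial_def by (simp add: mult.commute)
  show ?thesis
    using LIMSEQ_unique[OF 2[unfolded eq] tendsto_minus[OF 1]] by simp
qed

lemma energy_test_tendsto:
  assumes "v \<in> H10 d" "weak_gradient d v h" "d > 0"
  obtains \<phi> where "\<And>n. \<phi> n \<in> test_functions d"
    "(\<lambda>n. energy d (\<lambda>x. v x - \<phi> n x) (\<lambda>i x. h i x - partial_deriv i (\<phi> n) x)
      (\<lambda>x. v x - \<phi> n x) (\<lambda>i x. h i x - partial_deriv i (\<phi> n) x)) \<longlonglongrightarrow> 0"
proof -
  obtain \<phi> where \<phi>: "\<forall>n. \<phi> n \<in> test_functions d" "(\<lambda>n. H1_norm d (\<lambda>x. v x - \<phi> n x)) \<longlonglongrightarrow> 0"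
    using assms(1) unfolding H10_def by blast
  have wg: "weak_gradient d (\<lambda>x. v x - \<phi> n x) (\<lambda>i x. h i x - partial_deriv i (\<phi> n) x)" for n
    using weak_gradient_linear[OF assms(2) weak_gradient_test_function[OF \<phi>(1)[rule_format] assms(3)], of 1 "-1"]
    by simp
  have eq: "(H1_norm d (\<lambda>x. v x - \<phi> n x))\<^sup>2 = energy d (\<lambda>x. v x - \<phi> n x) (\<lambda>i x. h i x - partial_deriv i (\<phi> n) x)
      (\<lambda>x. v x - \<phi> n x) (\<lambda>i x. h i x - partial_deriv i (\<phi> n) x)" for n
    by (simp add: H1_norm_def H1_inner_eq_energy[OF wg wg] energy_nonneg)
  show ?thesis
    using that[of \<phi>] \<phi>(1) tendsto_power[OF \<phi>(2), of 2] unfolding eq by simp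
qed

lemma integral_square_le_energy:
  assumes "weak_gradient d u g"
  shows "(\<integral>x. (u x)\<^sup>2 \<partial>cube_lebesgue d) \<le> energy d u g u g"
    and "i < d \<Longrightarrow> (\<integral>x. (g i x)\<^sup>2 \<partial>cube_lebesgue d) \<le> energy d u g u g"
proof -
  show "(\<integral>x. (u x)\<^sup>2 \<partial>cube_lebesgue d) \<le> energy d u g u g"
    unfolding energy_def
    by (intro integral_mono integrable_energy assms L2_square weak_gradient_L2[OF assms])
       (auto simp: power2_eq_square intro!: sum_nonneg)
  assume i: "i < d"
  show "(\<integral>x. (g i x)\<^sup>2 \<partial>cube_lebesgue d) \<le> energy d u g u g"
    unfolding energy_def
  proof (intro integral_mono integrable_energy assms L2_square weak_gradient_L2[OF assms] i)
    fix x
    have "(g i x)\<^sup>2 \<le> (\<Sum>i<d. (g i x)\<^sup>2)" using i by (intro member_le_sum) auto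
    then show "(g i x)\<^sup>2 \<le> (\<Sum>i<d. g i x * g i x) + u x * u x"
      using zero_le_square[of "u x"] unfolding power2_eq_square by linarith
  qed
qed

text \<open>Here v supplies the zero boundary values, so products of every type are allowed. For a
  test function in place of v the identity is the weak derivative of \<open>trig\<close>, and both
  sides are continuous with respect to the energy.\<close>

lemma integration_by_parts_H10:
  assumes v: "v \<in> H10 d" "weak_gradient d v h" and i: "i < d"
  shows "(\<integral>x. trig d Z k x * h i x \<partial>cube_lebesgue d) = - (\<integral>x. dtrig d Z k i x * v x \<partial>cube_lebesgue d)"
proof -
  have "d > 0" using i by simp
  obtain \<phi> where \<phi>: "\<And>n. \<phi> n \<in> test_functions d"
    and lim: "(\<lambda>n. energy d (\<lambda>x. v x - \<phi> n x) (\<lambda>i x. h i x - partial_deriv i (\<phi> n) x)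
      (\<lambda>x. v x - \<phi> n x) (\<lambda>i x. h i x - partial_deriv i (\<phi> n) x)) \<longlonglongrightarrow> 0"
    using energy_test_tendsto[OF v \<open>d > 0\<close>] by blast
  have wg: "weak_gradient d (\<lambda>x. v x - \<phi> n x) (\<lambda>i x. h i x - partial_deriv i (\<phi> n) x)" for n
    using weak_gradient_linear[OF v(2) weak_gradient_test_function[OF \<phi> \<open>d > 0\<close>], of 1 "-1"] by simp
  have "(\<lambda>n. \<integral>x. (h i x - partial_deriv i (\<phi> n) x)\<^sup>2 \<partial>cube_lebesgue d) \<longlonglongrightarrow> 0"
    by (rule Lim_null_comparison[OF always_eventually lim])
       (use integral_square_le_energy(2)[OF wg i] in auto)
  from L2_tendsto_0_mult[OF _ trig_L2 this]
  have 1: "(\<lambda>n. \<integral>x. (h i x - partial_deriv i (\<phi> n) x) * trig d Z k x \<partial>cube_lebesgue d) \<longlonglongrightarrow> 0"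
    using weak_gradient_L2(2)[OF wg i] by blast
  have "(\<lambda>n. \<integral>x. (v x - \<phi> n x)\<^sup>2 \<partial>cube_lebesgue d) \<longlonglongrightarrow> 0"
    by (rule Lim_null_comparison[OF always_eventually lim])
       (use integral_square_le_energy(1)[OF wg] in auto)
  from L2_tendsto_0_mult[OF _ dtrig_L2 this]
  have 2: "(\<lambda>n. \<integral>x. (v x - \<phi> n x) * dtrig d Z k i x \<partial>cube_lebesgue d) \<longlonglongrightarrow> 0"
    using weak_gradient_L2(1)[OF wg] by blast
  \<comment> \<open>The left side tends to 0 and the right side does not depend on n, so the right
    side is 0.\<close>
  have "(\<integral>x. (h i x - partial_deriv i (\<phi> n) x) * trig d Z k x \<partial>cube_lebesgue d) +
      (\<integral>x. (v x - \<phi> n x) * dtrig d Z k i x \<partial>cube_lebesgue d) =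
      (\<integral>x. trig d Z k x * h i x \<partial>cube_lebesgue d) + (\<integral>x. dtrig d Z k i x * v x \<partial>cube_lebesgue d)" for n
  proof -
    note \<phi>2 = test_function_L2[OF \<phi> i, of n]
    have "(\<integral>x. (h i x - partial_deriv i (\<phi> n) x) * trig d Z k x \<partial>cube_lebesgue d) =
        (\<integral>x. trig d Z k x * h i x \<partial>cube_lebesgue d) - (\<integral>x. trig d Z k x * partial_deriv i (\<phi> n) x \<partial>cube_lebesgue d)"
      using weak_gradient_L2(2)[OF v(2) i] \<phi>2 trig_L2
      by (subst Bochner_Integration.integral_diff[symmetric]) (auto intro!: L2_mult_integrable simp: algebra_simps)
    moreover have "(\<integral>x. (v x - \<phi> n x) * dtrig d Z k i x \<partial>cube_lebesgue d) =
        (\<integral>x. dtrig d Z k i x * v x \<partial>cube_lebesgue d) - (\<integral>x. dtrig d Z k i x * \<phi> n x \<partial>cube_lebesgue d)"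
      using weak_gradient_L2(1)[OF v(2)] \<phi>2 dtrig_L2
      by (subst Bochner_Integration.integral_diff[symmetric]) (auto intro!: L2_mult_integrable simp: algebra_simps)
    moreover have "(\<integral>x. trig d Z k x * partial_deriv i (\<phi> n) x \<partial>cube_lebesgue d) = - (\<integral>x. dtrig d Z k i x * \<phi> n x \<partial>cube_lebesgue d)"
      using weak_gradient_trig[of d Z k] \<phi> i unfolding weak_gradient_def is_weak_partial_def by blast
    ultimately show ?thesis by simp
  qed
  with tendsto_add[OF 1 2] have "(\<integral>x. trig d Z k x * h i x \<partial>cube_lebesgue d) + (\<integral>x. dtrig d Z k i x * v x \<partial>cube_lebesgue d) = 0"
    by (simp add: LIMSEQ_const_iff)
  then show ?thesis by linarith
qed

text \<open>With a sine in every coordinate all partial derivatives of the truncated products are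
  dominated, so dominated convergence gives convergence in H1.\<close>

lemma trig_H10:
  assumes "d > 0" shows "trig d {..<d} k \<in> H10 d"
proof -
  let ?\<phi> = "cutoff d {..<d} k" and ?u = "trig d {..<d} k" and ?g = "dtrig d {..<d} k"
  have wg: "weak_gradient d (\<lambda>x. ?u x - ?\<phi> n x) (\<lambda>i x. ?g i x - partial_deriv i (?\<phi> n) x)" for n
    using weak_gradient_linear[OF weak_gradient_trig weak_gradient_test_function[OF cutoff_test_function assms], of 1 _ _ "-1"]
    by simp
  have m: "(\<lambda>x. (\<Sum>i<d. (?g i x - partial_deriv i (?\<phi> n) x) * (?g i x - partial_deriv i (?\<phi> n) x)) +
      (?u x - ?\<phi> n x) * (?u x - ?\<phi> n x)) \<in> borel_measurable (cube_lebesgue d)" for n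
    using integrable_energy[OF wg wg] by (rule borel_measurable_integrable)
  have "(\<lambda>n. energy d (\<lambda>x. ?u x - ?\<phi> n x) (\<lambda>i x. ?g i x - partial_deriv i (?\<phi> n) x)
      (\<lambda>x. ?u x - ?\<phi> n x) (\<lambda>i x. ?g i x - partial_deriv i (?\<phi> n) x)) \<longlonglongrightarrow> (\<integral>x. 0 \<partial>cube_lebesgue d)"
    unfolding energy_def
  \<comment> \<open>8 = 1 + 7: the derivative of the product is at most pi k_i and that of its
    truncation at most 7 pi k_i. The last summand bounds the square of the difference of two
    functions of modulus at most 1.\<close>
  proof (rule integral_dominated_convergence[where w = "\<lambda>x. (\<Sum>i<d. (8 * (pi * real (k i)))\<^sup>2) + 2\<^sup>2"])
    show "AE x in cube_lebesgue d. (\<lambda>n. (\<Sum>i<d. (?g i x - partial_deriv i (?\<phi> n) x) * (?g i x - partial_deriv i (?\<phi> n) x)) +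
      (?u x - ?\<phi> n x) * (?u x - ?\<phi> n x)) \<longlonglongrightarrow> 0"
    proof (rule AE_I2)
      fix x assume "x \<in> space (cube_lebesgue d)"
      then have x: "x \<in> cube d" by simp
      have "(\<lambda>n. (\<Sum>i<d. (?g i x - partial_deriv i (?\<phi> n) x) * (?g i x - partial_deriv i (?\<phi> n) x)) +
        (?u x - ?\<phi> n x) * (?u x - ?\<phi> n x)) \<longlonglongrightarrow> (\<Sum>i<d. (?g i x - ?g i x) * (?g i x - ?g i x)) + (?u x - ?u x) * (?u x - ?u x)"
        using x by (intro tendsto_add tendsto_sum tendsto_mult tendsto_diff tendsto_const
            cutoff_tendsto partial_deriv_cutoff_tendsto) auto
      then show "(\<lambda>n. (\<Sum>i<d. (?g i x - partial_deriv i (?\<phi> n) x) * (?g i x - partial_deriv i (?\<phi> n) x)) +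
        (?u x - ?\<phi> n x) * (?u x - ?\<phi> n x)) \<longlonglongrightarrow> 0" by simp
    qed
    show "AE x in cube_lebesgue d. norm ((\<Sum>i<d. (?g i x - partial_deriv i (?\<phi> n) x) * (?g i x - partial_deriv i (?\<phi> n) x)) +
      (?u x - ?\<phi> n x) * (?u x - ?\<phi> n x)) \<le> (\<Sum>i<d. (8 * (pi * real (k i)))\<^sup>2) + 2\<^sup>2" for n
    proof (rule AE_I2)
      fix x assume "x \<in> space (cube_lebesgue d)"
      then have x: "x \<in> cube d" by simp
      have "(?g i x - partial_deriv i (?\<phi> n) x) * (?g i x - partial_deriv i (?\<phi> n) x) \<le> (8 * (pi * real (k i)))\<^sup>2"
        if "i \<in> {..<d}" for i
      proof -
        have "\<bar>?g i x\<bar> \<le> pi * real (k i)" by (rule abs_dtrig_le)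
        moreover have "\<bar>partial_deriv i (?\<phi> n) x\<bar> \<le> 7 * (pi * real (k i))"
          using abs_partial_deriv_cutoff[of i d "{..<d}" x k n] that x by simp
        ultimately have "\<bar>?g i x - partial_deriv i (?\<phi> n) x\<bar> \<le> 8 * (pi * real (k i))" by linarith
        from abs_le_imp_square_le[OF this] show ?thesis by (simp add: power2_eq_square)
      qed
      then have "(\<Sum>i<d. (?g i x - partial_deriv i (?\<phi> n) x) * (?g i x - partial_deriv i (?\<phi> n) x)) \<le> (\<Sum>i<d. (8 * (pi * real (k i)))\<^sup>2)"
        by (rule sum_mono)
      moreover have "(?u x - ?\<phi> n x) * (?u x - ?\<phi> n x) \<le> 2\<^sup>2"
      proof -
        have "\<bar>?u x - ?\<phi> n x\<bar> \<le> 2" using abs_trig_le_1[of d "{..<d}" k x] abs_cutoff[of d "{..<d}" k n x] by linarith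
        from abs_le_imp_square_le[OF this] show ?thesis by (simp add: power2_eq_square)
      qed
      moreover have "0 \<le> (\<Sum>i<d. (?g i x - partial_deriv i (?\<phi> n) x) * (?g i x - partial_deriv i (?\<phi> n) x))"
        by (intro sum_nonneg) simp
      moreover have "0 \<le> (?u x - ?\<phi> n x) * (?u x - ?\<phi> n x)" by simp
      ultimately show "norm ((\<Sum>i<d. (?g i x - partial_deriv i (?\<phi> n) x) * (?g i x - partial_deriv i (?\<phi> n) x)) +
        (?u x - ?\<phi> n x) * (?u x - ?\<phi> n x)) \<le> (\<Sum>i<d. (8 * (pi * real (k i)))\<^sup>2) + 2\<^sup>2" by (simp only: real_norm_def)
    qed
    show "integrable (cube_lebesgue d) (\<lambda>x. (\<Sum>i<d. (8 * (pi * real (k i)))\<^sup>2) + 2\<^sup>2)"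
      using integrable_bounded[OF borel_measurable_const order_refl] .
  qed (rule borel_measurable_const m)+
  then have "(\<lambda>n. energy d (\<lambda>x. ?u x - ?\<phi> n x) (\<lambda>i x. ?g i x - partial_deriv i (?\<phi> n) x)
      (\<lambda>x. ?u x - ?\<phi> n x) (\<lambda>i x. ?g i x - partial_deriv i (?\<phi> n) x)) \<longlonglongrightarrow> 0"
    unfolding integral_const_cube .
  from tendsto_real_sqrt[OF this] have "(\<lambda>n. sqrt (energy d (\<lambda>x. ?u x - ?\<phi> n x) (\<lambda>i x. ?g i x - partial_deriv i (?\<phi> n) x)
      (\<lambda>x. ?u x - ?\<phi> n x) (\<lambda>i x. ?g i x - partial_deriv i (?\<phi> n) x))) \<longlonglongrightarrow> 0" by simp
  then have "(\<lambda>n. H1_norm d (\<lambda>x. ?u x - ?\<phi> n x)) \<longlonglongrightarrow> 0"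
    by (simp add: H1_norm_def H1_inner_eq_energy[OF wg wg])
  then show ?thesis
    unfolding H10_def using weak_gradient_H1[OF weak_gradient_trig] cutoff_test_function by blast
qed

section \<open>Barron expansions\<close>

lemma integral_cos_unit_interval:
  "(\<integral>t. cos (pi * real n * t) \<partial>unit_interval) = (if n = 0 then 1 else 0)"
proof (cases "n = 0")
  case True
  then show ?thesis
    using finite_measure.integrable_const[OF finite_measure_unit_interval]
    by (simp add: measure_def space_restrict_space)
next
  case False
  define F where "F = (\<lambda>t. sin (pi * real n * t) / (pi * real n))"
  have "(\<integral>t. cos (pi * real n * t) \<partial>unit_interval) = (LBINT t=0..1. cos (pi * real n * t))"
    by (subst integral_restrict_space)
       (auto simp: interval_lebesgue_integral_def set_lebesgue_integral_def zero_ereal_def one_ereal_def)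
  also have "\<dots> = F 1 - F 0"
  proof -
    have "(LBINT t=ereal 0..ereal 1. cos (pi * real n * t)) = F 1 - F 0"
    proof (rule interval_integral_FTC_finite)
      show "continuous_on {min 0 1..max 0 1} (\<lambda>t. cos (pi * real n * t))" by (intro continuous_intros)
      fix t :: real
      have "(F has_real_derivative cos (pi * real n * t)) (at t within {min 0 1..max 0 1})"
        unfolding F_def using False by (auto intro!: derivative_eq_intros)
      then show "(F has_vector_derivative cos (pi * real n * t)) (at t within {min 0 1..max 0 1})"
        by (simp add: has_real_derivative_iff_has_vector_derivative)
    qed
    then show ?thesis by (simp add: zero_ereal_def one_ereal_def)
  qed
  also have "\<dots> = 0" using sin_npi[of n] by (simp add: F_def mult.commute)
  finally show ?thesis using False by simp
qed

lemma integral_trig_cos: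
  "(\<integral>x. trig d {} k x \<partial>cube_lebesgue d) = (if \<forall>m<d. k m = 0 then 1 else 0)"
proof -
  interpret product_sigma_finite "\<lambda>_::nat. unit_interval" by (rule product_sigma_finite_unit_interval)
  have int: "integrable unit_interval (\<lambda>t. cos (pi * real n * t))" for n
  proof -
    interpret finite_measure unit_interval by (rule finite_measure_unit_interval)
    show ?thesis by (rule integrable_const_bound[of _ 1]) (auto intro: measurable_restrict_space1)
  qed
  have "(\<integral>x. trig d {} k x \<partial>cube_lebesgue d) = (\<integral>x. trig d {} k x \<partial>cube_borel d)"
    using trig_measurable by (simp add: cube_lebesgue_eq integral_completion)
  also have "\<dots> = (\<integral>x. (\<Prod>m<d. cos (pi * real (k m) * x m)) \<partial>Pi\<^sub>M {..<d} (\<lambda>_. unit_interval))"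
    unfolding cube_borel_def by (simp add: trig_def[abs_def] sin_or_cos_def)
  also have "\<dots> = (\<Prod>m<d. \<integral>t. cos (pi * real (k m) * t) \<partial>unit_interval)"
    by (rule product_integral_prod) (auto intro: int)
  also have "\<dots> = (if \<forall>m<d. k m = 0 then 1 else 0)"
    unfolding integral_cos_unit_interval by (auto intro!: prod_zero)
  finally show ?thesis .
qed

text \<open>The product of two functions of equal type is of pure cosine type, where only the zero
  frequency has a nonzero integral.\<close>

lemma integral_trig_mult:
  "(\<integral>x. trig d Z k x * trig d Z l x \<partial>cube_lebesgue d) =
    (\<Sum>s\<in>sign_choices d. product_coefficient d Z Z k l s * (if \<forall>m<d. product_frequency k l s m = 0 then 1 else 0))"
proof -
  have Z: "sdiff Z Z = {}" by (auto simp: sdiff_def)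
  show ?thesis
    unfolding trig_mult Z
    by (subst Bochner_Integration.integral_sum) (auto simp: integral_trig_cos L2_integrable[OF trig_L2])
qed

text \<open>Where the frequencies differ, neither their sum nor their difference is 0, so no term of
  the expanded product survives integration.\<close>

lemma trig_orthogonal:
  assumes "m < d" "k m \<noteq> l m"
  shows "(\<integral>x. trig d Z k x * trig d Z l x \<partial>cube_lebesgue d) = 0"
  unfolding integral_trig_mult
proof (rule sum.neutral, rule ballI)
  fix s
  have "product_frequency k l s m \<noteq> 0" using assms by (auto simp: product_frequency_def)
  then show "product_coefficient d Z Z k l s * (if \<forall>m<d. product_frequency k l s m = 0 then 1 else 0) = 0"
    using assms(1) by auto
qed

text \<open>All surviving terms are positive: in a sine coordinate the sum frequency is nonzero, so
  a surviving term has the difference there, whose sign for equal types is +1. Taking differences in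
  all coordinates gives a term that survives.\<close>

lemma trig_square_pos:
  assumes "\<And>m. m \<in> Z \<Longrightarrow> m < d \<Longrightarrow> k m \<noteq> 0"
  shows "0 < (\<integral>x. trig d Z k x * trig d Z k x \<partial>cube_lebesgue d)"
  unfolding integral_trig_mult
proof (rule sum_pos2[OF finite_sign_choices])
  have pos: "0 < product_coefficient d Z Z k k s" if "\<forall>m<d. product_frequency k k s m = 0" for s
    unfolding product_coefficient_def
  proof (intro prod_pos)
    fix m assume "m \<in> {..<d}"
    then show "0 < 1 / 2 * product_sign (m \<in> Z) (m \<in> Z) (k m) (k m) (s m)"
      using that assms[of m] by (auto simp: product_frequency_def product_sign_def split: if_splits)
  qed
  let ?s = "\<lambda>m\<in>{..<d}. False"
  show "?s \<in> sign_choices d" by (auto simp: sign_choices_def)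
  have "\<forall>m<d. product_frequency k k ?s m = 0" by (auto simp: product_frequency_def)
  then show "0 < product_coefficient d Z Z k k ?s * (if \<forall>m<d. product_frequency k k ?s m = 0 then 1 else 0)"
    using pos[of ?s] by simp
  show "0 \<le> product_coefficient d Z Z k k s * (if \<forall>m<d. product_frequency k k s m = 0 then 1 else 0)" for s
    using pos[of s] by auto
qed

text \<open>The residual of a finite partial sum has the same inner product with
  \<open>trig d Z k\<close> for all sums containing k, and by Cauchy-Schwarz this product is
  arbitrarily small.\<close>

lemma expansion_coefficient:
  assumes exp: "is_expansion d (trig d Z) Z g a" and g: "g \<in> L2 d" and k: "k \<in> multi_indices d"
  shows "(\<integral>x. g x * trig d Z k x \<partial>cube_lebesgue d) = a k * (\<integral>x. trig d Z k x * trig d Z k x \<partial>cube_lebesgue d)"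
    (is "?l = ?r")
proof -
  let ?r' = "\<lambda>F x. g x - (\<Sum>k\<in>F. a k * trig d Z k x)"
  let ?filter = "finite_subsets_at_top (multi_indices d)"
  have lim: "((\<lambda>F. \<integral>x. (?r' F x)\<^sup>2 \<partial>cube_lebesgue d) \<longlongrightarrow> 0) ?filter"
    using exp by (simp add: is_expansion_def)
  have ev: "\<forall>\<^sub>F F in ?filter. finite F \<and> k \<in> F \<and> F \<subseteq> multi_indices d"
    unfolding eventually_finite_subsets_at_top using k by (intro exI[of _ "{k}"]) auto
  have rL2: "?r' F \<in> L2 d" if "finite F" for F
    using that by (intro L2_diff g L2_sum L2_scale trig_L2)
  let ?B = "\<integral>x. (trig d Z k x)\<^sup>2 \<partial>cube_lebesgue d"
  have eq: "(\<integral>x. ?r' F x * trig d Z k x \<partial>cube_lebesgue d) = ?l - ?r"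
    if F: "finite F" "k \<in> F" "F \<subseteq> multi_indices d" for F
  proof -
    have "(\<integral>x. (\<Sum>l\<in>F. a l * trig d Z l x) * trig d Z k x \<partial>cube_lebesgue d) =
        (\<integral>x. (\<Sum>l\<in>F. a l * (trig d Z l x * trig d Z k x)) \<partial>cube_lebesgue d)"
      by (simp add: sum_distrib_right mult.assoc)
    also have "\<dots> = (\<Sum>l\<in>F. a l * (\<integral>x. trig d Z l x * trig d Z k x \<partial>cube_lebesgue d))"
      by (subst Bochner_Integration.integral_sum) (auto intro!: integrable_mult_right L2_mult_integrable trig_L2)
    also have "\<dots> = (\<Sum>l\<in>F. if l = k then ?r else 0)"
    proof (rule sum.cong[OF refl])
      fix l assume l: "l \<in> F"
      show "a l * (\<integral>x. trig d Z l x * trig d Z k x \<partial>cube_lebesgue d) = (if l = k then ?r else 0)"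
      proof (cases "l = k")
        case False
        moreover have "l \<in> multi_indices d" using l F by auto
        ultimately obtain m where "m < d" "l m \<noteq> k m"
          using k unfolding multi_indices_def by (metis PiE_ext lessThan_iff)
        then show ?thesis using False trig_orthogonal[of m d l k Z] by simp
      qed simp
    qed
    also have "\<dots> = ?r" using F by simp
    finally have "(\<integral>x. (\<Sum>l\<in>F. a l * trig d Z l x) * trig d Z k x \<partial>cube_lebesgue d) = ?r" .
    moreover have "(\<integral>x. ?r' F x * trig d Z k x \<partial>cube_lebesgue d) =
        ?l - (\<integral>x. (\<Sum>l\<in>F. a l * trig d Z l x) * trig d Z k x \<partial>cube_lebesgue d)"
      unfolding left_diff_distrib using F(1)
      by (intro Bochner_Integration.integral_diff L2_mult_integrable g trig_L2 L2_sum L2_scale)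
    ultimately show ?thesis by simp
  qed
  have "((\<lambda>F. (\<integral>x. (?r' F x)\<^sup>2 \<partial>cube_lebesgue d) * ?B) \<longlongrightarrow> 0 * ?B) ?filter"
    by (intro tendsto_mult lim tendsto_const)
  then have lim': "((\<lambda>F. (\<integral>x. (?r' F x)\<^sup>2 \<partial>cube_lebesgue d) * ?B) \<longlongrightarrow> 0) ?filter" by simp
  have "((\<lambda>F. (?l - ?r)\<^sup>2) \<longlongrightarrow> 0) ?filter"
  proof (rule Lim_null_comparison[OF _ lim'])
    show "\<forall>\<^sub>F F in ?filter. norm ((?l - ?r)\<^sup>2) \<le> (\<integral>x. (?r' F x)\<^sup>2 \<partial>cube_lebesgue d) * ?B"
      using ev
    proof eventually_elim
      case (elim F)
      then show ?case using L2_Cauchy_Schwarz[OF rL2[of F] trig_L2[of d Z k]] eq[of F] by simp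
    qed
  qed
  then have "(?l - ?r)\<^sup>2 = 0" by (simp add: tendsto_const_iff finite_subsets_at_top_neq_bot)
  then show ?thesis by simp
qed

text \<open>Inner products determine the coefficients, and those at excluded indices are 0 by
  convention; so the definite description in \<open>coefficients\<close> denotes the expansion at
  hand.\<close>

lemma coefficients_eq:
  assumes exp: "is_expansion d (trig d Z) Z g a" and g: "g \<in> L2 d"
  shows "coefficients d (trig d Z) Z g = a"
  unfolding coefficients_def
proof (rule the_equality[where P = "is_expansion d (trig d Z) Z g", OF exp])
  fix b assume b: "is_expansion d (trig d Z) Z g b"
  show "b = a"
  proof
    fix k
    show "b k = a k"
    proof (cases "k \<in> multi_indices d \<and> (\<forall>m\<in>Z. k m \<noteq> 0)")
      case True
      then have "0 < (\<integral>x. trig d Z k x * trig d Z k x \<partial>cube_lebesgue d)" by (intro trig_square_pos) auto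
      then show ?thesis
        using expansion_coefficient[OF exp g, of k] expansion_coefficient[OF b g, of k] True by simp
    next
      case False
      then show ?thesis using exp b unfolding is_expansion_def by (metis (full_types))
    qed
  qed
qed

lemma weighted_nonneg: "0 \<le> weighted d n a k"
  by (simp add: weighted_def L2_set_nonneg)

lemma barron_norm_nonneg: "0 \<le> barron_norm d e Z n g"
  unfolding barron_norm_def by (rule infsum_nonneg) (rule weighted_nonneg)

text \<open>The form in which the Barron hypotheses enter the iteration. A finite part of a sum of
  nonnegative terms stays below the total, and the L2 error is small by convergence along finite
  index sets.\<close>

lemma barron_truncation:
  assumes g: "g \<in> barron_space d (trig d Z) Z n" and "0 < \<tau>"
  shows "\<exists>F a. finite F \<and> (\<forall>k. (\<exists>m\<in>Z. k m = 0) \<longrightarrow> a k = 0) \<and>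
    (\<Sum>k\<in>F. weighted d n a k) \<le> barron_norm d (trig d Z) Z n g \<and>
    (\<integral>x. (g x - (\<Sum>k\<in>F. a k * trig d Z k x))\<^sup>2 \<partial>cube_lebesgue d) < \<tau>"
proof -
  obtain a where g2: "g \<in> L2 d" and a: "is_expansion d (trig d Z) Z g a"
    and s: "weighted d n a summable_on multi_indices d"
    using g by (auto simp: barron_space_def)
  have lim: "((\<lambda>F. \<integral>x. (g x - (\<Sum>k\<in>F. a k * trig d Z k x))\<^sup>2 \<partial>cube_lebesgue d) \<longlongrightarrow> 0)
      (finite_subsets_at_top (multi_indices d))"
    using a by (simp add: is_expansion_def)
  from order_tendstoD(2)[OF this \<open>0 < \<tau>\<close>] obtain F where F: "finite F" "F \<subseteq> multi_indices d"
    "(\<integral>x. (g x - (\<Sum>k\<in>F. a k * trig d Z k x))\<^sup>2 \<partial>cube_lebesgue d) < \<tau>"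
    unfolding eventually_finite_subsets_at_top by blast
  have "(\<Sum>k\<in>F. weighted d n a k) \<le> infsum (weighted d n a) (multi_indices d)"
    by (rule finite_sum_le_infsum[OF s F(1,2)]) (rule weighted_nonneg)
  then have "(\<Sum>k\<in>F. weighted d n a k) \<le> barron_norm d (trig d Z) Z n g"
    by (simp add: barron_norm_def coefficients_eq[OF a g2])
  moreover have "a k = 0" if "\<exists>m\<in>Z. k m = 0" for k
    using a that unfolding is_expansion_def by blast
  ultimately show ?thesis using F by blast
qed

text \<open>With norm 0 all coefficients of a truncation vanish, so the squared L2 norm of g would
  be below b^2, although g \<ge> b on a set of measure 1. Applied to c this yields
  \<open>0 < l_c\<close>, hence p(d) > 1.\<close>

lemma barron_norm_pos:
  assumes g: "g \<in> barron_space d (trig d Z) Z n" and "0 < b" "\<And>x. x \<in> cube d \<Longrightarrow> b \<le> g x"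
  shows "0 < barron_norm d (trig d Z) Z n g"
proof (rule ccontr)
  assume "\<not> 0 < barron_norm d (trig d Z) Z n g"
  then have 0: "barron_norm d (trig d Z) Z n g \<le> 0" by simp
  have g2: "g \<in> L2 d" using g by (simp add: barron_space_def)
  obtain F a where F: "finite F" "(\<Sum>k\<in>F. weighted d n a k) \<le> barron_norm d (trig d Z) Z n g"
    "(\<integral>x. (g x - (\<Sum>k\<in>F. a k * trig d Z k x))\<^sup>2 \<partial>cube_lebesgue d) < b\<^sup>2"
    using barron_truncation[OF g zero_less_power[OF \<open>0 < b\<close>, of 2]] by blast
  have "0 \<le> (\<Sum>k\<in>F. weighted d n a k)" by (intro sum_nonneg weighted_nonneg)
  then have "(\<Sum>k\<in>F. weighted d n a k) = 0" using F(2) 0 by linarith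
  then have "\<forall>k\<in>F. weighted d n a k = 0"
    using sum_nonneg_eq_0_iff[OF F(1), of "weighted d n a"] weighted_nonneg by blast
  moreover have "0 < 1 + pi ^ n * L2_set (\<lambda>m. real (k m)) {..<d} ^ n" for k
    by (intro add_pos_nonneg) (auto simp: L2_set_nonneg)
  ultimately have "\<forall>k\<in>F. a k = 0"
    unfolding weighted_def by (metis abs_eq_0 less_irrefl mult_eq_0_iff)
  then have "(\<integral>x. (g x)\<^sup>2 \<partial>cube_lebesgue d) < b\<^sup>2" using F(3) by simp
  moreover have "(\<integral>x. b\<^sup>2 \<partial>cube_lebesgue d) \<le> (\<integral>x. (g x)\<^sup>2 \<partial>cube_lebesgue d)"
    using assms(2,3) by (intro integral_mono L2_square g2) (auto intro!: power_mono L2_const)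
  ultimately show False by simp
qed

section \<open>Functionals represented by trigonometric polynomials\<close>

text \<open>A list with repetitions instead of a coefficient function: addition is concatenation,
  and equal frequencies produced by product-to-sum formulas stay uncollected. The norm belongs to
  the list and only bounds that of the function.\<close>

definition trig_poly :: "nat \<Rightarrow> nat set \<Rightarrow> (real \<times> (nat \<Rightarrow> nat)) list \<Rightarrow> (nat \<Rightarrow> real) \<Rightarrow> real" where
  "trig_poly d Z L x = (\<Sum>p\<leftarrow>L. fst p * trig d Z (snd p) x)"

definition dtrig_poly :: "nat \<Rightarrow> nat set \<Rightarrow> (real \<times> (nat \<Rightarrow> nat)) list \<Rightarrow> nat \<Rightarrow> (nat \<Rightarrow> real) \<Rightarrow> real" where
  "dtrig_poly d Z L i x = (\<Sum>p\<leftarrow>L. fst p * dtrig d Z (snd p) i x)"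

text \<open>The eigenvalue of 1 - \<Delta> on functions of frequency k, the same for all
  types.\<close>

definition frequency_weight :: "nat \<Rightarrow> (nat \<Rightarrow> nat) \<Rightarrow> real" where
  "frequency_weight d k = 1 + pi\<^sup>2 * (L2_set (\<lambda>m. real (k m)) {..<d})\<^sup>2"

definition trig_poly_norm :: "nat \<Rightarrow> (real \<times> (nat \<Rightarrow> nat)) list \<Rightarrow> real" where
  "trig_poly_norm d L = (\<Sum>p\<leftarrow>L. \<bar>fst p\<bar> * frequency_weight d (snd p))"

lemma frequency_weight_ge_1: "1 \<le> frequency_weight d k"
  by (simp add: frequency_weight_def)

text \<open>Integration by parts against the functions conjugate to those of type \<open>Z\<close>: for
  \<open>Z = {..<d}\<close> this expresses the Dirichlet condition, for \<open>Z = {}\<close> there is no condition.\<close>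

definition parts :: "nat \<Rightarrow> nat set \<Rightarrow> ((nat \<Rightarrow> real) \<Rightarrow> real) \<Rightarrow> (nat \<Rightarrow> (nat \<Rightarrow> real) \<Rightarrow> real) \<Rightarrow> bool" where
  "parts d Z v h \<longleftrightarrow> weak_gradient d v h \<and>
     (\<forall>i<d. \<forall>k. (\<integral>x. trig d (sdiff Z {i}) k x * h i x \<partial>cube_lebesgue d) =
       trig_sign Z i * (pi * real (k i)) * (\<integral>x. trig d Z k x * v x \<partial>cube_lebesgue d))"

lemma abs_trig_sign: "\<bar>trig_sign Z i\<bar> = 1"
  by (simp add: trig_sign_def)

lemma sdiff_twice: "sdiff (sdiff Z {i}) {i} = Z"
  by (auto simp: sdiff_def)

lemma dtrig_conjugate: "dtrig d (sdiff Z {i}) k i x = - trig_sign Z i * (pi * real (k i)) * trig d Z k x"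
  by (simp add: dtrig_def sdiff_twice trig_sign_def mem_sdiff)

lemma parts_weak_gradient: "parts d Z v h \<Longrightarrow> weak_gradient d v h"
  by (simp add: parts_def)

text \<open>Type \<open>{}\<close> has cosines only, so its conjugate \<open>sdiff {} {i}\<close>
  has a sine in coordinate i and removes the boundary term for every H1 function.\<close>

lemma parts_Neumann:
  assumes "weak_gradient d v h" shows "parts d {} v h"
  unfolding parts_def
proof (intro conjI allI impI assms)
  fix i k assume "i < d"
  then have "(\<integral>x. trig d (sdiff {} {i}) k x * h i x \<partial>cube_lebesgue d) = - (\<integral>x. dtrig d (sdiff {} {i}) k i x * v x \<partial>cube_lebesgue d)"
    by (intro integration_by_parts_H1 assms) (auto simp: mem_sdiff)
  then show "(\<integral>x. trig d (sdiff {} {i}) k x * h i x \<partial>cube_lebesgue d) =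
      trig_sign {} i * (pi * real (k i)) * (\<integral>x. trig d {} k x * v x \<partial>cube_lebesgue d)"
    unfolding dtrig_conjugate by (simp add: mult.assoc)
qed

lemma parts_Dirichlet:
  assumes "v \<in> H10 d" "weak_gradient d v h" shows "parts d {..<d} v h"
  unfolding parts_def
proof (intro conjI allI impI assms)
  fix i k assume "i < d"
  then have "(\<integral>x. trig d (sdiff {..<d} {i}) k x * h i x \<partial>cube_lebesgue d) = - (\<integral>x. dtrig d (sdiff {..<d} {i}) k i x * v x \<partial>cube_lebesgue d)"
    by (intro integration_by_parts_H10 assms)
  then show "(\<integral>x. trig d (sdiff {..<d} {i}) k x * h i x \<partial>cube_lebesgue d) =
      trig_sign {..<d} i * (pi * real (k i)) * (\<integral>x. trig d {..<d} k x * v x \<partial>cube_lebesgue d)"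
    unfolding dtrig_conjugate by (simp add: mult.assoc)
qed

lemma parts_linear:
  assumes v: "parts d Z v h" and w: "parts d Z w k"
  shows "parts d Z (\<lambda>x. a * v x + b * w x) (\<lambda>i x. a * h i x + b * k i x)"
  unfolding parts_def
proof (intro conjI allI impI weak_gradient_linear parts_weak_gradient[OF v] parts_weak_gradient[OF w])
  note L2 = weak_gradient_L2[OF parts_weak_gradient[OF v]] weak_gradient_L2[OF parts_weak_gradient[OF w]]
  have lin: "(\<integral>x. t x * (a * p x + b * q x) \<partial>cube_lebesgue d) =
      a * (\<integral>x. t x * p x \<partial>cube_lebesgue d) + b * (\<integral>x. t x * q x \<partial>cube_lebesgue d)"
    if "t \<in> L2 d" "p \<in> L2 d" "q \<in> L2 d" for t p q
  proof -
    have "(\<integral>x. t x * (a * p x + b * q x) \<partial>cube_lebesgue d) =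
        (\<integral>x. a * (t x * p x) + b * (t x * q x) \<partial>cube_lebesgue d)" by (simp add: algebra_simps)
    also have "\<dots> = a * (\<integral>x. t x * p x \<partial>cube_lebesgue d) + b * (\<integral>x. t x * q x \<partial>cube_lebesgue d)"
      using that by (simp add: Bochner_Integration.integral_add L2_mult_integrable)
    finally show ?thesis .
  qed
  fix i l assume i: "i < d"
  show "(\<integral>x. trig d (sdiff Z {i}) l x * (a * h i x + b * k i x) \<partial>cube_lebesgue d) =
      trig_sign Z i * (pi * real (l i)) * (\<integral>x. trig d Z l x * (a * v x + b * w x) \<partial>cube_lebesgue d)"
  proof -
    have "(\<integral>x. trig d (sdiff Z {i}) l x * (a * h i x + b * k i x) \<partial>cube_lebesgue d) =
        a * (\<integral>x. trig d (sdiff Z {i}) l x * h i x \<partial>cube_lebesgue d) +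
        b * (\<integral>x. trig d (sdiff Z {i}) l x * k i x \<partial>cube_lebesgue d)"
      by (rule lin) (use L2 i trig_L2 in auto)
    also have "\<dots> = trig_sign Z i * (pi * real (l i)) *
        (a * (\<integral>x. trig d Z l x * v x \<partial>cube_lebesgue d) + b * (\<integral>x. trig d Z l x * w x \<partial>cube_lebesgue d))"
      using v w i by (simp add: parts_def distrib_left)
    also have "a * (\<integral>x. trig d Z l x * v x \<partial>cube_lebesgue d) + b * (\<integral>x. trig d Z l x * w x \<partial>cube_lebesgue d) =
        (\<integral>x. trig d Z l x * (a * v x + b * w x) \<partial>cube_lebesgue d)"
      by (rule lin[symmetric]) (use L2 trig_L2 in auto)
    finally show ?thesis .
  qed
qed

text \<open>The weak form of the eigenvalue equation for 1 - \<Delta>. Each derivative leads to the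
  conjugate function and \<open>parts\<close> leads back, so the sign occurs twice and the factor pi
  k_i is squared.\<close>

lemma energy_trig_parts:
  assumes v: "parts d Z v h"
  shows "energy d (trig d Z k) (dtrig d Z k) v h =
    frequency_weight d k * (\<integral>x. trig d Z k x * v x \<partial>cube_lebesgue d)"
proof -
  note wg = parts_weak_gradient[OF v]
  let ?I = "\<integral>x. trig d Z k x * v x \<partial>cube_lebesgue d"
  have "energy d (trig d Z k) (dtrig d Z k) v h = (\<Sum>i<d. \<integral>x. dtrig d Z k i x * h i x \<partial>cube_lebesgue d) + ?I"
    unfolding energy_def using weak_gradient_L2[OF wg]
    by (subst Bochner_Integration.integral_add)
       (auto intro!: integrable_sum_mult L2_mult_integrable trig_L2 dtrig_L2 Bochner_Integration.integral_sum)
  also have "(\<Sum>i<d. \<integral>x. dtrig d Z k i x * h i x \<partial>cube_lebesgue d) = (\<Sum>i<d. (pi * real (k i))\<^sup>2 * ?I)"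
  proof (rule sum.cong[OF refl])
    fix i assume i: "i \<in> {..<d}"
    have "(\<integral>x. dtrig d Z k i x * h i x \<partial>cube_lebesgue d) =
        trig_sign Z i * (pi * real (k i)) * (\<integral>x. trig d (sdiff Z {i}) k x * h i x \<partial>cube_lebesgue d)"
      by (simp add: dtrig_def mult.assoc)
    also have "\<dots> = trig_sign Z i * (pi * real (k i)) * (trig_sign Z i * (pi * real (k i)) * ?I)"
      using v i by (simp add: parts_def)
    also have "\<dots> = (pi * real (k i))\<^sup>2 * ?I" by (simp add: trig_sign_def power2_eq_square)
    finally show "(\<integral>x. dtrig d Z k i x * h i x \<partial>cube_lebesgue d) = (pi * real (k i))\<^sup>2 * ?I" .
  qed
  also have "\<dots> = pi\<^sup>2 * (L2_set (\<lambda>m. real (k m)) {..<d})\<^sup>2 * ?I"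
    by (simp add: L2_set_def sum_nonneg sum_distrib_left sum_distrib_right power_mult_distrib)
  finally show ?thesis by (simp add: frequency_weight_def algebra_simps)
qed

lemma trig_poly_Nil: "trig_poly d Z [] = (\<lambda>x. 0)" "dtrig_poly d Z [] = (\<lambda>i x. 0)" "trig_poly_norm d [] = 0"
  by (simp_all add: fun_eq_iff trig_poly_def dtrig_poly_def trig_poly_norm_def)

lemma trig_poly_Cons:
  "trig_poly d Z (p # L) = (\<lambda>x. fst p * trig d Z (snd p) x + 1 * trig_poly d Z L x)"
  "dtrig_poly d Z (p # L) = (\<lambda>i x. fst p * dtrig d Z (snd p) i x + 1 * dtrig_poly d Z L i x)"
  by (simp_all add: fun_eq_iff trig_poly_def dtrig_poly_def)

lemma trig_poly_append_scale:
  "trig_poly d Z (L @ map (\<lambda>p. (c * fst p, snd p)) K) = (\<lambda>x. 1 * trig_poly d Z L x + c * trig_poly d Z K x)"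
  "dtrig_poly d Z (L @ map (\<lambda>p. (c * fst p, snd p)) K) = (\<lambda>i x. 1 * dtrig_poly d Z L i x + c * dtrig_poly d Z K i x)"
  "trig_poly_norm d (L @ map (\<lambda>p. (c * fst p, snd p)) K) = trig_poly_norm d L + \<bar>c\<bar> * trig_poly_norm d K"
  by (simp_all add: fun_eq_iff trig_poly_def dtrig_poly_def trig_poly_norm_def comp_def mult.assoc
      abs_mult sum_list_const_mult)

lemma weak_gradient_trig_poly: "weak_gradient d (trig_poly d Z L) (dtrig_poly d Z L)"
proof (induction L)
  case Nil
  then show ?case unfolding trig_poly_Nil by (rule weak_gradient_0)
next
  case (Cons p L)
  then show ?case unfolding trig_poly_Cons by (intro weak_gradient_linear weak_gradient_trig)
qed

section \<open>Functionals with a trigonometric Riesz representative\<close>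

text \<open>The polynomial is the Riesz representative of \<psi> in H1, that is, the inverse of 1 -
  \<Delta> applied to \<psi>, tested on all pairs that satisfy \<open>parts\<close>. The list is
  quantified before these pairs, so it represents the functional as a whole.\<close>

definition representable ::
    "nat \<Rightarrow> nat set \<Rightarrow> (((nat \<Rightarrow> real) \<Rightarrow> real) \<Rightarrow> (nat \<Rightarrow> (nat \<Rightarrow> real) \<Rightarrow> real) \<Rightarrow> real) \<Rightarrow> real \<Rightarrow> bool" where
  "representable d Z \<psi> W \<longleftrightarrow> (\<exists>L. trig_poly_norm d L \<le> W \<and>
     (\<forall>v h. parts d Z v h \<longrightarrow> energy d (trig_poly d Z L) (dtrig_poly d Z L) v h = \<psi> v h))"

lemma representable_0: "representable d Z (\<lambda>v h. 0) 0"
  unfolding representable_def by (intro exI[of _ "[]"]) (simp add: trig_poly_Nil energy_def)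

lemma representable_mono: "representable d Z \<psi> W \<Longrightarrow> W \<le> W' \<Longrightarrow> representable d Z \<psi> W'"
  unfolding representable_def by (meson order_trans)

lemma representable_cong:
  "representable d Z \<psi> W \<Longrightarrow> (\<And>v h. parts d Z v h \<Longrightarrow> \<psi> v h = \<psi>' v h) \<Longrightarrow> representable d Z \<psi>' W"
  unfolding representable_def by auto

lemma representable_add_scale:
  assumes "representable d Z \<psi> W" "representable d Z \<psi>' W'"
  shows "representable d Z (\<lambda>v h. \<psi> v h + c * \<psi>' v h) (W + \<bar>c\<bar> * W')"
proof -
  obtain L where L: "trig_poly_norm d L \<le> W"
    "\<And>v h. parts d Z v h \<Longrightarrow> energy d (trig_poly d Z L) (dtrig_poly d Z L) v h = \<psi> v h"
    using assms(1) unfolding representable_def by blast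
  obtain K where K: "trig_poly_norm d K \<le> W'"
    "\<And>v h. parts d Z v h \<Longrightarrow> energy d (trig_poly d Z K) (dtrig_poly d Z K) v h = \<psi>' v h"
    using assms(2) unfolding representable_def by blast
  show ?thesis
    unfolding representable_def
  proof (intro exI[of _ "L @ map (\<lambda>p. (c * fst p, snd p)) K"] conjI allI impI)
    show "trig_poly_norm d (L @ map (\<lambda>p. (c * fst p, snd p)) K) \<le> W + \<bar>c\<bar> * W'"
      unfolding trig_poly_append_scale using L(1) K(1) by (intro add_mono mult_left_mono) auto
    fix v h assume v: "parts d Z v h"
    show "energy d (trig_poly d Z (L @ map (\<lambda>p. (c * fst p, snd p)) K))
        (dtrig_poly d Z (L @ map (\<lambda>p. (c * fst p, snd p)) K)) v h = \<psi> v h + c * \<psi>' v h"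
      unfolding trig_poly_append_scale
        energy_linear[OF weak_gradient_trig_poly weak_gradient_trig_poly parts_weak_gradient[OF v]]
        L(2)[OF v] K(2)[OF v] by simp
  qed
qed

lemma representable_scale: "representable d Z \<psi> W \<Longrightarrow> representable d Z (\<lambda>v h. c * \<psi> v h) (\<bar>c\<bar> * W)"
  using representable_add_scale[OF representable_0, of d Z \<psi> W c] by simp

lemma representable_sum:
  "finite I \<Longrightarrow> (\<And>i. i \<in> I \<Longrightarrow> representable d Z (\<psi> i) (W i)) \<Longrightarrow>
    representable d Z (\<lambda>v h. \<Sum>i\<in>I. \<psi> i v h) (\<Sum>i\<in>I. W i)"
proof (induction I rule: finite_induct)
  case empty
  then show ?case by (simp add: representable_0)
next
  case (insert i I)
  then have "representable d Z (\<lambda>v h. \<psi> i v h + 1 * (\<Sum>i\<in>I. \<psi> i v h)) (W i + \<bar>1\<bar> * (\<Sum>i\<in>I. W i))"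
    by (intro representable_add_scale) auto
  then show ?case using insert by simp
qed

text \<open>The representative divides by the very eigenvalue with which the norm multiplies; the
  cost is 1 at every frequency.\<close>

lemma representable_trig:
  "representable d Z (\<lambda>v h. \<integral>x. trig d Z k x * v x \<partial>cube_lebesgue d) 1"
proof -
  have pos: "0 < frequency_weight d k" using frequency_weight_ge_1[of d k] by linarith
  let ?L = "[(1 / frequency_weight d k, k)]"
  show ?thesis
    unfolding representable_def
  proof (intro exI[of _ ?L] conjI allI impI)
    show "trig_poly_norm d ?L \<le> 1" using pos by (simp add: trig_poly_norm_def)
    fix v h assume v: "parts d Z v h"
    have "energy d (trig_poly d Z ?L) (dtrig_poly d Z ?L) v h =
        1 / frequency_weight d k * energy d (trig d Z k) (dtrig d Z k) v h + 1 * energy d (trig_poly d Z []) (dtrig_poly d Z []) v h"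
      unfolding trig_poly_Cons fst_conv snd_conv
      by (rule energy_linear[OF weak_gradient_trig weak_gradient_trig_poly parts_weak_gradient[OF v]])
    then show "energy d (trig_poly d Z ?L) (dtrig_poly d Z ?L) v h = (\<integral>x. trig d Z k x * v x \<partial>cube_lebesgue d)"
      using pos unfolding energy_trig_parts[OF v] by (simp add: trig_poly_Nil energy_def[of _ "\<lambda>x. 0"])
  qed
qed

text \<open>Moving the derivative from v to the trigonometric function produces the factor pi k_i,
  which is the whole cost.\<close>

lemma representable_trig_conjugate:
  assumes "i < d"
  shows "representable d Z (\<lambda>v h. \<integral>x. trig d (sdiff Z {i}) k x * h i x \<partial>cube_lebesgue d) (pi * real (k i))"
proof -
  have "representable d Z (\<lambda>v h. trig_sign Z i * (pi * real (k i)) * (\<integral>x. trig d Z k x * v x \<partial>cube_lebesgue d))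
      (\<bar>trig_sign Z i * (pi * real (k i))\<bar> * 1)"
    by (intro representable_scale representable_trig)
  then have "representable d Z (\<lambda>v h. trig_sign Z i * (pi * real (k i)) * (\<integral>x. trig d Z k x * v x \<partial>cube_lebesgue d)) (pi * real (k i))"
    by (simp add: abs_mult abs_trig_sign)
  then show ?thesis
    by (rule representable_cong) (use assms in \<open>simp add: parts_def\<close>)
qed

lemma integral_trig_mult_expand:
  assumes "v \<in> L2 d"
  shows "(\<integral>x. trig d W l x * trig d Y m x * v x \<partial>cube_lebesgue d) =
    (\<Sum>s\<in>sign_choices d. product_coefficient d W Y l m s *
      (\<integral>x. trig d (sdiff W Y) (product_frequency l m s) x * v x \<partial>cube_lebesgue d))"
  unfolding trig_mult sum_distrib_right using assms
  by (subst Bochner_Integration.integral_sum)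
     (auto simp: mult.assoc intro!: integrable_mult_right L2_mult_integrable trig_L2)

lemma representable_trig_mult:
  assumes "sdiff W Y = Z"
  shows "representable d Z (\<lambda>v h. \<integral>x. trig d W l x * trig d Y m x * v x \<partial>cube_lebesgue d) 1"
proof -
  have "representable d Z (\<lambda>v h. \<Sum>s\<in>sign_choices d. product_coefficient d W Y l m s *
      (\<integral>x. trig d Z (product_frequency l m s) x * v x \<partial>cube_lebesgue d))
      (\<Sum>s\<in>sign_choices d. \<bar>product_coefficient d W Y l m s\<bar> * 1)"
    by (intro representable_sum representable_scale representable_trig finite_sign_choices)
  then have "representable d Z (\<lambda>v h. \<Sum>s\<in>sign_choices d. product_coefficient d W Y l m s *
      (\<integral>x. trig d Z (product_frequency l m s) x * v x \<partial>cube_lebesgue d)) 1"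
    by (simp add: sum_abs_product_coefficient)
  then show ?thesis
    by (rule representable_cong)
       (simp add: integral_trig_mult_expand assms weak_gradient_L2(1)[OF parts_weak_gradient])
qed

text \<open>In coordinate i every frequency of the product is at most \<open>l i + m i\<close>, and
  the coefficients of the expansion have moduli with sum 1.\<close>

lemma representable_trig_mult_conjugate:
  assumes "sdiff W Y = sdiff Z {i}" "i < d"
  shows "representable d Z (\<lambda>v h. \<integral>x. trig d W l x * trig d Y m x * h i x \<partial>cube_lebesgue d) (pi * real (l i + m i))"
proof -
  have "representable d Z (\<lambda>v h. \<Sum>s\<in>sign_choices d. product_coefficient d W Y l m s *
      (\<integral>x. trig d (sdiff Z {i}) (product_frequency l m s) x * h i x \<partial>cube_lebesgue d))
      (\<Sum>s\<in>sign_choices d. \<bar>product_coefficient d W Y l m s\<bar> * (pi * real (l i + m i)))"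
    by (intro representable_sum representable_scale finite_sign_choices
        representable_mono[OF representable_trig_conjugate[OF assms(2)]] mult_left_mono)
       (auto simp only: of_nat_le_iff product_frequency_le pi_ge_zero)
  moreover have "(\<Sum>s\<in>sign_choices d. \<bar>product_coefficient d W Y l m s\<bar> * (pi * real (l i + m i))) = pi * real (l i + m i)"
    unfolding sum_distrib_right[symmetric] sum_abs_product_coefficient by simp
  ultimately have "representable d Z (\<lambda>v h. \<Sum>s\<in>sign_choices d. product_coefficient d W Y l m s *
      (\<integral>x. trig d (sdiff Z {i}) (product_frequency l m s) x * h i x \<partial>cube_lebesgue d)) (pi * real (l i + m i))"
    by simp
  then show ?thesis
    by (rule representable_cong)
       (simp add: integral_trig_mult_expand assms weak_gradient_L2(2)[OF parts_weak_gradient])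
qed

section \<open>Growth of the trigonometric norm under one step of the iteration\<close>

lemma trig_poly_sum:
  "trig_poly d Z L x = (\<Sum>n<length L. fst (L ! n) * trig d Z (snd (L ! n)) x)"
  "dtrig_poly d Z L i x = (\<Sum>n<length L. fst (L ! n) * dtrig d Z (snd (L ! n)) i x)"
  "trig_poly_norm d L = (\<Sum>n<length L. \<bar>fst (L ! n)\<bar> * frequency_weight d (snd (L ! n)))"
  by (simp_all add: trig_poly_def dtrig_poly_def trig_poly_norm_def sum_list_sum_nth atLeast0LessThan)

lemma frequency_le_L2_set: "(i::nat) < d \<Longrightarrow> real (k i) \<le> L2_set (\<lambda>m. real (k m)) {..<d}"
  by (rule member_le_L2_set[of "{..<d}" i "\<lambda>m. real (k m)"]) simp_all

text \<open>One factor comes from the gradient of the iterate, the other from taking the derivative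
  off the test function. The split leaves the coefficient frequency l in first order, matching the
  norm of order 1 for A_ij, and covers the two orders in m by the weight 1 + pi^2 |m|^2.\<close>

lemma frequency_product_le:
  assumes "i < d" "j < d"
  shows "(pi * real (m j)) * (pi * real (l i + m i)) \<le>
    (1 + pi ^ 1 * L2_set (\<lambda>n. real (l n)) {..<d} ^ 1) * frequency_weight d m"
proof -
  let ?l = "pi * L2_set (\<lambda>n. real (l n)) {..<d}" and ?m = "pi * L2_set (\<lambda>n. real (m n)) {..<d}"
  have pos: "0 \<le> ?l" "0 \<le> ?m" by (simp_all add: L2_set_nonneg)
  have 1: "pi * real (l i) \<le> ?l" "pi * real (m i) \<le> ?m" "pi * real (m j) \<le> ?m"
    using assms by (auto intro!: mult_left_mono frequency_le_L2_set)
  have "(pi * real (m j)) * (pi * real (l i + m i)) \<le> ?m * (?l + ?m)"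
  proof (rule mult_mono)
    show "pi * real (l i + m i) \<le> ?l + ?m" using add_mono[OF 1(1,2)] by (simp add: distrib_left)
  qed (use 1 pos in auto)
  also have "\<dots> \<le> (1 + ?l) * (1 + ?m\<^sup>2)"
  proof -
    have "?m \<le> 1 + ?m\<^sup>2" using abs_mult_le_squares[of ?m 1] pos by simp
    then have "?m * ?l \<le> (1 + ?m\<^sup>2) * ?l" using pos by (intro mult_right_mono)
    then show ?thesis by (simp add: algebra_simps power2_eq_square)
  qed
  finally show ?thesis by (simp add: frequency_weight_def power_mult_distrib)
qed

lemma trig_sum_L2: "finite F \<Longrightarrow> (\<lambda>x. \<Sum>l\<in>F. b l * trig d W l x) \<in> L2 d"
  by (intro L2_sum L2_scale trig_L2)

lemma trig_mult_integrable:
  assumes "v \<in> L2 d"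
  shows "integrable (cube_lebesgue d) (\<lambda>x. trig d W l x * trig d Y m x * v x)"
    "integrable (cube_lebesgue d) (\<lambda>x. trig d W l x * dtrig d Y m j x * v x)"
proof -
  show 1: "integrable (cube_lebesgue d) (\<lambda>x. trig d W l x * trig d Y m x * v x)" for Y
    using assms L2_bounded_mult[OF borel_measurable_cubeI[OF trig_measurable] abs_trig_le_1 trig_L2]
    by (intro L2_mult_integrable)
  show "integrable (cube_lebesgue d) (\<lambda>x. trig d W l x * dtrig d Y m j x * v x)"
    using integrable_mult_right[OF 1, of "trig_sign Y j * (pi * real (m j))" "sdiff Y {j}"]
    by (simp add: dtrig_def mult_ac)
qed

lemma integral_sum_mult_sum:
  fixes t s :: "_ \<Rightarrow> (nat \<Rightarrow> real) \<Rightarrow> real"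
  assumes "\<And>l n. integrable (cube_lebesgue d) (\<lambda>x. t l x * s n x * v x)"
  shows "(\<integral>x. (\<Sum>l\<in>F. b l * t l x) * (\<Sum>n\<in>N. a n * s n x) * v x \<partial>cube_lebesgue d) =
    (\<Sum>l\<in>F. \<Sum>n\<in>N. (b l * a n) * (\<integral>x. t l x * s n x * v x \<partial>cube_lebesgue d))"
proof -
  have "(\<integral>x. (\<Sum>l\<in>F. b l * t l x) * (\<Sum>n\<in>N. a n * s n x) * v x \<partial>cube_lebesgue d) =
      (\<integral>x. (\<Sum>l\<in>F. \<Sum>n\<in>N. (b l * a n) * (t l x * s n x * v x)) \<partial>cube_lebesgue d)"
    by (rule Bochner_Integration.integral_cong[OF refl], unfold sum_product, unfold sum_distrib_right)
       (intro sum.cong refl, simp add: mult_ac)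
  also have "\<dots> = (\<Sum>l\<in>F. \<Sum>n\<in>N. (b l * a n) * (\<integral>x. t l x * s n x * v x \<partial>cube_lebesgue d))"
    using assms by (simp add: Bochner_Integration.integral_sum)
  finally show ?thesis .
qed

text \<open>The coefficient has type \<open>sdiff {i} {j}\<close>, the gradient component
  \<open>sdiff Z {j}\<close> and their product \<open>sdiff Z {i}\<close>, exactly the type that
  pairs with h_i. For i = j the coefficient type is empty, so diagonal and off-diagonal entries are
  treated alike.\<close>

lemma representable_flux:
  assumes "i < d" "j < d" "finite F"
  shows "representable d Z
    (\<lambda>v h. \<integral>x. (\<Sum>l\<in>F. b l * trig d (sdiff {i} {j}) l x) * dtrig_poly d Z L j x * h i x \<partial>cube_lebesgue d)
    ((\<Sum>l\<in>F. weighted d 1 b l) * trig_poly_norm d L)"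
proof -
  let ?W = "sdiff {i} {j}"
  have set_eq: "sdiff ?W (sdiff Z {j}) = sdiff Z {i}" by (auto simp: mem_sdiff)
  have 1: "representable d Z (\<lambda>v h. \<integral>x. trig d ?W l x * dtrig d Z m j x * h i x \<partial>cube_lebesgue d)
      (pi * real (m j) * (pi * real (l i + m i)))" for l m
  proof -
    have "representable d Z (\<lambda>v h. trig_sign Z j * (pi * real (m j)) *
        (\<integral>x. trig d ?W l x * trig d (sdiff Z {j}) m x * h i x \<partial>cube_lebesgue d))
        (\<bar>trig_sign Z j * (pi * real (m j))\<bar> * (pi * real (l i + m i)))"
      by (intro representable_scale representable_trig_mult_conjugate set_eq assms)
    then have "representable d Z (\<lambda>v h. trig_sign Z j * (pi * real (m j)) *
        (\<integral>x. trig d ?W l x * trig d (sdiff Z {j}) m x * h i x \<partial>cube_lebesgue d))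
        (pi * real (m j) * (pi * real (l i + m i)))"
      by (simp add: abs_mult abs_trig_sign)
    then show ?thesis
      by (rule representable_cong)
         (subst integral_mult_right_zero[symmetric], rule Bochner_Integration.integral_cong, auto simp: dtrig_def mult_ac)
  qed
  let ?N = "{..<length L}"
  have "representable d Z (\<lambda>v h. \<Sum>l\<in>F. \<Sum>n\<in>?N. (b l * fst (L ! n)) *
      (\<integral>x. trig d ?W l x * dtrig d Z (snd (L ! n)) j x * h i x \<partial>cube_lebesgue d))
      (\<Sum>l\<in>F. \<Sum>n\<in>?N. \<bar>b l * fst (L ! n)\<bar> * (pi * real (snd (L ! n) j) * (pi * real (l i + snd (L ! n) i))))"
    by (intro representable_sum representable_scale 1 assms finite_lessThan)
  then have "representable d Z (\<lambda>v h. \<integral>x. (\<Sum>l\<in>F. b l * trig d ?W l x) * dtrig_poly d Z L j x * h i x \<partial>cube_lebesgue d)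
      (\<Sum>l\<in>F. \<Sum>n\<in>?N. \<bar>b l * fst (L ! n)\<bar> * (pi * real (snd (L ! n) j) * (pi * real (l i + snd (L ! n) i))))"
    by (rule representable_cong)
       (subst integral_sum_mult_sum[symmetric],
        auto intro!: trig_mult_integrable weak_gradient_L2(2)[OF parts_weak_gradient] assms simp: trig_poly_sum)
  then show ?thesis
  proof (rule representable_mono)
    have "(\<Sum>l\<in>F. \<Sum>n\<in>?N. \<bar>b l * fst (L ! n)\<bar> * (pi * real (snd (L ! n) j) * (pi * real (l i + snd (L ! n) i)))) \<le>
      (\<Sum>l\<in>F. \<Sum>n\<in>?N. weighted d 1 b l * (\<bar>fst (L ! n)\<bar> * frequency_weight d (snd (L ! n))))"
    proof (intro sum_mono)
      fix l n
      have "\<bar>b l * fst (L ! n)\<bar> * (pi * real (snd (L ! n) j) * (pi * real (l i + snd (L ! n) i))) \<le>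
        \<bar>b l * fst (L ! n)\<bar> * ((1 + pi ^ 1 * L2_set (\<lambda>n. real (l n)) {..<d} ^ 1) * frequency_weight d (snd (L ! n)))"
        by (intro mult_left_mono frequency_product_le assms) auto
      then show "\<bar>b l * fst (L ! n)\<bar> * (pi * real (snd (L ! n) j) * (pi * real (l i + snd (L ! n) i))) \<le>
        weighted d 1 b l * (\<bar>fst (L ! n)\<bar> * frequency_weight d (snd (L ! n)))"
        by (simp only: weighted_def abs_mult mult_ac)
    qed
    then show "(\<Sum>l\<in>F. \<Sum>n\<in>?N. \<bar>b l * fst (L ! n)\<bar> * (pi * real (snd (L ! n) j) * (pi * real (l i + snd (L ! n) i)))) \<le>
      (\<Sum>l\<in>F. weighted d 1 b l) * trig_poly_norm d L"
      by (simp add: trig_poly_sum sum_product)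
  qed
qed

text \<open>A coefficient of cosine type preserves the type \<open>Z\<close>. A product of two terms
  costs the product of their coefficients, and both weights are at least 1.\<close>

lemma representable_reaction:
  assumes "finite F"
  shows "representable d Z
    (\<lambda>v h. \<integral>x. (\<Sum>l\<in>F. b l * trig d {} l x) * trig_poly d Z L x * v x \<partial>cube_lebesgue d)
    ((\<Sum>l\<in>F. weighted d 2 b l) * trig_poly_norm d L)"
proof -
  have set_eq: "sdiff {} Z = Z" by (auto simp: mem_sdiff)
  let ?N = "{..<length L}"
  have "representable d Z (\<lambda>v h. \<Sum>l\<in>F. \<Sum>n\<in>?N. (b l * fst (L ! n)) *
      (\<integral>x. trig d {} l x * trig d Z (snd (L ! n)) x * v x \<partial>cube_lebesgue d))
      (\<Sum>l\<in>F. \<Sum>n\<in>?N. \<bar>b l * fst (L ! n)\<bar> * 1)"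
    by (intro representable_sum representable_scale representable_trig_mult set_eq assms finite_lessThan)
  then have "representable d Z (\<lambda>v h. \<integral>x. (\<Sum>l\<in>F. b l * trig d {} l x) * trig_poly d Z L x * v x \<partial>cube_lebesgue d)
      (\<Sum>l\<in>F. \<Sum>n\<in>?N. \<bar>b l * fst (L ! n)\<bar> * 1)"
    by (rule representable_cong)
       (subst integral_sum_mult_sum[symmetric],
        auto intro!: trig_mult_integrable weak_gradient_L2(1)[OF parts_weak_gradient] simp: trig_poly_sum)
  then show ?thesis
  proof (rule representable_mono)
    have "(\<Sum>l\<in>F. \<Sum>n\<in>?N. \<bar>b l * fst (L ! n)\<bar> * 1) \<le>
      (\<Sum>l\<in>F. \<Sum>n\<in>?N. weighted d 2 b l * (\<bar>fst (L ! n)\<bar> * frequency_weight d (snd (L ! n))))"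
    proof (intro sum_mono)
      fix l n
      have "\<bar>b l\<bar> * 1 \<le> weighted d 2 b l" unfolding weighted_def by (intro mult_left_mono) auto
      moreover have "\<bar>fst (L ! n)\<bar> * 1 \<le> \<bar>fst (L ! n)\<bar> * frequency_weight d (snd (L ! n))"
        by (intro mult_left_mono frequency_weight_ge_1) auto
      ultimately have "(\<bar>b l\<bar> * 1) * (\<bar>fst (L ! n)\<bar> * 1) \<le> weighted d 2 b l * (\<bar>fst (L ! n)\<bar> * frequency_weight d (snd (L ! n)))"
        by (intro mult_mono) (auto simp: weighted_nonneg frequency_weight_ge_1)
      then show "\<bar>b l * fst (L ! n)\<bar> * 1 \<le> weighted d 2 b l * (\<bar>fst (L ! n)\<bar> * frequency_weight d (snd (L ! n)))"
        by (simp add: abs_mult)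
    qed
    then show "(\<Sum>l\<in>F. \<Sum>n\<in>?N. \<bar>b l * fst (L ! n)\<bar> * 1) \<le> (\<Sum>l\<in>F. weighted d 2 b l) * trig_poly_norm d L"
      by (simp add: trig_poly_sum sum_product)
  qed
qed

text \<open>The weight of order 0 is 1 + pi^0 |l|^0 = 2, also at l = 0 because 0^0 = 1. This is the
  origin of the 2 in the denominator of \<open>M_bound\<close>.\<close>

lemma representable_source:
  assumes "finite F"
  shows "representable d Z (\<lambda>v h. \<integral>x. (\<Sum>l\<in>F. b l * trig d Z l x) * v x \<partial>cube_lebesgue d)
    ((\<Sum>l\<in>F. weighted d 0 b l) / 2)"
proof -
  have "representable d Z (\<lambda>v h. \<Sum>l\<in>F. b l * (\<integral>x. trig d Z l x * v x \<partial>cube_lebesgue d)) (\<Sum>l\<in>F. \<bar>b l\<bar> * 1)"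
    by (intro representable_sum representable_scale representable_trig assms)
  moreover have "(\<Sum>l\<in>F. \<bar>b l\<bar> * 1) = (\<Sum>l\<in>F. weighted d 0 b l) / 2"
    by (simp add: weighted_def sum_divide_distrib)
  ultimately have "representable d Z (\<lambda>v h. \<Sum>l\<in>F. b l * (\<integral>x. trig d Z l x * v x \<partial>cube_lebesgue d))
      ((\<Sum>l\<in>F. weighted d 0 b l) / 2)" by (simp only:)
  then show ?thesis
  proof (rule representable_cong)
    fix v h assume "parts d Z v h"
    then have "integrable (cube_lebesgue d) (\<lambda>x. trig d Z l x * v x)" for l
      by (intro L2_mult_integrable trig_L2 weak_gradient_L2(1)[OF parts_weak_gradient])
    then show "(\<Sum>l\<in>F. b l * (\<integral>x. trig d Z l x * v x \<partial>cube_lebesgue d)) =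
        (\<integral>x. (\<Sum>l\<in>F. b l * trig d Z l x) * v x \<partial>cube_lebesgue d)"
      by (simp add: sum_distrib_right mult.assoc Bochner_Integration.integral_sum)
  qed
qed

section \<open>The preconditioned gradient iteration\<close>

text \<open>Young's inequality with weight s. A bound by 1 plus a square replaces the product of
  norms, so that errors are compared with 1 plus the energy of the test function.\<close>

lemma abs_integral_mult_le:
  assumes "p \<in> L2 d" "q \<in> L2 d" "0 < s" "(\<integral>x. (p x)\<^sup>2 \<partial>cube_lebesgue d) \<le> s\<^sup>2"
  shows "\<bar>\<integral>x. p x * q x \<partial>cube_lebesgue d\<bar> \<le> s * (1 + (\<integral>x. (q x)\<^sup>2 \<partial>cube_lebesgue d))"
proof -
  have "\<bar>p x * q x\<bar> \<le> (p x)\<^sup>2 / s + s * (q x)\<^sup>2" for x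
  proof -
    have "\<bar>(p x / sqrt s) * (sqrt s * q x)\<bar> \<le> (p x / sqrt s)\<^sup>2 + (sqrt s * q x)\<^sup>2"
      by (rule abs_mult_le_squares)
    then show ?thesis using assms(3) by (simp add: power_divide power_mult_distrib)
  qed
  then have "\<bar>\<integral>x. p x * q x \<partial>cube_lebesgue d\<bar> \<le> (\<integral>x. (p x)\<^sup>2 / s + s * (q x)\<^sup>2 \<partial>cube_lebesgue d)"
    using assms by (intro order_trans[OF integral_abs_bound] integral_mono integrable_abs L2_mult_integrable
        Bochner_Integration.integrable_add integrable_mult_right integrable_divide L2_square) auto
  also have "\<dots> = (\<integral>x. (p x)\<^sup>2 \<partial>cube_lebesgue d) / s + s * (\<integral>x. (q x)\<^sup>2 \<partial>cube_lebesgue d)"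
    using assms by (subst Bochner_Integration.integral_add) (auto intro!: L2_square integrable_divide)
  also have "(\<integral>x. (p x)\<^sup>2 \<partial>cube_lebesgue d) / s \<le> s"
    using assms(3,4) by (simp add: pos_divide_le_eq power2_eq_square)
  finally show ?thesis by (simp add: distrib_left)
qed

lemma truncation_error:
  assumes "p \<in> L2 d" "w \<in> L2 d" "q \<in> borel_measurable (cube_lebesgue d)"
    "\<And>x. x \<in> cube d \<Longrightarrow> \<bar>q x\<bar> \<le> C" "0 < C" "0 < s"
    "(\<integral>x. (p x)\<^sup>2 \<partial>cube_lebesgue d) < (s / C)\<^sup>2"
  shows "\<bar>\<integral>x. p x * q x * w x \<partial>cube_lebesgue d\<bar> \<le> s * (1 + (\<integral>x. (w x)\<^sup>2 \<partial>cube_lebesgue d))"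
proof (rule abs_integral_mult_le)
  show "(\<lambda>x. p x * q x) \<in> L2 d"
    using L2_bounded_mult[OF assms(3,4,1)] by (simp add: mult.commute)
  have "(\<integral>x. (p x * q x)\<^sup>2 \<partial>cube_lebesgue d) \<le> (\<integral>x. C\<^sup>2 * (p x)\<^sup>2 \<partial>cube_lebesgue d)"
  proof (intro integral_mono integrable_mult_right L2_square assms(1))
    show "(\<lambda>x. p x * q x) \<in> L2 d" by fact
    fix x assume "x \<in> space (cube_lebesgue d)"
    then have "(q x)\<^sup>2 \<le> C\<^sup>2" using assms(4) by (intro abs_le_imp_square_le) auto
    then show "(p x * q x)\<^sup>2 \<le> C\<^sup>2 * (p x)\<^sup>2"
      unfolding power_mult_distrib by (subst mult.commute) (rule mult_right_mono, auto)
  qed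
  also have "\<dots> = C\<^sup>2 * (\<integral>x. (p x)\<^sup>2 \<partial>cube_lebesgue d)" by simp
  also have "\<dots> \<le> C\<^sup>2 * (s / C)\<^sup>2" using assms(7) by (intro mult_left_mono) auto
  also have "\<dots> = s\<^sup>2" using assms(5) by (simp add: power_divide)
  finally show "(\<integral>x. (p x * q x)\<^sup>2 \<partial>cube_lebesgue d) \<le> s\<^sup>2" .
qed (use assms in auto)

text \<open>Coefficients are truncated in L2 and then multiplied by the current iterate or its
  gradient; a uniform bound on these keeps the product small in L2. The truncation is therefore
  chosen anew for each iterate.\<close>

lemma trig_poly_bounded:
  "\<exists>C>0. \<forall>x. \<bar>trig_poly d Z L x\<bar> \<le> C \<and> (\<forall>j<d. \<bar>dtrig_poly d Z L j x\<bar> \<le> C)"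
proof -
  let ?C = "1 + (\<Sum>n<length L. \<bar>fst (L ! n)\<bar>) + (\<Sum>j<d. \<Sum>n<length L. \<bar>fst (L ! n)\<bar> * (pi * real (snd (L ! n) j)))"
  have nn: "0 \<le> (\<Sum>n<length L. \<bar>fst (L ! n)\<bar> * (pi * real (snd (L ! n) j)))" for j
    by (intro sum_nonneg mult_nonneg_nonneg) auto
  have nn': "0 \<le> (\<Sum>j<d. \<Sum>n<length L. \<bar>fst (L ! n)\<bar> * (pi * real (snd (L ! n) j)))"
    using nn by (rule sum_nonneg)
  have nn'': "0 \<le> (\<Sum>n<length L. \<bar>fst (L ! n)\<bar>)" by (rule sum_nonneg) simp
  have "\<bar>trig_poly d Z L x\<bar> \<le> ?C" for x
  proof -
    have "\<bar>trig_poly d Z L x\<bar> \<le> (\<Sum>n<length L. \<bar>fst (L ! n)\<bar>)"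
      unfolding trig_poly_sum
      by (rule order_trans[OF sum_abs sum_mono]) (simp add: abs_mult mult_left_le abs_trig_le_1)
    then show ?thesis using nn' by linarith
  qed
  moreover have "\<bar>dtrig_poly d Z L j x\<bar> \<le> ?C" if "j < d" for j x
  proof -
    have "\<bar>dtrig_poly d Z L j x\<bar> \<le> (\<Sum>n<length L. \<bar>fst (L ! n)\<bar> * (pi * real (snd (L ! n) j)))"
      unfolding trig_poly_sum
      by (rule order_trans[OF sum_abs sum_mono]) (simp add: abs_mult mult_left_mono abs_dtrig_le)
    also have "\<dots> \<le> (\<Sum>j<d. \<Sum>n<length L. \<bar>fst (L ! n)\<bar> * (pi * real (snd (L ! n) j)))"
      using that nn by (intro member_le_sum) auto
    finally show ?thesis using nn'' by linarith
  qed
  moreover have "0 < ?C" using nn' nn'' by linarith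
  ultimately show ?thesis by (intro exI[of _ ?C]) auto
qed

lemma trig_poly_measurable:
  "trig_poly d Z L \<in> borel_measurable (cube_lebesgue d)"
  "dtrig_poly d Z L j \<in> borel_measurable (cube_lebesgue d)"
  unfolding trig_poly_sum[abs_def]
  by (intro borel_measurable_cubeI borel_measurable_sum borel_measurable_times borel_measurable_const
      trig_measurable dtrig_measurable)+

text \<open>The upper bound on A is stated for squared Euclidean norms in coordinates, the form in
  which it enters integrals; one pair lmin, lmax serves the gradient part and the reaction
  part.\<close>

locale elliptic_coefficients =
  fixes d :: nat and A :: "(nat \<Rightarrow> real) \<Rightarrow> nat \<Rightarrow> nat \<Rightarrow> real" and c :: "(nat \<Rightarrow> real) \<Rightarrow> real"
    and lmin lmax :: real
  assumes lmin_pos: "0 < lmin" and lmin_le_lmax: "lmin \<le> lmax"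
    and A_meas: "\<And>i j. i < d \<Longrightarrow> j < d \<Longrightarrow> (\<lambda>x. A x i j) \<in> borel_measurable (cube_lebesgue d)"
    and A_sym: "\<And>x i j. x \<in> cube d \<Longrightarrow> i < d \<Longrightarrow> j < d \<Longrightarrow> A x i j = A x j i"
    and A_lower: "\<And>x v. x \<in> cube d \<Longrightarrow> lmin * (\<Sum>i<d. (v i)\<^sup>2) \<le> (\<Sum>i<d. (\<Sum>j<d. A x i j * v j) * v i)"
    and A_upper: "\<And>x v. x \<in> cube d \<Longrightarrow> (\<Sum>i<d. (\<Sum>j<d. A x i j * v j)\<^sup>2) \<le> lmax\<^sup>2 * (\<Sum>i<d. (v i)\<^sup>2)"
    and c_meas: "c \<in> borel_measurable (cube_lebesgue d)"
    and c_bounds: "\<And>x. x \<in> cube d \<Longrightarrow> lmin \<le> c x \<and> c x \<le> lmax"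
begin

definition form ::
    "((nat \<Rightarrow> real) \<Rightarrow> real) \<Rightarrow> (nat \<Rightarrow> (nat \<Rightarrow> real) \<Rightarrow> real) \<Rightarrow>
     ((nat \<Rightarrow> real) \<Rightarrow> real) \<Rightarrow> (nat \<Rightarrow> (nat \<Rightarrow> real) \<Rightarrow> real) \<Rightarrow> real" where
  "form w k v h = (\<integral>x. (\<Sum>i<d. (\<Sum>j<d. A x i j * k j x) * h i x) + c x * w x * v x \<partial>cube_lebesgue d)"

text \<open>An entry of A is a component of the image of a unit vector.\<close>

lemma A_bounded:
  assumes "x \<in> cube d" "i < d" "j < d" shows "\<bar>A x i j\<bar> \<le> lmax"
proof -
  let ?v = "\<lambda>n. if n = j then 1 else 0 :: real"
  have s: "(\<Sum>n<d. A x m n * ?v n) = A x m j" for m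
    using assms(3) by (simp add: if_distrib[of "\<lambda>t. A x m _ * t"] cong: if_cong)
  have "(A x i j)\<^sup>2 \<le> (\<Sum>m<d. (A x m j)\<^sup>2)" using assms(2) by (intro member_le_sum) auto
  also have "\<dots> \<le> lmax\<^sup>2 * (\<Sum>n<d. (?v n)\<^sup>2)" using A_upper[OF assms(1), of ?v] unfolding s .
  also have "(\<Sum>n<d. (?v n)\<^sup>2) = 1" using assms(3) by (simp add: if_distrib[of "\<lambda>t. t\<^sup>2"] cong: if_cong)
  finally have "\<bar>A x i j\<bar> \<le> \<bar>lmax\<bar>" by (simp add: abs_le_square_iff)
  then show ?thesis using lmin_pos lmin_le_lmax by simp
qed

lemma c_bounded: "x \<in> cube d \<Longrightarrow> \<bar>c x\<bar> \<le> lmax"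
  using c_bounds[of x] lmin_pos by auto

lemma A_L2: "i < d \<Longrightarrow> j < d \<Longrightarrow> (\<lambda>x. A x i j) \<in> L2 d"
  by (rule L2_bounded[OF A_meas A_bounded])

lemma c_L2: "c \<in> L2 d"
  by (rule L2_bounded[OF c_meas c_bounded])

lemma flux_L2:
  assumes "weak_gradient d w k" "i < d"
  shows "(\<lambda>x. \<Sum>j<d. A x i j * k j x) \<in> L2 d"
proof (rule L2_sum)
  fix j assume "j \<in> {..<d}"
  then show "(\<lambda>x. A x i j * k j x) \<in> L2 d"
    using assms by (intro L2_bounded_mult[OF A_meas A_bounded] weak_gradient_L2(2)[OF assms(1)]) auto
qed simp

lemma reaction_L2: "weak_gradient d w k \<Longrightarrow> (\<lambda>x. c x * w x) \<in> L2 d"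
  by (rule L2_bounded_mult[OF c_meas c_bounded weak_gradient_L2(1)])

lemma form_integrable:
  assumes "weak_gradient d w k" "weak_gradient d v h"
  shows "integrable (cube_lebesgue d) (\<lambda>x. (\<Sum>i<d. (\<Sum>j<d. A x i j * k j x) * h i x) + c x * w x * v x)"
  using flux_L2[OF assms(1)] reaction_L2[OF assms(1)] weak_gradient_L2[OF assms(2)]
  by (intro Bochner_Integration.integrable_add integrable_sum_mult[where h = h] L2_mult_integrable) auto

lemma form_linear_left:
  assumes "weak_gradient d w k" "weak_gradient d w' k'" "weak_gradient d v h"
  shows "form (\<lambda>x. a * w x + b * w' x) (\<lambda>i x. a * k i x + b * k' i x) v h = a * form w k v h + b * form w' k' v h"
proof -
  have "form (\<lambda>x. a * w x + b * w' x) (\<lambda>i x. a * k i x + b * k' i x) v h =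
    (\<integral>x. a * ((\<Sum>i<d. (\<Sum>j<d. A x i j * k j x) * h i x) + c x * w x * v x) +
      b * ((\<Sum>i<d. (\<Sum>j<d. A x i j * k' j x) * h i x) + c x * w' x * v x) \<partial>cube_lebesgue d)"
    unfolding form_def
    by (rule Bochner_Integration.integral_cong[OF refl])
       (simp add: algebra_simps sum.distrib sum_distrib_left sum_distrib_right)
  also have "\<dots> = a * form w k v h + b * form w' k' v h"
    unfolding form_def using form_integrable[OF assms(1,3)] form_integrable[OF assms(2,3)]
    by (subst Bochner_Integration.integral_add) (auto simp del: distrib_left_numeral)
  finally show ?thesis .
qed

lemma form_linear_right:
  assumes "weak_gradient d w k" "weak_gradient d v h" "weak_gradient d v' h'"
  shows "form w k (\<lambda>x. a * v x + b * v' x) (\<lambda>i x. a * h i x + b * h' i x) = a * form w k v h + b * form w k v' h'"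
proof -
  have "form w k (\<lambda>x. a * v x + b * v' x) (\<lambda>i x. a * h i x + b * h' i x) =
    (\<integral>x. a * ((\<Sum>i<d. (\<Sum>j<d. A x i j * k j x) * h i x) + c x * w x * v x) +
      b * ((\<Sum>i<d. (\<Sum>j<d. A x i j * k j x) * h' i x) + c x * w x * v' x) \<partial>cube_lebesgue d)"
    unfolding form_def
    by (rule Bochner_Integration.integral_cong[OF refl])
       (simp add: distrib_left sum.distrib sum_distrib_left mult_ac)
  also have "\<dots> = a * form w k v h + b * form w k v' h'"
    unfolding form_def using form_integrable[OF assms(1,2)] form_integrable[OF assms(1,3)]
    by (subst Bochner_Integration.integral_add) (auto simp del: distrib_left_numeral)
  finally show ?thesis .
qed

lemma form_coercive:
  assumes "weak_gradient d w k" shows "lmin * energy d w k w k \<le> form w k w k"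
proof -
  have "lmin * energy d w k w k = (\<integral>x. lmin * ((\<Sum>i<d. k i x * k i x) + w x * w x) \<partial>cube_lebesgue d)"
    by (simp add: energy_def)
  also have "\<dots> \<le> form w k w k"
    unfolding form_def
  proof (rule integral_mono)
    fix x assume "x \<in> space (cube_lebesgue d)"
    then have x: "x \<in> cube d" by simp
    have "lmin * (w x * w x) \<le> c x * (w x * w x)"
      using c_bounds[OF x] by (intro mult_right_mono) auto
    then show "lmin * ((\<Sum>i<d. k i x * k i x) + w x * w x)
        \<le> (\<Sum>i<d. (\<Sum>j<d. A x i j * k j x) * k i x) + c x * w x * w x"
      using A_lower[OF x, of "\<lambda>i. k i x"] by (simp add: distrib_left power2_eq_square mult.assoc)
  qed (intro integrable_mult_right integrable_energy form_integrable assms)+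
  finally show ?thesis .
qed

text \<open>Young's inequality for A applied to the gradient and for c w. With w the error and v its
  preconditioned residual it bounds the energy of the residual by lmax^2 times that of the error, up
  to truncation.\<close>

lemma form_bounded:
  assumes "weak_gradient d w k" "weak_gradient d v h"
  shows "2 * form w k v h \<le> lmax\<^sup>2 * energy d w k w k + energy d v h v h"
proof -
  have "2 * form w k v h = (\<integral>x. 2 * ((\<Sum>i<d. (\<Sum>j<d. A x i j * k j x) * h i x) + c x * w x * v x) \<partial>cube_lebesgue d)"
    by (simp only: form_def integral_mult_right_zero)
  also have "\<dots> \<le> (\<integral>x. lmax\<^sup>2 * ((\<Sum>i<d. k i x * k i x) + w x * w x) + ((\<Sum>i<d. h i x * h i x) + v x * v x) \<partial>cube_lebesgue d)"
  proof (rule integral_mono)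
    fix x assume "x \<in> space (cube_lebesgue d)"
    then have x: "x \<in> cube d" by simp
    have am: "2 * (p * q) \<le> p\<^sup>2 + q\<^sup>2" for p q :: real
      using zero_le_power2[of "p - q"] by (simp add: power2_diff)
    have "2 * (\<Sum>i<d. (\<Sum>j<d. A x i j * k j x) * h i x) \<le> (\<Sum>i<d. (\<Sum>j<d. A x i j * k j x)\<^sup>2 + (h i x)\<^sup>2)"
      unfolding sum_distrib_left by (intro sum_mono am)
    also have "\<dots> \<le> lmax\<^sup>2 * (\<Sum>i<d. (k i x)\<^sup>2) + (\<Sum>i<d. (h i x)\<^sup>2)"
      using A_upper[OF x, of "\<lambda>j. k j x"] by (simp add: sum.distrib)
    finally have 1: "2 * (\<Sum>i<d. (\<Sum>j<d. A x i j * k j x) * h i x) \<le> lmax\<^sup>2 * (\<Sum>i<d. (k i x)\<^sup>2) + (\<Sum>i<d. (h i x)\<^sup>2)" .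
    have "2 * (c x * w x * v x) \<le> (c x * w x)\<^sup>2 + (v x)\<^sup>2" by (rule am)
    also have "(c x * w x)\<^sup>2 \<le> lmax\<^sup>2 * (w x)\<^sup>2"
      unfolding power_mult_distrib using abs_le_imp_square_le[OF c_bounded[OF x]] by (rule mult_right_mono) simp
    finally have "2 * (c x * w x * v x) \<le> lmax\<^sup>2 * (w x)\<^sup>2 + (v x)\<^sup>2" by simp
    with 1 show "2 * ((\<Sum>i<d. (\<Sum>j<d. A x i j * k j x) * h i x) + c x * w x * v x)
        \<le> lmax\<^sup>2 * ((\<Sum>i<d. k i x * k i x) + w x * w x) + ((\<Sum>i<d. h i x * h i x) + v x * v x)"
      by (simp add: distrib_left power2_eq_square)
  qed (intro Bochner_Integration.integrable_add integrable_mult_right integrable_energy form_integrable assms)+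
  also have "\<dots> = lmax\<^sup>2 * energy d w k w k + energy d v h v h"
    unfolding energy_def using integrable_energy[OF assms(1,1)] integrable_energy[OF assms(2,2)]
    by (subst Bochner_Integration.integral_add) (auto simp del: distrib_left_numeral)
  finally show ?thesis .
qed

text \<open>\<open>weak_identity\<close> lets A act on the gradient of the test function and uses
  chosen representatives. Symmetry moves A to the solution, and the representatives for v agree with
  h almost everywhere.\<close>

lemma weak_identity_form:
  assumes u: "u \<in> H1 d" and v: "weak_gradient d v h" and f: "f \<in> L2 d" and weak: "weak_identity d A c f u v"
  shows "form u (\<lambda>i. weak_partial d i u) v h = (\<integral>x. f x * v x \<partial>cube_lebesgue d)"
proof -
  note wu = H1_weak_gradient[OF u] and wv = H1_weak_gradient[OF weak_gradient_H1[OF v]]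
  note m = L2_measurable[OF weak_gradient_L2(2)[OF wu]] L2_measurable[OF weak_gradient_L2(2)[OF wv]]
    L2_measurable[OF weak_gradient_L2(1)[OF wu]] L2_measurable[OF weak_gradient_L2(1)[OF wv]]
  let ?b = "\<lambda>x. (\<Sum>i<d. (\<Sum>j<d. A x i j * weak_partial d j u x) * h i x) + c x * u x * v x"
  have int: "integrable (cube_lebesgue d) ?b" by (rule form_integrable[OF wu v])
  have fint: "integrable (cube_lebesgue d) (\<lambda>x. f x * v x)" by (rule L2_mult_integrable[OF f weak_gradient_L2(1)[OF v]])
  have "0 = (\<integral>x. (\<Sum>i<d. weak_partial d i u x * (\<Sum>j<d. A x i j * weak_partial d j v x))
      + c x * u x * v x - f x * v x \<partial>cube_lebesgue d)"
    using weak by (simp add: weak_identity_def)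
  also have "\<dots> = (\<integral>x. ?b x - f x * v x \<partial>cube_lebesgue d)"
  proof (rule integral_cong_AE)
    show "(\<lambda>x. (\<Sum>i<d. weak_partial d i u x * (\<Sum>j<d. A x i j * weak_partial d j v x))
        + c x * u x * v x - f x * v x) \<in> borel_measurable (cube_lebesgue d)"
      by (intro borel_measurable_diff borel_measurable_add borel_measurable_sum borel_measurable_times
          m c_meas A_meas L2_measurable[OF f]) auto
    show "(\<lambda>x. ?b x - f x * v x) \<in> borel_measurable (cube_lebesgue d)"
      by (intro borel_measurable_diff borel_measurable_integrable[OF int] borel_measurable_integrable[OF fint])
    show "AE x in cube_lebesgue d. (\<Sum>i<d. weak_partial d i u x * (\<Sum>j<d. A x i j * weak_partial d j v x))
        + c x * u x * v x - f x * v x = ?b x - f x * v x"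
      using weak_gradient_AE[OF v] AE_space
    proof eventually_elim
      case (elim x)
      have "(\<Sum>i<d. weak_partial d i u x * (\<Sum>j<d. A x i j * weak_partial d j v x)) =
          (\<Sum>i<d. \<Sum>j<d. A x j i * weak_partial d i u x * h j x)"
        using elim A_sym[of x] by (simp add: sum_distrib_left mult_ac)
      also have "\<dots> = (\<Sum>j<d. \<Sum>i<d. A x j i * weak_partial d i u x * h j x)" by (rule sum.swap)
      finally show ?case by (simp add: sum_distrib_right)
    qed
  qed
  also have "\<dots> = form u (\<lambda>i. weak_partial d i u) v h - (\<integral>x. f x * v x \<partial>cube_lebesgue d)"
    unfolding form_def using int fint by (rule Bochner_Integration.integral_diff)
  finally show ?thesis by simp
qed

end

text \<open>Common to both boundary conditions, which differ in \<open>Z\<close>: the data enter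
  through truncations, and the weak equation is tested with u and with the functions
  \<open>trig d Z k\<close>.\<close>

locale elliptic_problem = elliptic_coefficients +
  fixes Z :: "nat set" and f :: "(nat \<Rightarrow> real) \<Rightarrow> real" and l_A l_c l_f :: real
    and u :: "(nat \<Rightarrow> real) \<Rightarrow> real" and g :: "nat \<Rightarrow> (nat \<Rightarrow> real) \<Rightarrow> real"
  assumes f_L2: "f \<in> L2 d"
    and A_truncation: "\<And>i j \<tau>. i < d \<Longrightarrow> j < d \<Longrightarrow> 0 < \<tau> \<Longrightarrow> \<exists>F b. finite F \<and>
      (\<Sum>l\<in>F. weighted d 1 b l) \<le> l_A \<and>
      (\<integral>x. (A x i j - (\<Sum>l\<in>F. b l * trig d (sdiff {i} {j}) l x))\<^sup>2 \<partial>cube_lebesgue d) < \<tau>"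
    and c_truncation: "\<And>\<tau>. 0 < \<tau> \<Longrightarrow> \<exists>F b. finite F \<and> (\<Sum>l\<in>F. weighted d 2 b l) \<le> l_c \<and>
      (\<integral>x. (c x - (\<Sum>l\<in>F. b l * trig d {} l x))\<^sup>2 \<partial>cube_lebesgue d) < \<tau>"
    and f_truncation: "\<And>\<tau>. 0 < \<tau> \<Longrightarrow> \<exists>F b. finite F \<and> (\<Sum>l\<in>F. weighted d 0 b l) \<le> l_f \<and>
      (\<integral>x. (f x - (\<Sum>l\<in>F. b l * trig d Z l x))\<^sup>2 \<partial>cube_lebesgue d) < \<tau>"
    and u_parts: "parts d Z u g"
    and trig_parts: "\<And>k. parts d Z (trig d Z k) (dtrig d Z k)"
    and solution_u: "form u g u g = (\<integral>x. f x * u x \<partial>cube_lebesgue d)"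
    and solution_trig: "\<And>k. form u g (trig d Z k) (dtrig d Z k) = (\<integral>x. f x * trig d Z k x \<partial>cube_lebesgue d)"
begin

text \<open>The test functions for which integration by parts and the weak equation are both
  available. They are closed under linear combinations and contain the solution and all
  trigonometric polynomials of type \<open>Z\<close>, hence the error of every iterate.\<close>

definition admissible :: "((nat \<Rightarrow> real) \<Rightarrow> real) \<Rightarrow> (nat \<Rightarrow> (nat \<Rightarrow> real) \<Rightarrow> real) \<Rightarrow> bool" where
  "admissible v h \<longleftrightarrow> parts d Z v h \<and> form u g v h = (\<integral>x. f x * v x \<partial>cube_lebesgue d)"

lemma admissible_u: "admissible u g"
  unfolding admissible_def by (intro conjI u_parts solution_u)

lemma admissible_trig: "admissible (trig d Z k) (dtrig d Z k)"
  unfolding admissible_def by (intro conjI trig_parts solution_trig)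

lemma source_linear:
  assumes "v \<in> L2 d" "w \<in> L2 d"
  shows "(\<integral>x. f x * (a * v x + b * w x) \<partial>cube_lebesgue d) =
    a * (\<integral>x. f x * v x \<partial>cube_lebesgue d) + b * (\<integral>x. f x * w x \<partial>cube_lebesgue d)"
proof -
  have "(\<integral>x. f x * (a * v x + b * w x) \<partial>cube_lebesgue d) =
      (\<integral>x. a * (f x * v x) + b * (f x * w x) \<partial>cube_lebesgue d)" by (simp add: algebra_simps)
  also have "\<dots> = a * (\<integral>x. f x * v x \<partial>cube_lebesgue d) + b * (\<integral>x. f x * w x \<partial>cube_lebesgue d)"
    using assms f_L2 by (simp add: Bochner_Integration.integral_add L2_mult_integrable)
  finally show ?thesis .
qed

lemma admissible_linear:
  assumes v: "admissible v h" and w: "admissible w k"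
  shows "admissible (\<lambda>x. a * v x + b * w x) (\<lambda>i x. a * h i x + b * k i x)"
proof -
  have p: "parts d Z v h" "parts d Z w k" using v w by (simp_all add: admissible_def)
  note wg = parts_weak_gradient[OF p(1)] parts_weak_gradient[OF p(2)]
  show ?thesis
    unfolding admissible_def
      form_linear_right[OF parts_weak_gradient[OF u_parts] wg]
      source_linear[OF weak_gradient_L2(1)[OF wg(1)] weak_gradient_L2(1)[OF wg(2)]]
    using v w parts_linear[OF p] by (simp add: admissible_def)
qed

lemma parts_0: "parts d Z (\<lambda>x. 0) (\<lambda>i x. 0)"
  by (simp add: parts_def weak_gradient_0)

lemma admissible_trig_poly: "admissible (trig_poly d Z L) (dtrig_poly d Z L)"
proof (induction L)
  case Nil
  then show ?case unfolding trig_poly_Nil admissible_def by (simp add: parts_0 form_def)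
next
  case (Cons p L)
  then show ?case unfolding trig_poly_Cons by (intro admissible_linear admissible_trig)
qed


text \<open>The data are replaced by trigonometric polynomials; the resulting functional is then
  represented by a trigonometric polynomial again, without any completeness of the basis.\<close>

lemma approximate_gradient:
  assumes "0 < \<tau>"
  shows "\<exists>K. trig_poly_norm d K \<le> ((real d)\<^sup>2 * l_A + l_c) * trig_poly_norm d L + l_f / 2 \<and>
    (\<forall>v h. admissible v h \<longrightarrow>
      \<bar>energy d (trig_poly d Z K) (dtrig_poly d Z K) v h -
        form (\<lambda>x. trig_poly d Z L x - u x) (\<lambda>i x. dtrig_poly d Z L i x - g i x) v h\<bar>
      \<le> \<tau> * (1 + energy d v h v h))"
proof -
  obtain C where C: "C > 0" "\<And>x. \<bar>trig_poly d Z L x\<bar> \<le> C" "\<And>j x. j < d \<Longrightarrow> \<bar>dtrig_poly d Z L j x\<bar> \<le> C"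
    using trig_poly_bounded[of d Z L] by blast
  \<comment> \<open>The tolerance \<tau> is shared by d^2 entries of A, one term for c and one for
    f.\<close>
  define s where "s = \<tau> / ((real d)\<^sup>2 + 2)"
  have dpos: "0 < (real d)\<^sup>2 + 2" by (intro add_nonneg_pos) auto
  have s: "s > 0" using assms dpos by (simp add: s_def)
  \<comment> \<open>The truncation error is multiplied by a function bounded by C, which turns (s /
    C)^2 into s^2.\<close>
  have sC: "0 < (s / C)\<^sup>2" using s C(1) by simp
  have "\<forall>p. \<exists>q. fst p < d \<longrightarrow> snd p < d \<longrightarrow> finite (fst q) \<and> (\<Sum>l\<in>fst q. weighted d 1 (snd q) l) \<le> l_A \<and>
      (\<integral>x. (A x (fst p) (snd p) - (\<Sum>l\<in>fst q. snd q l * trig d (sdiff {fst p} {snd p}) l x))\<^sup>2 \<partial>cube_lebesgue d) < (s / C)\<^sup>2"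
    using A_truncation[OF _ _ sC] by fastforce
  from choice[OF this] obtain Q where Q: "\<And>p. fst p < d \<longrightarrow> snd p < d \<longrightarrow> finite (fst (Q p)) \<and>
      (\<Sum>l\<in>fst (Q p). weighted d 1 (snd (Q p)) l) \<le> l_A \<and>
      (\<integral>x. (A x (fst p) (snd p) - (\<Sum>l\<in>fst (Q p). snd (Q p) l * trig d (sdiff {fst p} {snd p}) l x))\<^sup>2 \<partial>cube_lebesgue d) < (s / C)\<^sup>2"
    by blast
  define FA bA where "FA i j = fst (Q (i, j))" and "bA i j = snd (Q (i, j))" for i j
  have FA: "finite (FA i j) \<and> (\<Sum>l\<in>FA i j. weighted d 1 (bA i j) l) \<le> l_A \<and>
      (\<integral>x. (A x i j - (\<Sum>l\<in>FA i j. bA i j l * trig d (sdiff {i} {j}) l x))\<^sup>2 \<partial>cube_lebesgue d) < (s / C)\<^sup>2"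
    if "i < d" "j < d" for i j
    using Q[of "(i, j)"] that unfolding FA_def bA_def fst_conv snd_conv by blast
  obtain Fc bc where Fc: "finite Fc" "(\<Sum>l\<in>Fc. weighted d 2 bc l) \<le> l_c"
      "(\<integral>x. (c x - (\<Sum>l\<in>Fc. bc l * trig d {} l x))\<^sup>2 \<partial>cube_lebesgue d) < (s / C)\<^sup>2"
    using c_truncation[OF sC] by blast
  \<comment> \<open>The source is not multiplied by an iterate, so 1 takes the place of C.\<close>
  have s1: "0 < (s / 1)\<^sup>2" using s by simp
  obtain Ff bf where Ff: "finite Ff" "(\<Sum>l\<in>Ff. weighted d 0 bf l) \<le> l_f"
      "(\<integral>x. (f x - (\<Sum>l\<in>Ff. bf l * trig d Z l x))\<^sup>2 \<partial>cube_lebesgue d) < (s / 1)\<^sup>2"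
    using f_truncation[OF s1] by blast
  define tA where "tA i j x = (\<Sum>l\<in>FA i j. bA i j l * trig d (sdiff {i} {j}) l x)" for i j x
  define tc where "tc x = (\<Sum>l\<in>Fc. bc l * trig d {} l x)" for x
  define tf where "tf x = (\<Sum>l\<in>Ff. bf l * trig d Z l x)" for x
  \<comment> \<open>The residual functional of the current polynomial, with all data truncated. The
    coefficients 1 and -1 give it the shape of \<open>representable_add_scale\<close>.\<close>
  define \<psi> where "\<psi> v h = ((\<Sum>i<d. \<Sum>j<d. \<integral>x. tA i j x * dtrig_poly d Z L j x * h i x \<partial>cube_lebesgue d) +
      1 * (\<integral>x. tc x * trig_poly d Z L x * v x \<partial>cube_lebesgue d)) + (- 1) * (\<integral>x. tf x * v x \<partial>cube_lebesgue d)"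
    for v and h :: "nat \<Rightarrow> (nat \<Rightarrow> real) \<Rightarrow> real"
  let ?U = "trig_poly_norm d L"
  have U: "0 \<le> ?U"
    unfolding trig_poly_sum by (intro sum_nonneg mult_nonneg_nonneg) (auto intro: order_trans[OF zero_le_one frequency_weight_ge_1])
  have "representable d Z \<psi> (((\<Sum>i<d. \<Sum>j<d. (\<Sum>l\<in>FA i j. weighted d 1 (bA i j) l) * ?U) +
      \<bar>1\<bar> * ((\<Sum>l\<in>Fc. weighted d 2 bc l) * ?U)) + \<bar>- 1\<bar> * ((\<Sum>l\<in>Ff. weighted d 0 bf l) / 2))"
    unfolding \<psi>_def[abs_def] tA_def tc_def tf_def using FA Fc Ff
    by (intro representable_add_scale representable_sum representable_flux representable_reaction representable_source) auto
  then have "representable d Z \<psi> (((real d)\<^sup>2 * l_A + l_c) * ?U + l_f / 2)"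
  proof (rule representable_mono)
    have "(\<Sum>i<d. \<Sum>j<d. (\<Sum>l\<in>FA i j. weighted d 1 (bA i j) l) * ?U) \<le> (\<Sum>i<d. \<Sum>j<d. l_A * ?U)"
      using FA U by (intro sum_mono mult_right_mono) auto
    moreover have "(\<Sum>i<d. \<Sum>j<d. l_A * ?U) = (real d)\<^sup>2 * l_A * ?U" by (simp add: power2_eq_square)
    moreover have "(\<Sum>l\<in>Fc. weighted d 2 bc l) * ?U \<le> l_c * ?U" using Fc U by (intro mult_right_mono)
    ultimately show "((\<Sum>i<d. \<Sum>j<d. (\<Sum>l\<in>FA i j. weighted d 1 (bA i j) l) * ?U) +
      \<bar>1\<bar> * ((\<Sum>l\<in>Fc. weighted d 2 bc l) * ?U)) + \<bar>- 1\<bar> * ((\<Sum>l\<in>Ff. weighted d 0 bf l) / 2) \<le>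
      ((real d)\<^sup>2 * l_A + l_c) * ?U + l_f / 2"
      unfolding distrib_right abs_minus_cancel abs_one mult_1 using Ff(2) by linarith
  qed
  then obtain K where K: "trig_poly_norm d K \<le> ((real d)\<^sup>2 * l_A + l_c) * ?U + l_f / 2"
    "\<And>v h. parts d Z v h \<Longrightarrow> energy d (trig_poly d Z K) (dtrig_poly d Z K) v h = \<psi> v h"
    unfolding representable_def by blast
  show ?thesis
  proof (intro exI[of _ K] conjI K(1) allI impI)
    fix v h assume adm: "admissible v h"
    then have p: "parts d Z v h" by (simp add: admissible_def)
    note wg = parts_weak_gradient[OF p]
    note v2 = weak_gradient_L2(1)[OF wg] and h2 = weak_gradient_L2(2)[OF wg]
    let ?E = "energy d v h v h"
    \<comment> \<open>Here admissibility of v is used: the form of the unknown solution against v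
      equals the integral of f v, so the form of the error is expressed by the data alone.\<close>
    have "form (\<lambda>x. 1 * trig_poly d Z L x + (- 1) * u x) (\<lambda>i x. 1 * dtrig_poly d Z L i x + (- 1) * g i x) v h =
        1 * form (trig_poly d Z L) (dtrig_poly d Z L) v h + (- 1) * form u g v h"
      by (rule form_linear_left[OF weak_gradient_trig_poly parts_weak_gradient[OF u_parts] wg])
    then have e: "form (\<lambda>x. trig_poly d Z L x - u x) (\<lambda>i x. dtrig_poly d Z L i x - g i x) v h =
        form (trig_poly d Z L) (dtrig_poly d Z L) v h - (\<integral>x. f x * v x \<partial>cube_lebesgue d)"
      using adm by (simp add: admissible_def)
    have bm: "integrable (cube_lebesgue d) (\<lambda>x. P x * Q x * w x)"
      if "P \<in> L2 d" "w \<in> L2 d" "Q \<in> borel_measurable (cube_lebesgue d)" "\<And>x. \<bar>Q x\<bar> \<le> C" for P Q w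
      using L2_mult_integrable[OF L2_bounded_mult[OF that(3,4,1)] that(2)] by (simp add: mult_ac)
    have dm: "integrable (cube_lebesgue d) (\<lambda>x. P x * dtrig_poly d Z L j x * h i x)"
      if "P \<in> L2 d" "i < d" "j < d" for P i j
      by (rule bm[OF that(1) h2[OF that(2)] trig_poly_measurable(2) C(3)[OF that(3)]])
    have cm: "integrable (cube_lebesgue d) (\<lambda>x. P x * trig_poly d Z L x * v x)" if "P \<in> L2 d" for P
      by (rule bm[OF that v2 trig_poly_measurable(1) C(2)])
    have tA2: "tA i j \<in> L2 d" if "i < d" "j < d" for i j
      unfolding tA_def[abs_def] using FA[OF that] by (intro trig_sum_L2) auto
    have tc2: "tc \<in> L2 d" unfolding tc_def[abs_def] using Fc by (intro trig_sum_L2)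
    have tf2: "tf \<in> L2 d" unfolding tf_def[abs_def] using Ff by (intro trig_sum_L2)
    have form_eq: "form (trig_poly d Z L) (dtrig_poly d Z L) v h =
        (\<Sum>i<d. \<Sum>j<d. \<integral>x. A x i j * dtrig_poly d Z L j x * h i x \<partial>cube_lebesgue d) +
        (\<integral>x. c x * trig_poly d Z L x * v x \<partial>cube_lebesgue d)"
    proof -
      have "form (trig_poly d Z L) (dtrig_poly d Z L) v h =
        (\<integral>x. (\<Sum>i<d. \<Sum>j<d. A x i j * dtrig_poly d Z L j x * h i x) + c x * trig_poly d Z L x * v x \<partial>cube_lebesgue d)"
        by (simp add: form_def sum_distrib_right)
      also have "\<dots> = (\<integral>x. (\<Sum>i<d. \<Sum>j<d. A x i j * dtrig_poly d Z L j x * h i x) \<partial>cube_lebesgue d) +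
          (\<integral>x. c x * trig_poly d Z L x * v x \<partial>cube_lebesgue d)"
        by (intro Bochner_Integration.integral_add Bochner_Integration.integrable_sum dm cm A_L2 c_L2) auto
      also have "(\<integral>x. (\<Sum>i<d. \<Sum>j<d. A x i j * dtrig_poly d Z L j x * h i x) \<partial>cube_lebesgue d) =
          (\<Sum>i<d. \<integral>x. (\<Sum>j<d. A x i j * dtrig_poly d Z L j x * h i x) \<partial>cube_lebesgue d)"
        by (intro Bochner_Integration.integral_sum Bochner_Integration.integrable_sum dm A_L2) auto
      also have "\<dots> = (\<Sum>i<d. \<Sum>j<d. \<integral>x. A x i j * dtrig_poly d Z L j x * h i x \<partial>cube_lebesgue d)"
        by (intro sum.cong refl Bochner_Integration.integral_sum dm A_L2) auto
      finally show ?thesis .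
    qed
    have E1: "(\<integral>x. (v x)\<^sup>2 \<partial>cube_lebesgue d) \<le> ?E" by (rule integral_square_le_energy(1)[OF wg])
    have E2: "(\<integral>x. (h i x)\<^sup>2 \<partial>cube_lebesgue d) \<le> ?E" if "i < d" for i
      by (rule integral_square_le_energy(2)[OF wg that])
    have rA: "\<bar>(\<integral>x. tA i j x * dtrig_poly d Z L j x * h i x \<partial>cube_lebesgue d) -
        (\<integral>x. A x i j * dtrig_poly d Z L j x * h i x \<partial>cube_lebesgue d)\<bar> \<le> s * (1 + ?E)" if ij: "i < d" "j < d" for i j
    proof -
      have "(\<integral>x. tA i j x * dtrig_poly d Z L j x * h i x \<partial>cube_lebesgue d) -
          (\<integral>x. A x i j * dtrig_poly d Z L j x * h i x \<partial>cube_lebesgue d) =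
          - (\<integral>x. (A x i j - tA i j x) * dtrig_poly d Z L j x * h i x \<partial>cube_lebesgue d)"
        unfolding left_diff_distrib using ij by (subst Bochner_Integration.integral_diff) (auto intro!: dm tA2 A_L2)
      moreover have "\<bar>\<integral>x. (A x i j - tA i j x) * dtrig_poly d Z L j x * h i x \<partial>cube_lebesgue d\<bar>
          \<le> s * (1 + (\<integral>x. (h i x)\<^sup>2 \<partial>cube_lebesgue d))"
        using FA[OF ij] C(1) s
        by (intro truncation_error[OF _ _ trig_poly_measurable(2) C(3)] L2_diff A_L2 tA2 h2 ij) (auto simp: tA_def)
      moreover have "s * (1 + (\<integral>x. (h i x)\<^sup>2 \<partial>cube_lebesgue d)) \<le> s * (1 + ?E)"
        using E2[OF ij(1)] s by (intro mult_left_mono) auto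
      ultimately show ?thesis by linarith
    qed
    have rc: "\<bar>(\<integral>x. tc x * trig_poly d Z L x * v x \<partial>cube_lebesgue d) -
        (\<integral>x. c x * trig_poly d Z L x * v x \<partial>cube_lebesgue d)\<bar> \<le> s * (1 + ?E)"
    proof -
      have "(\<integral>x. tc x * trig_poly d Z L x * v x \<partial>cube_lebesgue d) -
          (\<integral>x. c x * trig_poly d Z L x * v x \<partial>cube_lebesgue d) =
          - (\<integral>x. (c x - tc x) * trig_poly d Z L x * v x \<partial>cube_lebesgue d)"
        unfolding left_diff_distrib by (subst Bochner_Integration.integral_diff) (auto intro!: cm tc2 c_L2)
      moreover have "\<bar>\<integral>x. (c x - tc x) * trig_poly d Z L x * v x \<partial>cube_lebesgue d\<bar>
          \<le> s * (1 + (\<integral>x. (v x)\<^sup>2 \<partial>cube_lebesgue d))"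
        using Fc C(1) s
        by (intro truncation_error[OF _ _ trig_poly_measurable(1) C(2)] L2_diff c_L2 tc2 v2) (auto simp: tc_def)
      moreover have "s * (1 + (\<integral>x. (v x)\<^sup>2 \<partial>cube_lebesgue d)) \<le> s * (1 + ?E)"
        using E1 s by (intro mult_left_mono) auto
      ultimately show ?thesis by linarith
    qed
    have rf: "\<bar>(\<integral>x. tf x * v x \<partial>cube_lebesgue d) - (\<integral>x. f x * v x \<partial>cube_lebesgue d)\<bar> \<le> s * (1 + ?E)"
    proof -
      have "(\<integral>x. tf x * v x \<partial>cube_lebesgue d) - (\<integral>x. f x * v x \<partial>cube_lebesgue d) =
          - (\<integral>x. (f x - tf x) * v x \<partial>cube_lebesgue d)"
        unfolding left_diff_distrib using f_L2 tf2 v2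
        by (subst Bochner_Integration.integral_diff) (auto intro!: L2_mult_integrable)
      moreover have "\<bar>\<integral>x. (f x - tf x) * v x \<partial>cube_lebesgue d\<bar> \<le> s * (1 + (\<integral>x. (v x)\<^sup>2 \<partial>cube_lebesgue d))"
        using Ff s by (intro abs_integral_mult_le L2_diff f_L2 tf2 v2) (auto simp: tf_def)
      moreover have "s * (1 + (\<integral>x. (v x)\<^sup>2 \<partial>cube_lebesgue d)) \<le> s * (1 + ?E)"
        using E1 s by (intro mult_left_mono) auto
      ultimately show ?thesis by linarith
    qed
    have rAs: "\<bar>(\<Sum>i<d. \<Sum>j<d. \<integral>x. tA i j x * dtrig_poly d Z L j x * h i x \<partial>cube_lebesgue d) -
        (\<Sum>i<d. \<Sum>j<d. \<integral>x. A x i j * dtrig_poly d Z L j x * h i x \<partial>cube_lebesgue d)\<bar> \<le> (real d)\<^sup>2 * (s * (1 + ?E))"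
    proof -
      have "\<bar>\<Sum>i<d. \<Sum>j<d. (\<integral>x. tA i j x * dtrig_poly d Z L j x * h i x \<partial>cube_lebesgue d) -
          (\<integral>x. A x i j * dtrig_poly d Z L j x * h i x \<partial>cube_lebesgue d)\<bar> \<le> (\<Sum>i<d. \<Sum>j<d. s * (1 + ?E))"
        by (intro order_trans[OF sum_abs] sum_mono rA) auto
      then show ?thesis by (simp add: sum_subtractf power2_eq_square)
    qed
    have "\<bar>\<psi> v h - (form (trig_poly d Z L) (dtrig_poly d Z L) v h - (\<integral>x. f x * v x \<partial>cube_lebesgue d))\<bar>
        \<le> (real d)\<^sup>2 * (s * (1 + ?E)) + s * (1 + ?E) + s * (1 + ?E)"
      unfolding \<psi>_def form_eq using rAs rc rf by linarith
    also have "\<dots> = ((real d)\<^sup>2 + 2) * s * (1 + ?E)" by (simp add: algebra_simps)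
    also have "\<dots> = \<tau> * (1 + ?E)" using dpos by (simp add: s_def)
    finally show "\<bar>energy d (trig_poly d Z K) (dtrig_poly d Z K) v h -
        form (\<lambda>x. trig_poly d Z L x - u x) (\<lambda>i x. dtrig_poly d Z L i x - g i x) v h\<bar> \<le> \<tau> * (1 + ?E)"
      unfolding e K(2)[OF p] .
  qed
qed

end

section \<open>Contraction of the error and growth of the norm\<close>

context elliptic_problem
begin

definition error_energy :: "(real \<times> (nat \<Rightarrow> nat)) list \<Rightarrow> real" where
  "error_energy L = energy d (\<lambda>x. trig_poly d Z L x - u x) (\<lambda>i x. dtrig_poly d Z L i x - g i x)
    (\<lambda>x. trig_poly d Z L x - u x) (\<lambda>i x. dtrig_poly d Z L i x - g i x)"

lemma admissible_error: "admissible (\<lambda>x. trig_poly d Z L x - u x) (\<lambda>i x. dtrig_poly d Z L i x - g i x)"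
  using admissible_linear[OF admissible_trig_poly admissible_u, of 1 L "-1"] by simp

text \<open>The next iterate subtracts \<alpha> z, where z represents the residual up to \<tau>. The
  new error energy is E - 2 \<alpha> (z, e) + \<alpha>^2 (z, z); coercivity bounds (z, e) below by
  lmin E and \<open>form_bounded\<close> bounds (z, z) above by lmax^2 E, each up to terms of order
  \<tau>.\<close>

lemma iteration_step:
  assumes "0 < \<delta>"
  shows "\<exists>L'. trig_poly_norm d L' \<le> trig_poly_norm d L +
      lmin / lmax\<^sup>2 * (((real d)\<^sup>2 * l_A + l_c) * trig_poly_norm d L + l_f / 2) \<and>
    error_energy L' \<le> (1 - lmin\<^sup>2 / lmax\<^sup>2) * error_energy L + \<delta>"
proof -
  define \<alpha> where "\<alpha> = lmin / lmax\<^sup>2"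
  let ?e = "\<lambda>x. trig_poly d Z L x - u x" and ?ge = "\<lambda>i x. dtrig_poly d Z L i x - g i x"
  define E where "E = error_energy L"
  have lmax: "0 < lmax" using lmin_pos lmin_le_lmax by linarith
  have \<alpha>: "0 < \<alpha>" using lmin_pos lmax by (simp add: \<alpha>_def)
  have e: "admissible ?e ?ge" by (rule admissible_error)
  have wge: "weak_gradient d ?e ?ge" using e by (simp add: admissible_def parts_def)
  have E0: "0 \<le> E" unfolding E_def error_energy_def by (rule energy_nonneg)
  \<comment> \<open>All terms carrying \<tau> in the final estimate, with 8 \<tau> replaced by 2
    because \<tau> \<le> 1/4.\<close>
  define C where "C = 2 * \<alpha> * (1 + E) + \<alpha>\<^sup>2 * (4 * lmax\<^sup>2 * E + 4)"
  have C: "0 < C" unfolding C_def using \<alpha> E0 by (intro add_pos_nonneg mult_pos_pos mult_nonneg_nonneg) auto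
  define \<tau> where "\<tau> = min (1 / 4) (\<delta> / C)"
  have \<tau>: "0 < \<tau>" "\<tau> \<le> 1 / 4" "\<tau> * C \<le> \<delta>"
    using assms C by (auto simp: \<tau>_def min_def field_simps)
  obtain K where K: "trig_poly_norm d K \<le> ((real d)\<^sup>2 * l_A + l_c) * trig_poly_norm d L + l_f / 2"
    and err: "\<And>v h. admissible v h \<Longrightarrow>
      \<bar>energy d (trig_poly d Z K) (dtrig_poly d Z K) v h - form ?e ?ge v h\<bar> \<le> \<tau> * (1 + energy d v h v h)"
    using approximate_gradient[OF \<tau>(1), of L] by blast
  let ?z = "trig_poly d Z K" and ?gz = "dtrig_poly d Z K"
  define Ez where "Ez = energy d ?z ?gz ?z ?gz"
  define P where "P = energy d ?z ?gz ?e ?ge"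
  have wgz: "weak_gradient d ?z ?gz" by (rule weak_gradient_trig_poly)
  have P: "lmin * E - \<tau> * (1 + E) \<le> P"
    using err[OF e] form_coercive[OF wge] unfolding P_def E_def error_energy_def by linarith
  have Ez0: "0 \<le> Ez" unfolding Ez_def by (rule energy_nonneg)
  \<comment> \<open>z is tested against itself; the summand Ez on the right is then absorbed by the
    left side.\<close>
  have "2 * Ez \<le> lmax\<^sup>2 * E + Ez + 2 * (\<tau> * (1 + Ez))"
    using err[OF admissible_trig_poly, of K] form_bounded[OF wge wgz]
    unfolding Ez_def E_def error_energy_def by linarith
  then have Ez1: "Ez * (1 - 2 * \<tau>) \<le> lmax\<^sup>2 * E + 2 * \<tau>" by (simp add: algebra_simps)
  have X0: "0 \<le> lmax\<^sup>2 * E + 2 * \<tau>" using E0 \<tau> by (intro add_nonneg_nonneg mult_nonneg_nonneg) auto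
  have Ez: "Ez \<le> (1 + 4 * \<tau>) * (lmax\<^sup>2 * E + 2 * \<tau>)"
  proof -
    \<comment> \<open>(1 - 2 \<tau>) (1 + 4 \<tau>) = 1 + 2 \<tau> - 8 \<tau>^2 is at least 1
      because \<tau> \<le> 1/4, so 1 + 4 \<tau> can replace the reciprocal of 1 - 2 \<tau>.\<close>
    have "\<tau> * \<tau> \<le> \<tau> * (1 / 4)" using \<tau> by (intro mult_left_mono) auto
    then have "1 \<le> (1 - 2 * \<tau>) * (1 + 4 * \<tau>)" by (simp add: algebra_simps)
    from mult_left_mono[OF this Ez0] have "Ez \<le> (Ez * (1 - 2 * \<tau>)) * (1 + 4 * \<tau>)" by (simp add: mult.assoc)
    also have "\<dots> \<le> (lmax\<^sup>2 * E + 2 * \<tau>) * (1 + 4 * \<tau>)" using Ez1 \<tau> by (intro mult_right_mono) auto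
    finally show ?thesis by (simp add: mult.commute)
  qed
  let ?L' = "L @ map (\<lambda>p. (- \<alpha> * fst p, snd p)) K"
  have new: "error_energy ?L' = E - 2 * \<alpha> * P + \<alpha>\<^sup>2 * Ez"
  proof -
    have eq: "(\<lambda>x. trig_poly d Z ?L' x - u x) = (\<lambda>x. 1 * ?e x + (- \<alpha>) * ?z x)"
      "(\<lambda>i x. dtrig_poly d Z ?L' i x - g i x) = (\<lambda>i x. 1 * ?ge i x + (- \<alpha>) * ?gz i x)"
      unfolding trig_poly_append_scale by (simp_all add: algebra_simps)
    note wgs = weak_gradient_linear[OF wge wgz, of 1 "- \<alpha>"]
    note lin = energy_linear[OF wge wgz, of _ _ 1 "- \<alpha>"]
    have "error_energy ?L' = 1 * energy d ?e ?ge (\<lambda>x. 1 * ?e x + (- \<alpha>) * ?z x) (\<lambda>i x. 1 * ?ge i x + (- \<alpha>) * ?gz i x)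
        + (- \<alpha>) * energy d ?z ?gz (\<lambda>x. 1 * ?e x + (- \<alpha>) * ?z x) (\<lambda>i x. 1 * ?ge i x + (- \<alpha>) * ?gz i x)"
      unfolding error_energy_def eq by (rule lin[OF wgs])
    also have "energy d ?e ?ge (\<lambda>x. 1 * ?e x + (- \<alpha>) * ?z x) (\<lambda>i x. 1 * ?ge i x + (- \<alpha>) * ?gz i x) = 1 * E + (- \<alpha>) * P"
      unfolding E_def error_energy_def P_def by (subst energy_commute) (rule lin[OF wge])
    also have "energy d ?z ?gz (\<lambda>x. 1 * ?e x + (- \<alpha>) * ?z x) (\<lambda>i x. 1 * ?ge i x + (- \<alpha>) * ?gz i x) =
        1 * energy d ?e ?ge ?z ?gz + (- \<alpha>) * Ez"
      unfolding Ez_def by (subst energy_commute) (rule lin[OF wgz])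
    also have "energy d ?e ?ge ?z ?gz = P" unfolding P_def by (rule energy_commute)
    finally show ?thesis by (simp add: algebra_simps power2_eq_square)
  qed
  have "error_energy ?L' \<le> E - 2 * \<alpha> * (lmin * E - \<tau> * (1 + E)) + \<alpha>\<^sup>2 * ((1 + 4 * \<tau>) * (lmax\<^sup>2 * E + 2 * \<tau>))"
  proof -
    have "2 * \<alpha> * (lmin * E - \<tau> * (1 + E)) \<le> 2 * \<alpha> * P" using P \<alpha> by (intro mult_left_mono) auto
    moreover have "\<alpha>\<^sup>2 * Ez \<le> \<alpha>\<^sup>2 * ((1 + 4 * \<tau>) * (lmax\<^sup>2 * E + 2 * \<tau>))" using Ez by (intro mult_left_mono) auto
    ultimately show ?thesis unfolding new by linarith
  qed
  also have "\<dots> = E * (1 - 2 * \<alpha> * lmin + \<alpha>\<^sup>2 * lmax\<^sup>2) +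
      \<tau> * (2 * \<alpha> * (1 + E) + \<alpha>\<^sup>2 * (4 * lmax\<^sup>2 * E + 2 + 8 * \<tau>))"
    by (simp add: algebra_simps)
  also have "\<dots> \<le> E * (1 - 2 * \<alpha> * lmin + \<alpha>\<^sup>2 * lmax\<^sup>2) + \<tau> * C"
    unfolding C_def using \<tau> by (intro add_left_mono mult_left_mono) auto
  \<comment> \<open>With \<alpha> = lmin / lmax^2 the two corrections are -2 and +1 times lmin^2 /
    lmax^2.\<close>
  also have "1 - 2 * \<alpha> * lmin + \<alpha>\<^sup>2 * lmax\<^sup>2 = 1 - lmin\<^sup>2 / lmax\<^sup>2"
    using lmax by (simp add: \<alpha>_def power2_eq_square field_simps)
  finally have "error_energy ?L' \<le> (1 - lmin\<^sup>2 / lmax\<^sup>2) * error_energy L + \<delta>"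
    using \<tau>(3) by (simp add: E_def mult.commute)
  moreover have "trig_poly_norm d ?L' \<le> trig_poly_norm d L +
      lmin / lmax\<^sup>2 * (((real d)\<^sup>2 * l_A + l_c) * trig_poly_norm d L + l_f / 2)"
    unfolding trig_poly_append_scale \<alpha>_def[symmetric] abs_minus_cancel
    using \<alpha> K by (intro add_left_mono) (simp add: mult_left_mono)
  ultimately show ?thesis by blast
qed

text \<open>The recursion U' \<le> p U + \<alpha> l_f / 2 starts from the empty list and sums to a
  geometric series. For the error, half of \<delta> is spent on the earlier steps, where the
  contraction does not enlarge it, and half on the last one.\<close>

lemma iteration:
  assumes "0 < \<delta>" "1 + lmin / lmax\<^sup>2 * ((real d)\<^sup>2 * l_A + l_c) \<le> p" "1 < p" "0 \<le> l_f"
  shows "\<exists>L. trig_poly_norm d L \<le> lmin / lmax\<^sup>2 * l_f * (p ^ T - 1) / (2 * (p - 1)) \<and>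
    error_energy L \<le> (1 - lmin\<^sup>2 / lmax\<^sup>2) ^ T * energy d u g u g + \<delta>"
  using assms(1)
proof (induction T arbitrary: \<delta>)
  case 0
  have "error_energy [] = energy d u g u g"
    by (simp add: error_energy_def energy_def trig_poly_Nil)
  then show ?case using 0 by (intro exI[of _ "[]"]) (simp add: trig_poly_Nil)
next
  case (Suc T)
  let ?q = "1 - lmin\<^sup>2 / lmax\<^sup>2" and ?\<alpha> = "lmin / lmax\<^sup>2"
  have lmax: "0 < lmax" using lmin_pos lmin_le_lmax by linarith
  have \<alpha>: "0 < ?\<alpha>" using lmin_pos lmax by simp
  have "lmin\<^sup>2 \<le> lmax\<^sup>2" using lmin_pos lmin_le_lmax by (intro power_mono) auto
  then have q: "0 \<le> ?q" "?q \<le> 1" using lmax by auto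
  from Suc.IH[of "\<delta> / 2"] Suc.prems obtain L where
    L: "trig_poly_norm d L \<le> ?\<alpha> * l_f * (p ^ T - 1) / (2 * (p - 1))"
      "error_energy L \<le> ?q ^ T * energy d u g u g + \<delta> / 2" by auto
  obtain L' where L': "trig_poly_norm d L' \<le> trig_poly_norm d L + ?\<alpha> * (((real d)\<^sup>2 * l_A + l_c) * trig_poly_norm d L + l_f / 2)"
    "error_energy L' \<le> ?q * error_energy L + \<delta> / 2"
    using iteration_step[of "\<delta> / 2" L] Suc.prems half_gt_zero by blast
  have U: "0 \<le> trig_poly_norm d L"
    unfolding trig_poly_sum by (intro sum_nonneg mult_nonneg_nonneg) (auto intro: order_trans[OF zero_le_one frequency_weight_ge_1])
  have "trig_poly_norm d L' \<le> (1 + ?\<alpha> * ((real d)\<^sup>2 * l_A + l_c)) * trig_poly_norm d L + ?\<alpha> * l_f / 2"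
    using L'(1) by (simp add: distrib_left distrib_right mult.assoc)
  also have "\<dots> \<le> p * trig_poly_norm d L + ?\<alpha> * l_f / 2"
    using assms(2) U by (intro add_right_mono mult_right_mono)
  also have "\<dots> \<le> p * (?\<alpha> * l_f * (p ^ T - 1) / (2 * (p - 1))) + ?\<alpha> * l_f / 2"
    using L(1) assms(3) by (intro add_right_mono mult_left_mono) auto
  also have "\<dots> = ?\<alpha> * l_f * (p ^ Suc T - 1) / (2 * (p - 1))"
  proof -
    define D where "D = p - 1"
    have D: "D > 0" "p = D + 1" using assms(3) by (simp_all add: D_def)
    have "p * (?\<alpha> * l_f * (p ^ T - 1) / (2 * D)) + ?\<alpha> * l_f / 2 = ?\<alpha> * l_f * (p * (p ^ T - 1) + D) / (2 * D)"
      using D(1) by (simp add: add_divide_distrib distrib_left)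
    also have "p * (p ^ T - 1) + D = p ^ Suc T - 1" by (simp add: D_def right_diff_distrib)
    finally show ?thesis by (simp add: D_def)
  qed
  finally have N: "trig_poly_norm d L' \<le> ?\<alpha> * l_f * (p ^ Suc T - 1) / (2 * (p - 1))" .
  have "?q * error_energy L \<le> ?q * (?q ^ T * energy d u g u g + \<delta> / 2)"
    using L(2) q by (intro mult_left_mono)
  also have "\<dots> \<le> ?q ^ Suc T * energy d u g u g + \<delta> / 2"
    using mult_right_mono[OF q(2), of "\<delta> / 2"] Suc.prems by (simp add: distrib_left mult.assoc)
  finally have "error_energy L' \<le> ?q ^ Suc T * energy d u g u g + \<delta>" using L'(2) by linarith
  with N show ?case by blast
qed

end

section \<open>Ridge functions as superpositions of rectified linear units\<close>

lemma abs_sin_diff_le: "\<bar>sin x - sin y\<bar> \<le> \<bar>x - (y::real)\<bar>"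
proof -
  have "\<bar>sin x - sin y\<bar> = 2 * (\<bar>sin ((x - y) / 2)\<bar> * \<bar>cos ((x + y) / 2)\<bar>)"
    by (simp add: sin_diff_sin abs_mult)
  also have "\<dots> \<le> 2 * (\<bar>(x - y) / 2\<bar> * 1)"
    by (intro mult_left_mono mult_mono abs_sin_x_le_abs_x) auto
  finally show ?thesis by simp
qed

text \<open>Obtained by integrating \<open>f'\<close>, which tolerates the finitely many kinks in
  \<open>S\<close>.\<close>

lemma increment_bound:
  fixes f :: "real \<Rightarrow> real"
  assumes "a \<le> b" "finite S" "continuous_on {a..b} f" "0 \<le> B"
    and f': "\<And>t. t \<in> {a<..<b} - S \<Longrightarrow> (f has_real_derivative f' t) (at t)"
    and B: "\<And>t. t \<in> {a<..<b} - S \<Longrightarrow> \<bar>f' t\<bar> \<le> B"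
  shows "\<bar>f b - f a\<bar> \<le> B * (b - a)"
proof -
  have "(f' has_integral f b - f a) {a..b}"
    using assms by (intro fundamental_theorem_of_calculus_interior_strong[OF assms(2,1)])
      (auto simp: has_real_derivative_iff_has_vector_derivative)
  from has_integral_bound_real[OF assms(4) _ this, of "S \<union> {a, b}"]
  have "norm (f b - f a) \<le> B * measure lborel {a..b}" using assms(2) B by auto
  then show ?thesis using assms(1) by simp
qed

text \<open>The derivative of \<open>ReLU\<close> away from the origin; the value 0 at the origin
  makes it left continuous.\<close>

definition step :: "real \<Rightarrow> real" where
  "step t = (if t > 0 then 1 else 0)"

lemma has_derivative_ReLU: "t \<noteq> 0 \<Longrightarrow> (ReLU has_real_derivative step t) (at t)"
proof -
  assume "t \<noteq> 0"
  then consider "t > 0" | "t < 0" by linarith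
  then show ?thesis
  proof cases
    case 1
    have "((\<lambda>t. t) has_real_derivative 1) (at t)" by simp
    from has_field_derivative_transform_within_open[OF this open_greaterThan[of 0], of ReLU] 1
    show ?thesis by (auto simp: ReLU_def step_def)
  next
    case 2
    have "((\<lambda>t. 0) has_real_derivative 0) (at t)" by simp
    from has_field_derivative_transform_within_open[OF this open_lessThan[of 0], of ReLU] 2
    show ?thesis by (auto simp: ReLU_def step_def)
  qed
qed

lemma continuous_ReLU: "continuous_on A ReLU"
  unfolding ReLU_def[abs_def] by (intro continuous_intros)

text \<open>The derivative of the cosine is approximated by a step function on a uniform grid, and
  each jump of the step function becomes one unit. The total weight is the initial slope, at most
  \<kappa>, plus the variation, at most the length 2 R times the Lipschitz constant \<kappa>^2; this
  is independent of the mesh and hence of \<eta>.\<close>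

lemma cosine_by_ReLU:
  fixes \<kappa> \<phi> R \<eta> :: real
  assumes "0 \<le> \<kappa>" "0 < R" "0 < \<eta>"
  shows "\<exists>N. \<exists>(a :: nat \<Rightarrow> real) b \<gamma>. \<bar>\<gamma>\<bar> \<le> 1 \<and> (\<Sum>j<N. \<bar>a j\<bar>) \<le> \<kappa> + 2 * R * \<kappa>\<^sup>2 \<and> (\<forall>j<N. \<bar>b j\<bar> \<le> R) \<and>
    (\<forall>t. -R < t \<and> t < R \<longrightarrow>
      \<bar>cos (\<kappa> * t + \<phi>) - (\<gamma> + (\<Sum>j<N. a j * ReLU (t + b j)))\<bar> \<le> \<eta> \<and>
      \<bar>- \<kappa> * sin (\<kappa> * t + \<phi>) - (\<Sum>j<N. a j * step (t + b j))\<bar> \<le> \<eta>)"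
proof -
  define D where "D t = - \<kappa> * sin (\<kappa> * t + \<phi>)" for t
  have D_lip: "\<bar>D s - D t\<bar> \<le> \<kappa>\<^sup>2 * \<bar>s - t\<bar>" for s t
  proof -
    have "\<bar>D s - D t\<bar> = \<kappa> * \<bar>sin (\<kappa> * s + \<phi>) - sin (\<kappa> * t + \<phi>)\<bar>"
    proof -
      have "D s - D t = - (\<kappa> * (sin (\<kappa> * s + \<phi>) - sin (\<kappa> * t + \<phi>)))" by (simp add: D_def algebra_simps)
      then show ?thesis using assms(1) by (simp only: abs_minus_cancel abs_mult abs_of_nonneg)
    qed
    also have "\<dots> \<le> \<kappa> * \<bar>(\<kappa> * s + \<phi>) - (\<kappa> * t + \<phi>)\<bar>"
      by (rule mult_left_mono[OF abs_sin_diff_le assms(1)])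
    also have "\<dots> = \<kappa>\<^sup>2 * \<bar>s - t\<bar>"
      using assms(1) by (simp add: power2_eq_square abs_mult right_diff_distrib[symmetric])
    finally show ?thesis .
  qed
  \<comment> \<open>For the mesh 2 R / N the error of the derivative is \<kappa>^2 times the mesh,
    and that of the value 2 R times as much; the factor 1 + 2 R covers both.\<close>
  obtain N :: nat where N: "N > 0" "2 * R * \<kappa>\<^sup>2 * (1 + 2 * R) / \<eta> < real N"
  proof -
    obtain n where "2 * R * \<kappa>\<^sup>2 * (1 + 2 * R) / \<eta> < real n" using reals_Archimedean2 by blast
    then show thesis by (intro that[of "Suc n"]) auto
  qed
  define h where "h = 2 * R / real N"
  have h: "h > 0" "real N * h = 2 * R" using assms N by (simp_all add: h_def)
  have small: "\<kappa>\<^sup>2 * h * (1 + 2 * R) \<le> \<eta>"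
  proof -
    have "2 * R * \<kappa>\<^sup>2 * (1 + 2 * R) \<le> \<eta> * real N" using N assms(3) by (simp add: field_simps)
    then show ?thesis using N by (simp add: h_def field_simps)
  qed
  have kh: "0 \<le> \<kappa>\<^sup>2 * h" using h by simp
  then have small1: "\<kappa>\<^sup>2 * h \<le> \<eta>" and small2: "\<kappa>\<^sup>2 * h * (2 * R) \<le> \<eta>"
  proof -
    have "0 \<le> \<kappa>\<^sup>2 * h * (2 * R)" using kh assms by simp
    then show "\<kappa>\<^sup>2 * h \<le> \<eta>" "\<kappa>\<^sup>2 * h * (2 * R) \<le> \<eta>"
      using small kh unfolding distrib_left mult_1_right by linarith+
  qed
  define s where "s j = - R + real j * h" for j
  have s_bound: "\<bar>s j\<bar> \<le> R" if "j \<le> N" for j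
  proof -
    have "real j * h \<le> 2 * R" using that h by (metis mult_right_mono of_nat_mono less_imp_le)
    moreover have "0 \<le> real j * h" using h(1) by simp
    ultimately show ?thesis unfolding s_def by linarith
  qed
  \<comment> \<open>Unit 0 carries the initial slope D(-R), unit j > 0 the change of D from one grid
    point to the next.\<close>
  define a where "a j = (if j = 0 then D (s 0) else D (s j) - D (s (j - 1)))" for j
  \<comment> \<open>Unit j has its kink at s (j - 1). Since 0 - 1 = 0 on \<open>nat\<close>, units 0
    and 1 share the kink s 0 = -R.\<close>
  define b where "b j = - s (j - 1)" for j
  have a_sum: "(\<Sum>j<Suc n. a j) = D (s n)" for n
    by (induction n) (simp_all add: a_def)
  have "(\<Sum>j<Suc N. \<bar>a j\<bar>) = \<bar>a 0\<bar> + (\<Sum>j<N. \<bar>a (Suc j)\<bar>)" by (rule sum.lessThan_Suc_shift)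
  also have "\<dots> \<le> \<kappa> + (\<Sum>j<N. \<kappa>\<^sup>2 * h)"
  proof (intro add_mono sum_mono)
    have "\<kappa> * \<bar>sin (\<kappa> * s 0 + \<phi>)\<bar> \<le> \<kappa>" using assms(1) by (intro mult_left_le) auto
    then show "\<bar>a 0\<bar> \<le> \<kappa>" using assms(1) by (simp add: a_def D_def abs_mult)
    fix j
    show "\<bar>a (Suc j)\<bar> \<le> \<kappa>\<^sup>2 * h"
      using D_lip[of "s (Suc j)" "s j"] h(1) by (simp add: a_def s_def algebra_simps)
  qed
  also have "\<dots> = \<kappa> + 2 * R * \<kappa>\<^sup>2" using h(2) by (simp add: mult_ac)
  finally have a_bound: "(\<Sum>j<Suc N. \<bar>a j\<bar>) \<le> \<kappa> + 2 * R * \<kappa>\<^sup>2" .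
  have deriv_err: "\<bar>D t - (\<Sum>j<Suc N. a j * step (t + b j))\<bar> \<le> \<kappa>\<^sup>2 * h" if t: "- R < t" "t < R" for t
  proof -
    \<comment> \<open>The grid cell of t: s (m - 1) < t \<le> s m. The active units are those up to
      m, and their weights telescope to D (s m).\<close>
    define m where "m = nat \<lceil>(t + R) / h\<rceil>"
    have pos: "0 < (t + R) / h" using t h by simp
    then have "0 < \<lceil>(t + R) / h\<rceil>" by (simp only: zero_less_ceiling)
    then have m1: "m \<ge> 1" unfolding m_def by linarith
    have rm: "real m = of_int \<lceil>(t + R) / h\<rceil>" using pos by (simp add: m_def)
    have up: "(t + R) / h \<le> real m" unfolding rm by (rule le_of_int_ceiling)
    have lo: "real m - 1 < (t + R) / h" unfolding rm by linarith
    have up': "t + R \<le> real m * h" using up h by (simp add: field_simps)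
    have lo': "(real m - 1) * h < t + R" using lo h by (simp add: field_simps)
    have mN: "m \<le> N"
    proof -
      have "(t + R) / h < real N" using t h by (simp add: field_simps)
      then have "real m - 1 < real N" using lo by linarith
      then show ?thesis by linarith
    qed
    have st: "step (t + b j) = (if j \<le> m then 1 else 0)" for j
    proof (cases "j \<le> m")
      case True
      have "real (j - 1) * h \<le> (real m - 1) * h" using True m1 h by (intro mult_right_mono) auto
      then have "0 < t + b j" using lo' by (simp add: b_def s_def)
      then show ?thesis using True by (simp add: step_def)
    next
      case False
      then have "real m * h \<le> real (j - 1) * h" using h by (intro mult_right_mono) auto
      then have "\<not> 0 < t + b j" using up' by (simp add: b_def s_def)
      then show ?thesis using False by (simp add: step_def)
    qed
    have "(\<Sum>j<Suc N. a j * step (t + b j)) = (\<Sum>j<Suc N. if j \<in> {..<Suc m} then a j else 0)"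
      by (rule sum.cong) (auto simp: st)
    also have "\<dots> = (\<Sum>j\<in>{..<Suc N} \<inter> {..<Suc m}. a j)" by (subst sum.inter_restrict) auto
    also have "{..<Suc N} \<inter> {..<Suc m} = {..<Suc m}" using mN by auto
    also have "(\<Sum>j<Suc m. a j) = D (s m)" by (rule a_sum)
    finally have "\<bar>D t - (\<Sum>j<Suc N. a j * step (t + b j))\<bar> = \<bar>D t - D (s m)\<bar>" by simp
    also have "\<dots> \<le> \<kappa>\<^sup>2 * \<bar>t - s m\<bar>" by (rule D_lip)
    also have "\<dots> \<le> \<kappa>\<^sup>2 * h"
      using up' lo' by (intro mult_left_mono) (auto simp: s_def algebra_simps)
    finally show ?thesis .
  qed
  define \<gamma> where "\<gamma> = cos (\<kappa> * (- R) + \<phi>)"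
  have val_err: "\<bar>cos (\<kappa> * t + \<phi>) - (\<gamma> + (\<Sum>j<Suc N. a j * ReLU (t + b j)))\<bar> \<le> \<kappa>\<^sup>2 * h * (2 * R)"
    if t: "- R < t" "t < R" for t
  proof -
    define F where "F t = cos (\<kappa> * t + \<phi>) - (\<gamma> + (\<Sum>j<Suc N. a j * ReLU (t + b j)))" for t
    \<comment> \<open>No kink lies to the left of -R, so the network starts there with the constant
      \<gamma>, which is the value of the cosine; the error of the derivative is integrated from
      this point.\<close>
    have "ReLU (- R + b j) = 0" for j
      using h(1) by (simp add: b_def s_def ReLU_def)
    then have F0: "F (- R) = 0" by (simp add: F_def \<gamma>_def)
    have "\<bar>F t - F (- R)\<bar> \<le> \<kappa>\<^sup>2 * h * (t - (- R))"
    proof (rule increment_bound[where f' = "\<lambda>t. D t - (\<Sum>j<Suc N. a j * step (t + b j))" and S = "(\<lambda>j. - b j) ` {..<Suc N}"])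
      have "continuous_on A (\<lambda>t. ReLU (t + b j))" for A j
        by (rule continuous_on_compose2[OF continuous_ReLU[of UNIV]]) (auto intro!: continuous_intros)
      then show "continuous_on {- R..t} F"
        unfolding F_def[abs_def] by (intro continuous_intros)
      fix r assume r: "r \<in> {- R<..<t} - (\<lambda>j. - b j) ` {..<Suc N}"
      have "((\<lambda>t. ReLU (t + b j)) has_real_derivative step (r + b j) * 1) (at r)" if "j \<in> {..<Suc N}" for j
      proof (rule DERIV_chain2[of ReLU])
        have "r \<noteq> - b j" using r that by blast
        then show "(ReLU has_real_derivative step (r + b j)) (at (r + b j))" by (intro has_derivative_ReLU) simp
      qed (auto intro!: derivative_eq_intros)
      then have "((\<lambda>t. \<Sum>j<Suc N. a j * ReLU (t + b j)) has_real_derivative (\<Sum>j<Suc N. a j * step (r + b j))) (at r)"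
        by (intro DERIV_sum DERIV_cmult) simp
      moreover have "((\<lambda>t. cos (\<kappa> * t + \<phi>)) has_real_derivative D r) (at r)"
        unfolding D_def by (auto intro!: derivative_eq_intros)
      ultimately show "(F has_real_derivative D r - (\<Sum>j<Suc N. a j * step (r + b j))) (at r)"
        unfolding F_def[abs_def] using DERIV_diff[OF _ DERIV_add[OF DERIV_const]] by force
      show "\<bar>D r - (\<Sum>j<Suc N. a j * step (r + b j))\<bar> \<le> \<kappa>\<^sup>2 * h"
        using r t by (intro deriv_err) auto
    qed (use t kh in auto)
    also have "\<dots> \<le> \<kappa>\<^sup>2 * h * (2 * R)" using t kh by (intro mult_left_mono) auto
    finally show ?thesis unfolding F0 by (simp add: F_def)
  qed
  have b_bound: "\<bar>b j\<bar> \<le> R" if "j < Suc N" for j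
    using s_bound[of "j - 1"] that by (simp add: b_def)
  show ?thesis
  proof (rule exI[of _ "Suc N"], rule exI[of _ a], rule exI[of _ b], rule exI[of _ \<gamma>], intro conjI allI impI)
    show "\<bar>\<gamma>\<bar> \<le> 1" by (simp add: \<gamma>_def)
    show "(\<Sum>j<Suc N. \<bar>a j\<bar>) \<le> \<kappa> + 2 * R * \<kappa>\<^sup>2" by (rule a_bound)
    show "\<bar>b j\<bar> \<le> R" if "j < Suc N" for j by (rule b_bound[OF that])
    fix t assume t: "- R < t \<and> t < R"
    show "\<bar>cos (\<kappa> * t + \<phi>) - (\<gamma> + (\<Sum>j<Suc N. a j * ReLU (t + b j)))\<bar> \<le> \<eta>"
      using val_err t small2 by (meson order_trans)
    show "\<bar>- \<kappa> * sin (\<kappa> * t + \<phi>) - (\<Sum>j<Suc N. a j * step (t + b j))\<bar> \<le> \<eta>"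
      using deriv_err t small1 unfolding D_def by (meson order_trans)
  qed
qed

section \<open>Networks\<close>

definition ridge :: "nat \<Rightarrow> (nat \<Rightarrow> real) \<Rightarrow> real \<Rightarrow> (nat \<Rightarrow> real) \<Rightarrow> real" where
  "ridge d w b x = ReLU ((\<Sum>j<d. w j * x j) + b)"

definition dridge :: "nat \<Rightarrow> (nat \<Rightarrow> real) \<Rightarrow> real \<Rightarrow> nat \<Rightarrow> (nat \<Rightarrow> real) \<Rightarrow> real" where
  "dridge d w b i x = w i * step ((\<Sum>j<d. w j * x j) + b)"

lemma abs_ReLU_le: "\<bar>ReLU t\<bar> \<le> \<bar>t\<bar>"
  by (simp add: ReLU_def)

lemma abs_step_le: "\<bar>step t\<bar> \<le> 1"
  by (simp add: step_def)

lemma affine_measurable: "(\<lambda>x. (\<Sum>j<d. w j * x j) + b) \<in> borel_measurable (cube_borel d)"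
  by (intro borel_measurable_add borel_measurable_sum borel_measurable_times borel_measurable_const
      measurable_coordinate) auto

lemma ridge_measurable:
  "ridge d w b \<in> borel_measurable (cube_borel d)" "dridge d w b i \<in> borel_measurable (cube_borel d)"
proof -
  have "ReLU \<in> borel_measurable borel" "step \<in> borel_measurable borel"
    unfolding ReLU_def[abs_def] step_def[abs_def] by measurable
  from this[THEN measurable_compose[OF affine_measurable[of w d b]]]
  show "ridge d w b \<in> borel_measurable (cube_borel d)" "dridge d w b i \<in> borel_measurable (cube_borel d)"
    unfolding ridge_def[abs_def] dridge_def[abs_def] by measurable
qed

lemma affine_fun_upd:
  assumes "(i::nat) < d"
  shows "(\<Sum>j<d. w j * (x(i := t)) j) = w i * t + (\<Sum>j\<in>{..<d} - {i}. w j * (x j :: real))"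
  using assms by (subst sum.remove[of _ i]) (auto intro!: sum.cong)

text \<open>On a line in direction i with w i nonzero the only kink is at - S / w i, so the
  criterion with finitely many exceptional points applies. If w i = 0 the function is constant along
  the line.\<close>

lemma weak_gradient_ridge: "weak_gradient d (ridge d w b) (dridge d w b)"
proof -
  define B where "B = (\<Sum>j<d. \<bar>w j\<bar>) + \<bar>b\<bar>"
  have bound: "\<bar>ridge d w b x\<bar> \<le> B" if "x \<in> cube d" for x
  proof -
    have "\<bar>ridge d w b x\<bar> \<le> \<bar>(\<Sum>j<d. w j * x j) + b\<bar>" unfolding ridge_def by (rule abs_ReLU_le)
    also have "\<dots> \<le> (\<Sum>j<d. \<bar>w j * x j\<bar>) + \<bar>b\<bar>" using sum_abs[of "\<lambda>j. w j * x j" "{..<d}"] by linarith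
    also have "\<dots> \<le> B"
      unfolding B_def abs_mult using cube_coordinate[OF that]
      by (intro add_right_mono sum_mono mult_left_le) (auto simp: less_imp_le)
    finally show ?thesis .
  qed
  have dbound: "\<bar>dridge d w b i x\<bar> \<le> B" if "i < d" for i x
  proof -
    have "\<bar>dridge d w b i x\<bar> \<le> \<bar>w i\<bar>"
      unfolding dridge_def abs_mult by (intro mult_left_le abs_step_le) simp
    also have "\<dots> \<le> (\<Sum>j<d. \<bar>w j\<bar>)" using that by (intro member_le_sum) auto
    finally show ?thesis by (simp add: B_def)
  qed
  show ?thesis
    unfolding weak_gradient_def
  proof (intro conjI allI impI)
    show "ridge d w b \<in> L2 d"
      by (rule L2_bounded[OF borel_measurable_cubeI[OF ridge_measurable(1)] bound])
    fix i assume i: "i < d"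
    show "is_weak_partial d i (ridge d w b) (dridge d w b i)"
    proof (rule is_weak_partial_classical[OF i ridge_measurable, where B = B])
      fix x assume x: "x \<in> cube d"
      show "\<bar>ridge d w b x\<bar> \<le> B" by (rule bound[OF x])
      show "\<bar>dridge d w b i x\<bar> \<le> B" by (rule dbound[OF i])
      define S where "S = (\<Sum>j\<in>{..<d} - {i}. w j * x j) + b"
      have aff: "(\<Sum>j<d. w j * (x(i := t)) j) + b = w i * t + S" for t
        unfolding affine_fun_upd[OF i] S_def by simp
      show "continuous_on {0<..<1} (\<lambda>t. ridge d w b (x(i := t)))"
        unfolding ridge_def aff by (rule continuous_on_compose2[OF continuous_ReLU[of UNIV]]) (auto intro!: continuous_intros)
      have "((\<lambda>t. ReLU (w i * t + S)) has_real_derivative w i * step (w i * t + S)) (at t)"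
        if "w i * t + S \<noteq> 0 \<or> w i = 0" for t
      proof (cases "w i = 0")
        case False
        have "((\<lambda>t. ReLU (w i * t + S)) has_real_derivative step (w i * t + S) * w i) (at t)"
          using that False by (intro DERIV_chain2[of ReLU] has_derivative_ReLU) (auto intro!: derivative_eq_intros)
        then show ?thesis by (simp add: mult.commute)
      qed simp
      moreover have "w i * t + S \<noteq> 0 \<or> w i = 0" if "t \<notin> {- S / w i}" for t
      proof (rule ccontr)
        assume "\<not> (w i * t + S \<noteq> 0 \<or> w i = 0)"
        then have "w i \<noteq> 0" "t * w i = - S" by (auto simp: mult.commute add_eq_0_iff2)
        then have "t = - S / w i" by (metis nonzero_eq_divide_eq)
        then show False using that by simp
      qed
      ultimately show "\<exists>T. finite T \<and> (\<forall>t\<in>{0<..<1} - T.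
          ((\<lambda>t. ridge d w b (x(i := t))) has_real_derivative dridge d w b i (x(i := t))) (at t))"
        unfolding ridge_def dridge_def aff by (intro exI[of _ "{- S / w i}"]) blast
    qed
  qed
qed

section \<open>Large networks as lists of units, and uniform approximation\<close>

definition net :: "nat \<Rightarrow> real \<Rightarrow> (real \<times> (nat \<Rightarrow> real) \<times> real) list \<Rightarrow> (nat \<Rightarrow> real) \<Rightarrow> real" where
  "net d \<gamma> Q x = \<gamma> + (\<Sum>q\<leftarrow>Q. fst q * ridge d (fst (snd q)) (snd (snd q)) x)"

definition dnet :: "nat \<Rightarrow> (real \<times> (nat \<Rightarrow> real) \<times> real) list \<Rightarrow> nat \<Rightarrow> (nat \<Rightarrow> real) \<Rightarrow> real" where
  "dnet d Q i x = (\<Sum>q\<leftarrow>Q. fst q * dridge d (fst (snd q)) (snd (snd q)) i x)"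

definition net_valid :: "nat \<Rightarrow> (real \<times> (nat \<Rightarrow> real) \<times> real) list \<Rightarrow> bool" where
  "net_valid d Q \<longleftrightarrow> (\<forall>q\<in>set Q. L2_set (fst (snd q)) {..<d} = 1 \<and> \<bar>snd (snd q)\<bar> \<le> sqrt (real d))"

definition outer_weight :: "(real \<times> (nat \<Rightarrow> real) \<times> real) list \<Rightarrow> real" where
  "outer_weight Q = (\<Sum>q\<leftarrow>Q. \<bar>fst q\<bar>)"

text \<open>The constant and the total outer weight are bounded independently of the accuracy
  \<eta>, while the number of units may grow with it. Function and gradient are approximated
  uniformly, which the sampling argument then converts into energy.\<close>

definition net_approximable ::
    "nat \<Rightarrow> ((nat \<Rightarrow> real) \<Rightarrow> real) \<Rightarrow> (nat \<Rightarrow> (nat \<Rightarrow> real) \<Rightarrow> real) \<Rightarrow> real \<Rightarrow> real \<Rightarrow> bool" where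
  "net_approximable d u g W0 W \<longleftrightarrow> (\<forall>\<eta>>0. \<exists>\<gamma> Q. \<bar>\<gamma>\<bar> \<le> W0 \<and> outer_weight Q \<le> W \<and> net_valid d Q \<and>
     (\<forall>x\<in>cube d. \<bar>u x - net d \<gamma> Q x\<bar> \<le> \<eta> \<and> (\<forall>i<d. \<bar>g i x - dnet d Q i x\<bar> \<le> \<eta>)))"

lemma net_append_scale:
  "net d (\<gamma> + c * \<gamma>') (Q @ map (\<lambda>q. (c * fst q, snd q)) P) x = net d \<gamma> Q x + c * net d \<gamma>' P x"
  "dnet d (Q @ map (\<lambda>q. (c * fst q, snd q)) P) i x = dnet d Q i x + c * dnet d P i x"
  "outer_weight (Q @ map (\<lambda>q. (c * fst q, snd q)) P) = outer_weight Q + \<bar>c\<bar> * outer_weight P"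
  by (simp_all add: net_def dnet_def outer_weight_def comp_def mult.assoc abs_mult sum_list_const_mult distrib_left)

lemma net_approximable_add_scale:
  assumes 1: "net_approximable d u g W0 W" and 2: "net_approximable d v h V0 V"
  shows "net_approximable d (\<lambda>x. u x + c * v x) (\<lambda>i x. g i x + c * h i x) (W0 + \<bar>c\<bar> * V0) (W + \<bar>c\<bar> * V)"
  unfolding net_approximable_def
proof (intro allI impI)
  fix \<eta> :: real assume \<eta>: "0 < \<eta>"
  \<comment> \<open>The second approximation is multiplied by c, which may be 0; adding 1 keeps the
    divisor positive.\<close>
  define \<eta>' where "\<eta>' = \<eta> / (2 * (\<bar>c\<bar> + 1))"
  have \<eta>': "0 < \<eta>'" "\<bar>c\<bar> * \<eta>' \<le> \<eta> / 2"
    using \<eta> by (auto simp: \<eta>'_def field_simps intro!: divide_pos_pos add_nonneg_pos)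
  obtain \<gamma> Q where Q: "\<bar>\<gamma>\<bar> \<le> W0" "outer_weight Q \<le> W" "net_valid d Q"
    "\<forall>x\<in>cube d. \<bar>u x - net d \<gamma> Q x\<bar> \<le> \<eta> / 2 \<and> (\<forall>i<d. \<bar>g i x - dnet d Q i x\<bar> \<le> \<eta> / 2)"
    using 1[unfolded net_approximable_def, rule_format, of "\<eta> / 2"] \<eta> by auto
  obtain \<gamma>' P where P: "\<bar>\<gamma>'\<bar> \<le> V0" "outer_weight P \<le> V" "net_valid d P"
    "\<forall>x\<in>cube d. \<bar>v x - net d \<gamma>' P x\<bar> \<le> \<eta>' \<and> (\<forall>i<d. \<bar>h i x - dnet d P i x\<bar> \<le> \<eta>')"
    using 2[unfolded net_approximable_def, rule_format, of \<eta>'] \<eta>' by auto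
  have comb: "\<bar>(p + c * q) - (p' + c * q')\<bar> \<le> \<eta>" if "\<bar>p - p'\<bar> \<le> \<eta> / 2" "\<bar>q - q'\<bar> \<le> \<eta>'" for p q p' q'
  proof -
    have "(p + c * q) - (p' + c * q') = (p - p') + c * (q - q')" by (simp add: algebra_simps)
    also have "\<bar>\<dots>\<bar> \<le> \<bar>p - p'\<bar> + \<bar>c\<bar> * \<bar>q - q'\<bar>" by (metis abs_mult abs_triangle_ineq)
    also have "\<dots> \<le> \<eta> / 2 + \<bar>c\<bar> * \<eta>'" using that by (intro add_mono mult_left_mono) auto
    finally show ?thesis using \<eta>'(2) by linarith
  qed
  let ?R = "Q @ map (\<lambda>q. (c * fst q, snd q)) P"
  show "\<exists>\<gamma> R. \<bar>\<gamma>\<bar> \<le> W0 + \<bar>c\<bar> * V0 \<and> outer_weight R \<le> W + \<bar>c\<bar> * V \<and> net_valid d R \<and>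
     (\<forall>x\<in>cube d. \<bar>u x + c * v x - net d \<gamma> R x\<bar> \<le> \<eta> \<and> (\<forall>i<d. \<bar>g i x + c * h i x - dnet d R i x\<bar> \<le> \<eta>))"
  proof (rule exI[of _ "\<gamma> + c * \<gamma>'"], rule exI[of _ ?R], intro conjI ballI allI impI)
    have "\<bar>\<gamma> + c * \<gamma>'\<bar> \<le> \<bar>\<gamma>\<bar> + \<bar>c\<bar> * \<bar>\<gamma>'\<bar>" by (metis abs_mult abs_triangle_ineq)
    also have "\<dots> \<le> W0 + \<bar>c\<bar> * V0" using Q(1) P(1) by (intro add_mono mult_left_mono) auto
    finally show "\<bar>\<gamma> + c * \<gamma>'\<bar> \<le> W0 + \<bar>c\<bar> * V0" .
    show "outer_weight ?R \<le> W + \<bar>c\<bar> * V"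
      unfolding net_append_scale using Q(2) P(2) by (intro add_mono mult_left_mono) auto
    show "net_valid d ?R" using Q(3) P(3) by (auto simp: net_valid_def)
    fix x assume x: "x \<in> cube d"
    show "\<bar>u x + c * v x - net d (\<gamma> + c * \<gamma>') ?R x\<bar> \<le> \<eta>"
      unfolding net_append_scale using Q(4) P(4) x by (intro comb) auto
    fix i assume "i < d"
    then show "\<bar>g i x + c * h i x - dnet d ?R i x\<bar> \<le> \<eta>"
      unfolding net_append_scale using Q(4) P(4) x by (intro comb) auto
  qed
qed

lemma net_approximable_const:
  "\<bar>c\<bar> \<le> W0 \<Longrightarrow> 0 \<le> W \<Longrightarrow> net_approximable d (\<lambda>x. c) (\<lambda>i x. 0) W0 W"
  unfolding net_approximable_def
  by (intro allI impI exI[of _ c] exI[of _ "[]"]) (simp add: net_def dnet_def outer_weight_def net_valid_def)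

lemma net_approximable_sum:
  "finite I \<Longrightarrow> (\<And>i. i \<in> I \<Longrightarrow> net_approximable d (u i) (g i) W0 W) \<Longrightarrow>
    net_approximable d (\<lambda>x. \<Sum>i\<in>I. c i * u i x) (\<lambda>n x. \<Sum>i\<in>I. c i * g i n x)
      ((\<Sum>i\<in>I. \<bar>c i\<bar>) * W0) ((\<Sum>i\<in>I. \<bar>c i\<bar>) * W)"
proof (induction I rule: finite_induct)
  case empty
  then show ?case by (simp add: net_approximable_const)
next
  case (insert i I)
  then have "net_approximable d (\<lambda>x. (\<Sum>i\<in>I. c i * u i x) + c i * u i x) (\<lambda>n x. (\<Sum>i\<in>I. c i * g i n x) + c i * g i n x)
      ((\<Sum>i\<in>I. \<bar>c i\<bar>) * W0 + \<bar>c i\<bar> * W0) ((\<Sum>i\<in>I. \<bar>c i\<bar>) * W + \<bar>c i\<bar> * W)"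
    by (intro net_approximable_add_scale) auto
  then show ?case using insert.hyps by (simp add: algebra_simps)
qed

lemma net_approximable_cong:
  assumes "net_approximable d u g W0 W" "\<And>x. x \<in> cube d \<Longrightarrow> u x = u' x"
    "\<And>x i. x \<in> cube d \<Longrightarrow> i < d \<Longrightarrow> g i x = g' i x"
  shows "net_approximable d u' g' W0 W"
  using assms(1) unfolding net_approximable_def by (simp add: assms(2,3))

lemma net_approximable_mono:
  "net_approximable d u g W0 W \<Longrightarrow> W0 \<le> V0 \<Longrightarrow> W \<le> V \<Longrightarrow> net_approximable d u g V0 V"
  unfolding net_approximable_def by (meson order_trans)

text \<open>Cauchy-Schwarz, with |x| < sqrt d on the open cube. The inequality is strict because the
  profiles are approximated on an open interval.\<close>

lemma abs_inner_cube_less: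
  assumes "x \<in> cube d" "L2_set w {..<d} = 1" "d > 0"
  shows "\<bar>\<Sum>j<d. w j * x j\<bar> < sqrt (real d)"
proof -
  have "\<bar>\<Sum>j<d. w j * x j\<bar> \<le> (\<Sum>j<d. \<bar>w j\<bar> * \<bar>x j\<bar>)"
    by (rule order_trans[OF sum_abs]) (simp add: abs_mult)
  also have "\<dots> \<le> L2_set w {..<d} * L2_set x {..<d}" by (rule L2_set_mult_ineq)
  also have "\<dots> = sqrt (\<Sum>j<d. (x j)\<^sup>2)" unfolding assms(2) by (simp add: L2_set_def)
  also have "\<dots> < sqrt (\<Sum>j<d. 1)"
  proof (intro real_sqrt_less_mono sum_strict_mono)
    fix j assume "j \<in> {..<d}"
    then have "0 < x j" "x j < 1" using cube_coordinate[OF assms(1)] by auto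
    then show "(x j)\<^sup>2 < 1" by (simp add: power_less_one_iff)
  qed (use assms(3) in auto)
  finally show ?thesis by simp
qed

lemma L2_set_component: "L2_set w {..<d} = 1 \<Longrightarrow> (i::nat) < d \<Longrightarrow> \<bar>w i\<bar> \<le> 1"
  using member_le_L2_set[of "{..<d}" i "\<lambda>j. \<bar>w j\<bar>"] by (simp add: L2_set_def)

text \<open>The profile is approximated on the interval of radius sqrt d, which contains the
  projections of the cube and bounds the biases. The gradient error carries the factor |w_i| \<le>
  1.\<close>

lemma net_approximable_cos_ridge:
  assumes "d > 0" "0 \<le> \<kappa>" "L2_set w {..<d} = 1"
  shows "net_approximable d (\<lambda>x. cos (\<kappa> * (\<Sum>j<d. w j * x j) + \<phi>))
    (\<lambda>i x. - \<kappa> * sin (\<kappa> * (\<Sum>j<d. w j * x j) + \<phi>) * w i) 1 (\<kappa> + 2 * sqrt (real d) * \<kappa>\<^sup>2)"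
  unfolding net_approximable_def
proof (intro allI impI)
  fix \<eta> :: real assume \<eta>: "0 < \<eta>"
  have R: "0 < sqrt (real d)" using assms(1) by simp
  obtain N and a b :: "nat \<Rightarrow> real" and \<gamma> where \<gamma>: "\<bar>\<gamma>\<bar> \<le> 1"
    and a: "(\<Sum>j<N. \<bar>a j\<bar>) \<le> \<kappa> + 2 * sqrt (real d) * \<kappa>\<^sup>2" and b: "\<forall>j<N. \<bar>b j\<bar> \<le> sqrt (real d)"
    and err: "\<And>t. - sqrt (real d) < t \<and> t < sqrt (real d) \<Longrightarrow>
      \<bar>cos (\<kappa> * t + \<phi>) - (\<gamma> + (\<Sum>j<N. a j * ReLU (t + b j)))\<bar> \<le> \<eta> \<and>
      \<bar>- \<kappa> * sin (\<kappa> * t + \<phi>) - (\<Sum>j<N. a j * step (t + b j))\<bar> \<le> \<eta>"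
    using cosine_by_ReLU[OF assms(2) R \<eta>, of \<phi>] by blast
  let ?Q = "map (\<lambda>j. (a j, w, b j)) [0..<N]"
  have Q: "net d \<gamma> ?Q x = \<gamma> + (\<Sum>j<N. a j * ReLU ((\<Sum>j<d. w j * x j) + b j))"
    "dnet d ?Q i x = (\<Sum>j<N. a j * step ((\<Sum>j<d. w j * x j) + b j)) * w i"
    "outer_weight ?Q = (\<Sum>j<N. \<bar>a j\<bar>)" for x i
    by (simp_all add: net_def dnet_def outer_weight_def comp_def interv_sum_list_conv_sum_set_nat
        ridge_def dridge_def atLeast0LessThan sum_distrib_right sum_distrib_left mult_ac)
  show "\<exists>\<gamma> Q. \<bar>\<gamma>\<bar> \<le> 1 \<and> outer_weight Q \<le> \<kappa> + 2 * sqrt (real d) * \<kappa>\<^sup>2 \<and> net_valid d Q \<and>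
     (\<forall>x\<in>cube d. \<bar>cos (\<kappa> * (\<Sum>j<d. w j * x j) + \<phi>) - net d \<gamma> Q x\<bar> \<le> \<eta> \<and>
      (\<forall>i<d. \<bar>- \<kappa> * sin (\<kappa> * (\<Sum>j<d. w j * x j) + \<phi>) * w i - dnet d Q i x\<bar> \<le> \<eta>))"
  proof (rule exI[of _ \<gamma>], rule exI[of _ ?Q], intro conjI ballI allI impI \<gamma>)
    show "outer_weight ?Q \<le> \<kappa> + 2 * sqrt (real d) * \<kappa>\<^sup>2" unfolding Q by (rule a)
    show "net_valid d ?Q" using b assms(3) by (auto simp: net_valid_def)
    fix x assume x: "x \<in> cube d"
    let ?t = "\<Sum>j<d. w j * x j"
    have t: "- sqrt (real d) < ?t \<and> ?t < sqrt (real d)"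
      using abs_inner_cube_less[OF x assms(3,1)] by linarith
    show "\<bar>cos (\<kappa> * ?t + \<phi>) - net d \<gamma> ?Q x\<bar> \<le> \<eta>" unfolding Q using err[OF t] by blast
    fix i assume i: "i < d"
    have "\<bar>- \<kappa> * sin (\<kappa> * ?t + \<phi>) * w i - dnet d ?Q i x\<bar> =
        \<bar>- \<kappa> * sin (\<kappa> * ?t + \<phi>) - (\<Sum>j<N. a j * step (?t + b j))\<bar> * \<bar>w i\<bar>"
      unfolding Q abs_mult[symmetric] by (simp add: left_diff_distrib)
    also have "\<dots> \<le> \<eta> * 1" using err[OF t] L2_set_component[OF assms(3) i] \<eta> by (intro mult_mono) auto
    finally show "\<bar>- \<kappa> * sin (\<kappa> * ?t + \<phi>) * w i - dnet d ?Q i x\<bar> \<le> \<eta>" by simp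
  qed
qed

section \<open>Trigonometric products as averages of plane waves\<close>

text \<open>Euler's formula in each factor, multiplied out over all choices of signs, with the real
  part taken at the end.\<close>

lemma prod_cos_eq_sum:
  fixes \<alpha> :: "nat \<Rightarrow> real"
  shows "(\<Prod>m<d. cos (\<alpha> m)) = (\<Sum>s\<in>sign_choices d. (1 / 2) ^ d * cos (\<Sum>m<d. (if s m then 1 else - 1) * \<alpha> m))"
proof -
  define e where "e s t = 1 / 2 * exp (\<i> * complex_of_real ((if s then 1 else - 1) * t))" for s t
  have cos_e: "complex_of_real (cos t) = (\<Sum>s\<in>UNIV. e s t)" for t
    by (simp add: UNIV_bool e_def cos_of_real[symmetric] cos_exp_eq add_divide_distrib add.commute)
  have "complex_of_real (\<Prod>m<d. cos (\<alpha> m)) = (\<Prod>m<d. \<Sum>s\<in>UNIV. e s (\<alpha> m))"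
    by (simp only: of_real_prod cos_e)
  also have "\<dots> = (\<Sum>s\<in>sign_choices d. \<Prod>m<d. e (s m) (\<alpha> m))"
    unfolding sign_choices_def by (rule prod_sum_PiE) auto
  also have "\<dots> = (\<Sum>s\<in>sign_choices d. (1 / 2) ^ d * exp (\<i> * complex_of_real (\<Sum>m<d. (if s m then 1 else - 1) * \<alpha> m)))"
    unfolding e_def prod.distrib of_real_sum sum_distrib_left exp_sum[OF finite_lessThan] by simp
  finally have "Re (complex_of_real (\<Prod>m<d. cos (\<alpha> m))) =
      Re (\<Sum>s\<in>sign_choices d. (1 / 2) ^ d * exp (\<i> * complex_of_real (\<Sum>m<d. (if s m then 1 else - 1) * \<alpha> m)))"
    by simp
  moreover have "Re ((1 / 2) ^ d * exp (\<i> * complex_of_real t)) = (1 / 2) ^ d * cos t" for t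
  proof -
    have "((1 / 2) ^ d * exp (\<i> * complex_of_real t)) = complex_of_real ((1 / 2) ^ d) * cis t"
      by (simp add: cis_conv_exp)
    moreover have "Re (complex_of_real r * cis t) = r * cos t" for r by simp
    ultimately show ?thesis by (simp only:)
  qed
  ultimately show ?thesis by (simp only: Re_sum Re_complex_of_real)
qed

text \<open>A sine is a cosine with phase - pi / 2.\<close>

lemma trig_eq_sum_cos:
  "trig d Z k x = (\<Sum>s\<in>sign_choices d. (1 / 2) ^ d *
    cos ((\<Sum>m<d. (if s m then 1 else - 1) * (pi * real (k m)) * x m) + (\<Sum>m<d. (if s m then 1 else - 1) * (if m \<in> Z then - (pi / 2) else 0))))"
proof -
  have "trig d Z k x = (\<Prod>m<d. cos (pi * real (k m) * x m + (if m \<in> Z then - (pi / 2) else 0)))"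
    unfolding trig_def by (intro prod.cong refl) (simp add: sin_or_cos_def cos_add)
  then show ?thesis
    unfolding prod_cos_eq_sum by (simp add: distrib_left sum.distrib mult.assoc)
qed

text \<open>The plane waves differ in the signs of their direction but share the frequency pi |k|,
  and their weights add up to 1. So \<open>trig\<close> costs as much as one wave, \<kappa> + 2 sqrt
  d \<kappa>^2, which is at most 4 sqrt d (1 + \<kappa>^2); this is the 4 sqrt d of the final
  bound.\<close>

lemma net_approximable_trig:
  assumes d: "d > 0"
  shows "net_approximable d (trig d Z k) (dtrig d Z k) (frequency_weight d k) (4 * sqrt (real d) * frequency_weight d k)"
proof -
  define K where "K = L2_set (\<lambda>m. real (k m)) {..<d}"
  define \<kappa> where "\<kappa> = pi * K"
  define \<sigma> where "\<sigma> s m = (if s m then 1 else - 1 :: real)" for s and m :: nat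
  define \<phi> where "\<phi> s = (\<Sum>m<d. \<sigma> s m * (if m \<in> Z then - (pi / 2) else 0))" for s
  define \<theta> where "\<theta> s x = (\<Sum>m<d. \<sigma> s m * (pi * real (k m)) * x m) + \<phi> s" for s x
  have K0: "0 \<le> K" by (simp add: K_def L2_set_nonneg)
  then have \<kappa>0: "0 \<le> \<kappa>" by (simp add: \<kappa>_def)
  have trig_eq: "trig d Z k x = (\<Sum>s\<in>sign_choices d. (1 / 2) ^ d * cos (\<theta> s x))" for x
    unfolding trig_eq_sum_cos \<theta>_def \<phi>_def \<sigma>_def by simp
  have dtrig_eq: "dtrig d Z k i x = (\<Sum>s\<in>sign_choices d. (1 / 2) ^ d * (- sin (\<theta> s x) * (\<sigma> s i * (pi * real (k i)))))"
    if i: "i < d" for i x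
  proof -
    have aff: "\<theta> s (x(i := t)) = \<sigma> s i * (pi * real (k i)) * t + ((\<Sum>m\<in>{..<d} - {i}. \<sigma> s m * (pi * real (k m)) * x m) + \<phi> s)" for s t
      unfolding \<theta>_def affine_fun_upd[OF i] by simp
    have "((\<lambda>t. \<theta> s (x(i := t))) has_real_derivative \<sigma> s i * (pi * real (k i))) (at (x i))" for s
      unfolding aff by (auto intro!: derivative_eq_intros)
    then have "((\<lambda>t. cos (\<theta> s (x(i := t)))) has_real_derivative - sin (\<theta> s (x(i := x i))) * (\<sigma> s i * (pi * real (k i)))) (at (x i))" for s
      by (rule DERIV_chain2[OF DERIV_cos])
    then have "((\<lambda>t. trig d Z k (x(i := t))) has_real_derivative
        (\<Sum>s\<in>sign_choices d. (1 / 2) ^ d * (- sin (\<theta> s (x(i := x i))) * (\<sigma> s i * (pi * real (k i)))))) (at (x i))"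
      unfolding trig_eq by (intro DERIV_sum DERIV_cmult)
    \<comment> \<open>Both expressions are derivatives of \<open>trig\<close> along the same
      coordinate line.\<close>
    from DERIV_unique[OF this has_derivative_trig[OF i]] show ?thesis by simp
  qed
  have fw: "frequency_weight d k = 1 + \<kappa>\<^sup>2"
    by (simp add: frequency_weight_def \<kappa>_def K_def power_mult_distrib)
  have d1: "1 \<le> sqrt (real d)" using d by simp
  have bnd: "\<kappa> + 2 * sqrt (real d) * \<kappa>\<^sup>2 \<le> 4 * sqrt (real d) * (1 + \<kappa>\<^sup>2)"
  proof -
    have "\<kappa> \<le> 1 + \<kappa>\<^sup>2" using abs_mult_le_squares[of \<kappa> 1] \<kappa>0 by simp
    also have "\<dots> \<le> sqrt (real d) * (1 + \<kappa>\<^sup>2)" using mult_right_mono[OF d1, of "1 + \<kappa>\<^sup>2"] by simp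
    finally have "\<kappa> + 2 * sqrt (real d) * \<kappa>\<^sup>2 \<le> sqrt (real d) * (1 + \<kappa>\<^sup>2) + 2 * sqrt (real d) * (1 + \<kappa>\<^sup>2)"
      by (simp add: distrib_left) (use d1 in linarith)
    also have "\<dots> \<le> 4 * sqrt (real d) * (1 + \<kappa>\<^sup>2)"
      unfolding distrib_right[symmetric] by (intro mult_right_mono) auto
    finally show ?thesis .
  qed
  have one: "net_approximable d (\<lambda>x. cos (\<theta> s x)) (\<lambda>i x. - sin (\<theta> s x) * (\<sigma> s i * (pi * real (k i)))) 1 (\<kappa> + 2 * sqrt (real d) * \<kappa>\<^sup>2)" for s
  \<comment> \<open>Frequency 0 has no direction to normalize; the wave is the constant cos (\<phi>
    s), realized by \<gamma> alone.\<close>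
  proof (cases "K = 0")
    case True
    then have k0: "k m = 0" if "m < d" for m
      using frequency_le_L2_set[OF that, of k] unfolding K_def by simp
    then have "\<theta> s x = \<phi> s" for x unfolding \<theta>_def by simp
    moreover have "net_approximable d (\<lambda>x. cos (\<phi> s)) (\<lambda>i x. 0) 1 (\<kappa> + 2 * sqrt (real d) * \<kappa>\<^sup>2)"
      using \<kappa>0 by (intro net_approximable_const) auto
    ultimately show ?thesis using k0 by (elim net_approximable_cong) auto
  next
    case False
    then have K: "0 < K" using K0 by simp
    define w where "w m = \<sigma> s m * real (k m) / K" for m
    have "(\<Sum>m<d. (w m)\<^sup>2) = (\<Sum>m<d. (real (k m))\<^sup>2) / K\<^sup>2"
    proof -
      have "(\<sigma> s m * real (k m))\<^sup>2 = (real (k m))\<^sup>2" for m by (simp add: \<sigma>_def power_mult_distrib)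
      then show ?thesis by (simp only: w_def power_divide sum_divide_distrib)
    qed
    also have "\<dots> = 1" using K by (simp add: K_def L2_set_def sum_nonneg)
    finally have w1: "L2_set w {..<d} = 1" by (simp add: L2_set_def)
    have "\<theta> s x = \<kappa> * (\<Sum>j<d. w j * x j) + \<phi> s" for x
      using K by (simp add: \<theta>_def \<kappa>_def w_def sum_distrib_left mult_ac)
    moreover have "\<sigma> s i * (pi * real (k i)) = \<kappa> * w i" for i using K by (simp add: \<kappa>_def w_def)
    ultimately show ?thesis
      using net_approximable_cos_ridge[OF d \<kappa>0 w1, of "\<phi> s"] by (simp add: mult_ac)
  qed
  have "net_approximable d (\<lambda>x. \<Sum>s\<in>sign_choices d. (1 / 2) ^ d * cos (\<theta> s x))
      (\<lambda>i x. \<Sum>s\<in>sign_choices d. (1 / 2) ^ d * (- sin (\<theta> s x) * (\<sigma> s i * (pi * real (k i)))))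
      ((\<Sum>s\<in>sign_choices d. \<bar>(1 / 2) ^ d\<bar>) * 1) ((\<Sum>s\<in>sign_choices d. \<bar>(1 / 2) ^ d\<bar>) * (\<kappa> + 2 * sqrt (real d) * \<kappa>\<^sup>2))"
    by (intro net_approximable_sum finite_sign_choices one)
  moreover have "(\<Sum>s\<in>sign_choices d. \<bar>(1 / 2 :: real) ^ d\<bar>) = 1"
    by (simp add: card_sign_choices power_one_over)
  ultimately have "net_approximable d (\<lambda>x. \<Sum>s\<in>sign_choices d. (1 / 2) ^ d * cos (\<theta> s x))
      (\<lambda>i x. \<Sum>s\<in>sign_choices d. (1 / 2) ^ d * (- sin (\<theta> s x) * (\<sigma> s i * (pi * real (k i)))))
      1 (\<kappa> + 2 * sqrt (real d) * \<kappa>\<^sup>2)" by simp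
  then have "net_approximable d (trig d Z k) (dtrig d Z k) 1 (\<kappa> + 2 * sqrt (real d) * \<kappa>\<^sup>2)"
    by (rule net_approximable_cong) (simp_all add: trig_eq dtrig_eq)
  then show ?thesis
    by (rule net_approximable_mono) (use bnd in \<open>simp_all add: fw\<close>)
qed

lemma net_approximable_trig_poly:
  assumes d: "d > 0"
  shows "net_approximable d (trig_poly d Z L) (dtrig_poly d Z L) (trig_poly_norm d L) (4 * sqrt (real d) * trig_poly_norm d L)"
proof (induction L)
  case Nil
  then show ?case unfolding trig_poly_Nil by (intro net_approximable_const) auto
next
  case (Cons p L)
  from net_approximable_add_scale[OF Cons net_approximable_trig[OF d, of Z "snd p"], of "fst p"]
  show ?case
    unfolding trig_poly_Cons by (simp add: trig_poly_norm_def algebra_simps)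
qed

section \<open>Sparse convex combinations\<close>

text \<open>The bilinear form of a matrix of inner products. The selection works on coefficient
  vectors and sees the units only through symmetry, positivity and the diagonal of
  \<open>G\<close>.\<close>

definition gram :: "nat \<Rightarrow> (nat \<Rightarrow> nat \<Rightarrow> real) \<Rightarrow> (nat \<Rightarrow> real) \<Rightarrow> (nat \<Rightarrow> real) \<Rightarrow> real" where
  "gram m G e e' = (\<Sum>q<m. \<Sum>r<m. e q * e' r * G q r)"

lemma gram_linear_right: "gram m G e (\<lambda>q. a * f q + b * h q) = a * gram m G e f + b * gram m G e h"
  by (simp add: gram_def algebra_simps sum.distrib sum_distrib_left)

lemma gram_linear_left: "gram m G (\<lambda>q. a * f q + b * h q) e = a * gram m G f e + b * gram m G h e"
  by (simp add: gram_def algebra_simps sum.distrib sum_distrib_left)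

lemma gram_sum_right: "gram m G e (\<lambda>q. \<Sum>p\<in>I. c p * f p q) = (\<Sum>p\<in>I. c p * gram m G e (f p))"
proof (induction I rule: infinite_finite_induct)
  case (insert p I)
  then show ?case using gram_linear_right[of m G e "c p" "f p" 1 "\<lambda>q. \<Sum>p\<in>I. c p * f p q"] by simp
qed (simp_all add: gram_def)

lemma gram_unit:
  assumes "p < m" shows "gram m G (\<lambda>q. of_bool (q = p)) (\<lambda>q. of_bool (q = p)) = G p p"
proof -
  have "gram m G (\<lambda>q. of_bool (q = p)) (\<lambda>q. of_bool (q = p)) = (\<Sum>q<m. if q = p then (\<Sum>r<m. if r = p then G q r else 0) else 0)"
    unfolding gram_def by (intro sum.cong refl) (auto intro!: sum.cong)
  then show ?thesis using assms by simp
qed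

text \<open>Greedy form of Maurey's lemma: averaging over the weights \<open>c\<close> shows that some index does not
  increase the squared error of the partial sums by more than \<open>B\<close>.\<close>

lemma greedy_selection:
  assumes sym: "\<And>q r. G q r = G r q" and psd: "\<And>e. 0 \<le> gram m G e e"
    and c: "\<And>q. q < m \<Longrightarrow> 0 \<le> c q" "(\<Sum>q<m. c q) = 1"
    and B: "\<And>q. q < m \<Longrightarrow> G q q \<le> B"
  shows "\<exists>s :: nat \<Rightarrow> nat. (\<forall>i<n. s i < m) \<and>
    gram m G (\<lambda>q. real n * c q - (\<Sum>i<n. of_bool (q = s i))) (\<lambda>q. real n * c q - (\<Sum>i<n. of_bool (q = s i)))
    \<le> real n * B"
proof (induction n)
  case 0
  then show ?case by (simp add: gram_def)
next
  case (Suc n)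
  then obtain s where s: "\<forall>i<n. s i < m"
    and IH: "gram m G (\<lambda>q. real n * c q - (\<Sum>i<n. of_bool (q = s i))) (\<lambda>q. real n * c q - (\<Sum>i<n. of_bool (q = s i))) \<le> real n * B"
    by blast
  define e where "e q = real n * c q - (\<Sum>i<n. of_bool (q = s i))" for q
  define u where "u p q = (of_bool (q = p) :: real)" for p q :: nat
  define f where "f p q = 1 * c q + (- 1) * u p q" for p q
  \<comment> \<open>The increase of the squared error when unit p is added; f p = c - u p is the
    corresponding change of the coefficient error.\<close>
  define X where "X p = 2 * gram m G e (f p) + gram m G (f p) (f p)" for p
  have gsym: "gram m G a b = gram m G b a" for a b
    unfolding gram_def by (subst sum.swap) (simp add: sym mult.commute)
  have csum: "c q = (\<Sum>p<m. c p * u p q)" if "q < m" for q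
    using that by (simp add: u_def if_distrib of_bool_def cong: if_cong)
  have gc: "gram m G e c = (\<Sum>p<m. c p * gram m G e (u p))" for e
  proof -
    have "gram m G e c = gram m G e (\<lambda>q. \<Sum>p<m. c p * u p q)"
      unfolding gram_def using csum by (intro sum.cong refl) simp
    then show ?thesis by (simp only: gram_sum_right)
  qed
  have Xp: "X p = 2 * (gram m G e c - gram m G e (u p)) + (gram m G c c - 2 * gram m G c (u p) + gram m G (u p) (u p))" for p
    unfolding X_def f_def[abs_def] gram_linear_right gram_linear_left using gsym[of "u p" c] by simp
  have K: "(\<Sum>p<m. c p * k) = k" for k using c(2) by (simp add: sum_distrib_right[symmetric])
  \<comment> \<open>On average over c the cross terms with e cancel, because the average of the unit
    vectors is c. What remains is the variance of the units, which is at most B.\<close>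
  have "(\<Sum>p<m. c p * X p) = 2 * (gram m G e c - (\<Sum>p<m. c p * gram m G e (u p))) +
      (gram m G c c - 2 * (\<Sum>p<m. c p * gram m G c (u p)) + (\<Sum>p<m. c p * gram m G (u p) (u p)))"
    unfolding Xp distrib_left right_diff_distrib sum.distrib sum_subtractf K mult.left_commute[of _ 2]
      sum_distrib_left[symmetric] ..
  also have "\<dots> = (\<Sum>p<m. c p * gram m G (u p) (u p)) - gram m G c c"
    unfolding gc[symmetric] by simp
  also have "\<dots> \<le> (\<Sum>p<m. c p * B)"
  proof -
    have "gram m G (u p) (u p) = G p p" if "p < m" for p
      using gram_unit[OF that, of G] by (simp add: u_def[abs_def])
    then have "(\<Sum>p<m. c p * gram m G (u p) (u p)) \<le> (\<Sum>p<m. c p * B)"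
      using B c(1) by (intro sum_mono mult_left_mono) auto
    then show ?thesis using psd[of c] by linarith
  qed
  finally have avg: "(\<Sum>p<m. c p * X p) \<le> B" using c(2) by (simp add: sum_distrib_right[symmetric])
  have "\<exists>p<m. X p \<le> B"
  proof (rule ccontr)
    assume "\<not> (\<exists>p<m. X p \<le> B)"
    then have gt: "B < X p" if "p < m" for p using that by (meson not_le)
    have "(\<Sum>p<m. c p * (X p - B)) \<le> 0"
      using avg c(2) by (simp add: right_diff_distrib sum_subtractf sum_distrib_right[symmetric])
    moreover have nn: "0 \<le> c p * (X p - B)" if "p \<in> {..<m}" for p
      using that c(1)[of p] gt[of p] by (intro mult_nonneg_nonneg) auto
    ultimately have "(\<Sum>p<m. c p * (X p - B)) = 0" using sum_nonneg[OF nn] by (intro antisym)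
    then have z: "c p * (X p - B) = 0" if "p \<in> {..<m}" for p
      using sum_nonneg_0[OF finite_lessThan nn _ that] by simp
    have "c p = 0" if "p \<in> {..<m}" for p
      using z[OF that] gt[of p] that by simp
    then have "(\<Sum>p<m. c p) = 0" by (intro sum.neutral) blast
    then show False using c(2) by simp
  qed
  then obtain p where p: "p < m" "X p \<le> B" by blast
  define s' where "s' = s(n := p)"
  have new: "(\<lambda>q. real (Suc n) * c q - (\<Sum>i<Suc n. of_bool (q = s' i))) = (\<lambda>q. 1 * e q + 1 * f p q)"
  proof
    fix q
    have "(\<Sum>i<n. of_bool (q = s' i)) = (\<Sum>i<n. of_bool (q = s i) :: real)"
      by (rule sum.cong) (auto simp: s'_def)
    then show "real (Suc n) * c q - (\<Sum>i<Suc n. of_bool (q = s' i)) = 1 * e q + 1 * f p q"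
      by (simp add: e_def f_def u_def s'_def algebra_simps)
  qed
  have "gram m G (\<lambda>q. 1 * e q + 1 * f p q) (\<lambda>q. 1 * e q + 1 * f p q) = gram m G e e + X p"
    unfolding gram_linear_right gram_linear_left X_def using gsym[of "f p" e] by simp
  also have "\<dots> \<le> real n * B + B" using IH p(2) unfolding e_def[abs_def] by (rule add_mono)
  finally have "gram m G (\<lambda>q. real (Suc n) * c q - (\<Sum>i<Suc n. of_bool (q = s' i)))
      (\<lambda>q. real (Suc n) * c q - (\<Sum>i<Suc n. of_bool (q = s' i))) \<le> real (Suc n) * B"
    unfolding new by (simp add: algebra_simps)
  moreover have "\<forall>i<Suc n. s' i < m" using s p(1) by (auto simp: s'_def less_Suc_eq)
  ultimately show ?case by blast
qed

section \<open>Sampling a network in the energy norm\<close>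

lemma weak_gradient_sum:
  "finite I \<Longrightarrow> (\<And>q. q \<in> I \<Longrightarrow> weak_gradient d (u q) (g q)) \<Longrightarrow>
    weak_gradient d (\<lambda>x. \<Sum>q\<in>I. e q * u q x) (\<lambda>i x. \<Sum>q\<in>I. e q * g q i x)"
proof (induction I rule: finite_induct)
  case empty
  then show ?case by (simp add: weak_gradient_0)
next
  case (insert q I)
  then have "weak_gradient d (\<lambda>x. e q * u q x + 1 * (\<Sum>q\<in>I. e q * u q x)) (\<lambda>i x. e q * g q i x + 1 * (\<Sum>q\<in>I. e q * g q i x))"
    by (intro weak_gradient_linear) auto
  then show ?case using insert.hyps by simp
qed

lemma energy_sum_left:
  "finite I \<Longrightarrow> (\<And>q. q \<in> I \<Longrightarrow> weak_gradient d (u q) (g q)) \<Longrightarrow> weak_gradient d v h \<Longrightarrow>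
    energy d (\<lambda>x. \<Sum>q\<in>I. e q * u q x) (\<lambda>i x. \<Sum>q\<in>I. e q * g q i x) v h = (\<Sum>q\<in>I. e q * energy d (u q) (g q) v h)"
proof (induction I rule: finite_induct)
  case empty
  then show ?case by (simp add: energy_def)
next
  case (insert q I)
  have "energy d (\<lambda>x. e q * u q x + 1 * (\<Sum>q\<in>I. e q * u q x)) (\<lambda>i x. e q * g q i x + 1 * (\<Sum>q\<in>I. e q * g q i x)) v h =
      e q * energy d (u q) (g q) v h + 1 * energy d (\<lambda>x. \<Sum>q\<in>I. e q * u q x) (\<lambda>i x. \<Sum>q\<in>I. e q * g q i x) v h"
    using insert by (intro energy_linear weak_gradient_sum) auto
  then show ?case using insert by simp
qed

lemma energy_sum_gram:
  assumes "\<And>q. q < m \<Longrightarrow> weak_gradient d (u q) (g q)"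
  shows "energy d (\<lambda>x. \<Sum>q<m. e q * u q x) (\<lambda>i x. \<Sum>q<m. e q * g q i x) (\<lambda>x. \<Sum>q<m. e q * u q x) (\<lambda>i x. \<Sum>q<m. e q * g q i x) =
    gram m (\<lambda>q r. energy d (u q) (g q) (u r) (g r)) e e"
proof -
  let ?U = "\<lambda>x. \<Sum>q<m. e q * u q x" and ?G = "\<lambda>i x. \<Sum>q<m. e q * g q i x"
  have wg: "weak_gradient d ?U ?G" using assms by (intro weak_gradient_sum) auto
  have "energy d ?U ?G ?U ?G = (\<Sum>q<m. e q * energy d (u q) (g q) ?U ?G)"
    using assms wg by (intro energy_sum_left) auto
  also have "\<dots> = (\<Sum>q<m. e q * (\<Sum>r<m. e r * energy d (u q) (g q) (u r) (g r)))"
  proof (rule sum.cong[OF refl])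
    fix q assume "q \<in> {..<m}"
    then have "energy d ?U ?G (u q) (g q) = (\<Sum>r<m. e r * energy d (u r) (g r) (u q) (g q))"
      using assms by (intro energy_sum_left) auto
    then show "e q * energy d (u q) (g q) ?U ?G = e q * (\<Sum>r<m. e r * energy d (u q) (g q) (u r) (g r))"
      by (subst (1 2) energy_commute) simp
  qed
  finally show ?thesis by (simp add: gram_def sum_distrib_left mult.assoc)
qed

text \<open>The cube has measure 1, so a pointwise bound passes to the energy.\<close>

lemma energy_le_pointwise:
  assumes "\<And>x. x \<in> cube d \<Longrightarrow> (\<Sum>i<d. (g i x)\<^sup>2) + (u x)\<^sup>2 \<le> B" "0 \<le> B"
  shows "energy d u g u g \<le> B"
  unfolding energy_def by (rule integral_le_bound[OF _ assms(2)]) (use assms(1) in \<open>simp add: power2_eq_square\<close>)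

definition dnetwork ::
    "nat \<Rightarrow> nat \<Rightarrow> (nat \<Rightarrow> real) \<Rightarrow> (nat \<Rightarrow> nat \<Rightarrow> real) \<Rightarrow> (nat \<Rightarrow> real) \<Rightarrow> nat \<Rightarrow> (nat \<Rightarrow> real) \<Rightarrow> real" where
  "dnetwork d k a w b n x = (\<Sum>i=1..k. a i * dridge d (w i) (b i) n x)"

lemma network_eq_ridge: "network d k \<gamma> a w b x = \<gamma> + (\<Sum>i=1..k. a i * ridge d (w i) (b i) x)"
  by (simp add: network_def ridge_def)

lemma weak_gradient_const: "weak_gradient d (\<lambda>x. c) (\<lambda>i x. 0)"
proof -
  have "is_weak_partial d i (\<lambda>x. c) (\<lambda>x. 0)" if "i < d" for i
    by (rule is_weak_partial_classical[OF that, where B = "\<bar>c\<bar>"]) auto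
  then show ?thesis by (simp add: weak_gradient_def L2_const)
qed

lemma weak_gradient_network: "weak_gradient d (network d k \<gamma> a w b) (dnetwork d k a w b)"
proof -
  have "weak_gradient d (\<lambda>x. 1 * \<gamma> + 1 * (\<Sum>i=1..k. a i * ridge d (w i) (b i) x))
      (\<lambda>n x. 1 * 0 + 1 * (\<Sum>i=1..k. a i * dridge d (w i) (b i) n x))"
    by (intro weak_gradient_linear weak_gradient_const weak_gradient_sum weak_gradient_ridge) auto
  then show ?thesis by (simp add: network_eq_ridge[abs_def] dnetwork_def[abs_def])
qed

lemma weak_gradient_net: "weak_gradient d (net d \<gamma> Q) (dnet d Q)"
proof -
  have "weak_gradient d (\<lambda>x. 1 * \<gamma> + 1 * (\<Sum>n<length Q. fst (Q ! n) * ridge d (fst (snd (Q ! n))) (snd (snd (Q ! n))) x))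
      (\<lambda>i x. 1 * 0 + 1 * (\<Sum>n<length Q. fst (Q ! n) * dridge d (fst (snd (Q ! n))) (snd (snd (Q ! n))) i x))"
    by (intro weak_gradient_linear weak_gradient_const weak_gradient_sum weak_gradient_ridge) auto
  then show ?thesis
    by (simp add: net_def[abs_def] dnet_def[abs_def] sum_list_sum_nth atLeast0LessThan)
qed

text \<open>The large network without its constant is a convex combination of signed units scaled by
  W, and n greedy selections leave an energy error B / n. Here B = W^2 (1 + 4 d): a unit has
  gradient of length at most 1 and value at most |w x| + |b| \<le> 2 sqrt d. Both networks have the
  same constant, which cancels.\<close>

lemma network_selection:
  assumes d: "d > 0" and Q: "net_valid d Q" "outer_weight Q \<le> W" and n: "n > 0"
  shows "\<exists>a w b. (\<Sum>i=1..n. \<bar>a i\<bar>) \<le> W \<and> (\<forall>i\<in>{1..n}. L2_set (w i) {..<d} = 1 \<and> \<bar>b i\<bar> \<le> sqrt (real d)) \<and>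
    energy d (\<lambda>x. net d \<gamma> Q x - network d n \<gamma> a w b x) (\<lambda>i x. dnet d Q i x - dnetwork d n a w b i x)
      (\<lambda>x. net d \<gamma> Q x - network d n \<gamma> a w b x) (\<lambda>i x. dnet d Q i x - dnetwork d n a w b i x)
      \<le> W\<^sup>2 * (1 + 4 * real d) / real n"
proof -
  let ?w0 = "\<lambda>j. if j = 0 then 1 else 0 :: real"
  \<comment> \<open>A dummy unit of weight 0 in front receives the probability left over when the
    outer weight is below W, and makes the list nonempty.\<close>
  define P where "P = (0 :: real, ?w0, 0 :: real) # Q"
  define m where "m = length P"
  define A where "A q = fst (P ! q)" for q
  define V where "V q = fst (snd (P ! q))" for q
  define D where "D q = snd (snd (P ! q))" for q
  have w0: "L2_set ?w0 {..<d} = 1"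
    using d by (simp add: L2_set_def if_distrib[of "\<lambda>t. t\<^sup>2"] cong: if_cong)
  have valid: "L2_set (V q) {..<d} = 1" "\<bar>D q\<bar> \<le> sqrt (real d)" if "q < m" for q
  proof -
    have "P ! q \<in> set P" using that by (simp add: m_def)
    then show "L2_set (V q) {..<d} = 1" "\<bar>D q\<bar> \<le> sqrt (real d)"
      using Q(1) w0 by (auto simp: P_def V_def D_def net_valid_def)
  qed
  have W0: "0 \<le> outer_weight Q" unfolding outer_weight_def by (rule sum_list_nonneg) auto
  then have W: "0 \<le> W" using Q(2) by linarith
  have owP: "(\<Sum>q<m. \<bar>A q\<bar>) = outer_weight Q"
  proof -
    have "(\<Sum>q<m. \<bar>A q\<bar>) = outer_weight P"
      by (simp add: outer_weight_def sum_list_sum_nth atLeast0LessThan m_def A_def)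
    then show ?thesis by (simp add: P_def outer_weight_def)
  qed
  have netP: "net d \<gamma> Q x = \<gamma> + (\<Sum>q<m. A q * ridge d (V q) (D q) x)"
    "dnet d Q i x = (\<Sum>q<m. A q * dridge d (V q) (D q) i x)" for x i
  proof -
    have "net d \<gamma> Q x = net d \<gamma> P x" "dnet d Q i x = dnet d P i x" by (simp_all add: net_def dnet_def P_def)
    then show "net d \<gamma> Q x = \<gamma> + (\<Sum>q<m. A q * ridge d (V q) (D q) x)"
      "dnet d Q i x = (\<Sum>q<m. A q * dridge d (V q) (D q) i x)"
      by (simp_all add: net_def dnet_def sum_list_sum_nth atLeast0LessThan m_def A_def V_def D_def)
  qed
  have m0: "0 < m" by (simp add: m_def P_def)
  have A0: "A 0 = 0" by (simp add: A_def P_def)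
  \<comment> \<open>For W = 0 the quotients are 0 by convention, and all probability sits on the
    dummy unit.\<close>
  define c where "c q = (if q = 0 then 1 - outer_weight Q / W else \<bar>A q\<bar> / W)" for q
  have c_nonneg: "0 \<le> c q" if "q < m" for q
  proof -
    have "outer_weight Q / W \<le> 1" using W W0 Q(2) by (cases "W = 0") (auto intro: divide_le_eq_1_pos[THEN iffD2])
    then show ?thesis using W by (simp add: c_def)
  qed
  have c_sum: "(\<Sum>q<m. c q) = 1"
  proof -
    have "(\<Sum>q<m. c q) = c 0 + (\<Sum>q\<in>{..<m} - {0}. c q)" using m0 by (subst sum.remove[of _ 0]) auto
    also have "(\<Sum>q\<in>{..<m} - {0}. c q) = (\<Sum>q\<in>{..<m} - {0}. \<bar>A q\<bar> / W)" by (rule sum.cong) (auto simp: c_def)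
    also have "\<dots> = (\<Sum>q<m. \<bar>A q\<bar> / W)" using m0 A0 by (subst (2) sum.remove[of _ 0]) auto
    also have "\<dots> = outer_weight Q / W" by (simp only: sum_divide_distrib[symmetric] owP)
    finally show ?thesis by (simp add: c_def)
  qed
  \<comment> \<open>Signs and scale move from the weights into the functions: c is a probability
    vector, and c q times \<sigma> q is the original weight.\<close>
  define \<sigma> where "\<sigma> q = W * sgn (A q)" for q
  have cA: "c q * \<sigma> q = A q" if "q < m" for q
  proof (cases "W = 0")
    case True
    then have "(\<Sum>q<m. \<bar>A q\<bar>) \<le> 0" using owP Q(2) by simp
    moreover have "\<bar>A q\<bar> \<le> (\<Sum>q<m. \<bar>A q\<bar>)" using that by (intro member_le_sum) auto
    ultimately have "A q = 0" by linarith
    then show ?thesis by (simp add: \<sigma>_def)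
  next
    case False
    then show ?thesis using A0 by (cases "q = 0") (simp_all add: c_def \<sigma>_def abs_mult_sgn)
  qed
  \<comment> \<open>The summand with factor 0 only gives the scaled unit the shape of
    \<open>weak_gradient_linear\<close>.\<close>
  define H where "H q x = \<sigma> q * ridge d (V q) (D q) x + 0 * ridge d (V q) (D q) x" for q x
  define H' where "H' q i x = \<sigma> q * dridge d (V q) (D q) i x + 0 * dridge d (V q) (D q) i x" for q i x
  have wgH: "weak_gradient d (H q) (H' q)" for q
    unfolding H_def[abs_def] H'_def[abs_def] by (intro weak_gradient_linear weak_gradient_ridge)
  define G where "G q r = energy d (H q) (H' q) (H r) (H' r)" for q r
  have "\<bar>\<sigma> q\<bar> \<le> W" for q using W by (simp add: \<sigma>_def abs_mult sgn_real_def)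
  then have \<sigma>2: "(\<sigma> q)\<^sup>2 \<le> W\<^sup>2" for q by (rule abs_le_imp_square_le)
  have GB: "G q q \<le> W\<^sup>2 * (1 + 4 * real d)" if q: "q < m" for q
    unfolding G_def
  proof (rule energy_le_pointwise)
    fix x assume x: "x \<in> cube d"
    have "\<bar>ridge d (V q) (D q) x\<bar> \<le> \<bar>(\<Sum>j<d. V q j * x j) + D q\<bar>" unfolding ridge_def by (rule abs_ReLU_le)
    also have "\<dots> \<le> 2 * sqrt (real d)" using abs_inner_cube_less[OF x valid(1)[OF q] d] valid(2)[OF q] by linarith
    finally have "(ridge d (V q) (D q) x)\<^sup>2 \<le> (2 * sqrt (real d))\<^sup>2" by (rule abs_le_imp_square_le)
    then have 1: "(ridge d (V q) (D q) x)\<^sup>2 \<le> 4 * real d" by (simp add: power_mult_distrib)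
    have "(\<Sum>i<d. (dridge d (V q) (D q) i x)\<^sup>2) \<le> (\<Sum>i<d. (V q i)\<^sup>2)"
      by (intro sum_mono) (simp add: dridge_def power_mult_distrib step_def)
    also have "\<dots> = 1" using valid(1)[OF q] by (simp add: L2_set_def)
    finally have 2: "(\<Sum>i<d. (dridge d (V q) (D q) i x)\<^sup>2) \<le> 1" .
    have "(\<Sum>i<d. (H' q i x)\<^sup>2) + (H q x)\<^sup>2 = (\<sigma> q)\<^sup>2 * ((\<Sum>i<d. (dridge d (V q) (D q) i x)\<^sup>2) + (ridge d (V q) (D q) x)\<^sup>2)"
      by (simp add: H_def H'_def power_mult_distrib sum_distrib_left distrib_left)
    also have "\<dots> \<le> W\<^sup>2 * (1 + 4 * real d)"
      using \<sigma>2 1 2 by (intro mult_mono add_mono) (auto intro!: add_nonneg_nonneg sum_nonneg)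
    finally show "(\<Sum>i<d. (H' q i x)\<^sup>2) + (H q x)\<^sup>2 \<le> W\<^sup>2 * (1 + 4 * real d)" .
  qed simp
  have psd: "0 \<le> gram m G e e" for e
    unfolding G_def[abs_def] energy_sum_gram[of m d H H' e, OF wgH, symmetric] by (rule energy_nonneg)
  have sym: "G q r = G r q" for q r unfolding G_def by (rule energy_commute)
  have "\<exists>s :: nat \<Rightarrow> nat. (\<forall>i<n. s i < m) \<and>
    gram m G (\<lambda>q. real n * c q - (\<Sum>i<n. of_bool (q = s i))) (\<lambda>q. real n * c q - (\<Sum>i<n. of_bool (q = s i)))
    \<le> real n * (W\<^sup>2 * (1 + 4 * real d))"
    by (rule greedy_selection[of G m c, OF sym psd c_nonneg c_sum GB])
  then obtain s where s: "\<forall>i<n. s i < m"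
    and bound: "gram m G (\<lambda>q. real n * c q - (\<Sum>i<n. of_bool (q = s i))) (\<lambda>q. real n * c q - (\<Sum>i<n. of_bool (q = s i)))
      \<le> real n * (W\<^sup>2 * (1 + 4 * real d))"
    by blast
  define e where "e q = real n * c q - (\<Sum>i<n. of_bool (q = s i))" for q
  \<comment> \<open>Networks number their units from 1, selections from 0. A unit selected
    repeatedly occurs repeatedly in the network.\<close>
  define a where "a i = \<sigma> (s (i - 1)) / real n" for i
  define w where "w i = V (s (i - 1))" for i
  define b where "b i = D (s (i - 1))" for i
  have shift: "(\<Sum>i=1..n. F (s (i - 1))) = (\<Sum>i<n. F (s i))" for F :: "nat \<Rightarrow> real"
    by (rule sum.reindex_bij_witness[of _ Suc "\<lambda>i. i - 1"]) auto
  have count: "(\<Sum>q<m. (\<Sum>i<n. of_bool (q = s i)) * F q) = (\<Sum>i<n. F (s i))" for F :: "nat \<Rightarrow> real"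
  proof -
    have "(\<Sum>q<m. (\<Sum>i<n. of_bool (q = s i)) * F q) = (\<Sum>i<n. \<Sum>q<m. of_bool (q = s i) * F q)"
      unfolding sum_distrib_right by (rule sum.swap)
    also have "\<dots> = (\<Sum>i<n. F (s i))"
    proof (rule sum.cong[OF refl])
      fix i assume "i \<in> {..<n}"
      then have "s i < m" using s by simp
      then show "(\<Sum>q<m. of_bool (q = s i) * F q) = F (s i)"
        by (simp add: of_bool_def if_distrib[of "\<lambda>t. t * _"] cong: if_cong)
    qed
    finally show ?thesis .
  qed
  \<comment> \<open>F is the value or a partial derivative of the units at a fixed point, so one
    identity serves the function and its gradient.\<close>
  have eF: "(\<Sum>q<m. e q * (\<sigma> q * F q)) / real n = (\<Sum>q<m. A q * F q) - (\<Sum>i=1..n. a i * F (s (i - 1)))" for F :: "nat \<Rightarrow> real"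
  proof -
    have "(\<Sum>q<m. e q * (\<sigma> q * F q)) = real n * (\<Sum>q<m. (c q * \<sigma> q) * F q) - (\<Sum>i<n. \<sigma> (s i) * F (s i))"
      by (simp only: e_def left_diff_distrib sum_subtractf count) (simp add: sum_distrib_left mult.assoc)
    also have "(\<Sum>q<m. (c q * \<sigma> q) * F q) = (\<Sum>q<m. A q * F q)" using cA by (intro sum.cong) auto
    also have "(\<Sum>i<n. \<sigma> (s i) * F (s i)) = real n * (\<Sum>i=1..n. a i * F (s (i - 1)))"
    proof -
      have "(\<Sum>i<n. \<sigma> (s i) * F (s i)) = (\<Sum>i=1..n. \<sigma> (s (i - 1)) * F (s (i - 1)))"
        by (rule shift[of "\<lambda>q. \<sigma> q * F q", symmetric])
      then show ?thesis
        unfolding a_def sum_distrib_left using n by (simp cong: sum.cong)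
    qed
    finally show ?thesis using n by (simp add: right_diff_distrib[symmetric])
  qed
  have diff: "(\<lambda>x. net d \<gamma> Q x - network d n \<gamma> a w b x) = (\<lambda>x. \<Sum>q<m. (e q / real n) * H q x)"
    "(\<lambda>i x. dnet d Q i x - dnetwork d n a w b i x) = (\<lambda>i x. \<Sum>q<m. (e q / real n) * H' q i x)"
  proof -
    have "(\<Sum>q<m. (e q / real n) * H q x) = net d \<gamma> Q x - network d n \<gamma> a w b x" for x
      using eF[of "\<lambda>q. ridge d (V q) (D q) x"]
      by (simp add: netP network_eq_ridge w_def b_def H_def sum_divide_distrib)
    moreover have "(\<Sum>q<m. (e q / real n) * H' q i x) = dnet d Q i x - dnetwork d n a w b i x" for i x
      using eF[of "\<lambda>q. dridge d (V q) (D q) i x"]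
      by (simp add: netP dnetwork_def w_def b_def H'_def sum_divide_distrib)
    ultimately show "(\<lambda>x. net d \<gamma> Q x - network d n \<gamma> a w b x) = (\<lambda>x. \<Sum>q<m. (e q / real n) * H q x)"
      "(\<lambda>i x. dnet d Q i x - dnetwork d n a w b i x) = (\<lambda>i x. \<Sum>q<m. (e q / real n) * H' q i x)" by simp_all
  qed
  \<comment> \<open>The average of the selections divides the bound n B on the squared error by
    n^2.\<close>
  have "gram m G (\<lambda>q. e q / real n) (\<lambda>q. e q / real n) = gram m G e e / (real n)\<^sup>2"
    using n by (simp add: gram_def sum_divide_distrib power2_eq_square)
  also have "\<dots> \<le> real n * (W\<^sup>2 * (1 + 4 * real d)) / (real n)\<^sup>2"
    using bound unfolding e_def[abs_def] by (rule divide_right_mono) simp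
  also have "\<dots> = W\<^sup>2 * (1 + 4 * real d) / real n" using n by (simp add: power2_eq_square)
  finally have en: "energy d (\<lambda>x. net d \<gamma> Q x - network d n \<gamma> a w b x) (\<lambda>i x. dnet d Q i x - dnetwork d n a w b i x)
      (\<lambda>x. net d \<gamma> Q x - network d n \<gamma> a w b x) (\<lambda>i x. dnet d Q i x - dnetwork d n a w b i x)
      \<le> W\<^sup>2 * (1 + 4 * real d) / real n"
    unfolding diff energy_sum_gram[of m d H H' "\<lambda>q. e q / real n", OF wgH] G_def[abs_def] .
  have "(\<Sum>i=1..n. \<bar>a i\<bar>) \<le> (\<Sum>i=1..n. W / real n)"
    unfolding a_def using \<open>\<And>q. \<bar>\<sigma> q\<bar> \<le> W\<close> by (intro sum_mono) (simp add: divide_right_mono)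
  then have "(\<Sum>i=1..n. \<bar>a i\<bar>) \<le> W" using n by simp
  moreover have "\<forall>i\<in>{1..n}. L2_set (w i) {..<d} = 1 \<and> \<bar>b i\<bar> \<le> sqrt (real d)"
    using s valid by (auto simp: w_def b_def)
  ultimately show ?thesis using en by blast
qed

lemma energy_minus_commute:
  "energy d (\<lambda>x. u x - v x) (\<lambda>i x. g i x - h i x) (\<lambda>x. u x - v x) (\<lambda>i x. g i x - h i x) =
   energy d (\<lambda>x. v x - u x) (\<lambda>i x. h i x - g i x) (\<lambda>x. v x - u x) (\<lambda>i x. h i x - g i x)"
proof -
  have sq: "(a - b) * (a - b) = (b - a) * (b - a)" for a b :: real by (simp add: algebra_simps)
  show ?thesis unfolding energy_def by (subst sq, subst (2) sq) simp
qed

section \<open>Approximation of the solution by a network\<close>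

context elliptic_problem
begin

text \<open>Budget in units of \<epsilon>^2: the polynomial is within 1/4 + 1/16 of u, the large
  network within 1/64 of the polynomial, the sampled network within 1/64 of the large one. Two uses
  of \<open>energy_diff_le\<close> give 2 (5/16) + 4 (1/64 + 1/64) = 3/4.\<close>

lemma network_approximation:
  assumes d: "d > 0" and p: "1 + lmin / lmax\<^sup>2 * ((real d)\<^sup>2 * l_A + l_c) \<le> p" "1 < p" and lf: "0 \<le> l_f"
    and \<epsilon>: "0 < \<epsilon>" and T: "(1 - lmin\<^sup>2 / lmax\<^sup>2) ^ T * energy d u g u g \<le> \<epsilon>\<^sup>2 / 4"
    and M: "M = lmin / lmax\<^sup>2 * l_f * (p ^ T - 1) / (2 * (p - 1))"
    and n: "n > 0" "(4 * sqrt (real d) * M)\<^sup>2 * (1 + 4 * real d) / real n \<le> \<epsilon>\<^sup>2 / 64"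
  shows "network_approximates d n M \<epsilon> u"
proof -
  have e16: "0 < \<epsilon>\<^sup>2 / 16" using \<epsilon> by simp
  obtain L where L: "trig_poly_norm d L \<le> M" "error_energy L \<le> \<epsilon>\<^sup>2 / 4 + \<epsilon>\<^sup>2 / 16"
    using iteration[OF e16 p lf, of T] T unfolding M by force
  have U: "0 \<le> trig_poly_norm d L"
    unfolding trig_poly_sum by (intro sum_nonneg mult_nonneg_nonneg) (auto intro: order_trans[OF zero_le_one frequency_weight_ge_1])
  then have M0: "0 \<le> M" using L(1) by linarith
  have dd: "0 < 8 * sqrt (real d + 1)" by simp
  \<comment> \<open>Errors \<eta> in the value and in each of the d derivatives contribute (d + 1)
    \<eta>^2, which is to equal \<epsilon>^2 / 64.\<close>
  define \<eta> where "\<eta> = \<epsilon> / (8 * sqrt (real d + 1))"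
  have \<eta>: "0 < \<eta>" using \<epsilon> dd by (simp add: \<eta>_def)
  have "c * (\<epsilon> / (8 * sqrt c))\<^sup>2 = \<epsilon>\<^sup>2 / 64" if "0 < c" for c
    using that by (simp add: power_divide power_mult_distrib)
  then have \<eta>2: "(real d + 1) * \<eta>\<^sup>2 = \<epsilon>\<^sup>2 / 64" unfolding \<eta>_def by simp
  let ?tp = "trig_poly d Z L" and ?dtp = "dtrig_poly d Z L"
  obtain \<gamma> Q where Q: "\<bar>\<gamma>\<bar> \<le> trig_poly_norm d L" "outer_weight Q \<le> 4 * sqrt (real d) * trig_poly_norm d L" "net_valid d Q"
    and err: "\<And>x. x \<in> cube d \<Longrightarrow> \<bar>?tp x - net d \<gamma> Q x\<bar> \<le> \<eta> \<and> (\<forall>i<d. \<bar>?dtp i x - dnet d Q i x\<bar> \<le> \<eta>)"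
    using net_approximable_trig_poly[OF d, of Z L] \<eta> unfolding net_approximable_def by blast
  have W: "outer_weight Q \<le> 4 * sqrt (real d) * M"
    using Q(2) mult_left_mono[OF L(1), of "4 * sqrt (real d)"] by simp
  have E1: "energy d (\<lambda>x. ?tp x - net d \<gamma> Q x) (\<lambda>i x. ?dtp i x - dnet d Q i x) (\<lambda>x. ?tp x - net d \<gamma> Q x) (\<lambda>i x. ?dtp i x - dnet d Q i x) \<le> \<epsilon>\<^sup>2 / 64"
  proof (rule energy_le_pointwise)
    fix x assume x: "x \<in> cube d"
    have "(\<Sum>i<d. (?dtp i x - dnet d Q i x)\<^sup>2) \<le> (\<Sum>i<d. \<eta>\<^sup>2)"
      using err[OF x] by (intro sum_mono abs_le_imp_square_le) auto
    moreover have "(?tp x - net d \<gamma> Q x)\<^sup>2 \<le> \<eta>\<^sup>2" using err[OF x] by (intro abs_le_imp_square_le) auto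
    ultimately show "(\<Sum>i<d. (?dtp i x - dnet d Q i x)\<^sup>2) + (?tp x - net d \<gamma> Q x)\<^sup>2 \<le> \<epsilon>\<^sup>2 / 64"
      unfolding \<eta>2[symmetric] by (simp add: distrib_right)
  qed simp
  obtain a w b where N: "(\<Sum>i=1..n. \<bar>a i\<bar>) \<le> 4 * sqrt (real d) * M"
      "\<forall>i\<in>{1..n}. L2_set (w i) {..<d} = 1 \<and> \<bar>b i\<bar> \<le> sqrt (real d)"
    and E2: "energy d (\<lambda>x. net d \<gamma> Q x - network d n \<gamma> a w b x) (\<lambda>i x. dnet d Q i x - dnetwork d n a w b i x)
      (\<lambda>x. net d \<gamma> Q x - network d n \<gamma> a w b x) (\<lambda>i x. dnet d Q i x - dnetwork d n a w b i x) \<le> \<epsilon>\<^sup>2 / 64"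
    using network_selection[OF d Q(3) W n(1), of \<gamma>] n(2) by (meson order_trans)
  let ?N = "network d n \<gamma> a w b" and ?dN = "dnetwork d n a w b"
  note wgN = weak_gradient_network[of d n \<gamma> a w b] and wgQ = weak_gradient_net[of d \<gamma> Q]
    and wgt = weak_gradient_trig_poly[of d Z L] and wgu = parts_weak_gradient[OF u_parts]
  have "energy d (\<lambda>x. ?N x - ?tp x) (\<lambda>i x. ?dN i x - ?dtp i x) (\<lambda>x. ?N x - ?tp x) (\<lambda>i x. ?dN i x - ?dtp i x) \<le> 2 * (\<epsilon>\<^sup>2 / 64) + 2 * (\<epsilon>\<^sup>2 / 64)"
    using energy_diff_le[OF wgN wgt wgQ] E1 E2
    unfolding energy_minus_commute[of d "network d n \<gamma> a w b" "net d \<gamma> Q" "dnetwork d n a w b" "dnet d Q"]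
      energy_minus_commute[of d "net d \<gamma> Q" "trig_poly d Z L" "dnet d Q" "dtrig_poly d Z L"] by linarith
  then have E: "energy d (\<lambda>x. ?N x - u x) (\<lambda>i x. ?dN i x - g i x) (\<lambda>x. ?N x - u x) (\<lambda>i x. ?dN i x - g i x) \<le> \<epsilon>\<^sup>2"
    using energy_diff_le[OF wgN wgu wgt] L(2) zero_le_power2[of \<epsilon>] unfolding error_energy_def by linarith
  have wg: "weak_gradient d (\<lambda>x. ?N x - u x) (\<lambda>i x. ?dN i x - g i x)"
    using weak_gradient_linear[OF wgN wgu, of 1 "-1"] by simp
  have "H1_norm d (\<lambda>x. ?N x - u x) \<le> sqrt (\<epsilon>\<^sup>2)"
    unfolding H1_norm_def H1_inner_eq_energy[OF wg wg] by (rule real_sqrt_le_mono[OF E])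
  then have H: "H1_norm d (\<lambda>x. ?N x - u x) \<le> \<epsilon>" using \<epsilon> by simp
  have "\<bar>\<gamma>\<bar> \<le> 2 * M" using Q(1) L(1) M0 by linarith
  then show ?thesis unfolding network_approximates_def using N H by blast
qed

text \<open>The equation tested with u gives lmin E \<le> (f, u) \<le> F sqrt E. The hypothesis on F
  refers to bounds s of the energy norm, a form that both dual norms provide.\<close>

lemma energy_solution_le:
  assumes F: "\<And>s. 0 < s \<Longrightarrow> energy d u g u g \<le> s\<^sup>2 \<Longrightarrow> (\<integral>x. f x * u x \<partial>cube_lebesgue d) \<le> F * s" and "0 \<le> F"
  shows "energy d u g u g \<le> (F / lmin)\<^sup>2"
proof -
  define E where "E = energy d u g u g"
  have E0: "0 \<le> E" unfolding E_def by (rule energy_nonneg)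
  have le: "lmin * E \<le> (\<integral>x. f x * u x \<partial>cube_lebesgue d)"
    using form_coercive[OF parts_weak_gradient[OF u_parts]] admissible_u unfolding E_def admissible_def by simp
  show ?thesis
  proof (cases "E = 0")
    case True
    then show ?thesis by (simp add: E_def)
  next
    case False
    then have pos: "0 < sqrt E" using E0 by simp
    have "lmin * (sqrt E * sqrt E) \<le> F * sqrt E" using le F[OF pos] E0 by (simp add: E_def)
    then have "(lmin * sqrt E) * sqrt E \<le> F * sqrt E" by (simp only: mult.assoc)
    then have "lmin * sqrt E \<le> F" using pos by (rule mult_right_le_imp_le)
    then have "sqrt E \<le> F / lmin" using lmin_pos by (simp add: pos_le_divide_eq mult.commute)
    then have "(sqrt E)\<^sup>2 \<le> (F / lmin)\<^sup>2" using pos by (intro power_mono) auto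
    then show ?thesis using E0 by (simp add: E_def)
  qed
qed

end

section \<open>The constants\<close>

text \<open>The steps are counted so that \<beta>^T F / lmin \<le> \<epsilon> / 2, where F / lmin
  bounds the norm of the solution and thus the error of the initial iterate 0. The claim is the
  square of this.\<close>

lemma num_steps_suffices:
  assumes "0 < lmin" "lmin \<le> lmax" "0 \<le> F" "0 < \<epsilon>"
  shows "(1 - lmin\<^sup>2 / lmax\<^sup>2) ^ num_steps lmin lmax F \<epsilon> * (F / lmin)\<^sup>2 \<le> \<epsilon>\<^sup>2 / 4"
proof -
  define \<beta> where "\<beta> = beta_star lmin lmax"
  define T where "T = num_steps lmin lmax F \<epsilon>"
  have lmax: "0 < lmax" using assms by linarith
  have "lmin\<^sup>2 \<le> lmax\<^sup>2" using assms by (intro power_mono) auto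
  then have q: "0 \<le> 1 - lmin\<^sup>2 / lmax\<^sup>2" "1 - lmin\<^sup>2 / lmax\<^sup>2 < 1" using lmax assms by auto
  have \<beta>2: "1 - lmin\<^sup>2 / lmax\<^sup>2 = \<beta>\<^sup>2" using q by (simp add: \<beta>_def beta_star_def)
  have \<beta>: "0 \<le> \<beta>" "\<beta> < 1" using q by (auto simp: \<beta>_def beta_star_def)
  have main: "\<beta> ^ T * (F / lmin) \<le> \<epsilon> / 2"
  \<comment> \<open>If \<beta> = 0, the convention T = 1 makes the power 0; if F = 0, the initial
    error is already 0.\<close>
  proof (cases "\<beta> = 0 \<or> F = 0")
    case True
    then show ?thesis using assms by (auto simp: T_def num_steps_def \<beta>_def)
  next
    case False
    then have \<beta>pos: "0 < \<beta>" and Fpos: "0 < F" using \<beta> assms by auto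
    define y where "y = 2 * F / (\<epsilon> * lmin)"
    have y: "0 < y" using Fpos assms by (simp add: y_def)
    have ln\<beta>: "ln \<beta> < 0" using \<beta>pos \<beta> by simp
    have "ln y / \<bar>ln \<beta>\<bar> \<le> log_plus y / \<bar>ln \<beta>\<bar>"
      using y by (intro divide_right_mono) (auto simp: log_plus_def)
    also have "\<dots> \<le> real T"
      unfolding T_def num_steps_def y_def[symmetric] using False by (simp add: \<beta>_def[symmetric]) linarith
    finally have "ln y / \<bar>ln \<beta>\<bar> \<le> real T" .
    moreover have "0 < \<bar>ln \<beta>\<bar>" using ln\<beta> by simp
    ultimately have "ln y \<le> real T * \<bar>ln \<beta>\<bar>" by (simp only: pos_divide_le_eq)
    then have "ln y + real T * ln \<beta> \<le> 0" using ln\<beta> by simp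
    then have "ln (y * \<beta> ^ T) \<le> 0" using y \<beta>pos by (simp add: ln_mult ln_realpow)
    then have "y * \<beta> ^ T \<le> 1" using y \<beta>pos by (simp add: ln_le_zero_iff)
    then show ?thesis using assms by (simp add: y_def field_simps)
  qed
  have "(\<beta> ^ T * (F / lmin))\<^sup>2 \<le> (\<epsilon> / 2)\<^sup>2"
    using main \<beta> assms by (intro power_mono) auto
  then show ?thesis
    unfolding \<beta>2 T_def[symmetric] by (simp add: power_mult_distrib power_divide power_mult[symmetric] mult.commute)
qed

text \<open>From \<epsilon> < 1/2 follows |ln \<epsilon>| \<ge> ln 2, so constants are absorbed into
  multiples of |ln \<epsilon>|, including the 1 lost in rounding up.\<close>

lemma num_steps_le:
  assumes "0 < lmin" "lmin \<le> lmax" "0 \<le> F"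
  shows "\<exists>\<kappa>>0. \<forall>\<epsilon>. 0 < \<epsilon> \<longrightarrow> \<epsilon> < 1 / 2 \<longrightarrow> real (num_steps lmin lmax F \<epsilon>) \<le> \<kappa> * \<bar>ln \<epsilon>\<bar>"
proof -
  define \<beta> where "\<beta> = beta_star lmin lmax"
  define K where "K = (\<bar>ln (2 * F / lmin)\<bar> / ln 2 + 1) / \<bar>ln \<beta>\<bar> + 1 / ln 2"
  have K: "0 < K" unfolding K_def by (intro add_nonneg_pos divide_nonneg_nonneg add_nonneg_nonneg) auto
  have "real (num_steps lmin lmax F \<epsilon>) \<le> K * \<bar>ln \<epsilon>\<bar>" if \<epsilon>: "0 < \<epsilon>" "\<epsilon> < 1 / 2" for \<epsilon>
  proof -
    define \<Lambda> where "\<Lambda> = \<bar>ln \<epsilon>\<bar>"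
    have "ln \<epsilon> \<le> ln (1 / 2)" using \<epsilon> by (subst ln_le_cancel_iff) auto
    moreover have ln2: "0 < ln (2::real)" by simp
    moreover have "ln (1 / 2) = - ln (2::real)" by (simp add: ln_div)
    ultimately have \<Lambda>: "\<Lambda> = - ln \<epsilon>" "ln 2 \<le> \<Lambda>" unfolding \<Lambda>_def by linarith+
    have one: "1 \<le> \<Lambda> / ln 2" using \<Lambda>(2) by simp
    have "real (num_steps lmin lmax F \<epsilon>) \<le> log_plus (2 * F / (\<epsilon> * lmin)) / \<bar>ln \<beta>\<bar> + 1"
    proof (cases "\<beta> = 0")
      case True
      then show ?thesis by (simp add: num_steps_def \<beta>_def)
    next
      case False
      have "0 \<le> log_plus (2 * F / (\<epsilon> * lmin)) / \<bar>ln \<beta>\<bar>" by (intro divide_nonneg_nonneg) (auto simp: log_plus_def)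
      then show ?thesis using False by (simp add: num_steps_def \<beta>_def)
    qed
    moreover have "log_plus (2 * F / (\<epsilon> * lmin)) \<le> (\<bar>ln (2 * F / lmin)\<bar> / ln 2 + 1) * \<Lambda>"
    proof -
      have "log_plus (2 * F / (\<epsilon> * lmin)) \<le> \<bar>ln (2 * F / lmin)\<bar> + \<Lambda>"
      proof (cases "F = 0")
        case True
        then show ?thesis by (simp add: log_plus_def \<Lambda>_def)
      next
        case False
        have "2 * F / (\<epsilon> * lmin) = (2 * F / lmin) / \<epsilon>" by simp
        then have "ln (2 * F / (\<epsilon> * lmin)) = ln (2 * F / lmin) - ln \<epsilon>"
          using False assms \<epsilon> by (simp only:) (subst ln_div, auto)
        then have "ln (2 * F / (\<epsilon> * lmin)) \<le> \<bar>ln (2 * F / lmin)\<bar> + \<Lambda>" "0 \<le> \<bar>ln (2 * F / lmin)\<bar> + \<Lambda>"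
          using \<Lambda> ln2 by linarith+
        moreover have "log_plus t \<le> max (ln t) 0" for t by (simp add: log_plus_def)
        ultimately show ?thesis by (meson max.boundedI order_trans)
      qed
      also have "\<bar>ln (2 * F / lmin)\<bar> \<le> \<bar>ln (2 * F / lmin)\<bar> * (\<Lambda> / ln 2)"
        using mult_left_mono[OF one, of "\<bar>ln (2 * F / lmin)\<bar>"] by simp
      finally show ?thesis by (simp add: algebra_simps)
    qed
    then have "log_plus (2 * F / (\<epsilon> * lmin)) / \<bar>ln \<beta>\<bar> \<le> (\<bar>ln (2 * F / lmin)\<bar> / ln 2 + 1) * \<Lambda> / \<bar>ln \<beta>\<bar>"
      by (intro divide_right_mono) auto
    ultimately have "real (num_steps lmin lmax F \<epsilon>) \<le> (\<bar>ln (2 * F / lmin)\<bar> / ln 2 + 1) * \<Lambda> / \<bar>ln \<beta>\<bar> + \<Lambda> / ln 2"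
      using one by linarith
    also have "\<dots> = K * \<Lambda>" by (simp add: K_def distrib_right)
    finally show ?thesis by (simp add: \<Lambda>_def)
  qed
  then show ?thesis using K by blast
qed

text \<open>Because d \<ge> 2 and |ln \<epsilon>| \<ge> ln 2, every factor becomes a power of d: a
  constant P \<ge> 1 is at most d^(ln P / ln 2), and 1 / \<epsilon> = exp |ln \<epsilon>| is at most
  d^(|ln \<epsilon>| / ln 2).\<close>

lemma width_and_bound:
  assumes pos: "0 < lambda_min a_min c_min" "lambda_min a_min c_min \<le> lambda_max a_max c_max"
    "0 \<le> l_A" "0 < l_c" "0 \<le> l_f" "0 \<le> F"
  shows "\<exists>C0>0. \<exists>C1>0. \<exists>C2>0. \<forall>d \<epsilon>. 2 \<le> d \<longrightarrow> 0 < \<epsilon> \<longrightarrow> \<epsilon> < 1 / 2 \<longrightarrow>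
    (\<exists>n>0. (4 * sqrt (real d) * M_bound d a_min a_max c_min c_max l_A l_c l_f F \<epsilon>)\<^sup>2 * (1 + 4 * real d) / real n \<le> \<epsilon>\<^sup>2 / 64 \<and>
      real n \<le> C0 * real d powr (C1 * \<bar>ln \<epsilon>\<bar>)) \<and>
    M_bound d a_min a_max c_min c_max l_A l_c l_f F \<epsilon> \<le> C0 * real d powr (C2 * \<bar>ln \<epsilon>\<bar>)"
proof -
  define lmin where "lmin = lambda_min a_min c_min"
  define lmax where "lmax = lambda_max a_max c_max"
  define \<alpha> where "\<alpha> = alpha_star lmin lmax"
  have l: "0 < lmin" "lmin \<le> lmax" using pos by (simp_all add: lmin_def lmax_def)
  then have \<alpha>: "0 < \<alpha>" by (simp add: \<alpha>_def alpha_star_def)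
  obtain \<kappa> where \<kappa>: "0 < \<kappa>" "\<And>\<epsilon>. 0 < \<epsilon> \<Longrightarrow> \<epsilon> < 1 / 2 \<Longrightarrow> real (num_steps lmin lmax F \<epsilon>) \<le> \<kappa> * \<bar>ln \<epsilon>\<bar>"
    using num_steps_le[OF l pos(6)] by blast
  define P where "P = (1 + pi) / pi * \<alpha> * l_A + \<alpha> * l_c + 1"
  have P1: "1 \<le> P" unfolding P_def using pos \<alpha> by (intro order_trans[OF _ add_right_mono[OF add_nonneg_nonneg]]) auto
  \<comment> \<open>The exponent in p \<le> P d^2 \<le> d^a.\<close>
  define a where "a = ln P / ln 2 + 2"
  have a: "0 < a" unfolding a_def using P1 by (intro add_nonneg_pos divide_nonneg_nonneg) auto
  define C2 where "C2 = a * \<kappa>"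
  \<comment> \<open>M is at most R p^T, because p - 1 \<ge> \<alpha> l_c and the factor \<alpha>
    cancels.\<close>
  define R where "R = l_f / (2 * l_c)"
  \<comment> \<open>2 C2 for the factor M^2 of the width, and 2 / ln 2 for each of the factors d^2
    and 1 / \<epsilon>^2.\<close>
  define C1 where "C1 = 2 * C2 + 4 / ln 2"
  \<comment> \<open>5120 = 5 * 1024 stands in front of M^2 d^2 / \<epsilon>^2, R bounds M, and 2
    pays for rounding the width up to a positive integer.\<close>
  define C0 where "C0 = 5120 * R\<^sup>2 + R + 2"
  have R: "0 \<le> R" using pos by (simp add: R_def)
  have C: "0 < C0" "0 < C1" "0 < C2"
    unfolding C0_def C1_def C2_def using R a \<kappa> by (auto intro!: add_pos_pos add_nonneg_pos add_nonneg_nonneg mult_pos_pos)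
  show ?thesis
  proof (rule exI[of _ C0], rule conjI[OF C(1)], rule exI[of _ C1], rule conjI[OF C(2)],
      rule exI[of _ C2], rule conjI[OF C(3)], intro allI impI conjI)
    fix d :: nat and \<epsilon> :: real
    assume d: "2 \<le> d" and \<epsilon>: "0 < \<epsilon>" "\<epsilon> < 1 / 2"
    define \<Lambda> where "\<Lambda> = \<bar>ln \<epsilon>\<bar>"
    have "ln \<epsilon> \<le> ln (1 / 2)" using \<epsilon> by (subst ln_le_cancel_iff) auto
    moreover have ln2: "0 < ln (2::real)" by simp
    moreover have "ln (1 / 2) = - ln (2::real)" by (simp add: ln_div)
    ultimately have \<Lambda>: "\<Lambda> = - ln \<epsilon>" "ln 2 \<le> \<Lambda>" unfolding \<Lambda>_def by linarith+
    have \<Lambda>0: "0 \<le> \<Lambda>" using \<Lambda>(2) ln2 by linarith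
    have rd: "2 \<le> real d" "0 < real d" "1 \<le> real d" using d by auto
    have lnd: "ln 2 \<le> ln (real d)" using rd by (subst ln_le_cancel_iff) auto
    define T where "T = num_steps lmin lmax F \<epsilon>"
    define p where "p = growth_factor \<alpha> l_A l_c d"
    define M where "M = M_bound d a_min a_max c_min c_max l_A l_c l_f F \<epsilon>"
    have M: "M = \<alpha> * l_f * (p ^ T - 1) / (2 * (p - 1))"
      unfolding M_def M_bound_def Let_def p_def T_def \<alpha>_def lmin_def lmax_def ..
    have p1: "\<alpha> * l_c \<le> p - 1" unfolding p_def growth_factor_def using pos \<alpha> by simp
    have lc: "0 < \<alpha> * l_c" using pos \<alpha> by simp
    then have p: "1 < p" using p1 by linarith
    have sq1: "1 \<le> (real d)\<^sup>2" using rd by simp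
    have "p \<le> P * (real d)\<^sup>2"
    proof -
      have "\<alpha> * l_c \<le> \<alpha> * l_c * (real d)\<^sup>2" using mult_left_mono[OF sq1, of "\<alpha> * l_c"] lc by simp
      then show ?thesis unfolding p_def growth_factor_def P_def using sq1 by (simp add: distrib_right)
    qed
    also have "P * (real d)\<^sup>2 \<le> real d powr a"
    proof -
      have "ln P \<le> (ln P / ln 2) * ln (real d)"
        using mult_left_mono[OF lnd, of "ln P / ln 2"] P1 ln2 by simp
      then have "exp (ln P) \<le> exp ((ln P / ln 2) * ln (real d))" by simp
      then have "P \<le> real d powr (ln P / ln 2)" using P1 rd by (simp add: powr_def)
      moreover have "(real d)\<^sup>2 = real d powr 2" using rd by (simp add: powr_numeral)
      ultimately show ?thesis unfolding a_def powr_add by (intro mult_mono) auto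
    qed
    finally have pa: "p \<le> real d powr a" .
    have "p ^ T \<le> (real d powr a) ^ T" using pa p by (intro power_mono) auto
    also have "\<dots> = real d powr (a * real T)" using rd by (simp add: powr_realpow[symmetric] powr_powr)
    also have "\<dots> \<le> real d powr (C2 * \<Lambda>)"
      using \<kappa>(2)[OF \<epsilon>] a rd unfolding C2_def T_def \<Lambda>_def by (intro powr_mono) (simp_all add: mult.assoc)
    finally have pT: "p ^ T \<le> real d powr (C2 * \<Lambda>)" .
    have pT0: "0 \<le> p ^ T" using p by simp
    have M0: "0 \<le> M" unfolding M using p pos \<alpha> one_le_power[of p T] by (intro divide_nonneg_nonneg mult_nonneg_nonneg) auto
    have "M \<le> \<alpha> * l_f * p ^ T / (2 * (\<alpha> * l_c))"
      unfolding M using p pos \<alpha> p1 lc pT0 by (intro frac_le mult_left_mono mult_nonneg_nonneg) auto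
    also have "\<dots> = R * p ^ T" using \<alpha> pos by (simp add: R_def)
    also have "\<dots> \<le> R * real d powr (C2 * \<Lambda>)" using pT R by (rule mult_left_mono)
    finally have MR: "M \<le> R * real d powr (C2 * \<Lambda>)" .
    also have "\<dots> \<le> C0 * real d powr (C2 * \<Lambda>)" by (intro mult_right_mono) (simp_all add: C0_def)
    finally show "M_bound d a_min a_max c_min c_max l_A l_c l_f F \<epsilon> \<le> C0 * real d powr (C2 * \<bar>ln \<epsilon>\<bar>)"
      unfolding M_def \<Lambda>_def .
    \<comment> \<open>The width at which the sampling error equals \<epsilon>^2 / 64; 1024 = 16 *
      64, with 16 from the square of 4 sqrt d.\<close>
    define X where "X = 1024 * real d * M\<^sup>2 * (1 + 4 * real d) / \<epsilon>\<^sup>2"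
    define n where "n = nat \<lceil>X\<rceil> + 1"
    have X0: "0 \<le> X" unfolding X_def using rd by (intro divide_nonneg_nonneg mult_nonneg_nonneg) auto
    have nX: "X \<le> real n" "real n \<le> X + 2" unfolding n_def using X0 by linarith+
    have n0: "0 < n" by (simp add: n_def)
    have e2: "(4 * sqrt (real d) * M)\<^sup>2 * (1 + 4 * real d) = X * \<epsilon>\<^sup>2 / 64"
      using \<epsilon> by (simp add: X_def power_mult_distrib)
    have "X * \<epsilon>\<^sup>2 / 64 / real n \<le> \<epsilon>\<^sup>2 / 64"
      using nX(1) n0 mult_right_mono[OF nX(1), of "\<epsilon>\<^sup>2"] by (simp add: pos_divide_le_eq mult.commute)
    then have 1: "(4 * sqrt (real d) * M)\<^sup>2 * (1 + 4 * real d) / real n \<le> \<epsilon>\<^sup>2 / 64" unfolding e2 .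
    have dp: "real d powr (2 * \<Lambda> / ln 2) = exp (2 * (\<Lambda> / ln 2) * ln (real d))" using rd by (simp add: powr_def)
    have "1 / \<epsilon>\<^sup>2 = exp (2 * \<Lambda>)"
    proof -
      have "exp \<Lambda> = 1 / \<epsilon>" using \<epsilon> by (simp add: \<Lambda>(1) exp_minus inverse_eq_divide)
      then show ?thesis by (simp add: exp_double power_divide)
    qed
    also have "\<dots> \<le> exp (2 * (\<Lambda> / ln 2) * ln (real d))"
      using mult_left_mono[OF lnd, of "\<Lambda> / ln 2"] \<Lambda>0 by simp
    finally have eps: "1 / \<epsilon>\<^sup>2 \<le> real d powr (2 * \<Lambda> / ln 2)" unfolding dp .
    have d2: "(real d)\<^sup>2 \<le> real d powr (2 * \<Lambda> / ln 2)"
    proof -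
      have "real d powr 2 \<le> real d powr (2 * \<Lambda> / ln 2)"
        using \<Lambda>(2) rd by (intro powr_mono) (simp_all add: pos_le_divide_eq)
      then show ?thesis using rd by (simp add: powr_numeral)
    qed
    have M2: "M\<^sup>2 \<le> R\<^sup>2 * real d powr (2 * C2 * \<Lambda>)"
    proof -
      have "M\<^sup>2 \<le> (R * real d powr (C2 * \<Lambda>))\<^sup>2" using MR M0 by (intro power_mono)
      also have "\<dots> = R\<^sup>2 * real d powr (2 * C2 * \<Lambda>)"
        by (simp add: power_mult_distrib power2_eq_square powr_add[symmetric] mult.assoc)
      finally show ?thesis .
    qed
    have "X \<le> 5120 * (M\<^sup>2 * ((real d)\<^sup>2 * (1 / \<epsilon>\<^sup>2)))"
    proof -
      have "real d * (1 + 4 * real d) \<le> 5 * (real d)\<^sup>2" using rd by (simp add: power2_eq_square distrib_left)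
      then have "(real d * (1 + 4 * real d)) * (1024 * M\<^sup>2 / \<epsilon>\<^sup>2) \<le> (5 * (real d)\<^sup>2) * (1024 * M\<^sup>2 / \<epsilon>\<^sup>2)"
        by (intro mult_right_mono) auto
      then show ?thesis by (simp add: X_def mult_ac)
    qed
    also have "\<dots> \<le> 5120 * ((R\<^sup>2 * real d powr (2 * C2 * \<Lambda>)) * (real d powr (2 * \<Lambda> / ln 2) * real d powr (2 * \<Lambda> / ln 2)))"
      by (intro mult_left_mono mult_mono[OF M2 mult_mono[OF d2 eps]]) auto
    also have "\<dots> = 5120 * R\<^sup>2 * real d powr (C1 * \<Lambda>)"
      by (simp add: C1_def powr_add[symmetric] distrib_right)
    finally have "X \<le> 5120 * R\<^sup>2 * real d powr (C1 * \<Lambda>)" .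
    moreover have "1 \<le> real d powr (C1 * \<Lambda>)" using rd C(2) \<Lambda>0 by (intro ge_one_powr_ge_zero) auto
    moreover have "0 \<le> R * real d powr (C1 * \<Lambda>)" using R by simp
    ultimately have 2: "real n \<le> C0 * real d powr (C1 * \<Lambda>)"
      unfolding C0_def distrib_right using nX(2) by linarith
    show "\<exists>n>0. (4 * sqrt (real d) * M_bound d a_min a_max c_min c_max l_A l_c l_f F \<epsilon>)\<^sup>2 * (1 + 4 * real d) / real n \<le> \<epsilon>\<^sup>2 / 64 \<and>
      real n \<le> C0 * real d powr (C1 * \<bar>ln \<epsilon>\<bar>)"
      using n0 1 2 unfolding M_def \<Lambda>_def by blast
  qed
qed

section \<open>Dual norms of the right-hand side\<close>

text \<open>A coordinate line through a point of the open cube stays inside for a short while, so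
  the derivatives there depend on values in the cube only.\<close>

lemma Ck_cong:
  "Ck m d \<phi> \<Longrightarrow> (\<And>x. x \<in> cube d \<Longrightarrow> \<phi> x = \<psi> x) \<Longrightarrow> Ck m d \<psi>"
proof (induction m arbitrary: \<phi> \<psi>)
  case 0
  then show ?case by (simp cong: continuous_on_cong)
next
  case (Suc m)
  have ev: "eventually (\<lambda>t. \<phi> (x(i := t)) = \<psi> (x(i := t))) (nhds (x i))" if "x \<in> cube d" "i < d" for x i
  proof -
    have "x i \<in> {0<..<1}" using cube_coordinate[OF that] by simp
    then have "eventually (\<lambda>t. t \<in> {0<..<1}) (nhds (x i))" by (intro eventually_nhds_in_open) auto
    then show ?thesis proof eventually_elim
      case (elim t)
      then show ?case using that by (intro Suc.prems(2) fun_upd_in_cube) auto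
    qed
  qed
  have "continuous_on (cube d) \<psi>"
    by (rule continuous_on_eq[OF _ Suc.prems(2)]) (use Suc.prems(1) in simp_all)
  moreover have "(\<lambda>t. \<psi> (x(i := t))) differentiable (at (x i))" if "x \<in> cube d" "i < d" for x i
  proof -
    have "(\<lambda>t. \<phi> (x(i := t))) differentiable (at (x i))" using Suc.prems(1) that by simp
    then obtain D where "((\<lambda>t. \<phi> (x(i := t))) has_real_derivative D) (at (x i))"
      unfolding real_differentiable_def by blast
    then have "((\<lambda>t. \<psi> (x(i := t))) has_real_derivative D) (at (x i))"
      using DERIV_cong_ev[OF refl ev[OF that] refl] by simp
    then show ?thesis unfolding real_differentiable_def by blast
  qed
  moreover have "Ck m d (partial_deriv i \<psi>)" if i: "i < d" for i
  proof (rule Suc.IH)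
    show "Ck m d (partial_deriv i \<phi>)" using Suc.prems(1) i by simp
    fix x assume "x \<in> cube d"
    then show "partial_deriv i \<phi> x = partial_deriv i \<psi> x"
      unfolding partial_deriv_def by (rule deriv_cong_ev[OF ev[OF _ i] refl])
  qed
  ultimately show ?case by simp
qed

lemma Ck_scale: "Ck m d \<phi> \<Longrightarrow> Ck m d (\<lambda>x. r * \<phi> x)"
proof (induction m arbitrary: \<phi>)
  case 0
  then show ?case by (auto intro: continuous_intros)
next
  case (Suc m)
  have D: "((\<lambda>t. r * \<phi> (x(i := t))) has_real_derivative r * partial_deriv i \<phi> x) (at (x i))"
    if "x \<in> cube d" "i < d" for x i
    using Suc.prems that
    by (intro DERIV_cmult) (auto simp: partial_deriv_def DERIV_deriv_iff_real_differentiable)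
  have "continuous_on (cube d) (\<lambda>x. r * \<phi> x)" using Suc.prems by (auto intro: continuous_intros)
  moreover have "(\<lambda>t. r * \<phi> (x(i := t))) differentiable (at (x i))" if "x \<in> cube d" "i < d" for x i
    using D[OF that] unfolding real_differentiable_def by blast
  moreover have "Ck m d (partial_deriv i (\<lambda>x. r * \<phi> x))" if i: "i < d" for i
  proof (rule Ck_cong)
    show "Ck m d (\<lambda>x. r * partial_deriv i \<phi> x)" using Suc.prems i by (intro Suc.IH) simp
    fix x assume "x \<in> cube d"
    from DERIV_imp_deriv[OF D[OF this i]]
    show "r * partial_deriv i \<phi> x = partial_deriv i (\<lambda>x. r * \<phi> x) x" by (simp add: partial_deriv_def)
  qed
  ultimately show ?case by simp
qed

lemma test_functions_scale: "\<phi> \<in> test_functions d \<Longrightarrow> (\<lambda>x. r * \<phi> x) \<in> test_functions d"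
  unfolding test_functions_def by (auto intro: Ck_scale)

lemma energy_scale:
  "energy d (\<lambda>x. r * u x) (\<lambda>i x. r * g i x) (\<lambda>x. r * u x) (\<lambda>i x. r * g i x) = r\<^sup>2 * energy d u g u g"
proof -
  have "energy d (\<lambda>x. r * u x) (\<lambda>i x. r * g i x) (\<lambda>x. r * u x) (\<lambda>i x. r * g i x) =
      (\<integral>x. r\<^sup>2 * ((\<Sum>i<d. g i x * g i x) + u x * u x) \<partial>cube_lebesgue d)"
    unfolding energy_def
    by (rule Bochner_Integration.integral_cong[OF refl])
       (simp add: power2_eq_square distrib_left sum_distrib_left mult_ac)
  then show ?thesis by (simp add: energy_def)
qed

lemma weak_gradient_scale: "weak_gradient d u g \<Longrightarrow> weak_gradient d (\<lambda>x. r * u x) (\<lambda>i x. r * g i x)"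
  using weak_gradient_linear[OF _ weak_gradient_0, of d u g r 0] by simp

lemma H1_norm_eq: "weak_gradient d u g \<Longrightarrow> H1_norm d u = sqrt (energy d u g u g)"
  by (simp add: H1_norm_def H1_inner_eq_energy)

lemma H10_scale:
  assumes v: "v \<in> H10 d" and "d > 0"
  shows "(\<lambda>x. r * v x) \<in> H10 d"
proof -
  have wv: "weak_gradient d v (\<lambda>i. weak_partial d i v)" using v by (intro H1_weak_gradient) (simp add: H10_def)
  obtain \<phi> where \<phi>: "\<And>n. \<phi> n \<in> test_functions d"
    and lim: "(\<lambda>n. energy d (\<lambda>x. v x - \<phi> n x) (\<lambda>i x. weak_partial d i v x - partial_deriv i (\<phi> n) x)
      (\<lambda>x. v x - \<phi> n x) (\<lambda>i x. weak_partial d i v x - partial_deriv i (\<phi> n) x)) \<longlonglongrightarrow> 0"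
    using energy_test_tendsto[OF v wv \<open>d > 0\<close>] by blast
  have wg: "weak_gradient d (\<lambda>x. v x - \<phi> n x) (\<lambda>i x. weak_partial d i v x - partial_deriv i (\<phi> n) x)" for n
    using weak_gradient_linear[OF wv weak_gradient_test_function[OF \<phi> \<open>d > 0\<close>], of 1 "-1"] by simp
  have eq: "(\<lambda>x. r * v x - r * \<phi> n x) = (\<lambda>x. r * (v x - \<phi> n x))" for n by (simp add: right_diff_distrib)
  have "(\<lambda>n. sqrt (r\<^sup>2 * energy d (\<lambda>x. v x - \<phi> n x) (\<lambda>i x. weak_partial d i v x - partial_deriv i (\<phi> n) x)
      (\<lambda>x. v x - \<phi> n x) (\<lambda>i x. weak_partial d i v x - partial_deriv i (\<phi> n) x))) \<longlonglongrightarrow> sqrt (r\<^sup>2 * 0)"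
    by (intro tendsto_real_sqrt tendsto_mult_left lim)
  then have "(\<lambda>n. H1_norm d (\<lambda>x. r * v x - r * \<phi> n x)) \<longlonglongrightarrow> 0"
    unfolding eq H1_norm_eq[OF weak_gradient_scale[OF wg]] energy_scale by simp
  moreover have "\<forall>n. (\<lambda>x. r * \<phi> n x) \<in> test_functions d" using \<phi> test_functions_scale by blast
  moreover have "(\<lambda>x. r * v x) \<in> H1 d" by (rule weak_gradient_H1[OF weak_gradient_scale[OF wv]])
  ultimately show ?thesis
    unfolding H10_def by (intro CollectI conjI exI[of _ "\<lambda>n x. r * \<phi> n x"])
qed

lemma integral_square_gradient:
  assumes "weak_gradient d u g"
  shows "(\<integral>x. (\<Sum>i<d. (weak_partial d i u x)\<^sup>2) \<partial>cube_lebesgue d) \<le> energy d u g u g"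
proof -
  note wu = H1_weak_gradient[OF weak_gradient_H1[OF assms]]
  have "(\<integral>x. (\<Sum>i<d. weak_partial d i u x * weak_partial d i u x) \<partial>cube_lebesgue d)
      \<le> energy d u (\<lambda>i. weak_partial d i u) u (\<lambda>i. weak_partial d i u)"
    unfolding energy_def
    by (intro integral_mono integrable_sum_mult integrable_energy wu) (use weak_gradient_L2(2)[OF wu] in auto)
  also have "\<dots> = energy d u g u g"
    unfolding H1_inner_eq_energy[OF wu wu, symmetric] by (rule H1_inner_eq_energy[OF assms assms])
  finally show ?thesis by (simp add: power2_eq_square)
qed

section \<open>The suprema defining the dual norms\<close>

text \<open>\<open>Sup\<close> is an upper bound once the set is known to be bounded above, which
  follows from the L2 norm of f. The second claim applies it to u scaled by 1 / s.\<close>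

lemma H1_dual_norm_bound:
  assumes f: "f \<in> L2 d"
  shows "0 \<le> H1_dual_norm d f"
    and "weak_gradient d u g \<Longrightarrow> 0 < s \<Longrightarrow> energy d u g u g \<le> s\<^sup>2 \<Longrightarrow>
      (\<integral>x. f x * u x \<partial>cube_lebesgue d) \<le> H1_dual_norm d f * s"
proof -
  let ?S = "{\<integral>x. f x * \<phi> x \<partial>cube_lebesgue d | \<phi>. \<phi> \<in> H1 d \<and> H1_norm d \<phi> \<le> 1}"
  \<comment> \<open>The added 1 makes K positive also when f has norm 0.\<close>
  define K where "K = sqrt (\<integral>x. (f x)\<^sup>2 \<partial>cube_lebesgue d) + 1"
  have f0: "0 \<le> (\<integral>x. (f x)\<^sup>2 \<partial>cube_lebesgue d)" by (rule integral_nonneg_AE) auto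
  then have K: "0 < K" unfolding K_def by (intro add_nonneg_pos) auto
  have fK: "(\<integral>x. (f x)\<^sup>2 \<partial>cube_lebesgue d) \<le> K\<^sup>2"
  proof -
    have "(sqrt (\<integral>x. (f x)\<^sup>2 \<partial>cube_lebesgue d))\<^sup>2 \<le> K\<^sup>2" unfolding K_def using f0 by (intro power_mono) auto
    then show ?thesis using f0 by simp
  qed
  have bdd: "bdd_above ?S"
  proof (rule bdd_aboveI[of _ "K * 2"])
    fix y assume "y \<in> ?S"
    then obtain \<phi> where y: "y = (\<integral>x. f x * \<phi> x \<partial>cube_lebesgue d)" and \<phi>: "\<phi> \<in> H1 d" "H1_norm d \<phi> \<le> 1" by blast
    note wg = H1_weak_gradient[OF \<phi>(1)]
    have "energy d \<phi> (\<lambda>i. weak_partial d i \<phi>) \<phi> (\<lambda>i. weak_partial d i \<phi>) \<le> 1"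
      using \<phi>(2) unfolding H1_norm_eq[OF wg] by simp
    then have "(\<integral>x. (\<phi> x)\<^sup>2 \<partial>cube_lebesgue d) \<le> 1" using integral_square_le_energy(1)[OF wg] by linarith
    then have "K * (1 + (\<integral>x. (\<phi> x)\<^sup>2 \<partial>cube_lebesgue d)) \<le> K * 2" using K by (intro mult_left_mono) auto
    then show "y \<le> K * 2"
      using abs_integral_mult_le[OF f weak_gradient_L2(1)[OF wg] K fK] unfolding y by linarith
  qed
  have sup: "(\<integral>x. f x * \<phi> x \<partial>cube_lebesgue d) \<le> H1_dual_norm d f" if "\<phi> \<in> H1 d" "H1_norm d \<phi> \<le> 1" for \<phi>
    unfolding H1_dual_norm_def using that by (intro cSup_upper bdd) blast
  have "(\<lambda>x. 0) \<in> H1 d" "H1_norm d (\<lambda>x. 0) \<le> 1"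
    using weak_gradient_H1[OF weak_gradient_0] H1_norm_eq[OF weak_gradient_0] by (auto simp: energy_def)
  from sup[OF this] show "0 \<le> H1_dual_norm d f" by simp
  assume u: "weak_gradient d u g" and s: "0 < s" "energy d u g u g \<le> s\<^sup>2"
  note wg = weak_gradient_scale[OF u, of "1 / s"]
  have "(1 / s)\<^sup>2 * energy d u g u g \<le> 1" using s by (simp add: power_divide pos_divide_le_eq)
  then have "H1_norm d (\<lambda>x. 1 / s * u x) \<le> 1" unfolding H1_norm_eq[OF wg] energy_scale by simp
  from sup[OF weak_gradient_H1[OF wg] this]
  have "(\<integral>x. f x * u x \<partial>cube_lebesgue d) / s \<le> H1_dual_norm d f" by simp
  then show "(\<integral>x. f x * u x \<partial>cube_lebesgue d) \<le> H1_dual_norm d f * s" using s(1) by (simp add: pos_divide_le_eq)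
qed

text \<open>The constraint on \<phi> bounds its gradient only, so boundedness of the set calls for a
  Poincare-type estimate. It is drawn from the sine expansion of f: integration by parts in
  coordinate 0 bounds each integral of \<phi> against a sine product by the gradient, since the
  frequency in that coordinate is at least 1.\<close>

lemma Hminus1_norm_bound:
  assumes d: "0 < d" and f: "f \<in> barron_space d (trig d {..<d}) {..<d} 0"
  shows "0 \<le> Hminus1_norm d f"
    and "u \<in> H10 d \<Longrightarrow> weak_gradient d u g \<Longrightarrow> 0 < s \<Longrightarrow> energy d u g u g \<le> s\<^sup>2 \<Longrightarrow>
      (\<integral>x. f x * u x \<partial>cube_lebesgue d) \<le> Hminus1_norm d f * s"
proof -
  have f2: "f \<in> L2 d" using f by (simp add: barron_space_def)
  let ?S = "{\<integral>x. f x * \<phi> x \<partial>cube_lebesgue d | \<phi>. \<phi> \<in> H10 d \<and> grad_norm d \<phi> \<le> 1}"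
  define l where "l = barron_norm d (trig d {..<d}) {..<d} 0 f"
  have bdd: "bdd_above ?S"
  proof (rule bdd_aboveI[of _ "l + 1"])
    fix y assume "y \<in> ?S"
    then obtain \<phi> where y: "y = (\<integral>x. f x * \<phi> x \<partial>cube_lebesgue d)" and \<phi>: "\<phi> \<in> H10 d" "grad_norm d \<phi> \<le> 1" by blast
    have wg: "weak_gradient d \<phi> (\<lambda>i. weak_partial d i \<phi>)" using \<phi>(1) by (intro H1_weak_gradient) (simp add: H10_def)
    note \<phi>2 = weak_gradient_L2(1)[OF wg] and h2 = weak_gradient_L2(2)[OF wg d]
    have "(\<integral>x. (\<Sum>i<d. (weak_partial d i \<phi> x)\<^sup>2) \<partial>cube_lebesgue d) \<le> 1"
      using \<phi>(2) by (simp add: grad_norm_def)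
    moreover have "(\<integral>x. (weak_partial d 0 \<phi> x)\<^sup>2 \<partial>cube_lebesgue d) \<le> (\<integral>x. (\<Sum>i<d. (weak_partial d i \<phi> x)\<^sup>2) \<partial>cube_lebesgue d)"
      using d weak_gradient_L2(2)[OF wg]
      by (intro integral_mono L2_square Bochner_Integration.integrable_sum member_le_sum) auto
    ultimately have h1: "(\<integral>x. (weak_partial d 0 \<phi> x)\<^sup>2 \<partial>cube_lebesgue d) \<le> 1" by linarith
    \<comment> \<open>The constant 2 matches the weight of order 0, which is 2 |a_k|, so the finite
      sum is bounded by the Barron norm.\<close>
    have trig: "\<bar>\<integral>x. trig d {..<d} k x * \<phi> x \<partial>cube_lebesgue d\<bar> \<le> 2" if k: "k 0 \<noteq> 0" for k
    proof -
      let ?t = "trig d (sdiff {..<d} {0}) k"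
      have "(\<integral>x. (?t x)\<^sup>2 \<partial>cube_lebesgue d) \<le> 1\<^sup>2"
        by (rule integral_le_bound) (auto simp: abs_square_le_1 abs_trig_le_1)
      from abs_integral_mult_le[OF trig_L2 h2 _ this]
      have "\<bar>\<integral>x. ?t x * weak_partial d 0 \<phi> x \<partial>cube_lebesgue d\<bar> \<le> 2" using h1 by simp
      moreover have "(\<integral>x. ?t x * weak_partial d 0 \<phi> x \<partial>cube_lebesgue d) =
          trig_sign {..<d} 0 * (pi * real (k 0)) * (\<integral>x. trig d {..<d} k x * \<phi> x \<partial>cube_lebesgue d)"
        using parts_Dirichlet[OF \<phi>(1) wg] d unfolding parts_def by blast
      ultimately have le: "(pi * real (k 0)) * \<bar>\<integral>x. trig d {..<d} k x * \<phi> x \<partial>cube_lebesgue d\<bar> \<le> 2"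
        by (simp add: abs_mult abs_trig_sign)
      have "1 * 1 \<le> pi * real (k 0)" using k pi_ge_two by (intro mult_mono) auto
      then have "1 * \<bar>\<integral>x. trig d {..<d} k x * \<phi> x \<partial>cube_lebesgue d\<bar> \<le>
          (pi * real (k 0)) * \<bar>\<integral>x. trig d {..<d} k x * \<phi> x \<partial>cube_lebesgue d\<bar>" by (intro mult_right_mono) auto
      then show ?thesis using le by linarith
    qed
    \<comment> \<open>The tolerance depends on \<phi>, whose L2 norm is uncontrolled here. The
      truncation error is thereby at most 1 for every \<phi>, and the bound l + 1 is
      uniform.\<close>
    define \<tau> where "\<tau> = 1 / (1 + (\<integral>x. (\<phi> x)\<^sup>2 \<partial>cube_lebesgue d))"
    have "0 \<le> (\<integral>x. (\<phi> x)\<^sup>2 \<partial>cube_lebesgue d)" by (rule integral_nonneg_AE) auto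
    then have "0 < 1 + (\<integral>x. (\<phi> x)\<^sup>2 \<partial>cube_lebesgue d)" by linarith
    then have \<tau>: "0 < \<tau>" "\<tau> * (1 + (\<integral>x. (\<phi> x)\<^sup>2 \<partial>cube_lebesgue d)) = 1" by (simp_all add: \<tau>_def)
    obtain F a where F: "finite F" "\<forall>k. (\<exists>m\<in>{..<d}. k m = 0) \<longrightarrow> a k = 0" "(\<Sum>k\<in>F. weighted d 0 a k) \<le> l"
      "(\<integral>x. (f x - (\<Sum>k\<in>F. a k * trig d {..<d} k x))\<^sup>2 \<partial>cube_lebesgue d) < \<tau>\<^sup>2"
      using barron_truncation[OF f zero_less_power[OF \<tau>(1), of 2]] unfolding l_def by blast
    let ?fF = "\<lambda>x. \<Sum>k\<in>F. a k * trig d {..<d} k x"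
    have fF2: "?fF \<in> L2 d" by (rule trig_sum_L2[OF F(1)])
    have "\<bar>\<integral>x. (f x - ?fF x) * \<phi> x \<partial>cube_lebesgue d\<bar> \<le> 1"
      using abs_integral_mult_le[OF L2_diff[OF f2 fF2] \<phi>2 \<tau>(1) less_imp_le[OF F(4)]] unfolding \<tau>(2) .
    moreover have "(\<integral>x. (f x - ?fF x) * \<phi> x \<partial>cube_lebesgue d) = y - (\<integral>x. ?fF x * \<phi> x \<partial>cube_lebesgue d)"
      unfolding left_diff_distrib y by (intro Bochner_Integration.integral_diff L2_mult_integrable f2 fF2 \<phi>2)
    moreover have "(\<integral>x. ?fF x * \<phi> x \<partial>cube_lebesgue d) \<le> l"
    proof -
      have "(\<integral>x. ?fF x * \<phi> x \<partial>cube_lebesgue d) = (\<Sum>k\<in>F. a k * (\<integral>x. trig d {..<d} k x * \<phi> x \<partial>cube_lebesgue d))"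
        using \<phi>2 trig_L2 by (simp add: sum_distrib_right mult.assoc Bochner_Integration.integral_sum L2_mult_integrable)
      also have "\<dots> \<le> (\<Sum>k\<in>F. weighted d 0 a k)"
      proof (rule sum_mono)
        fix k
        show "a k * (\<integral>x. trig d {..<d} k x * \<phi> x \<partial>cube_lebesgue d) \<le> weighted d 0 a k"
        proof (cases "k 0 = 0")
          case True
          then have "a k = 0" using F(2) d by blast
          then show ?thesis by (simp add: weighted_def)
        next
          case False
          have "a k * (\<integral>x. trig d {..<d} k x * \<phi> x \<partial>cube_lebesgue d) \<le> \<bar>a k\<bar> * \<bar>\<integral>x. trig d {..<d} k x * \<phi> x \<partial>cube_lebesgue d\<bar>"
            by (simp flip: abs_mult)
          also have "\<dots> \<le> \<bar>a k\<bar> * 2" using trig[of k, OF False] by (intro mult_left_mono) auto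
          finally show ?thesis by (simp add: weighted_def)
        qed
      qed
      finally show ?thesis using F(3) by linarith
    qed
    ultimately show "y \<le> l + 1" by linarith
  qed
  have sup: "(\<integral>x. f x * \<phi> x \<partial>cube_lebesgue d) \<le> Hminus1_norm d f" if "\<phi> \<in> H10 d" "grad_norm d \<phi> \<le> 1" for \<phi>
    unfolding Hminus1_norm_def using that by (intro cSup_upper bdd) blast
  have grad: "grad_norm d v \<le> 1" if "weak_gradient d v k" "energy d v k v k \<le> 1" for v k
    using integral_square_gradient[OF that(1)] that(2) by (simp add: grad_norm_def)
  have "(\<lambda>x. 0) \<in> H10 d" using H10_scale[OF trig_H10[OF d] d, of 0] by simp
  moreover have "grad_norm d (\<lambda>x. 0) \<le> 1" by (rule grad[OF weak_gradient_0]) (simp add: energy_def)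
  ultimately show "0 \<le> Hminus1_norm d f" using sup by force
  assume u: "u \<in> H10 d" "weak_gradient d u g" and s: "0 < s" "energy d u g u g \<le> s\<^sup>2"
  have "(1 / s)\<^sup>2 * energy d u g u g \<le> 1" using s by (simp add: power_divide pos_divide_le_eq)
  then have "grad_norm d (\<lambda>x. 1 / s * u x) \<le> 1"
    by (intro grad[OF weak_gradient_scale[OF u(2), of "1 / s"]]) (simp only: energy_scale)
  from sup[OF H10_scale[OF u(1) d] this]
  have "(\<integral>x. f x * u x \<partial>cube_lebesgue d) / s \<le> Hminus1_norm d f" by simp
  then show "(\<integral>x. f x * u x \<partial>cube_lebesgue d) \<le> Hminus1_norm d f * s" using s(1) by (simp add: pos_divide_le_eq)
qed

section \<open>The theorem\<close>

lemma cube_nonempty: "(\<lambda>i\<in>{..<d}. 1 / 2) \<in> cube d"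
  by (auto simp: cube_def)

text \<open>The quotients of the operator norm bound A(x) v whenever v has a nonzero coordinate
  below d; otherwise both sides of the squared bound are 0.\<close>

lemma elliptic_coefficients_basic:
  assumes d: "0 < d" and basic: "basic_assumptions d A c f a_min a_max c_min c_max"
  shows "elliptic_coefficients d A c (lambda_min a_min c_min) (lambda_max a_max c_max)"
proof -
  have bd: "bdd_above (op_norm_quotients d A)" "a_max = Sup (op_norm_quotients d A)"
    and cm: "0 < a_min" "0 < c_min" "\<And>x. x \<in> cube d \<Longrightarrow> c_min \<le> c x \<and> c x \<le> c_max"
    and low: "\<And>x v. x \<in> cube d \<Longrightarrow> a_min * (L2_set v {..<d})\<^sup>2 \<le> (\<Sum>i<d. \<Sum>j<d. v i * A x i j * v j)"
    using basic by (auto simp: basic_assumptions_def)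
  have quot: "L2_set (\<lambda>i. \<Sum>j<d. A x i j * v j) {..<d} / L2_set v {..<d} \<le> a_max" if "x \<in> cube d" "\<exists>i<d. v i \<noteq> 0" for x v
    unfolding bd(2) using that by (intro cSup_upper bd(1)) (auto simp: op_norm_quotients_def)
  have "0 \<le> L2_set (\<lambda>i. \<Sum>j<d. A (\<lambda>i\<in>{..<d}. 1 / 2) i j * 1) {..<d} / L2_set (\<lambda>_. 1) {..<d}"
    by (intro divide_nonneg_nonneg L2_set_nonneg)
  also have "\<dots> \<le> a_max" using d by (intro quot[OF cube_nonempty]) auto
  finally have amax: "0 \<le> a_max" .
  have cmm: "c_min \<le> c_max" using cm(3)[OF cube_nonempty] by linarith
  show ?thesis
  proof
    show "0 < lambda_min a_min c_min" using cm by (simp add: lambda_min_def)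
    show "lambda_min a_min c_min \<le> lambda_max a_max c_max"
      using cmm unfolding lambda_min_def lambda_max_def by linarith
    show "c \<in> borel_measurable (cube_lebesgue d)"
      "\<And>i j. i < d \<Longrightarrow> j < d \<Longrightarrow> (\<lambda>x. A x i j) \<in> borel_measurable (cube_lebesgue d)"
      "\<And>x i j. x \<in> cube d \<Longrightarrow> i < d \<Longrightarrow> j < d \<Longrightarrow> A x i j = A x j i"
      using basic by (auto simp: basic_assumptions_def)
    show "lambda_min a_min c_min \<le> c x \<and> c x \<le> lambda_max a_max c_max" if "x \<in> cube d" for x
      using cm(3)[OF that] unfolding lambda_min_def lambda_max_def by linarith
    fix x v assume x: "x \<in> cube d"
    have "lambda_min a_min c_min * (\<Sum>i<d. (v i)\<^sup>2) \<le> a_min * (\<Sum>i<d. (v i)\<^sup>2)"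
      unfolding lambda_min_def by (intro mult_right_mono sum_nonneg) auto
    also have "\<dots> \<le> (\<Sum>i<d. \<Sum>j<d. v i * A x i j * v j)"
      using low[OF x, of v] by (simp add: L2_set_def sum_nonneg)
    also have "\<dots> = (\<Sum>i<d. (\<Sum>j<d. A x i j * v j) * v i)"
      unfolding sum_distrib_right by (intro sum.cong refl) (simp add: mult_ac)
    finally show "lambda_min a_min c_min * (\<Sum>i<d. (v i)\<^sup>2) \<le> (\<Sum>i<d. (\<Sum>j<d. A x i j * v j) * v i)" .
    show "(\<Sum>i<d. (\<Sum>j<d. A x i j * v j)\<^sup>2) \<le> (lambda_max a_max c_max)\<^sup>2 * (\<Sum>i<d. (v i)\<^sup>2)"
    proof (cases "\<exists>i<d. v i \<noteq> 0")
      case True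
      then have "L2_set v {..<d} \<noteq> 0" by (auto simp: L2_set_eq_0_iff)
      then have pos: "0 < L2_set v {..<d}" using L2_set_nonneg[of v "{..<d}"] by linarith
      have "L2_set (\<lambda>i. \<Sum>j<d. A x i j * v j) {..<d} \<le> a_max * L2_set v {..<d}"
        using quot[OF x True] pos by (simp add: pos_divide_le_eq)
      also have "\<dots> \<le> lambda_max a_max c_max * L2_set v {..<d}"
        unfolding lambda_max_def by (intro mult_right_mono L2_set_nonneg) auto
      finally have "(L2_set (\<lambda>i. \<Sum>j<d. A x i j * v j) {..<d})\<^sup>2 \<le> (lambda_max a_max c_max * L2_set v {..<d})\<^sup>2"
        by (intro power_mono L2_set_nonneg)
      then show ?thesis by (simp add: L2_set_def sum_nonneg power_mult_distrib)
    next
      case False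
      then show ?thesis by simp
    qed
  qed
qed

text \<open>Diagonal entries have type \<open>{}\<close>, the others type \<open>{i, j}\<close>;
  both equal \<open>sdiff {i} {j}\<close>, so one statement covers the matrix. Each norm is below
  the maximum of a finite set.\<close>

lemma truncation_A:
  assumes barron: "barron_assumptions d A c l_A l_c" and ij: "i < d" "j < d" "0 < \<tau>"
  shows "\<exists>F b. finite F \<and> (\<Sum>l\<in>F. weighted d 1 b l) \<le> l_A \<and>
    (\<integral>x. (A x i j - (\<Sum>l\<in>F. b l * trig d (sdiff {i} {j}) l x))\<^sup>2 \<partial>cube_lebesgue d) < \<tau>"
proof (cases "i = j")
  case True
  have s: "sdiff {i} {j} = {}" using True by (auto simp: mem_sdiff)
  have A: "(\<lambda>x. A x i i) \<in> barron_space d (trig d {}) {} 1"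
    using barron ij by (simp add: barron_assumptions_def barron_space_c_def cos_basis_eq)
  have "barron_norm d (trig d {}) {} 1 (\<lambda>x. A x i i) \<le> Max {barron_norm_c d 1 (\<lambda>x. A x i i) | i. i < d}"
    using ij by (intro Max_ge) (auto simp: barron_norm_c_def cos_basis_eq)
  also have "\<dots> \<le> l_A" using barron by (simp add: barron_assumptions_def ell_A_def)
  finally show ?thesis
    using barron_truncation[OF A ij(3)] True unfolding s by (meson order_trans)
next
  case False
  have s: "sdiff {i} {j} = {i, j}" using False by (auto simp: mem_sdiff)
  have A: "(\<lambda>x. A x i j) \<in> barron_space d (trig d {i, j}) {i, j} 1"
    using barron ij False by (simp add: barron_assumptions_def barron_space_mixed_def mixed_basis_eq)
  have fin: "finite {barron_norm_mixed d i j 1 (\<lambda>x. A x i j) | i j. i < d \<and> j < d \<and> i \<noteq> j}"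
  proof (rule finite_subset)
    show "{barron_norm_mixed d i j 1 (\<lambda>x. A x i j) | i j. i < d \<and> j < d \<and> i \<noteq> j} \<subseteq>
        (\<lambda>p. barron_norm_mixed d (fst p) (snd p) 1 (\<lambda>x. A x (fst p) (snd p))) ` ({..<d} \<times> {..<d})" by force
  qed auto
  have "barron_norm d (trig d {i, j}) {i, j} 1 (\<lambda>x. A x i j) = barron_norm_mixed d i j 1 (\<lambda>x. A x i j)"
    using ij False by (simp add: barron_norm_mixed_def mixed_basis_eq)
  also have "\<dots> \<le> Max {barron_norm_mixed d i j 1 (\<lambda>x. A x i j) | i j. i < d \<and> j < d \<and> i \<noteq> j}"
    using ij False by (intro Max_ge[OF fin]) blast
  also have "\<dots> \<le> l_A" using barron by (simp add: barron_assumptions_def ell_A_def)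
  finally show ?thesis
    using barron_truncation[OF A ij(3)] unfolding s by (meson order_trans)
qed

lemma elliptic_problem_solution:
  assumes d: "0 < d" and basic: "basic_assumptions d A c f a_min a_max c_min c_max"
    and barron: "barron_assumptions d A c l_A l_c"
    and f: "f \<in> barron_space d (trig d Z) Z 0" and lf: "l_f = barron_norm d (trig d Z) Z 0 f"
    and u: "u \<in> H1 d" "parts d Z u (\<lambda>i. weak_partial d i u)"
    and trig: "\<And>k. parts d Z (trig d Z k) (dtrig d Z k)"
    and weak: "weak_identity d A c f u u" "\<And>k. weak_identity d A c f u (trig d Z k)"
  shows "elliptic_problem d A c (lambda_min a_min c_min) (lambda_max a_max c_max) Z f l_A l_c l_f u (\<lambda>i. weak_partial d i u)"
proof -
  interpret elliptic_coefficients d A c "lambda_min a_min c_min" "lambda_max a_max c_max"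
    by (rule elliptic_coefficients_basic[OF d basic])
  have f2: "f \<in> L2 d" using f by (simp add: barron_space_def)
  have c: "c \<in> barron_space d (trig d {}) {} 2" "l_c = barron_norm d (trig d {}) {} 2 c"
    using barron by (simp_all add: barron_assumptions_def barron_space_c_def barron_norm_c_def cos_basis_eq)
  show ?thesis
  proof
    show "\<exists>F b. finite F \<and> (\<Sum>l\<in>F. weighted d 2 b l) \<le> l_c \<and>
      (\<integral>x. (c x - (\<Sum>l\<in>F. b l * trig d {} l x))\<^sup>2 \<partial>cube_lebesgue d) < \<tau>" if "0 < \<tau>" for \<tau>
      using barron_truncation[OF c(1) that] unfolding c(2) by blast
    show "\<exists>F b. finite F \<and> (\<Sum>l\<in>F. weighted d 0 b l) \<le> l_f \<and>
      (\<integral>x. (f x - (\<Sum>l\<in>F. b l * trig d Z l x))\<^sup>2 \<partial>cube_lebesgue d) < \<tau>" if "0 < \<tau>" for \<tau>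
      using barron_truncation[OF f that] unfolding lf by blast
    show "form u (\<lambda>i. weak_partial d i u) u (\<lambda>i. weak_partial d i u) = (\<integral>x. f x * u x \<partial>cube_lebesgue d)"
      by (rule weak_identity_form[OF u(1) H1_weak_gradient[OF u(1)] f2 weak(1)])
    show "form u (\<lambda>i. weak_partial d i u) (trig d Z k) (dtrig d Z k) = (\<integral>x. f x * trig d Z k x \<partial>cube_lebesgue d)" for k
      by (rule weak_identity_form[OF u(1) weak_gradient_trig f2 weak(2)])
  qed (use f2 truncation_A[OF barron] u trig in auto)
qed

text \<open>\<open>0 \<le> l_A\<close> because some truncation has its nonnegative coefficient sum
  below it, and \<open>0 < l_c\<close> because c is bounded below by a positive number. The latter
  makes p(d) exceed 1, so \<open>M_bound\<close> divides by a positive number.\<close>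

lemma constants_admissible:
  assumes d: "2 \<le> d" and basic: "basic_assumptions d A c f a_min a_max c_min c_max"
    and barron: "barron_assumptions d A c l_A l_c"
  shows "0 < lambda_min a_min c_min" "lambda_min a_min c_min \<le> lambda_max a_max c_max" "0 \<le> l_A" "0 < l_c"
proof -
  have d0: "0 < d" using d by simp
  interpret elliptic_coefficients d A c "lambda_min a_min c_min" "lambda_max a_max c_max"
    by (rule elliptic_coefficients_basic[OF d0 basic])
  show "0 < lambda_min a_min c_min" "lambda_min a_min c_min \<le> lambda_max a_max c_max"
    by (rule lmin_pos lmin_le_lmax)+
  obtain F b where "(\<Sum>l\<in>F. weighted d 1 b l) \<le> l_A"
    using truncation_A[OF barron d0 d0, of 1] by auto
  moreover have "0 \<le> (\<Sum>l\<in>F. weighted d 1 b l)" by (intro sum_nonneg weighted_nonneg)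
  ultimately show "0 \<le> l_A" by linarith
  have c: "c \<in> barron_space d (trig d {}) {} 2" "l_c = barron_norm d (trig d {}) {} 2 c"
    using barron by (simp_all add: barron_assumptions_def barron_space_c_def barron_norm_c_def cos_basis_eq)
  show "0 < l_c" unfolding c(2) using c_bounds by (intro barron_norm_pos[OF c(1) lmin_pos]) blast
qed

text \<open>The growth factor of the iteration is 1 + \<alpha> (d^2 l_A + l_c), which is at most
  p(d) since (1 + pi) / pi \<ge> 1.\<close>

lemma network_for_solution:
  assumes d: "2 \<le> d" and pos: "0 \<le> l_A" "0 < l_c" "0 \<le> l_f" "0 \<le> F"
    and P: "elliptic_problem d A c (lambda_min a_min c_min) (lambda_max a_max c_max) Z f l_A l_c l_f u g"
    and F: "\<And>s. 0 < s \<Longrightarrow> energy d u g u g \<le> s\<^sup>2 \<Longrightarrow> (\<integral>x. f x * u x \<partial>cube_lebesgue d) \<le> F * s"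
    and \<epsilon>: "0 < \<epsilon>"
    and n: "0 < n" "(4 * sqrt (real d) * M_bound d a_min a_max c_min c_max l_A l_c l_f F \<epsilon>)\<^sup>2 * (1 + 4 * real d) / real n \<le> \<epsilon>\<^sup>2 / 64"
  shows "network_approximates d n (M_bound d a_min a_max c_min c_max l_A l_c l_f F \<epsilon>) \<epsilon> u"
proof -
  let ?lmin = "lambda_min a_min c_min" and ?lmax = "lambda_max a_max c_max"
  interpret elliptic_problem d A c ?lmin ?lmax Z f l_A l_c l_f u g by (rule P)
  define \<alpha> where "\<alpha> = alpha_star ?lmin ?lmax"
  define p where "p = growth_factor \<alpha> l_A l_c d"
  define T where "T = num_steps ?lmin ?lmax F \<epsilon>"
  have \<alpha>: "\<alpha> = ?lmin / ?lmax\<^sup>2" "0 < \<alpha>" using lmin_pos lmin_le_lmax by (simp_all add: \<alpha>_def alpha_star_def)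
  have "1 \<le> (1 + pi) / pi" by simp
  then have "1 * (\<alpha> * l_A * (real d)\<^sup>2) \<le> (1 + pi) / pi * (\<alpha> * l_A * (real d)\<^sup>2)"
    using \<alpha> pos by (intro mult_right_mono mult_nonneg_nonneg) auto
  then have p: "1 + ?lmin / ?lmax\<^sup>2 * ((real d)\<^sup>2 * l_A + l_c) \<le> p"
    unfolding \<alpha>(1)[symmetric] p_def growth_factor_def by (simp add: algebra_simps)
  have "0 < \<alpha> * ((real d)\<^sup>2 * l_A + l_c)" using \<alpha> pos by (intro mult_pos_pos add_nonneg_pos) auto
  then have p1: "1 < p" using p unfolding \<alpha>(1)[symmetric] by linarith
  have M: "M_bound d a_min a_max c_min c_max l_A l_c l_f F \<epsilon> = ?lmin / ?lmax\<^sup>2 * l_f * (p ^ T - 1) / (2 * (p - 1))"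
    unfolding M_bound_def Let_def p_def T_def \<alpha>_def \<alpha>(1)[symmetric] \<alpha>(1)[unfolded \<alpha>_def, symmetric] ..
  have "?lmin\<^sup>2 \<le> ?lmax\<^sup>2" using lmin_pos lmin_le_lmax by (intro power_mono) auto
  then have "0 \<le> 1 - ?lmin\<^sup>2 / ?lmax\<^sup>2" by (simp add: divide_le_eq_1)
  then have "(1 - ?lmin\<^sup>2 / ?lmax\<^sup>2) ^ T * energy d u g u g \<le> (1 - ?lmin\<^sup>2 / ?lmax\<^sup>2) ^ T * (F / ?lmin)\<^sup>2"
    by (intro mult_left_mono energy_solution_le[OF F pos(4)]) auto
  also have "\<dots> \<le> \<epsilon>\<^sup>2 / 4" unfolding T_def by (rule num_steps_suffices[OF lmin_pos lmin_le_lmax pos(4) \<epsilon>])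
  finally have T: "(1 - ?lmin\<^sup>2 / ?lmax\<^sup>2) ^ T * energy d u g u g \<le> \<epsilon>\<^sup>2 / 4" .
  show ?thesis
    using d n by (intro network_approximation[OF _ p p1 pos(3) \<epsilon> T M]) auto
qed

text \<open>The constants are chosen before the data; if no data are compatible with the given
  parameters, there is nothing to show.\<close>

lemma theorem_from_cases:
  fixes P :: "nat \<Rightarrow> ((nat \<Rightarrow> real) \<Rightarrow> real) \<Rightarrow> bool"
  assumes P: "\<And>d u. P d u \<Longrightarrow> 2 \<le> d \<and> 0 < lambda_min a_min c_min \<and>
      lambda_min a_min c_min \<le> lambda_max a_max c_max \<and> 0 \<le> l_A \<and> 0 < l_c \<and> 0 \<le> l_f \<and> 0 \<le> F"
    and network: "\<And>d u \<epsilon> n. P d u \<Longrightarrow> 0 < \<epsilon> \<Longrightarrow> 0 < n \<Longrightarrow>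
      (4 * sqrt (real d) * M_bound d a_min a_max c_min c_max l_A l_c l_f F \<epsilon>)\<^sup>2 * (1 + 4 * real d) / real n \<le> \<epsilon>\<^sup>2 / 64 \<Longrightarrow>
      network_approximates d n (M_bound d a_min a_max c_min c_max l_A l_c l_f F \<epsilon>) \<epsilon> u"
  shows "\<exists>C0>0. \<exists>C1>0. \<exists>C2>0. \<forall>d u \<epsilon>. P d u \<longrightarrow> 0 < \<epsilon> \<longrightarrow> \<epsilon> < 1 / 2 \<longrightarrow>
    (\<exists>k>0. network_approximates d k (M_bound d a_min a_max c_min c_max l_A l_c l_f F \<epsilon>) \<epsilon> u \<and>
      real k \<le> C0 * real d powr (C1 * \<bar>ln \<epsilon>\<bar>)) \<and>
    M_bound d a_min a_max c_min c_max l_A l_c l_f F \<epsilon> \<le> C0 * real d powr (C2 * \<bar>ln \<epsilon>\<bar>)"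
proof (cases "\<exists>d u. P d u")
  case True
  then obtain d0 u0 where "P d0 u0" by blast
  from P[OF this] obtain C0 C1 C2 :: real where C: "0 < C0" "0 < C1" "0 < C2"
    and bound: "\<And>d \<epsilon>. 2 \<le> d \<Longrightarrow> 0 < \<epsilon> \<Longrightarrow> \<epsilon> < 1 / 2 \<Longrightarrow>
      (\<exists>n>0. (4 * sqrt (real d) * M_bound d a_min a_max c_min c_max l_A l_c l_f F \<epsilon>)\<^sup>2 * (1 + 4 * real d) / real n \<le> \<epsilon>\<^sup>2 / 64 \<and>
        real n \<le> C0 * real d powr (C1 * \<bar>ln \<epsilon>\<bar>)) \<and>
      M_bound d a_min a_max c_min c_max l_A l_c l_f F \<epsilon> \<le> C0 * real d powr (C2 * \<bar>ln \<epsilon>\<bar>)"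
    using width_and_bound[of a_min c_min a_max c_max l_A l_c l_f F] by blast
  show ?thesis
  proof (rule exI[of _ C0], rule conjI[OF C(1)], rule exI[of _ C1], rule conjI[OF C(2)],
      rule exI[of _ C2], rule conjI[OF C(3)], intro allI impI)
    fix d u \<epsilon> assume Pd: "P d u" and \<epsilon>: "0 < \<epsilon>" "\<epsilon> < (1::real) / 2"
    have d: "2 \<le> d" using P[OF Pd] by blast
    show "(\<exists>k>0. network_approximates d k (M_bound d a_min a_max c_min c_max l_A l_c l_f F \<epsilon>) \<epsilon> u \<and>
        real k \<le> C0 * real d powr (C1 * \<bar>ln \<epsilon>\<bar>)) \<and>
      M_bound d a_min a_max c_min c_max l_A l_c l_f F \<epsilon> \<le> C0 * real d powr (C2 * \<bar>ln \<epsilon>\<bar>)"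
      using bound[OF d \<epsilon>] network[OF Pd \<epsilon>(1)] by blast
  qed
next
  case False
  then show ?thesis by (intro exI[of _ 1] conjI zero_less_one) blast
qed

theorem theorem2p9:
  fixes a_min a_max c_min c_max l_A l_c l_f F :: real
  shows
    "(\<exists>C0>0. \<exists>C1>0. \<exists>C2>0.
        \<forall>(d::nat) (A :: (nat \<Rightarrow> real) \<Rightarrow> nat \<Rightarrow> nat \<Rightarrow> real)
          (c :: (nat \<Rightarrow> real) \<Rightarrow> real) (f :: (nat \<Rightarrow> real) \<Rightarrow> real) (u :: (nat \<Rightarrow> real) \<Rightarrow> real) (\<epsilon>::real).
          d \<ge> 2 \<longrightarrow>
          basic_assumptions d A c f a_min a_max c_min c_max \<longrightarrow>
          barron_assumptions d A c l_A l_c \<longrightarrow>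
          f \<in> barron_space_s d 0 \<longrightarrow> l_f = barron_norm_s d 0 f \<longrightarrow>
          F = Hminus1_norm d f \<longrightarrow>
          dirichlet_solution d A c f u \<longrightarrow>
          0 < \<epsilon> \<longrightarrow> \<epsilon> < 1 / 2 \<longrightarrow>
          (let M = M_bound d a_min a_max c_min c_max l_A l_c l_f F \<epsilon> in
             (\<exists>k>0. network_approximates d k M \<epsilon> u \<and>
                    real k \<le> C0 * real d powr (C1 * \<bar>ln \<epsilon>\<bar>)) \<and>
             M \<le> C0 * real d powr (C2 * \<bar>ln \<epsilon>\<bar>)))
     \<and>
     (\<exists>C0>0. \<exists>C1>0. \<exists>C2>0.
        \<forall>(d::nat) (A :: (nat \<Rightarrow> real) \<Rightarrow> nat \<Rightarrow> nat \<Rightarrow> real)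
          (c :: (nat \<Rightarrow> real) \<Rightarrow> real) (f :: (nat \<Rightarrow> real) \<Rightarrow> real) (u :: (nat \<Rightarrow> real) \<Rightarrow> real) (\<epsilon>::real).
          d \<ge> 2 \<longrightarrow>
          basic_assumptions d A c f a_min a_max c_min c_max \<longrightarrow>
          barron_assumptions d A c l_A l_c \<longrightarrow>
          f \<in> barron_space_c d 0 \<longrightarrow> l_f = barron_norm_c d 0 f \<longrightarrow>
          F = H1_dual_norm d f \<longrightarrow>
          neumann_solution d A c f u \<longrightarrow>
          0 < \<epsilon> \<longrightarrow> \<epsilon> < 1 / 2 \<longrightarrow>
          (let M = M_bound d a_min a_max c_min c_max l_A l_c l_f F \<epsilon> in
             (\<exists>k>0. network_approximates d k M \<epsilon> u \<and>
                    real k \<le> C0 * real d powr (C1 * \<bar>ln \<epsilon>\<bar>)) \<and>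
             M \<le> C0 * real d powr (C2 * \<bar>ln \<epsilon>\<bar>)))"
    (is "?Dirichlet \<and> ?Neumann")
proof
  let ?lmin = "lambda_min a_min c_min" and ?lmax = "lambda_max a_max c_max"
  \<comment> \<open>The data other than d and u are hidden behind an existential, because the
    conclusion mentions only d, u and \<epsilon>. This is the predicate to which
    \<open>theorem_from_cases\<close> is applied.\<close>
  let ?D = "\<lambda>d u. 2 \<le> d \<and> (\<exists>A c f. basic_assumptions d A c f a_min a_max c_min c_max \<and> barron_assumptions d A c l_A l_c \<and>
      f \<in> barron_space_s d 0 \<and> l_f = barron_norm_s d 0 f \<and> F = Hminus1_norm d f \<and> dirichlet_solution d A c f u)"
  have dirichlet: "(2 \<le> d \<and> 0 < ?lmin \<and> ?lmin \<le> ?lmax \<and> 0 \<le> l_A \<and> 0 < l_c \<and> 0 \<le> l_f \<and> 0 \<le> F) \<and>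
      (\<exists>A c f g. elliptic_problem d A c ?lmin ?lmax {..<d} f l_A l_c l_f u g \<and>
        (\<forall>s>0. energy d u g u g \<le> s\<^sup>2 \<longrightarrow> (\<integral>x. f x * u x \<partial>cube_lebesgue d) \<le> F * s))" if "?D d u" for d u
  proof -
    obtain A c f where h: "2 \<le> d" "basic_assumptions d A c f a_min a_max c_min c_max" "barron_assumptions d A c l_A l_c"
      "f \<in> barron_space_s d 0" "l_f = barron_norm_s d 0 f" "F = Hminus1_norm d f" "dirichlet_solution d A c f u"
      using \<open>?D d u\<close> by blast
    have d: "0 < d" using h(1) by simp
    have f: "f \<in> barron_space d (trig d {..<d}) {..<d} 0" "l_f = barron_norm d (trig d {..<d}) {..<d} 0 f"
      using h(4,5) by (simp_all add: barron_space_s_def barron_norm_s_def sin_basis_eq)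
    have u: "u \<in> H10 d" "\<And>v. v \<in> H10 d \<Longrightarrow> weak_identity d A c f u v"
      using h(7) by (simp_all add: dirichlet_solution_def)
    then have u1: "u \<in> H1 d" by (simp add: H10_def)
    note wu = H1_weak_gradient[OF u1]
    have E: "elliptic_problem d A c ?lmin ?lmax {..<d} f l_A l_c l_f u (\<lambda>i. weak_partial d i u)"
      by (rule elliptic_problem_solution[OF d h(2,3) f u1 parts_Dirichlet[OF u(1) wu]
            parts_Dirichlet[OF trig_H10[OF d] weak_gradient_trig] u(2)[OF u(1)] u(2)[OF trig_H10[OF d]]])
    have "0 \<le> l_f" unfolding f(2) by (rule barron_norm_nonneg)
    moreover have "0 \<le> F" unfolding h(6) by (rule Hminus1_norm_bound(1)[OF d f(1)])
    moreover have "\<forall>s>0. energy d u (\<lambda>i. weak_partial d i u) u (\<lambda>i. weak_partial d i u) \<le> s\<^sup>2 \<longrightarrow>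
        (\<integral>x. f x * u x \<partial>cube_lebesgue d) \<le> F * s"
      unfolding h(6) using Hminus1_norm_bound(2)[OF d f(1) u(1) wu] by blast
    ultimately show ?thesis using E constants_admissible[OF h(1-3)] h(1) by blast
  qed
  have "\<exists>C0>0. \<exists>C1>0. \<exists>C2>0. \<forall>d u \<epsilon>. ?D d u \<longrightarrow> 0 < \<epsilon> \<longrightarrow> \<epsilon> < 1 / 2 \<longrightarrow>
    (\<exists>k>0. network_approximates d k (M_bound d a_min a_max c_min c_max l_A l_c l_f F \<epsilon>) \<epsilon> u \<and>
      real k \<le> C0 * real d powr (C1 * \<bar>ln \<epsilon>\<bar>)) \<and>
    M_bound d a_min a_max c_min c_max l_A l_c l_f F \<epsilon> \<le> C0 * real d powr (C2 * \<bar>ln \<epsilon>\<bar>)"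
  proof (rule theorem_from_cases)
    fix d u assume D: "?D d u"
    show "2 \<le> d \<and> 0 < ?lmin \<and> ?lmin \<le> ?lmax \<and> 0 \<le> l_A \<and> 0 < l_c \<and> 0 \<le> l_f \<and> 0 \<le> F"
      using dirichlet[OF D] by blast
    fix \<epsilon> :: real and n :: nat
    assume "0 < \<epsilon>" "0 < n" "(4 * sqrt (real d) * M_bound d a_min a_max c_min c_max l_A l_c l_f F \<epsilon>)\<^sup>2 * (1 + 4 * real d) / real n \<le> \<epsilon>\<^sup>2 / 64"
    then show "network_approximates d n (M_bound d a_min a_max c_min c_max l_A l_c l_f F \<epsilon>) \<epsilon> u"
      using dirichlet[OF D] network_for_solution[of d l_A l_c l_f F _ _ a_min c_min a_max c_max "{..<d}"] by blast
  qed
  then obtain C0 C1 C2 where C: "0 < C0" "0 < C1" "0 < C2" and bound: "\<And>d u \<epsilon>. ?D d u \<Longrightarrow> 0 < \<epsilon> \<Longrightarrow> \<epsilon> < 1 / 2 \<Longrightarrow>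
    (\<exists>k>0. network_approximates d k (M_bound d a_min a_max c_min c_max l_A l_c l_f F \<epsilon>) \<epsilon> u \<and>
      real k \<le> C0 * real d powr (C1 * \<bar>ln \<epsilon>\<bar>)) \<and>
    M_bound d a_min a_max c_min c_max l_A l_c l_f F \<epsilon> \<le> C0 * real d powr (C2 * \<bar>ln \<epsilon>\<bar>)"
    by metis
  show ?Dirichlet unfolding Let_def
  proof (rule exI[of _ C0], rule conjI[OF C(1)], rule exI[of _ C1], rule conjI[OF C(2)],
      rule exI[of _ C2], rule conjI[OF C(3)], intro allI impI)
    fix d A c f u and \<epsilon> :: real
    assume h: "2 \<le> d" "basic_assumptions d A c f a_min a_max c_min c_max" "barron_assumptions d A c l_A l_c"
      "f \<in> barron_space_s d 0" "l_f = barron_norm_s d 0 f" "F = Hminus1_norm d f" "dirichlet_solution d A c f u"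
      and \<epsilon>: "0 < \<epsilon>" "\<epsilon> < 1 / 2"
    have "?D d u" using h by blast
    from bound[OF this \<epsilon>]
    show "(\<exists>k>0. network_approximates d k (M_bound d a_min a_max c_min c_max l_A l_c l_f F \<epsilon>) \<epsilon> u \<and>
        real k \<le> C0 * real d powr (C1 * \<bar>ln \<epsilon>\<bar>)) \<and>
      M_bound d a_min a_max c_min c_max l_A l_c l_f F \<epsilon> \<le> C0 * real d powr (C2 * \<bar>ln \<epsilon>\<bar>)" .
  qed
  let ?N = "\<lambda>d u. 2 \<le> d \<and> (\<exists>A c f. basic_assumptions d A c f a_min a_max c_min c_max \<and> barron_assumptions d A c l_A l_c \<and>
      f \<in> barron_space_c d 0 \<and> l_f = barron_norm_c d 0 f \<and> F = H1_dual_norm d f \<and> neumann_solution d A c f u)"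
  have neumann: "(2 \<le> d \<and> 0 < ?lmin \<and> ?lmin \<le> ?lmax \<and> 0 \<le> l_A \<and> 0 < l_c \<and> 0 \<le> l_f \<and> 0 \<le> F) \<and>
      (\<exists>A c f g. elliptic_problem d A c ?lmin ?lmax {} f l_A l_c l_f u g \<and>
        (\<forall>s>0. energy d u g u g \<le> s\<^sup>2 \<longrightarrow> (\<integral>x. f x * u x \<partial>cube_lebesgue d) \<le> F * s))" if "?N d u" for d u
  proof -
    obtain A c f where h: "2 \<le> d" "basic_assumptions d A c f a_min a_max c_min c_max" "barron_assumptions d A c l_A l_c"
      "f \<in> barron_space_c d 0" "l_f = barron_norm_c d 0 f" "F = H1_dual_norm d f" "neumann_solution d A c f u"
      using \<open>?N d u\<close> by blast
    have d: "0 < d" using h(1) by simp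
    have f: "f \<in> barron_space d (trig d {}) {} 0" "l_f = barron_norm d (trig d {}) {} 0 f"
      using h(4,5) by (simp_all add: barron_space_c_def barron_norm_c_def cos_basis_eq)
    have f2: "f \<in> L2 d" using f(1) by (simp add: barron_space_def)
    have u1: "u \<in> H1 d" and u: "\<And>v. v \<in> H1 d \<Longrightarrow> weak_identity d A c f u v"
      using h(7) by (simp_all add: neumann_solution_def)
    note wu = H1_weak_gradient[OF u1]
    have E: "elliptic_problem d A c ?lmin ?lmax {} f l_A l_c l_f u (\<lambda>i. weak_partial d i u)"
      by (rule elliptic_problem_solution[OF d h(2,3) f u1 parts_Neumann[OF wu]
            parts_Neumann[OF weak_gradient_trig] u[OF u1] u[OF weak_gradient_H1[OF weak_gradient_trig]]])
    have "0 \<le> l_f" unfolding f(2) by (rule barron_norm_nonneg)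
    moreover have "0 \<le> F" unfolding h(6) by (rule H1_dual_norm_bound(1)[OF f2])
    moreover have "\<forall>s>0. energy d u (\<lambda>i. weak_partial d i u) u (\<lambda>i. weak_partial d i u) \<le> s\<^sup>2 \<longrightarrow>
        (\<integral>x. f x * u x \<partial>cube_lebesgue d) \<le> F * s"
      unfolding h(6) using H1_dual_norm_bound(2)[OF f2 wu] by blast
    ultimately show ?thesis using E constants_admissible[OF h(1-3)] h(1) by blast
  qed
  have "\<exists>C0>0. \<exists>C1>0. \<exists>C2>0. \<forall>d u \<epsilon>. ?N d u \<longrightarrow> 0 < \<epsilon> \<longrightarrow> \<epsilon> < 1 / 2 \<longrightarrow>
    (\<exists>k>0. network_approximates d k (M_bound d a_min a_max c_min c_max l_A l_c l_f F \<epsilon>) \<epsilon> u \<and>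
      real k \<le> C0 * real d powr (C1 * \<bar>ln \<epsilon>\<bar>)) \<and>
    M_bound d a_min a_max c_min c_max l_A l_c l_f F \<epsilon> \<le> C0 * real d powr (C2 * \<bar>ln \<epsilon>\<bar>)"
  proof (rule theorem_from_cases)
    fix d u assume N: "?N d u"
    show "2 \<le> d \<and> 0 < ?lmin \<and> ?lmin \<le> ?lmax \<and> 0 \<le> l_A \<and> 0 < l_c \<and> 0 \<le> l_f \<and> 0 \<le> F"
      using neumann[OF N] by blast
    fix \<epsilon> :: real and n :: nat
    assume "0 < \<epsilon>" "0 < n" "(4 * sqrt (real d) * M_bound d a_min a_max c_min c_max l_A l_c l_f F \<epsilon>)\<^sup>2 * (1 + 4 * real d) / real n \<le> \<epsilon>\<^sup>2 / 64"
    then show "network_approximates d n (M_bound d a_min a_max c_min c_max l_A l_c l_f F \<epsilon>) \<epsilon> u"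
      using neumann[OF N] network_for_solution[of d l_A l_c l_f F _ _ a_min c_min a_max c_max "{}"] by blast
  qed
  then obtain C0 C1 C2 where C: "0 < C0" "0 < C1" "0 < C2" and bound: "\<And>d u \<epsilon>. ?N d u \<Longrightarrow> 0 < \<epsilon> \<Longrightarrow> \<epsilon> < 1 / 2 \<Longrightarrow>
    (\<exists>k>0. network_approximates d k (M_bound d a_min a_max c_min c_max l_A l_c l_f F \<epsilon>) \<epsilon> u \<and>
      real k \<le> C0 * real d powr (C1 * \<bar>ln \<epsilon>\<bar>)) \<and>
    M_bound d a_min a_max c_min c_max l_A l_c l_f F \<epsilon> \<le> C0 * real d powr (C2 * \<bar>ln \<epsilon>\<bar>)"
    by metis
  show ?Neumann unfolding Let_def
  proof (rule exI[of _ C0], rule conjI[OF C(1)], rule exI[of _ C1], rule conjI[OF C(2)],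
      rule exI[of _ C2], rule conjI[OF C(3)], intro allI impI)
    fix d A c f u and \<epsilon> :: real
    assume h: "2 \<le> d" "basic_assumptions d A c f a_min a_max c_min c_max" "barron_assumptions d A c l_A l_c"
      "f \<in> barron_space_c d 0" "l_f = barron_norm_c d 0 f" "F = H1_dual_norm d f" "neumann_solution d A c f u"
      and \<epsilon>: "0 < \<epsilon>" "\<epsilon> < 1 / 2"
    have "?N d u" using h by blast
    from bound[OF this \<epsilon>]
    show "(\<exists>k>0. network_approximates d k (M_bound d a_min a_max c_min c_max l_A l_c l_f F \<epsilon>) \<epsilon> u \<and>
        real k \<le> C0 * real d powr (C1 * \<bar>ln \<epsilon>\<bar>)) \<and>
      M_bound d a_min a_max c_min c_max l_A l_c l_f F \<epsilon> \<le> C0 * real d powr (C2 * \<bar>ln \<epsilon>\<bar>)" .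
  qed
qed

end
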